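(* Let $\mathcal D=\{t\in\mathbb C:\ \mathrm{dist}(t,[0,T])\le r\}$, for some $r>0$, $T>0$, be a domain in the complex $t$-plane containing the interval $[0,T]$. Let $\alpha=e^{2\pi i/3}$ and, for $x>0$, $$I_{f_0}(x,t)=\frac{1-\alpha}{2\pi}\int_{\partial\Omega_1}e^{ikx-ik^3t}k^2F_0(ik^3,t)\,dk+\frac{1-\alpha^2}{2\pi}\int_{\partial\Omega_2}e^{ikx-ik^3t}k^2F_0(ik^3,t)\,dk,$$ $$I_{f_1}(x,t)=\frac{1-\alpha^2}{2\pi i}\int_{\partial\Omega_1}e^{ikx-ik^3t}kF_1(ik^3,t)\,dk+\frac{1-\alpha}{2\pi i}\int_{\partial\Omega_2}e^{ikx-ik^3t}kF_1(ik^3,t)\,dk.$$ (i) If $f_0(t)$ is analytic in $\mathcal D$, then $I_{f_0}(x,t)$ is analytic for $x>0$ and $0\le t\le T$, and its series representation $\sum_{n=0}^\infty a_n(t)x^n$ is entire in $x$ for $0\le t\le T$. (ii) If $f_1(t)$ is analytic in $\mathcal D$, then $I_{f_1}(x,t)$ is analytic for $x>0$ and $0\le t\le T$, and its series representation $\sum_{n=0}^\infty b_n(t)x^n$ is entire in $x$ for $0\le t\le T$. Here the coefficients $a_n(t)$, $b_n(t)$ are those given explicitly in the context.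
   Context: $F_m(ik^3,t)=\int_0^te^{ik^3s}f_m(s)\,ds$ for $m=0,1$. $\Omega_1=\{k\in\mathbb C:\ 0<\mathrm{Arg}(k)<\pi/3\}$, $\Omega_2=\{k\in\mathbb C:\ 2\pi/3<\mathrm{Arg}(k)<\pi\}$, with $\partial\Omega_j$ oriented with $\Omega_j$ on its left ($\partial\Omega_1$ from $\infty e^{i\pi/3}$ through $0$ to $+\infty$; $\partial\Omega_2$ from $-\infty$ through $0$ to $\infty e^{2\pi i/3}$); the integrals along the real axis are understood as improper integrals. The functions $I_{f_0}$, $I_{f_1}$ are the boundary contributions to the Unified Transform (Fokas) solution of $u_t-u_{xxx}=0$, $x>0$, $t>0$, with $u(x,0)=u_0(x)$, $u(0,t)=f_0(t)$, $u_x(0,t)=f_1(t)$. The coefficients of the series representations $I_{f_0}(x,t)=\sum_{n\ge0}a_n(t)x^n$ and $I_{f_1}(x,t)=\sum_{n\ge0}b_n(t)x^n$ are $$a_{3n}(t)=\frac{f_0^{(n)}(t)}{(3n)!}\ (n\ge0),\qquad a_{3n-2}(t)=0\ (n\ge1),$$ $$a_{3n-1}(t)=-\frac{\sqrt3\,\Gamma(\frac23)}{2\pi(3n-1)!}\left[\sum_{m=1}^n\frac{(-1)^{n-m}\Gamma(n-m+\frac23)}{t^{\,n-m+\frac23}\,\Gamma(\frac23)}f_0^{(m-1)}(0)+\int_0^t\frac{f_0^{(n)}(s)}{(t-s)^{2/3}}\,ds\right]\ (n\ge1),$$ $$b_{3n}(t)=0\ (n\ge0),\qquad b_{3n+1}(t)=\frac{f_1^{(n)}(t)}{(3n+1)!}\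 (n\ge0),$$ $$b_{3n-1}(t)=-\frac{\sqrt3\,\Gamma(\frac13)}{2\pi(3n-1)!}\left[\sum_{m=1}^n\frac{(-1)^{n-m}\Gamma(n-m+\frac13)}{t^{\,n-m+\frac13}\,\Gamma(\frac13)}f_1^{(m-1)}(0)+\int_0^t\frac{f_1^{(n)}(s)}{(t-s)^{1/3}}\,ds\right]\ (n\ge1).$$ "Entire in $x$" means that the series converges for all $x\in\mathbb C$ and defines an entire function of $x$.
   Formalization: At t=0 the coefficients contain undefined negative powers of t (read as 0 there): the series is shown to equal I, and I to be jointly analytic in (x,t), only for 0<t≤T; at t=0 only analyticity of I in x and entirety of the series so read are stated. *)

theory Defs
  imports "HOL-Complex_Analysis.Complex_Analysis"
begin

definition time_domain :: "real \<Rightarrow> real \<Rightarrow> complex set" where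
  "time_domain T r = {t. infdist t (complex_of_real ` {0..T}) \<le> r}"

definition F_transform :: "(complex \<Rightarrow> complex) \<Rightarrow> complex \<Rightarrow> real \<Rightarrow> complex" where
  "F_transform f w t = integral {0..t} (\<lambda>s. exp (w * of_real s) * f (of_real s))"


text \<open>
  Integrals over the ray of argument \<open>\<theta>\<close>, directed from 0 to infinity. The gauge integral over
  the half-line \<open>{0..}\<close> exists iff the integrals over all \<open>{0..R}\<close> exist and converge
  as \<open>R\<close> tends to infinity, and it is then this limit; so it is the improper integral, and no
  absolute convergence is required.
\<close>

definition ray_integrand :: "real \<Rightarrow> (complex \<Rightarrow> complex) \<Rightarrow> real \<Rightarrow> complex" where
  "ray_integrand \<theta> g \<rho> = g (of_real \<rho> * cis \<theta>) * cis \<theta>"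

definition ray_integrable :: "real \<Rightarrow> (complex \<Rightarrow> complex) \<Rightarrow> bool" where
  "ray_integrable \<theta> g \<longleftrightarrow> ray_integrand \<theta> g integrable_on {0..}"

definition ray_integral :: "real \<Rightarrow> (complex \<Rightarrow> complex) \<Rightarrow> complex" where
  "ray_integral \<theta> g = integral {0..} (ray_integrand \<theta> g)"

text \<open>
  \<open>\<Omega>\<^sub>1 = {k. 0 < Arg k < \<pi>/3}\<close> and \<open>\<Omega>\<^sub>2 = {k. 2\<pi>/3 < Arg k < \<pi>}\<close>. Each boundary consists of two
  rays and is oriented with the sector on its left: one comes in from infinity along the ray of
  larger argument for \<open>\<Omega>\<^sub>1\<close> and \<open>\<Omega>\<^sub>2\<close> alike (hence the minus sign) and leaves along the other one.
\<close>

definition bd_Omega1_integrable :: "(complex \<Rightarrow> complex) \<Rightarrow> bool" where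
  "bd_Omega1_integrable g \<longleftrightarrow> ray_integrable (pi / 3) g \<and> ray_integrable 0 g"

definition bd_Omega1_integral :: "(complex \<Rightarrow> complex) \<Rightarrow> complex" where
  "bd_Omega1_integral g = - ray_integral (pi / 3) g + ray_integral 0 g"

definition bd_Omega2_integrable :: "(complex \<Rightarrow> complex) \<Rightarrow> bool" where
  "bd_Omega2_integrable g \<longleftrightarrow> ray_integrable pi g \<and> ray_integrable (2 * pi / 3) g"

definition bd_Omega2_integral :: "(complex \<Rightarrow> complex) \<Rightarrow> complex" where
  "bd_Omega2_integral g = - ray_integral pi g + ray_integral (2 * pi / 3) g"


definition alpha :: complex where
  "alpha = exp (2 * of_real pi * \<i> / 3)"

definition integrand0 :: "(complex \<Rightarrow> complex) \<Rightarrow> real \<Rightarrow> real \<Rightarrow> complex \<Rightarrow> complex" where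
  "integrand0 f x t k =
     exp (\<i> * k * of_real x - \<i> * k ^ 3 * of_real t) * k\<^sup>2 * F_transform f (\<i> * k ^ 3) t"

definition integrand1 :: "(complex \<Rightarrow> complex) \<Rightarrow> real \<Rightarrow> real \<Rightarrow> complex \<Rightarrow> complex" where
  "integrand1 f x t k =
     exp (\<i> * k * of_real x - \<i> * k ^ 3 * of_real t) * k * F_transform f (\<i> * k ^ 3) t"

definition I_f0 :: "(complex \<Rightarrow> complex) \<Rightarrow> real \<Rightarrow> real \<Rightarrow> complex" where
  "I_f0 f x t =
     (1 - alpha) / (2 * of_real pi) * bd_Omega1_integral (integrand0 f x t)
   + (1 - alpha\<^sup>2) / (2 * of_real pi) * bd_Omega2_integral (integrand0 f x t)"

definition I_f1 :: "(complex \<Rightarrow> complex) \<Rightarrow> real \<Rightarrow> real \<Rightarrow> complex" where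
  "I_f1 f x t =
     (1 - alpha\<^sup>2) / (2 * of_real pi * \<i>) * bd_Omega1_integral (integrand1 f x t)
   + (1 - alpha) / (2 * of_real pi * \<i>) * bd_Omega2_integral (integrand1 f x t)"


text \<open>
  The bracket in the coefficients of index \<open>3n - 1\<close>, with \<open>q = 2/3\<close> for \<open>a\<close> and \<open>q = 1/3\<close> for \<open>b\<close>.
  At \<open>t = 0\<close> the negative powers of \<open>t\<close> are undefined on paper; here division by
  \<open>0 powr _ = 0\<close> makes those terms 0.
\<close>

definition frac_bracket :: "real \<Rightarrow> (complex \<Rightarrow> complex) \<Rightarrow> nat \<Rightarrow> real \<Rightarrow> complex" where
  "frac_bracket q f n t =
     (\<Sum>m = 1..n. of_real ((- 1) ^ (n - m) * Gamma (real (n - m) + q)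
                            / (t powr (real (n - m) + q) * Gamma q)) * (deriv ^^ (m - 1)) f 0)
   + integral {0..t} (\<lambda>s. (deriv ^^ n) f (of_real s) / of_real ((t - s) powr q))"

definition a_coeff :: "(complex \<Rightarrow> complex) \<Rightarrow> nat \<Rightarrow> real \<Rightarrow> complex" where
  "a_coeff f j t =
     (if j mod 3 = 0 then (deriv ^^ (j div 3)) f (of_real t) / fact j
      else if j mod 3 = 1 then 0
      else - of_real (sqrt 3 * Gamma (2/3) / (2 * pi * fact j)) * frac_bracket (2/3) f ((j + 1) div 3) t)"

definition b_coeff :: "(complex \<Rightarrow> complex) \<Rightarrow> nat \<Rightarrow> real \<Rightarrow> complex" where
  "b_coeff f j t =
     (if j mod 3 = 0 then 0
      else if j mod 3 = 1 then (deriv ^^ (j div 3)) f (of_real t) / fact j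
      else - of_real (sqrt 3 * Gamma (1/3) / (2 * pi * fact j)) * frac_bracket (1/3) f ((j + 1) div 3) t)"


text \<open>
  Real analyticity (of complex-valued functions) of one and of two real variables: locally the sum
  of a power series. If \<open>S\<close> is not open, this is relative to \<open>S\<close>.
\<close>

definition real_analytic_on :: "(real \<Rightarrow> complex) \<Rightarrow> real set \<Rightarrow> bool" where
  "real_analytic_on u S \<longleftrightarrow>
     (\<forall>x0\<in>S. \<exists>\<delta>>0. \<exists>c :: nat \<Rightarrow> complex. \<forall>x\<in>S. \<bar>x - x0\<bar> < \<delta> \<longrightarrow>
        (\<lambda>n. c n * of_real (x - x0) ^ n) sums u x)"

definition real_analytic2_on :: "(real \<Rightarrow> real \<Rightarrow> complex) \<Rightarrow> (real \<times> real) set \<Rightarrow> bool" where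
  "real_analytic2_on u S \<longleftrightarrow>
     (\<forall>(x0, t0)\<in>S. \<exists>\<delta>>0. \<exists>c :: nat \<Rightarrow> nat \<Rightarrow> complex.
        \<forall>(x, t)\<in>S. \<bar>x - x0\<bar> < \<delta> \<longrightarrow> \<bar>t - t0\<bar> < \<delta> \<longrightarrow>
        ((\<lambda>(m, n). c m n * of_real (x - x0) ^ m * of_real (t - t0) ^ n) has_sum u x t) UNIV)"

definition entire_series :: "(nat \<Rightarrow> complex) \<Rightarrow> bool" where
  "entire_series c \<longleftrightarrow>
     (\<forall>z. summable (\<lambda>n. c n * z ^ n)) \<and> (\<lambda>z. \<Sum>n. c n * z ^ n) holomorphic_on UNIV"

end

theory Submission
  imports Defs "HOL-Real_Asymp.Real_Asymp"
begin

text \<open>Put \<open>k = \<rho> cis \<beta>\<close> on each boundary ray and \<open>s = t - \<tau>\<close> in \<open>F\<close>. Then \<open>2\<pi> I\<close> is a weighted sum of four integrals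
  \<open>\<integral>\<^sub>0\<^sup>\<infinity> \<rho>\<^sup>p exp(- z \<rho>) \<integral>\<^sub>0\<^sup>t f(t - \<tau>) exp(- s \<rho>\<^sup>3 \<tau>) d\<tau> d\<rho>\<close> with \<open>s = \<plusminus>\<i>\<close>, \<open>Re z \<ge> 0\<close>, and \<open>p = 2\<close> for \<open>f\<^sub>0\<close>, \<open>p = 1\<close>
  for \<open>f\<^sub>1\<close>. Integration by parts in \<open>\<tau>\<close> gives convergence, and Abel's theorem carries identities from
  \<open>Re z > 0\<close>, where Fubini applies, to the imaginary axis.

  Split the \<open>\<tau>\<close>-integral at a small \<open>\<delta>\<close>. For \<open>\<tau> \<ge> \<delta>\<close> the inner \<open>\<rho>\<close>-integral is a power series in \<open>z\<close>, and the
  weights kill all powers \<open>x\<^sup>n\<close> with \<open>n mod 3 \<noteq> 2\<close>. For \<open>\<tau> \<le> \<delta>\<close> expand \<open>f(t - \<tau>)\<close> in powers of \<open>\<tau>\<close>: the monomial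
  \<open>\<tau>\<^sup>m\<close> produces the same powers of \<open>x\<close> and one resonant term, a multiple of \<open>x\<^sup>N\<close> with \<open>N = 3m + 2 - p\<close>,
  which accounts for the coefficients \<open>f\<^sup>(\<^sup>m\<^sup>)(t) / N!\<close>. The remaining coefficients are finite parts of
  \<open>\<integral>\<^sub>0\<^sup>t f(t - \<tau>) \<tau>\<^sup>-\<^sup>n\<^sup>-\<^sup>q d\<tau>\<close> with \<open>q = p/3\<close>; integration by parts identifies them with the bracket.

  The bracket is also the \<open>n\<close>-th derivative of \<open>G(t) = \<integral>\<^sub>0\<^sup>t f(s) (t - s)\<^sup>-\<^sup>q ds\<close>, which is holomorphic near \<open>(0, T]\<close>.
  So \<open>I\<close> is a combination of two series \<open>\<Sum> h\<^sup>(\<^sup>k\<^sup>)(t) x\<^sup>3\<^sup>k\<^sup>+\<^sup>e / (3k + e)!\<close>, with \<open>h = f\<close> and \<open>h = G'\<close>, and Cauchy's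
  estimates for \<open>h\<close> give both the entirety in \<open>x\<close> and the joint analyticity.\<close>

section \<open>Improper integrals over half-lines\<close>

text \<open>Two obstacles shape the argument. This is why termwise summation of the Taylor series of
  \<open>f\<close> rests on a bound for the ray integrals that is linear in a C2 norm. Secondly, the
  kernel contributes \<tau> to the power -(n+p+1)/3, which for large n is not integrable at \<tau> =
  0. This forces the split, and \<delta> has to stay below the radius of convergence of the Taylor
  series at \<open>t\<close>. The resonant term belongs to the exponent -1, whose primitive is a
  logarithm: Ln \<open>s\<close> - 3 Ln \<open>z\<close> has the same real part on all rays, but
  imaginary parts that differ by multiples of 2\<pi>, and this is the 2\<pi> that cancels the
  prefactor. The point \<open>t\<close> = 0 is exceptional: \<open>G\<close> behaves like a
  fractional power of \<open>t\<close> there, and the contour integrals vanish while the series need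
  not.\<close>

lemma has_integral_atLeastI:
  fixes f :: "real \<Rightarrow> 'a::euclidean_space"
  assumes int: "\<And>R. R \<ge> a \<Longrightarrow> f integrable_on {a..R}"
    and lim: "((\<lambda>R. integral {a..R} f) \<longlongrightarrow> l) at_top"
  shows "(f has_integral l) {a..}"
  unfolding has_integral_alt'[of f]
proof (intro conjI allI impI)
  have eq: "cbox u v \<inter> {a..} = {max u a..v}" for u v :: real by auto
  have sub: "f integrable_on {max u a..v}" for u v
  proof (cases "max u a \<le> v")
    case True
    then show ?thesis
      by (intro integrable_subinterval_real[OF int[of v]]) auto
  next
    case False
    then have "{max u a..v} = {}" by auto
    then show ?thesis by (simp only: integrable_on_empty)
  qed
  show "(\<lambda>x. if x \<in> {a..} then f x else 0) integrable_on cbox u v" for u v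
    unfolding integrable_restrict_Int Int_commute[of "{a..}"] eq by (rule sub)
  fix e :: real assume "e > 0"
  then obtain R0 where R0: "\<And>R. R \<ge> R0 \<Longrightarrow> norm (integral {a..R} f - l) < e"
    using lim unfolding tendsto_iff eventually_at_top_linorder dist_norm by blast
  \<comment> \<open>A box containing the ball of radius \<open>B\<close> reaches below
    \<open>a\<close> and beyond \<open>R0\<close>, so its trace on the half-line is
    \<open>{a..v}\<close> with \<open>v \<ge> R0\<close>. This reduces arbitrary boxes to
    truncations at the right end (Hake's theorem).\<close>
  define B where "B = max (\<bar>a\<bar> + 1) (\<bar>R0\<bar> + 1)"
  show "\<exists>B>0. \<forall>u v. ball 0 B \<subseteq> cbox u v \<longrightarrow>
     norm (integral (cbox u v) (\<lambda>x. if x \<in> {a..} then f x else 0) - l) < e"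
  proof (intro exI[of _ B] conjI allI impI)
    show "B > 0" by (auto simp: B_def)
    fix u v :: real assume "ball 0 B \<subseteq> cbox u v"
    then have "ball (0::real) B \<subseteq> {u..v}" by simp
    then have "{-B<..<B} \<subseteq> {u..v}" by (simp add: ball_eq_greaterThanLessThan)
    then have "u \<le> -B" "B \<le> v" using \<open>B > 0\<close> by (auto simp: greaterThanLessThan_subseteq_atLeastAtMost_iff)
    then have "max u a = a" "v \<ge> R0" by (auto simp: B_def)
    then have "cbox u v \<inter> {a..} = {a..v}" using eq by simp
    then have "integral (cbox u v) (\<lambda>x. if x \<in> {a..} then f x else 0) = integral {a..v} f"
      by (simp only: integral_restrict_Int Int_commute)
    then show "norm (integral (cbox u v) (\<lambda>x. if x \<in> {a..} then f x else 0) - l) < e"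
      using R0[OF \<open>v \<ge> R0\<close>] by simp
  qed
qed

lemma has_integral_atLeastD:
  fixes f :: "real \<Rightarrow> 'a::euclidean_space"
  assumes "(f has_integral l) {a..}"
  shows "((\<lambda>R. integral {a..R} f) \<longlongrightarrow> l) at_top"
proof -
  have alt: "(\<forall>u v. (\<lambda>x. if x \<in> {a..} then f x else 0) integrable_on cbox u v)"
     "(\<forall>e>0. \<exists>B>0. \<forall>u v. ball 0 B \<subseteq> cbox u v \<longrightarrow>
            norm (integral (cbox u v) (\<lambda>x. if x \<in> {a..} then f x else 0) - l) < e)"
    using assms unfolding has_integral_alt'[of f] by auto
  show "((\<lambda>R. integral {a..R} f) \<longlongrightarrow> l) at_top"
    unfolding tendsto_iff dist_norm
  proof (intro allI impI)
    fix e :: real assume "e > 0"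
    then obtain B where B: "B > 0" "\<And>u v. ball 0 B \<subseteq> cbox u v \<Longrightarrow>
            norm (integral (cbox u v) (\<lambda>x. if x \<in> {a..} then f x else 0) - l) < e"
      using alt(2) by blast
    have "norm (integral {a..R} f - l) < e" if "R \<ge> B" for R
    proof -
      \<comment> \<open>The left end is lowered until the box contains the ball; its trace on the
        half-line is still \<open>{a..R}\<close>.\<close>
      have "ball 0 B \<subseteq> cbox (min a (-B)) R" using that by (auto simp: dist_norm)
      moreover have "{a..} \<inter> cbox (min a (-B)) R = {a..R}" by auto
      ultimately show ?thesis using B(2)[of "min a (-B)" R] by (simp only: integral_restrict_Int)
    qed
    then show "eventually (\<lambda>R. norm (integral {a..R} f - l) < e) at_top"
      unfolding eventually_at_top_linorder by blast
  qed
qed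

lemma bounded_by_integrable_atLeast:
  fixes f :: "real \<Rightarrow> 'a::euclidean_space"
  assumes "continuous_on {a..} f" "h integrable_on {a..}" "\<And>x. x \<ge> a \<Longrightarrow> norm (f x) \<le> h x"
  shows "f integrable_on {a..}" "norm (integral {a..} f) \<le> integral {a..} h"
proof -
  show "f integrable_on {a..}"
  proof (rule measurable_bounded_by_integrable_imp_integrable[of _ _ h])
    show "f \<in> borel_measurable (lebesgue_on {a..})"
      by (intro continuous_imp_measurable_on_sets_lebesgue assms) auto
  qed (use assms in auto)
  then show "norm (integral {a..} f) \<le> integral {a..} h"
    by (intro integral_norm_bound_integral) (use assms in auto)
qed

lemma power_exp_bound:
  fixes c :: real
  assumes "c > 0"
  obtains C where "C > 0" "\<And>\<rho>. \<rho> \<ge> 0 \<Longrightarrow> \<rho> ^ p * exp (-(c * \<rho>)) \<le> C * exp (-(c/2 * \<rho>))"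
proof
  \<comment> \<open>Half of the decay absorbs the power: the single term (c\<rho>/2)^p / p! of the
    exponential series is at most exp(c\<rho>/2).\<close>
  let ?C = "fact p * (2/c) ^ p"
  show "?C > 0" using assms by simp
  fix \<rho> :: real assume "\<rho> \<ge> 0"
  have e: "(c/2 * \<rho>) ^ p / fact p \<le> exp (c/2 * \<rho>)"
  proof -
    have "(\<Sum>n\<in>{p}. (c/2 * \<rho>) ^ n /\<^sub>R fact n) \<le> (\<Sum>n. (c/2 * \<rho>) ^ n /\<^sub>R fact n)"
      by (rule sum_le_suminf[OF summable_exp_generic]) (use assms \<open>\<rho> \<ge> 0\<close> in auto)
    also have "\<dots> = exp (c/2 * \<rho>)"
      by (rule sums_unique[OF exp_converges, symmetric])
    finally show ?thesis by (simp only: sum.insert sum.empty finite.emptyI empty_iff add_0_right real_scaleR_def divide_inverse_commute not_False_eq_True)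
  qed
  have "\<rho> ^ p = ?C * ((c/2 * \<rho>) ^ p / fact p)"
    using assms by (simp add: power_mult_distrib power_divide)
  also have "\<dots> \<le> ?C * exp (c/2 * \<rho>)"
    using e \<open>?C > 0\<close> by (intro mult_left_mono) auto
  finally have "\<rho> ^ p \<le> ?C * exp (c/2 * \<rho>)" .
  then have "\<rho> ^ p * exp (-(c * \<rho>)) \<le> ?C * exp (c/2 * \<rho>) * exp (-(c * \<rho>))"
    by (intro mult_right_mono) auto
  also have "\<dots> = ?C * exp (-(c/2 * \<rho>))"
    by (simp only: mult.assoc exp_add[symmetric]) (simp add: field_simps)
  finally show "\<rho> ^ p * exp (-(c * \<rho>)) \<le> ?C * exp (-(c/2 * \<rho>))" .
qed

lemma integrable_power_exp:
  fixes c a :: real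
  assumes "c > 0" "a \<ge> 0"
  shows "(\<lambda>\<rho>. \<rho> ^ p * exp (-(c * \<rho>))) integrable_on {a..}"
proof -
  obtain C where C: "C > 0" "\<And>\<rho>. \<rho> \<ge> 0 \<Longrightarrow> \<rho> ^ p * exp (-(c * \<rho>)) \<le> C * exp (-(c/2 * \<rho>))"
    using power_exp_bound[OF assms(1)] by metis
  show ?thesis
  proof (rule measurable_bounded_by_integrable_imp_integrable)
    show "(\<lambda>\<rho>. \<rho> ^ p * exp (-(c * \<rho>))) \<in> borel_measurable (lebesgue_on {a..})"
      by (intro continuous_imp_measurable_on_sets_lebesgue continuous_intros) auto
    show "(\<lambda>\<rho>. C * exp (-(c/2 * \<rho>))) integrable_on {a..}"
      using integrable_on_exp_minus_to_infinity[of "c/2" a] assms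
      by (intro integrable_on_mult_right) simp_all
  qed (use C assms in auto)
qed


text \<open>The M-test for improper integrals: whatever \<open>x\<close> is, the tail of
  \<open>f x\<close> is at most the tail of \<open>h\<close>. Truncation at natural numbers fits the
  theorems on sequences of holomorphic functions that are applied later.\<close>

lemma uniform_limit_improper_integral:
  fixes f :: "'b \<Rightarrow> real \<Rightarrow> 'a::euclidean_space"
  assumes cont: "\<And>x. x \<in> A \<Longrightarrow> continuous_on {a..} (f x)"
    and h: "h integrable_on {a..}"
    and le: "\<And>x \<rho>. x \<in> A \<Longrightarrow> \<rho> \<ge> a \<Longrightarrow> norm (f x \<rho>) \<le> h \<rho>"
  shows "uniform_limit A (\<lambda>n x. integral {a..real n} (f x)) (\<lambda>x. integral {a..} (f x)) sequentially"
proof -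
  have hR: "h integrable_on {u..v}" if "a \<le> u" for u v
    by (rule integrable_on_subinterval[OF h]) (use that in auto)
  have fR: "f x integrable_on {u..v}" if "x \<in> A" "a \<le> u" for x u v
    using cont[OF that(1)] that by (intro integrable_continuous_interval continuous_on_subset[OF cont]) auto
  have bound: "norm (integral {a..} (f x) - integral {a..R} (f x)) \<le> integral {a..} h - integral {a..R} h"
    if x: "x \<in> A" and R: "R \<ge> a" for x R
  \<comment> \<open>The tails are compared on \<open>{R..r}\<close>, where both integrals are
    proper, and then \<open>r\<close> tends to infinity.\<close>
  proof (rule tendsto_le[OF trivial_limit_at_top_linorder])
    have "f x integrable_on {a..}"
      using bounded_by_integrable_atLeast[of a "f x" h] cont h le x by blast
    then have l: "((\<lambda>r. integral {a..r} (f x)) \<longlongrightarrow> integral {a..} (f x)) at_top"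
      by (intro has_integral_atLeastD integrable_integral)
    show "((\<lambda>r. norm (integral {a..r} (f x) - integral {a..R} (f x))) \<longlongrightarrow>
            norm (integral {a..} (f x) - integral {a..R} (f x))) at_top"
      by (intro tendsto_intros l)
    have l: "((\<lambda>r. integral {a..r} h) \<longlongrightarrow> integral {a..} h) at_top"
      using h by (intro has_integral_atLeastD integrable_integral)
    show "((\<lambda>r. integral {a..r} h - integral {a..R} h) \<longlongrightarrow> integral {a..} h - integral {a..R} h) at_top"
      by (intro tendsto_intros l)
    have "norm (integral {a..r} (f x) - integral {a..R} (f x)) \<le> integral {a..r} h - integral {a..R} h"
      if r: "r \<ge> R" for r
    proof -
      have "integral {a..r} (f x) - integral {a..R} (f x) = integral {R..r} (f x)"
        using Henstock_Kurzweil_Integration.integral_combine[OF R r fR[OF x order_refl]] by (simp add: algebra_simps)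
      moreover have "integral {a..r} h - integral {a..R} h = integral {R..r} h"
        using Henstock_Kurzweil_Integration.integral_combine[OF R r hR[OF order_refl]] by (simp add: algebra_simps)
      moreover have "norm (integral {R..r} (f x)) \<le> integral {R..r} h"
        using x R by (intro integral_norm_bound_integral fR hR) (auto intro!: le)
      ultimately show ?thesis by simp
    qed
    then show "\<forall>\<^sub>F r in at_top. norm (integral {a..r} (f x) - integral {a..R} (f x))
        \<le> integral {a..r} h - integral {a..R} h"
      unfolding eventually_at_top_linorder by blast
  qed
  have "((\<lambda>r. integral {a..r} h) \<longlongrightarrow> integral {a..} h) at_top"
    using h by (intro has_integral_atLeastD integrable_integral)
  then have lim: "(\<lambda>n. integral {a..real n} h) \<longlonglongrightarrow> integral {a..} h"
    by (rule filterlim_compose) (rule filterlim_real_sequentially)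
  show ?thesis
  proof (rule uniform_limitI)
    fix e :: real assume "e > 0"
    then have "\<forall>\<^sub>F n in sequentially. dist (integral {a..real n} h) (integral {a..} h) < e"
      using lim by (rule tendstoD[rotated])
    moreover have "\<forall>\<^sub>F n in sequentially. a \<le> real n"
      using filterlim_real_sequentially unfolding filterlim_at_top by blast
    ultimately show "\<forall>\<^sub>F n in sequentially. \<forall>x\<in>A. dist (integral {a..real n} (f x)) (integral {a..} (f x)) < e"
    proof eventually_elim
      case (elim n)
      show ?case
      proof
        fix x assume "x \<in> A"
        from bound[OF this elim(2)] elim(1)
        show "dist (integral {a..real n} (f x)) (integral {a..} (f x)) < e"
          unfolding dist_norm by (simp add: norm_minus_commute)
      qed
    qed
  qed
qed

section \<open>Laplace integrals with a cubic phase\<close>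

text \<open>The factor \<open>\<psi>\<close> stays abstract because two instances occur,
  \<open>exp (- w)\<close> for the kernel itself and \<open>phi m\<close> for the kernel integrated
  against a monomial in \<tau>; continuation in \<open>z\<close> and \<open>s\<close> is then proved
  once for both.\<close>

definition cubic_laplace :: "nat \<Rightarrow> (complex \<Rightarrow> complex) \<Rightarrow> complex \<Rightarrow> complex \<Rightarrow> complex" where
  "cubic_laplace p \<psi> z s = integral {0..} (\<lambda>\<rho>. of_real \<rho> ^ p * exp (- (z * of_real \<rho>)) * \<psi> (s * of_real \<rho> ^ 3))"

text \<open>The bound on the closed half-plane dominates the integrand by \<rho>^p exp(-\<rho> Re z)
  uniformly in \<open>s\<close>, imaginary \<open>s\<close> included; being entire allows
  differentiation in \<open>s\<close>.\<close>

definition contractive :: "(complex \<Rightarrow> complex) \<Rightarrow> bool" where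
  "contractive \<psi> \<longleftrightarrow> \<psi> holomorphic_on UNIV \<and> (\<forall>w. Re w \<ge> 0 \<longrightarrow> norm (\<psi> w) \<le> 1)"

lemma contractive_continuous:
  assumes "contractive \<psi>" "continuous_on A f"
  shows "continuous_on A (\<lambda>x. \<psi> (f x))"
proof (rule continuous_on_compose2[OF _ assms(2) subset_UNIV])
  have "\<psi> holomorphic_on UNIV" using assms(1) by (simp add: contractive_def)
  then show "continuous_on UNIV \<psi>" by (rule holomorphic_on_imp_continuous_on)
qed

lemma contractive_norm:
  assumes "contractive \<psi>" "Re s \<ge> 0" "\<rho> \<ge> 0"
  shows "norm (\<psi> (s * of_real \<rho> ^ 3)) \<le> 1"
proof -
  have "Re (s * of_real \<rho> ^ 3) = Re s * \<rho> ^ 3"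
    by (simp flip: of_real_power)
  then show ?thesis using assms unfolding contractive_def by simp
qed

lemma cubic_laplace_integrand_bound:
  assumes "contractive \<psi>" "Re s \<ge> 0" "Re z \<ge> c" "\<rho> \<ge> 0"
  shows "norm (of_real \<rho> ^ p * exp (- (z * of_real \<rho>)) * \<psi> (s * of_real \<rho> ^ 3)) \<le> \<rho> ^ p * exp (-(c * \<rho>))"
proof -
  have "norm (of_real \<rho> ^ p * exp (- (z * of_real \<rho>)) * \<psi> (s * of_real \<rho> ^ 3))
     \<le> \<rho> ^ p * exp (-(Re z * \<rho>)) * 1"
    unfolding norm_mult using assms contractive_norm[OF assms(1,2,4)]
    by (intro mult_mono) (auto simp: norm_power norm_exp_eq_Re)
  also have "\<dots> \<le> \<rho> ^ p * exp (-(c * \<rho>))"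
    using assms by (auto intro!: mult_left_mono mult_right_mono)
  finally show ?thesis .
qed

lemma cubic_laplace_integrand_continuous:
  assumes "contractive \<psi>"
  shows "continuous_on A (\<lambda>\<rho>. of_real \<rho> ^ p * exp (- (z * of_real \<rho>)) * \<psi> (s * of_real \<rho> ^ 3))"
  by (intro continuous_intros contractive_continuous[OF assms])

lemma cubic_laplace_uniform_limit:
  assumes "contractive \<psi>" "c > 0" "\<And>z s. (z, s) \<in> A \<Longrightarrow> Re z \<ge> c \<and> Re s \<ge> 0"
  shows "uniform_limit A (\<lambda>n (z,s). integral {0..real n}
           (\<lambda>\<rho>. of_real \<rho> ^ p * exp (- (z * of_real \<rho>)) * \<psi> (s * of_real \<rho> ^ 3)))
           (\<lambda>(z,s). cubic_laplace p \<psi> z s) sequentially"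
proof -
  have "uniform_limit A (\<lambda>n x. integral {0..real n}
           (\<lambda>\<rho>. of_real \<rho> ^ p * exp (- (fst x * of_real \<rho>)) * \<psi> (snd x * of_real \<rho> ^ 3)))
           (\<lambda>x. integral {0..}
           (\<lambda>\<rho>. of_real \<rho> ^ p * exp (- (fst x * of_real \<rho>)) * \<psi> (snd x * of_real \<rho> ^ 3))) sequentially"
  proof (rule uniform_limit_improper_integral[where h = "\<lambda>\<rho>. \<rho> ^ p * exp (-(c * \<rho>))"])
    show "(\<lambda>\<rho>. \<rho> ^ p * exp (- (c * \<rho>))) integrable_on {0..}"
      using assms(2) by (intro integrable_power_exp) auto
  next
    fix x \<rho> assume "x \<in> A" and "\<rho> \<ge> (0::real)"
    moreover from \<open>x \<in> A\<close> have "Re (fst x) \<ge> c" "Re (snd x) \<ge> 0"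
      using assms(3)[of "fst x" "snd x"] by auto
    ultimately show "cmod (of_real \<rho> ^ p * exp (- (fst x * of_real \<rho>)) * \<psi> (snd x * of_real \<rho> ^ 3))
         \<le> \<rho> ^ p * exp (- (c * \<rho>))"
      by (intro cubic_laplace_integrand_bound assms(1))
  qed (intro cubic_laplace_integrand_continuous assms(1))
  then show ?thesis by (simp add: cubic_laplace_def case_prod_unfold)
qed

text \<open>The point is continuity up to the line Re \<open>s\<close> = 0, where the phases of the
  boundary rays lie. The truncations converge uniformly on Re \<open>z\<close> > \<open>c\<close>
  for every positive \<open>c\<close>; continuity is local, so \<open>c\<close> may depend on the
  point.\<close>

lemma cubic_laplace_continuous_on:
  assumes "contractive \<psi>"
  shows "continuous_on ({z. Re z > 0} \<times> {s. Re s \<ge> 0}) (\<lambda>(z,s). cubic_laplace p \<psi> z s)"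
proof -
  have "continuous_on ({z. Re z > c} \<times> {s. Re s \<ge> 0}) (\<lambda>(z,s). cubic_laplace p \<psi> z s)" if "c > 0" for c
  proof (rule uniform_limit_theorem[OF _ cubic_laplace_uniform_limit[OF assms that]])
    show "\<forall>\<^sub>F n in sequentially. continuous_on ({z. Re z > c} \<times> {s. Re s \<ge> 0})
       (\<lambda>(z, s). integral {0..real n} (\<lambda>\<rho>. of_real \<rho> ^ p * exp (- (z * of_real \<rho>)) * \<psi> (s * of_real \<rho> ^ 3)))"
    proof (intro always_eventually allI)
      fix n
      have "continuous_on ({z. Re z > c} \<times> {s. Re s \<ge> 0}) (\<lambda>x. integral (cbox 0 (real n))
        (\<lambda>\<rho>. of_real \<rho> ^ p * exp (- (fst x * of_real \<rho>)) * \<psi> (snd x * of_real \<rho> ^ 3)))"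
        by (rule integral_continuous_on_param, unfold case_prod_unfold)
           (intro continuous_intros contractive_continuous[OF assms])
      then show "continuous_on ({z. Re z > c} \<times> {s. Re s \<ge> 0}) (\<lambda>(z, s). integral {0..real n}
        (\<lambda>\<rho>. of_real \<rho> ^ p * exp (- (z * of_real \<rho>)) * \<psi> (s * of_real \<rho> ^ 3)))"
        by (simp add: case_prod_unfold)
    qed
  qed auto
  then have c: "continuous (at x within {z. Re z > c} \<times> {s. Re s \<ge> 0}) (\<lambda>(z,s). cubic_laplace p \<psi> z s)"
    if "c > 0" "x \<in> {z. Re z > c} \<times> {s. Re s \<ge> 0}" for x c
    using that by (auto simp: continuous_on_eq_continuous_within)
  show ?thesis
    unfolding continuous_on_eq_continuous_within
  proof
    fix x :: "complex \<times> complex" assume x: "x \<in> {z. Re z > 0} \<times> {s. Re s \<ge> 0}"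
    have "open ({z. Re z > Re (fst x) / 2} \<times> (UNIV :: complex set))"
      by (intro open_Times open_halfspace_Re_gt open_UNIV)
    then have "at x within {z. Re z > 0} \<times> {s. Re s \<ge> 0} =
          at x within {z. Re z > Re (fst x) / 2} \<times> {s. Re s \<ge> 0}"
      by (rule at_within_nhd[rotated]) (use x in auto)
    then show "continuous (at x within {z. Re z > 0} \<times> {s. Re s \<ge> 0}) (\<lambda>(z,s). cubic_laplace p \<psi> z s)"
      using c[of "Re (fst x) / 2" x] x by auto
  qed
qed

text \<open>Truncated integrals are holomorphic by differentiation under the integral sign. On the
  closed ball of radius Re \<open>x\<close> / 2 about \<open>x\<close> the decay rate is at least Re
  \<open>x\<close> / 2, so they converge uniformly there.\<close>

lemma cubic_laplace_holomorphic_z: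
  assumes \<psi>: "contractive \<psi>" and s: "Re s \<ge> 0"
  shows "(\<lambda>z. cubic_laplace p \<psi> z s) holomorphic_on {z. Re z > 0}"
proof (rule holomorphic_uniform_sequence[OF open_halfspace_Re_gt])
  fix n :: nat
  have "convex {z. Re z > 0}" by (rule convex_halfspace_Re_gt)
  show "(\<lambda>z. integral {0..real n} (\<lambda>\<rho>. of_real \<rho> ^ p * exp (- (z * of_real \<rho>)) * \<psi> (s * of_real \<rho> ^ 3)))
      holomorphic_on {z. Re z > 0}"
    unfolding box_real(2)[symmetric]
  proof (rule leibniz_rule_holomorphic[rotated 3])
    show "((\<lambda>z. of_real \<rho> ^ p * exp (- (z * of_real \<rho>)) * \<psi> (s * of_real \<rho> ^ 3)) has_field_derivative
       - of_real \<rho> * (of_real \<rho> ^ p * exp (- (z * of_real \<rho>)) * \<psi> (s * of_real \<rho> ^ 3))) (at z within {z. Re z > 0})"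
      for z and \<rho> :: real
      by (rule derivative_eq_intros refl | simp)+
    show "(\<lambda>\<rho>. of_real \<rho> ^ p * exp (- (z * of_real \<rho>)) * \<psi> (s * of_real \<rho> ^ 3))
        integrable_on cbox 0 (real n)" for z
      by (intro integrable_continuous cubic_laplace_integrand_continuous[OF \<psi>])
    show "continuous_on ({z. 0 < Re z} \<times> cbox 0 (real n))
     (\<lambda>(z, \<rho>). - of_real \<rho> * (of_real \<rho> ^ p * exp (- (z * of_real \<rho>)) * \<psi> (s * of_real \<rho> ^ 3)))"
      unfolding case_prod_unfold
      by (intro continuous_intros contractive_continuous[OF \<psi>])
  qed (fact \<open>convex {z. Re z > 0}\<close>)
next
  fix x :: complex assume x: "x \<in> {z. Re z > 0}"
  have sub: "Re z \<ge> Re x / 2" if "z \<in> cball x (Re x / 2)" for z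
    using that abs_Re_le_cmod[of "x - z"] by (simp add: dist_norm)
  show "\<exists>d>0. cball x d \<subseteq> {z. 0 < Re z} \<and> uniform_limit (cball x d)
     (\<lambda>n z. integral {0..real n} (\<lambda>\<rho>. of_real \<rho> ^ p * exp (- (z * of_real \<rho>)) * \<psi> (s * of_real \<rho> ^ 3)))
     (\<lambda>z. cubic_laplace p \<psi> z s) sequentially"
  proof (intro exI[of _ "Re x / 2"] conjI)
    show "0 < Re x / 2" using x by simp
    show "cball x (Re x / 2) \<subseteq> {z. 0 < Re z}" using sub x by force
    have "uniform_limit (cball x (Re x / 2) \<times> {s}) (\<lambda>n (z,s). integral {0..real n}
           (\<lambda>\<rho>. of_real \<rho> ^ p * exp (- (z * of_real \<rho>)) * \<psi> (s * of_real \<rho> ^ 3)))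
           (\<lambda>(z,s). cubic_laplace p \<psi> z s) sequentially"
      by (rule cubic_laplace_uniform_limit[of _ "Re x / 2"]) (use \<psi> s sub x in auto)
    then show "uniform_limit (cball x (Re x / 2))
     (\<lambda>n z. integral {0..real n} (\<lambda>\<rho>. of_real \<rho> ^ p * exp (- (z * of_real \<rho>)) * \<psi> (s * of_real \<rho> ^ 3)))
     (\<lambda>z. cubic_laplace p \<psi> z s) sequentially"
      by (auto simp: uniform_limit_iff elim!: eventually_mono)
  qed
qed

text \<open>With \<open>z\<close> fixed, the one decay rate Re \<open>z\<close> serves all
  \<open>s\<close>. The derivative of \<open>\<psi>\<close> appears only inside the truncated
  integrals, where its continuity suffices.\<close>

lemma cubic_laplace_holomorphic_s:
  assumes \<psi>: "contractive \<psi>" and z: "Re z > 0"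
  shows "(\<lambda>s. cubic_laplace p \<psi> z s) holomorphic_on {s. Re s > 0}"
proof (rule holomorphic_uniform_sequence[OF open_halfspace_Re_gt])
  fix n :: nat
  have "convex {z. Re z > 0}" by (rule convex_halfspace_Re_gt)
  have d: "(\<psi> has_field_derivative deriv \<psi> w) (at w within A)" for w A
    using \<psi> unfolding contractive_def
    by (meson UNIV_I has_field_derivative_at_within holomorphic_derivI open_UNIV)
  have dc: "continuous_on A (\<lambda>x. deriv \<psi> (f x))" if "continuous_on A f" for A :: "'c::topological_space set" and f
  proof (rule continuous_on_compose2[OF _ that subset_UNIV])
    have "\<psi> holomorphic_on UNIV" using \<psi> by (simp add: contractive_def)
    then show "continuous_on UNIV (deriv \<psi>)"
      by (intro holomorphic_on_imp_continuous_on holomorphic_deriv) auto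
  qed
  show "(\<lambda>s. integral {0..real n} (\<lambda>\<rho>. of_real \<rho> ^ p * exp (- (z * of_real \<rho>)) * \<psi> (s * of_real \<rho> ^ 3)))
      holomorphic_on {z. Re z > 0}"
    unfolding box_real(2)[symmetric]
  proof (rule leibniz_rule_holomorphic[rotated 3])
    show "((\<lambda>s. of_real \<rho> ^ p * exp (- (z * of_real \<rho>)) * \<psi> (s * of_real \<rho> ^ 3)) has_field_derivative
       of_real \<rho> ^ p * exp (- (z * of_real \<rho>)) * (deriv \<psi> (s * of_real \<rho> ^ 3) * of_real \<rho> ^ 3))
       (at s within {z. Re z > 0})" for s and \<rho> :: real
    proof (rule DERIV_cmult)
      have "((\<lambda>s. s * of_real \<rho> ^ 3) has_field_derivative of_real \<rho> ^ 3) (at s within {z. Re z > 0})"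
        by (auto intro!: derivative_eq_intros)
      from DERIV_chain'[OF this d]
      show "((\<lambda>s. \<psi> (s * of_real \<rho> ^ 3)) has_field_derivative deriv \<psi> (s * of_real \<rho> ^ 3) * of_real \<rho> ^ 3)
         (at s within {z. Re z > 0})" .
    qed
    show "(\<lambda>\<rho>. of_real \<rho> ^ p * exp (- (z * of_real \<rho>)) * \<psi> (s * of_real \<rho> ^ 3))
        integrable_on cbox 0 (real n)" for s
      by (intro integrable_continuous cubic_laplace_integrand_continuous[OF \<psi>])
    show "continuous_on ({z. 0 < Re z} \<times> cbox 0 (real n))
     (\<lambda>(s, \<rho>). of_real \<rho> ^ p * exp (- (z * of_real \<rho>)) * (deriv \<psi> (s * of_real \<rho> ^ 3) * of_real \<rho> ^ 3))"
      unfolding case_prod_unfold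
      by (intro continuous_intros dc)
  qed (fact \<open>convex {z. Re z > 0}\<close>)
next
  fix x :: complex assume x: "x \<in> {z. Re z > 0}"
  have sub: "Re z \<ge> Re x / 2" if "z \<in> cball x (Re x / 2)" for z
    using that abs_Re_le_cmod[of "x - z"] by (simp add: dist_norm)
  show "\<exists>d>0. cball x d \<subseteq> {z. 0 < Re z} \<and> uniform_limit (cball x d)
     (\<lambda>n s. integral {0..real n} (\<lambda>\<rho>. of_real \<rho> ^ p * exp (- (z * of_real \<rho>)) * \<psi> (s * of_real \<rho> ^ 3)))
     (\<lambda>s. cubic_laplace p \<psi> z s) sequentially"
  proof (intro exI[of _ "Re x / 2"] conjI)
    show "0 < Re x / 2" using x by simp
    show "cball x (Re x / 2) \<subseteq> {z. 0 < Re z}" using sub x by force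
    have "uniform_limit ({z} \<times> cball x (Re x / 2)) (\<lambda>n (z,s). integral {0..real n}
           (\<lambda>\<rho>. of_real \<rho> ^ p * exp (- (z * of_real \<rho>)) * \<psi> (s * of_real \<rho> ^ 3)))
           (\<lambda>(z,s). cubic_laplace p \<psi> z s) sequentially"
      by (rule cubic_laplace_uniform_limit[of _ "Re z"]) (use \<psi> z sub x in force)+
    then show "uniform_limit (cball x (Re x / 2))
     (\<lambda>n s. integral {0..real n} (\<lambda>\<rho>. of_real \<rho> ^ p * exp (- (z * of_real \<rho>)) * \<psi> (s * of_real \<rho> ^ 3)))
     (\<lambda>s. cubic_laplace p \<psi> z s) sequentially"
      by (auto simp: uniform_limit_iff elim!: eventually_mono)
  qed
qed

text \<open>The identity theorem: the positive reals accumulate at 1, a point of the connected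
  half-plane.\<close>

lemma halfplane_identity:
  assumes "f holomorphic_on {z. Re z > 0}" "g holomorphic_on {z. Re z > 0}"
    and "\<And>x::real. x > 0 \<Longrightarrow> f (of_real x) = g (of_real x)" and "Re z > 0"
  shows "f z = g z"
proof -
  have "f z - g z = 0"
  proof (rule analytic_continuation[where S = "{z. Re z > 0}" and U = "of_real ` {0<..}" and \<xi> = 1
        and f = "\<lambda>z. f z - g z"])
    show "connected {z. Re z > 0}" by (rule convex_connected[OF convex_halfspace_Re_gt])
    show "(1::complex) islimpt of_real ` {0<..}"
      unfolding islimpt_approachable
    proof (intro allI impI)
      fix e :: real assume "e > 0"
      have "dist (of_real (1 + e/2)) (of_real 1 :: complex) < e" "1 + e/2 > 0" "of_real (1 + e/2) \<noteq> (of_real 1 :: complex)"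
        using \<open>e > 0\<close> unfolding dist_of_real of_real_eq_iff by (auto simp: dist_real_def)
      then show "\<exists>x'\<in>of_real ` {0<..}. x' \<noteq> 1 \<and> dist x' (1::complex) < e"
        unfolding of_real_1 by (metis greaterThan_iff imageI)
    qed
  qed (use assms in \<open>auto intro!: holomorphic_intros open_halfspace_Re_gt\<close>)
  then show ?thesis by simp
qed

text \<open>A formula computed for positive real parameters spreads in three moves: to the open
  half-plane in \<open>s\<close>, then to the open half-plane in \<open>z\<close>, both by the
  identity theorem, and finally to imaginary \<open>s\<close> by continuity. The point
  \<open>s\<close> = 0 is excluded because the formulas \<open>F\<close> in question contain
  \<open>Ln s\<close>.\<close>

lemma cubic_laplace_eqI:
  assumes \<psi>: "contractive \<psi>"
    and Fz: "\<And>s. Re s > 0 \<Longrightarrow> (\<lambda>z. F z s) holomorphic_on {z. Re z > 0}"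
    and Fs: "\<And>z. Re z > 0 \<Longrightarrow> (\<lambda>s. F z s) holomorphic_on {s. Re s > 0}"
    and Fc: "\<And>z. Re z > 0 \<Longrightarrow> continuous_on {s. Re s \<ge> 0 \<and> s \<noteq> 0} (F z)"
    and eq: "\<And>x y::real. x > 0 \<Longrightarrow> y > 0 \<Longrightarrow> cubic_laplace p \<psi> (of_real x) (of_real y) = F (of_real x) (of_real y)"
    and z: "Re z > 0" and s: "Re s \<ge> 0" "s \<noteq> 0"
  shows "cubic_laplace p \<psi> z s = F z s"
proof -
  have 1: "cubic_laplace p \<psi> (of_real x) s = F (of_real x) s" if "x > 0" "Re s > 0" for x s
  proof (rule halfplane_identity[of "\<lambda>s. cubic_laplace p \<psi> (of_real x) s" "\<lambda>s. F (of_real x) s"])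
    show "(\<lambda>s. cubic_laplace p \<psi> (of_real x) s) holomorphic_on {z. 0 < Re z}"
      using that by (intro cubic_laplace_holomorphic_s \<psi>) auto
    show "(\<lambda>s. F (of_real x) s) holomorphic_on {z. 0 < Re z}" using that by (intro Fs) auto
  qed (use eq that in auto)
  have 2: "cubic_laplace p \<psi> z s = F z s" if "Re s > 0" "Re z > 0" for z s
  proof (rule halfplane_identity[of "\<lambda>z. cubic_laplace p \<psi> z s" "\<lambda>z. F z s"])
    show "(\<lambda>z. cubic_laplace p \<psi> z s) holomorphic_on {z. 0 < Re z}"
      using that by (intro cubic_laplace_holomorphic_z \<psi>) auto
    show "(\<lambda>z. F z s) holomorphic_on {z. 0 < Re z}" using that by (intro Fz) auto
  qed (use 1 that in auto)
  \<comment> \<open>Shifting by 1/(n+1) to the right puts the approximating points into the open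
    half-plane.\<close>
  define sn where "sn = (\<lambda>n. s + of_real (1 / real (Suc n)))"
  have sn: "sn \<longlonglongrightarrow> s"
    unfolding sn_def inverse_eq_divide[symmetric]
    using tendsto_add[OF tendsto_const[of s] tendsto_of_real[OF LIMSEQ_inverse_real_of_nat, where 'a=complex]]
    by (simp only: of_real_0 add_0_right)
  have sn0: "Re (sn n) > 0" for n
    using s by (auto simp: sn_def intro!: add_nonneg_pos)
  have ne: "sn n \<noteq> 0" for n
    using sn0[of n] by (metis less_irrefl zero_complex.sel(1))
  have "(\<lambda>n. F z (sn n)) \<longlonglongrightarrow> F z s"
    by (rule continuous_on_tendsto_compose[OF Fc[OF z] sn])
      (use s sn0 ne in \<open>auto intro!: always_eventually intro: less_imp_le\<close>)
  moreover have "(\<lambda>n. cubic_laplace p \<psi> z (sn n)) \<longlonglongrightarrow> cubic_laplace p \<psi> z s"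
  proof -
    have "(\<lambda>n. (z, sn n)) \<longlonglongrightarrow> (z, s)" by (intro tendsto_Pair tendsto_const sn)
    then have "(\<lambda>n. (\<lambda>(z, s). cubic_laplace p \<psi> z s) (z, sn n)) \<longlonglongrightarrow> (\<lambda>(z, s). cubic_laplace p \<psi> z s) (z, s)"
      by (rule continuous_on_tendsto_compose[OF cubic_laplace_continuous_on[OF \<psi>]])
         (use z s sn0 in \<open>auto intro!: always_eventually intro: less_imp_le\<close>)
    then show ?thesis by simp
  qed
  ultimately show ?thesis
    using 2[OF sn0 z] by (simp add: LIMSEQ_unique)
qed

section \<open>Gamma moments and the power series of the kernel\<close>

lemma has_integral_greaterThan_iff:
  fixes f :: "real \<Rightarrow> 'a::euclidean_space"
  shows "(f has_integral y) {a<..} \<longleftrightarrow> (f has_integral y) {a..}"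
proof (rule has_integral_spike_set_eq)
  show "negligible {x \<in> {a<..} - {a..}. f x \<noteq> 0}"
    by (rule negligible_subset[of "{a}"]) auto
  show "negligible {x \<in> {a..} - {a<..}. f x \<noteq> 0}"
    by (rule negligible_subset[of "{a}"]) auto
qed

text \<open>The substitution t = y \<rho>^3 in Euler's integral for Gamma at (k+1)/3. It is carried
  out on the open half-line, where it is a bijection and the laws of \<open>powr\<close> hold; the
  end point does not change the integral.\<close>

lemma has_integral_power_exp_cube:
  fixes y :: real
  assumes y: "y > 0"
  shows "((\<lambda>\<rho>. \<rho> ^ k * exp (-(y * \<rho> ^ 3))) has_integral
           (Gamma (real (k + 1) / 3) / 3 * y powr (-(real (k + 1) / 3)))) {0..}"
proof -
  define a where "a = real (k + 1) / 3"
  have a: "a > 0" by (simp add: a_def)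
  let ?f = "\<lambda>t. t powr (a - 1) / exp t"
  have f: "(?f has_integral Gamma a) {0<..}"
    unfolding has_integral_greaterThan_iff by (rule Gamma_integral_real[OF a])
  then have fa: "?f absolutely_integrable_on {0<..}"
    by (intro nonnegative_absolutely_integrable_1) auto
  have img: "(\<lambda>\<rho>. y * \<rho> ^ 3) ` {0<..} = {0<..}"
  proof (intro equalityI subsetI)
    fix t :: real assume "t \<in> {0<..}"
    then have "t = y * (root 3 (t / y)) ^ 3" "root 3 (t/y) > 0"
      using y by (simp_all add: odd_real_root_pow)
    then show "t \<in> (\<lambda>\<rho>. y * \<rho> ^ 3) ` {0<..}"
      using image_eqI[of t "\<lambda>\<rho>. y * \<rho> ^ 3" "root 3 (t/y)" "{0<..}"] by blast
  qed (use y in auto)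
  have inj: "inj_on (\<lambda>\<rho>. y * \<rho> ^ 3) {0<..}"
    using y by (auto simp: inj_on_def intro: power_eq_imp_eq_base[of _ 3])
  have "(\<lambda>\<rho>. \<bar>y * (3 * \<rho>^2)\<bar> * ?f (y * \<rho> ^ 3)) absolutely_integrable_on {0<..} \<and>
        integral {0<..} (\<lambda>\<rho>. \<bar>y * (3 * \<rho>^2)\<bar> * ?f (y * \<rho> ^ 3)) = Gamma a"
    by (subst has_absolute_integral_change_of_variables_1'[OF _ _ inj])
       (auto intro!: derivative_eq_intros simp: img fa integral_unique[OF f])
  then have "((\<lambda>\<rho>. \<bar>y * (3 * \<rho>^2)\<bar> * ?f (y * \<rho> ^ 3)) has_integral Gamma a) {0<..}"
    unfolding has_integral_iff by (blast intro: set_lebesgue_integral_eq_integral(1))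
  then have 1: "((\<lambda>\<rho>. 3 * y powr a * (\<rho> ^ k * exp (-(y * \<rho> ^ 3)))) has_integral Gamma a) {0<..}"
  proof (rule has_integral_eq[rotated])
    fix \<rho> :: real assume "\<rho> \<in> {0<..}"
    then have r: "\<rho> > 0" by simp
    have "(y * \<rho> ^ 3) powr (a - 1) = y powr (a - 1) * \<rho> powr (3 * (a - 1))"
    proof -
      have "\<rho> ^ 3 = \<rho> powr 3" using powr_realpow[OF r, of 3] by simp
      then show ?thesis using r y by (simp only: powr_mult powr_powr)
    qed
    also have "\<dots> = y powr a / y * (\<rho> ^ k / \<rho>^2)"
    proof -
      have "3 * (a - 1) = real k - 2" by (simp add: a_def)
      then show ?thesis using r y by (simp add: powr_diff powr_realpow)
    qed
    finally show "\<bar>y * (3 * \<rho>^2)\<bar> * ?f (y * \<rho> ^ 3) = 3 * y powr a * (\<rho> ^ k * exp (-(y * \<rho> ^ 3)))"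
      using r y by (simp add: exp_minus field_simps)
  qed
  have "((\<lambda>\<rho>. \<rho> ^ k * exp (-(y * \<rho> ^ 3))) has_integral (inverse (3 * y powr a) * Gamma a)) {0<..}"
    using has_integral_mult_right[OF 1, of "inverse (3 * y powr a)"] y by (simp add: field_simps)
  then have "((\<lambda>\<rho>. \<rho> ^ k * exp (-(y * \<rho> ^ 3))) has_integral (inverse (3 * y powr a) * Gamma a)) {0..}"
    unfolding has_integral_greaterThan_iff .
  then show ?thesis by (simp add: a_def powr_minus field_simps)
qed

text \<open>The positive point \<open>norm \<eta> + 1\<close> lies beyond the circle through
  \<open>\<eta>\<close>, and a power series converges absolutely strictly inside the radius of any
  point of convergence.\<close>

lemma powser_abs_summable_everywhere:
  fixes c :: "nat \<Rightarrow> complex" and \<eta> :: complex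
  assumes "\<And>x::real. x > 0 \<Longrightarrow> summable (\<lambda>n. c n * of_real x ^ n)"
  shows "summable (\<lambda>n. norm (c n * \<eta> ^ n))"
proof -
  have "norm \<eta> < norm (of_real (norm \<eta> + 1) :: complex)"
    unfolding norm_of_real using norm_ge_zero[of \<eta>] by linarith
  moreover have "summable (\<lambda>n. c n * of_real (norm \<eta> + 1) ^ n)"
    using norm_ge_zero[of \<eta>] by (intro assms) linarith
  ultimately show ?thesis by (rule powser_insidea[rotated])
qed

lemma powser_holomorphic:
  fixes c :: "nat \<Rightarrow> complex"
  assumes "\<And>\<eta>. summable (\<lambda>n. norm (c n * \<eta> ^ n))"
  shows "(\<lambda>\<eta>. \<Sum>n. c n * \<eta> ^ n) holomorphic_on A"
proof -
  have "((\<lambda>\<eta>. \<Sum>n. c n * \<eta> ^ n) has_field_derivative (\<Sum>n. diffs c n * \<eta> ^ n)) (at \<eta> within A)" for \<eta>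
    by (rule has_field_derivative_at_within[OF termdiffs_strong_converges_everywhere])
       (rule summable_norm_cancel[OF assms])
  then show ?thesis
    unfolding holomorphic_on_def field_differentiable_def by blast
qed

lemma contractive_exp: "contractive (\<lambda>w. exp (- w))"
  unfolding contractive_def by (auto intro!: holomorphic_intros)

text \<open>These numbers arise when exp(-\<eta>\<rho>) is expanded and \<rho>^(n+p) exp(-\<rho>^3)
  is integrated over the half-line, which gives Gamma((n+p+1)/3)/3.\<close>

definition kernel_coeff :: "nat \<Rightarrow> nat \<Rightarrow> real" where
  "kernel_coeff p n = (-1) ^ n * Gamma (real (n + p + 1) / 3) / (3 * fact n)"

text \<open>The entire continuation in \<eta> of the integral of \<rho>^p exp(-\<eta>\<rho> -
  \<rho>^3) over the half-line; up to scaling, a derivative of Scorer's function Hi.\<close>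

definition kernel_fun :: "nat \<Rightarrow> complex \<Rightarrow> complex" where
  "kernel_fun p \<eta> = (\<Sum>n. of_real (kernel_coeff p n) * \<eta> ^ n)"

text \<open>The two terms (x+1)\<rho> and y\<rho>^3 balance at \<rho> = sqrt((x+1)/y). Beyond that
  point the cubic term wins, and before it the linear term is at most its value there. Using x + 1
  in place of x leaves the factor exp(-\<rho>) for integration.\<close>

lemma cubic_exponent_bound:
  fixes x y \<rho> :: real
  assumes "x > 0" "y > 0" "\<rho> \<ge> 0"
  shows "exp (x * \<rho>) * exp (-(y * \<rho> ^ 3)) \<le> exp ((x + 1) * sqrt ((x + 1) / y)) * exp (-\<rho>)"
proof -
  have "(x + 1) * \<rho> - y * \<rho> ^ 3 \<le> (x + 1) * sqrt ((x + 1) / y)"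
  proof (cases "\<rho> \<le> sqrt ((x + 1) / y)")
    case True
    then have "(x + 1) * \<rho> \<le> (x + 1) * sqrt ((x + 1) / y)" using assms by (intro mult_left_mono) auto
    then show ?thesis using assms by (smt (verit) mult_nonneg_nonneg zero_le_power)
  next
    case False
    then have "(x + 1) / y \<le> \<rho> ^ 2"
      using assms by (metis linorder_not_le real_le_lsqrt less_imp_le sqrt_le_D)
    then have "(x + 1) \<le> y * \<rho> ^ 2" using assms by (simp add: field_simps)
    then have "(x + 1) * \<rho> \<le> y * \<rho> ^ 2 * \<rho>" using assms by (intro mult_right_mono) auto
    then have "(x + 1) * \<rho> - y * \<rho> ^ 3 \<le> 0" by (simp add: power3_eq_cube power2_eq_square mult.assoc)
    also have "0 \<le> (x + 1) * sqrt ((x + 1) / y)" using assms by simp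
    finally show ?thesis .
  qed
  then have "exp (x * \<rho> + (-(y * \<rho> ^ 3))) \<le> exp ((x + 1) * sqrt ((x + 1) / y) + (-\<rho>))"
    unfolding exp_le_cancel_iff by (simp add: algebra_simps)
  then show ?thesis by (simp only: exp_add)
qed

text \<open>The partial sums of exp(-x\<rho>) are bounded by exp(x\<rho>), which exp(-y\<rho>^3)
  outweighs, so dominated convergence allows termwise integration over the whole half-line.\<close>

lemma kernel_sums_real:
  fixes x y :: real
  assumes x: "x > 0" and y: "y > 0"
  shows "(\<lambda>n. of_real (kernel_coeff p n * x ^ n * y powr (-(real (n + p + 1) / 3)))) sums
           cubic_laplace p (\<lambda>w. exp (- w)) (of_real x) (of_real y)"
proof -
  define f :: "nat \<Rightarrow> real \<Rightarrow> complex" where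
    "f = (\<lambda>k \<rho>. of_real (\<Sum>n<k. (-x) ^ n / fact n * (\<rho> ^ (n + p) * exp (-(y * \<rho> ^ 3)))))"
  define h where "h = (\<lambda>\<rho>. exp ((x + 1) * sqrt ((x + 1) / y)) * (\<rho> ^ p * exp (-(1 * \<rho>))))"
  have fi: "(f k has_integral of_real (\<Sum>n<k. kernel_coeff p n * x ^ n * y powr (-(real (n + p + 1) / 3)))) {0..}" for k
  proof -
    have "((\<lambda>\<rho>. \<Sum>n<k. (-x) ^ n / fact n * (\<rho> ^ (n + p) * exp (-(y * \<rho> ^ 3)))) has_integral
       (\<Sum>n<k. (-x) ^ n / fact n * (Gamma (real (n + p + 1) / 3) / 3 * y powr (-(real (n + p + 1) / 3))))) {0..}"
      by (intro has_integral_sum has_integral_mult_right has_integral_power_exp_cube y) auto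
    moreover have "(-x) ^ n / fact n * (Gamma (real (n + p + 1) / 3) / 3 * y powr (-(real (n + p + 1) / 3))) =
       kernel_coeff p n * x ^ n * y powr (-(real (n + p + 1) / 3))" for n
      unfolding kernel_coeff_def power_minus[of x] by (simp add: field_simps)
    ultimately show ?thesis unfolding f_def by (intro has_integral_of_real) simp
  qed
  have hi: "h integrable_on {0..}"
    unfolding h_def by (intro integrable_on_mult_right integrable_power_exp) auto
  have factor: "f k \<rho> = of_real ((\<Sum>n<k. (-x * \<rho>) ^ n / fact n) * (\<rho> ^ p * exp (-(y * \<rho> ^ 3))))" for k \<rho>
    unfolding f_def of_real_eq_iff sum_distrib_right
    by (intro sum.cong refl) (simp only: power_add power_mult_distrib times_divide_eq_left times_divide_eq_right ac_simps)
  have bound: "norm (f k \<rho>) \<le> h \<rho>" if "\<rho> \<in> {0..}" for k \<rho>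
  proof -
    have r: "\<rho> \<ge> 0" using that by simp
    have "\<bar>\<Sum>n<k. (-x * \<rho>) ^ n / fact n\<bar> \<le> (\<Sum>n<k. \<bar>(-x * \<rho>) ^ n / fact n\<bar>)" by (rule sum_abs)
    also have "\<dots> = (\<Sum>n<k. (x * \<rho>) ^ n /\<^sub>R fact n)"
      using x r by (intro sum.cong refl) (simp add: power_abs abs_mult divide_inverse_commute)
    also have "\<dots> \<le> (\<Sum>n. (x * \<rho>) ^ n /\<^sub>R fact n)"
      by (rule sum_le_suminf[OF summable_exp_generic]) (use x r in auto)
    also have "\<dots> = exp (x * \<rho>)" by (rule sums_unique[OF exp_converges, symmetric])
    finally have 1: "\<bar>\<Sum>n<k. (-x * \<rho>) ^ n / fact n\<bar> \<le> exp (x * \<rho>)" .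
    have "norm (f k \<rho>) = \<bar>\<Sum>n<k. (-x * \<rho>) ^ n / fact n\<bar> * (\<rho> ^ p * exp (-(y * \<rho> ^ 3)))"
      unfolding factor norm_of_real abs_mult using r by simp
    also have "\<dots> \<le> exp (x * \<rho>) * (\<rho> ^ p * exp (-(y * \<rho> ^ 3)))"
      using 1 r by (intro mult_right_mono) auto
    also have "\<dots> = (exp (x * \<rho>) * exp (-(y * \<rho> ^ 3))) * \<rho> ^ p" by simp
    also have "\<dots> \<le> (exp ((x + 1) * sqrt ((x + 1) / y)) * exp (-\<rho>)) * \<rho> ^ p"
      by (intro mult_right_mono cubic_exponent_bound x y r zero_le_power)
    also have "\<dots> = h \<rho>" by (simp add: h_def)
    finally show ?thesis .
  qed
  have conv: "(\<lambda>k. f k \<rho>) \<longlonglongrightarrow> of_real \<rho> ^ p * exp (- (of_real x * of_real \<rho>)) * exp (- (of_real y * of_real \<rho> ^ 3))" for \<rho>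
  proof -
    have "(\<lambda>n. (-x * \<rho>) ^ n /\<^sub>R fact n) sums exp (-x * \<rho>)" by (rule exp_converges)
    then have "(\<lambda>k. \<Sum>n<k. (-x * \<rho>) ^ n / fact n) \<longlonglongrightarrow> exp (-x * \<rho>)"
      by (simp add: sums_def divide_inverse_commute)
    then have "(\<lambda>k. f k \<rho>) \<longlonglongrightarrow> of_real (exp (-x * \<rho>) * (\<rho> ^ p * exp (-(y * \<rho> ^ 3))))"
      unfolding factor by (intro tendsto_intros)
    moreover have "of_real (exp (-x * \<rho>) * (\<rho> ^ p * exp (-(y * \<rho> ^ 3)))) =
        (of_real \<rho> ^ p * exp (- (of_real x * of_real \<rho>)) * exp (- (of_real y * of_real \<rho> ^ 3)) :: complex)"
      by (simp only: exp_of_real[symmetric] of_real_mult of_real_power of_real_minus mult_minus_left mult.assoc)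
        (simp only: mult.left_commute)
    ultimately show ?thesis by (simp only:)
  qed
  have "(\<lambda>k. integral {0..} (f k)) \<longlonglongrightarrow> cubic_laplace p (\<lambda>w. exp (- w)) (of_real x) (of_real y)"
    unfolding cubic_laplace_def
    by (rule dominated_convergence(2)[OF _ hi bound conv]) (use fi in \<open>auto simp: integrable_on_def\<close>)
  then show ?thesis
    by (simp only: sums_def integral_unique[OF fi] of_real_sum)
qed

text \<open>At y = 1 the power of y disappears from \<open>kernel_sums_real\<close>, which leaves
  the plain power series at every positive point.\<close>

lemma kernel_coeff_abs_summable: "summable (\<lambda>n. norm (of_real (kernel_coeff p n) * \<eta> ^ n :: complex))"
proof (rule powser_abs_summable_everywhere)
  fix x :: real assume "x > 0"
  from kernel_sums_real[OF this zero_less_one, of p]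
  show "summable (\<lambda>n. of_real (kernel_coeff p n) * of_real x ^ n :: complex)"
    unfolding powr_one_eq_one mult_1_right of_real_mult of_real_power by (rule sums_summable)
qed

lemma kernel_fun_sums: "(\<lambda>n. of_real (kernel_coeff p n) * \<eta> ^ n) sums kernel_fun p \<eta>"
  unfolding kernel_fun_def by (rule summable_sums[OF summable_norm_cancel[OF kernel_coeff_abs_summable]])

lemma kernel_fun_holomorphic: "kernel_fun p holomorphic_on A"
  unfolding kernel_fun_def[abs_def] by (rule powser_holomorphic[OF kernel_coeff_abs_summable])

lemma kernel_fun_holomorphic_compose:
  assumes "f holomorphic_on A"
  shows "(\<lambda>x. kernel_fun p (f x)) holomorphic_on A"
  using holomorphic_on_compose[OF assms kernel_fun_holomorphic] by (simp add: o_def)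

lemma kernel_fun_continuous_compose:
  assumes "continuous_on A f"
  shows "continuous_on A (\<lambda>x. kernel_fun p (f x))"
  by (rule continuous_on_compose2[OF holomorphic_on_imp_continuous_on[OF kernel_fun_holomorphic[of p UNIV]] assms subset_UNIV])

lemma Re_nonneg_notin_nonpos_Reals: "Re s \<ge> 0 \<Longrightarrow> s \<noteq> 0 \<Longrightarrow> s \<notin> \<real>\<^sub>\<le>\<^sub>0"
  by (auto simp: complex_nonpos_Reals_iff complex_eq_iff)

lemma Re_pos_notin_nonpos_Reals: "Re s > 0 \<Longrightarrow> s \<notin> \<real>\<^sub>\<le>\<^sub>0"
  by (auto simp: complex_nonpos_Reals_iff)

text \<open>Each term of the real series is s^(-(p+1)/3) (z s^(-1/3))^n. Writing the powers through
  the principal \<open>Ln\<close> makes the formula holomorphic off the nonpositive reals, hence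
  valid up to imaginary \<open>s\<close> by \<open>cubic_laplace_eqI\<close>.\<close>

lemma kernel_series:
  assumes "Re z > 0" "Re s \<ge> 0" "s \<noteq> 0"
  shows "cubic_laplace p (\<lambda>w. exp (- w)) z s = exp (-(of_real (real (p + 1) / 3) * Ln s)) * kernel_fun p (z * exp (-(Ln s / 3)))"
proof (rule cubic_laplace_eqI[OF contractive_exp _ _ _ _ assms,
    where F = "\<lambda>z s. exp (-(of_real (real (p + 1) / 3) * Ln s)) * kernel_fun p (z * exp (-(Ln s / 3)))"])
  show "(\<lambda>z. exp (-(of_real (real (p + 1) / 3) * Ln s)) * kernel_fun p (z * exp (-(Ln s / 3)))) holomorphic_on {z. 0 < Re z}" for s
    by (intro holomorphic_intros kernel_fun_holomorphic_compose) auto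
  show "(\<lambda>s. exp (-(of_real (real (p + 1) / 3) * Ln s)) * kernel_fun p (z * exp (-(Ln s / 3)))) holomorphic_on {s. 0 < Re s}" for z
    by (intro holomorphic_intros kernel_fun_holomorphic_compose)
       (auto simp: Re_pos_notin_nonpos_Reals)
  show "continuous_on {s. 0 \<le> Re s \<and> s \<noteq> 0} (\<lambda>s. exp (-(of_real (real (p + 1) / 3) * Ln s)) * kernel_fun p (z * exp (-(Ln s / 3))))" for z
    by (intro continuous_intros kernel_fun_continuous_compose)
       (auto simp: Re_nonneg_notin_nonpos_Reals)
next
  fix x y :: real assume x: "x > 0" and y: "y > 0"
  define \<eta> where "\<eta> = x * exp (-(ln y / 3))"
  have L: "Ln (of_real y) = of_real (ln y)" using y by (simp add: Ln_of_real)
  have eq: "kernel_coeff p n * x ^ n * y powr (-(real (n + p + 1) / 3)) = exp (-(real (p + 1) / 3 * ln y)) * (kernel_coeff p n * \<eta> ^ n)" for n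
  proof -
    have "y powr (-(real (n + p + 1) / 3)) = exp (-(real (p + 1) / 3 * ln y)) * exp (-(ln y / 3)) ^ n"
      using y by (simp add: powr_def exp_of_nat_mult[symmetric] exp_add[symmetric] field_simps)
    then show ?thesis by (simp add: \<eta>_def power_mult_distrib mult_ac)
  qed
  have "(\<lambda>n. of_real (exp (-(real (p + 1) / 3 * ln y))) * (of_real (kernel_coeff p n) * of_real \<eta> ^ n)) sums
       (of_real (exp (-(real (p + 1) / 3 * ln y))) * kernel_fun p (of_real \<eta>))"
    by (intro sums_mult kernel_fun_sums)
  moreover have "(\<lambda>n. of_real (exp (-(real (p + 1) / 3 * ln y))) * (of_real (kernel_coeff p n) * of_real \<eta> ^ n)) sums
      cubic_laplace p (\<lambda>w. exp (- w)) (of_real x) (of_real y)"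
    using kernel_sums_real[OF x y, of p] unfolding eq by (simp only: of_real_mult of_real_power)
  ultimately have "cubic_laplace p (\<lambda>w. exp (- w)) (of_real x) (of_real y) =
     of_real (exp (-(real (p + 1) / 3 * ln y))) * kernel_fun p (of_real \<eta>)"
    by (rule sums_unique2[symmetric])
  then show "cubic_laplace p (\<lambda>w. exp (- w)) (of_real x) (of_real y) =
     exp (-(of_real (real (p + 1) / 3) * Ln (of_real y))) * kernel_fun p (of_real x * exp (-(Ln (of_real y) / 3)))"
    unfolding L \<eta>_def by (simp add: exp_of_real[symmetric])
qed

text \<open>The order is exchanged on the compact rectangle with \<rho> at most n, where everything
  is continuous. The bound M \<rho>^p exp(-\<rho> Re z), uniform in \<tau>, then lets n tend to
  infinity on both sides.\<close>

lemma cubic_laplace_fubini: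
  assumes z: "Re z > 0" and s: "Re s \<ge> 0" and a: "0 \<le> a" and g: "continuous_on {a..b} g"
  shows "integral {0..} (\<lambda>\<rho>. of_real \<rho> ^ p * exp (- (z * of_real \<rho>)) *
            integral {a..b} (\<lambda>\<tau>. exp (- (s * of_real \<rho> ^ 3 * of_real \<tau>)) * g \<tau>)) =
         integral {a..b} (\<lambda>\<tau>. cubic_laplace p (\<lambda>w. exp (- w)) z (s * of_real \<tau>) * g \<tau>)"
proof -
  obtain M where M: "M > 0" "\<And>\<tau>. \<tau> \<in> {a..b} \<Longrightarrow> norm (g \<tau>) \<le> M"
    using compact_continuous_image[OF g compact_Icc, THEN compact_imp_bounded] unfolding bounded_pos by auto
  define h where "h = (\<lambda>\<rho>. M * (\<rho> ^ p * exp (-(Re z * \<rho>))))"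
  have hi: "h integrable_on {0..}"
    unfolding h_def using z by (intro integrable_on_mult_right integrable_power_exp) auto
  define G where "G = (\<lambda>\<tau> \<rho>. of_real \<rho> ^ p * exp (- (z * of_real \<rho>)) * exp (- (s * of_real \<tau> * of_real \<rho> ^ 3)) * g \<tau>)"
  have GF: "G \<tau> \<rho> = of_real \<rho> ^ p * exp (- (z * of_real \<rho>)) * (exp (- (s * of_real \<rho> ^ 3 * of_real \<tau>)) * g \<tau>)" for \<tau> \<rho>
    by (simp add: G_def mult_ac)
  have Gb: "norm (G \<tau> \<rho>) \<le> h \<rho>" if "\<tau> \<in> {a..b}" "\<rho> \<ge> 0" for \<tau> \<rho>
  proof -
    have "norm (of_real \<rho> ^ p * exp (- (z * of_real \<rho>)) * exp (- (s * of_real \<tau> * of_real \<rho> ^ 3))) \<le> \<rho> ^ p * exp (-(Re z * \<rho>))"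
      by (rule cubic_laplace_integrand_bound[OF contractive_exp]) (use that a s in auto)
    from mult_mono[OF this M(2)[OF that(1)]] show ?thesis
      using that by (simp add: G_def h_def norm_mult mult_ac)
  qed
  have Gc2: "continuous_on ({0..real n} \<times> {a..b}) (\<lambda>(\<rho>, \<tau>). G \<tau> \<rho>)" for n
  proof -
    have "continuous_on ({0..real n} \<times> {a..b}) (\<lambda>x. g (snd x))"
      by (rule continuous_on_compose2[OF g]) (auto intro!: continuous_intros)
    then show ?thesis unfolding G_def case_prod_unfold by (intro continuous_intros)
  qed
  have swap: "integral {0..real n} (\<lambda>\<rho>. integral {a..b} (\<lambda>\<tau>. G \<tau> \<rho>)) =
      integral {a..b} (\<lambda>\<tau>. integral {0..real n} (G \<tau>))" for n
    using integral_swap_continuous[of 0 a "real n" b "\<lambda>\<rho> \<tau>. G \<tau> \<rho>"] Gc2[of n]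
    by (simp add: cbox_Pair_eq)
  have "uniform_limit {a..b} (\<lambda>n \<tau>. integral {0..real n} (G \<tau>)) (\<lambda>\<tau>. integral {0..} (G \<tau>)) sequentially"
    by (rule uniform_limit_improper_integral[OF _ hi Gb]) (auto simp: G_def intro!: continuous_intros)
  moreover have "continuous_on {a..b} (\<lambda>\<tau>. integral {0..real n} (G \<tau>))" for n
  proof -
    have "continuous_on ({a..b} \<times> {0..real n}) (\<lambda>x. g (fst x))"
      by (rule continuous_on_compose2[OF g]) (auto intro!: continuous_intros)
    then have "continuous_on ({a..b} \<times> {0..real n}) (\<lambda>(\<tau>, \<rho>). G \<tau> \<rho>)"
      unfolding G_def case_prod_unfold by (intro continuous_intros)
    then show ?thesis
      using integral_continuous_on_param[of "{a..b}" 0 "real n" G] by simp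
  qed
  ultimately obtain I J where IJ: "\<And>n. ((\<lambda>\<tau>. integral {0..real n} (G \<tau>)) has_integral I n) {a..b}"
    "((\<lambda>\<tau>. integral {0..} (G \<tau>)) has_integral J) {a..b}" "I \<longlonglongrightarrow> J"
    using uniform_limit_integral[OF _ _ sequentially_bot] by blast
  define L where "L = (\<lambda>\<rho>. integral {a..b} (\<lambda>\<tau>. G \<tau> \<rho>))"
  have L: "L \<rho> = of_real \<rho> ^ p * exp (- (z * of_real \<rho>)) *
            integral {a..b} (\<lambda>\<tau>. exp (- (s * of_real \<rho> ^ 3 * of_real \<tau>)) * g \<tau>)" for \<rho>
    unfolding L_def GF by simp
  have Lc: "continuous_on {0..} L"
  proof -
    have "continuous_on ({0..} \<times> {a..b}) (\<lambda>x. g (snd x))"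
      by (rule continuous_on_compose2[OF g]) (auto intro!: continuous_intros)
    then have "continuous_on ({0..} \<times> {a..b}) (\<lambda>(\<rho>, \<tau>). G \<tau> \<rho>)"
      unfolding G_def case_prod_unfold by (intro continuous_intros)
    then show ?thesis
      using integral_continuous_on_param[of "{0..}" a b "\<lambda>\<rho> \<tau>. G \<tau> \<rho>"] by (simp add: L_def)
  qed
  have Lb: "norm (L \<rho>) \<le> (b - a) * h \<rho>" if "a \<le> b" "\<rho> \<ge> 0" for \<rho>
  proof -
    have "continuous_on {a..b} (\<lambda>\<tau>. G \<tau> \<rho>)" unfolding G_def by (intro continuous_intros g)
    from integral_bound[OF that(1) this, of "h \<rho>"] Gb that show ?thesis
      unfolding L_def by (simp add: mult.commute)
  qed
  \<comment> \<open>Plain convergence of the truncated integrals of \<open>L\<close>, read off as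
    uniform convergence over a one-element index set.\<close>
  have "uniform_limit {()} (\<lambda>n _. integral {0..real n} L) (\<lambda>_. integral {0..} L) sequentially" if "a \<le> b"
    by (rule uniform_limit_improper_integral[where h = "\<lambda>\<rho>. (b - a) * h \<rho>"])
       (use Lc Lb[OF that] hi in \<open>auto intro!: integrable_on_mult_right\<close>)
  then have "(\<lambda>n. integral {0..real n} L) \<longlonglongrightarrow> integral {0..} L" if "a \<le> b"
    using that by simp
  moreover have "(\<lambda>n. integral {0..real n} L) \<longlonglongrightarrow> J"
    using IJ(3) swap integral_unique[OF IJ(1)] by (simp add: L_def)
  ultimately have "integral {0..} L = J" if "a \<le> b" using LIMSEQ_unique that by blast
  moreover have "J = integral {a..b} (\<lambda>\<tau>. integral {0..} (G \<tau>))" using IJ(2) by (simp add: integral_unique)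
  moreover have "integral {0..} (G \<tau>) = cubic_laplace p (\<lambda>w. exp (- w)) z (s * of_real \<tau>) * g \<tau>" for \<tau>
    unfolding cubic_laplace_def G_def by simp
  ultimately have "integral {0..} L = integral {a..b} (\<lambda>\<tau>. cubic_laplace p (\<lambda>w. exp (- w)) z (s * of_real \<tau>) * g \<tau>)" if "a \<le> b"
    using that by simp
  then show ?thesis unfolding L[abs_def]
    by (cases "a \<le> b") auto
qed

section \<open>Moments of the exponential\<close>

text \<open>Origin: integrating \<sigma>^m against the kernel termwise gives primitives of
  \<sigma>^((N-n)/3 - 1), that is 3/(N-n) times a power. At n = N the primitive is a logarithm,
  which is kept apart, so that coefficient is set to 0.\<close>

definition eser :: "nat \<Rightarrow> nat \<Rightarrow> complex \<Rightarrow> complex" where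
  "eser p N \<eta> = (\<Sum>n. of_real (if n = N then 0 else 3 * kernel_coeff p n / (real N - real n)) * \<eta> ^ n)"

lemma eser_abs_summable:
  "summable (\<lambda>n. norm (of_real (if n = N then 0 else 3 * kernel_coeff p n / (real N - real n)) * \<eta> ^ n :: complex))"
proof (rule summable_comparison_test')
  show "summable (\<lambda>n. 3 * norm (of_real (kernel_coeff p n) * \<eta> ^ n :: complex))"
    by (intro summable_mult kernel_coeff_abs_summable)
  fix n
  have "\<bar>if n = N then 0 else 3 * kernel_coeff p n / (real N - real n)\<bar> \<le> 3 * \<bar>kernel_coeff p n\<bar>"
  proof (cases "n = N")
    case False
    then have "1 \<le> \<bar>real N - real n\<bar>" by linarith
    then have "\<bar>3 * kernel_coeff p n\<bar> / \<bar>real N - real n\<bar> \<le> \<bar>3 * kernel_coeff p n\<bar> / 1"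
      by (intro divide_left_mono) auto
    then show ?thesis using False by (simp add: abs_divide abs_mult)
  qed simp
  from mult_right_mono[OF this norm_ge_zero, of "\<eta> ^ n"]
  have "norm (of_real (if n = N then 0 else 3 * kernel_coeff p n / (real N - real n)) * \<eta> ^ n)
    \<le> 3 * norm (of_real (kernel_coeff p n) * \<eta> ^ n)"
    unfolding norm_mult norm_of_real by (simp only: mult.assoc)
  then show "norm (norm (of_real (if n = N then 0 else 3 * kernel_coeff p n / (real N - real n)) * \<eta> ^ n))
    \<le> 3 * norm (of_real (kernel_coeff p n) * \<eta> ^ n)"
    by (simp only: real_norm_def abs_norm_cancel)
qed

lemma eser_sums: "(\<lambda>n. of_real (if n = N then 0 else 3 * kernel_coeff p n / (real N - real n)) * \<eta> ^ n) sums eser p N \<eta>"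
  unfolding eser_def by (rule summable_sums[OF summable_norm_cancel[OF eser_abs_summable]])

lemma eser_holomorphic: "eser p N holomorphic_on A"
  unfolding eser_def[abs_def] by (rule powser_holomorphic[OF eser_abs_summable])

lemma eser_holomorphic_compose:
  assumes "f holomorphic_on A"
  shows "(\<lambda>x. eser p N (f x)) holomorphic_on A"
  using holomorphic_on_compose[OF assms eser_holomorphic] by (simp add: o_def)

lemma eser_continuous_compose:
  assumes "continuous_on A f"
  shows "continuous_on A (\<lambda>x. eser p N (f x))"
  by (rule continuous_on_compose2[OF holomorphic_on_imp_continuous_on[OF eser_holomorphic[of p N UNIV]] assms subset_UNIV])

text \<open>The coefficients of \<open>eser\<close> are chosen so that Euler's operator \<open>N - \<eta> d/d\<eta>\<close> maps it to
  \<open>3 kernel_fun\<close> without the resonant term of degree \<open>N\<close>.\<close>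

lemma eser_has_derivative:
  obtains e' where "(eser p N has_field_derivative e') (at \<eta>)"
    "of_nat N * eser p N \<eta> - \<eta> * e' = 3 * (kernel_fun p \<eta> - of_real (kernel_coeff p N) * \<eta> ^ N)"
proof
  define c :: "nat \<Rightarrow> complex" where "c = (\<lambda>n. of_real (if n = N then 0 else 3 * kernel_coeff p n / (real N - real n)))"
  have sm: "summable (\<lambda>n. c n * \<eta> ^ n)" for \<eta>
    unfolding c_def by (rule summable_norm_cancel[OF eser_abs_summable])
  show "(eser p N has_field_derivative (\<Sum>n. diffs c n * \<eta> ^ n)) (at \<eta>)"
  proof -
    have "eser p N = (\<lambda>\<eta>. \<Sum>n. c n * \<eta> ^ n)" by (simp add: eser_def[abs_def] c_def)
    then show ?thesis using termdiffs_strong_converges_everywhere[OF sm] by simp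
  qed
  have "summable (\<lambda>n. diffs c n * \<eta> ^ n)"
    by (rule termdiff_converges_all[OF sm])
  then have "(\<lambda>n. of_nat n * c n * \<eta> ^ (n - Suc 0)) sums (\<Sum>n. diffs c n * \<eta> ^ n)" by (rule diffs_equiv)
  then have "(\<lambda>n. \<eta> * (of_nat n * c n * \<eta> ^ (n - Suc 0))) sums (\<eta> * (\<Sum>n. diffs c n * \<eta> ^ n))" by (rule sums_mult)
  \<comment> \<open>Multiplication by \<eta> restores the exponent lowered by differentiation; for n
    = 0 the factor n makes both sides vanish.\<close>
  moreover have "\<eta> * (of_nat n * c n * \<eta> ^ (n - Suc 0)) = of_nat n * (c n * \<eta> ^ n)" for n
    by (cases n) auto
  ultimately have 1: "(\<lambda>n. of_nat n * (c n * \<eta> ^ n)) sums (\<eta> * (\<Sum>n. diffs c n * \<eta> ^ n))" by simp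
  have 2: "(\<lambda>n. of_nat N * (c n * \<eta> ^ n)) sums (of_nat N * eser p N \<eta>)"
    unfolding c_def by (intro sums_mult eser_sums)
  have 3: "(\<lambda>n. of_nat N * (c n * \<eta> ^ n) - of_nat n * (c n * \<eta> ^ n)) sums
     (of_nat N * eser p N \<eta> - \<eta> * (\<Sum>n. diffs c n * \<eta> ^ n))"
    by (rule sums_diff[OF 2 1])
  have 4: "(\<lambda>n. 3 * (of_real (kernel_coeff p n) * \<eta> ^ n - (if n = N then of_real (kernel_coeff p n) * \<eta> ^ n else 0))) sums
     (3 * (kernel_fun p \<eta> - of_real (kernel_coeff p N) * \<eta> ^ N))"
    by (intro sums_mult sums_diff kernel_fun_sums sums_single)
  have "of_nat N * (c n * \<eta> ^ n) - of_nat n * (c n * \<eta> ^ n) =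
      3 * (of_real (kernel_coeff p n) * \<eta> ^ n - (if n = N then of_real (kernel_coeff p n) * \<eta> ^ n else 0))" for n
  proof (cases "n = N")
    case False
    have "of_nat N * (c n * \<eta> ^ n) - of_nat n * (c n * \<eta> ^ n) = of_real (real N - real n) * c n * \<eta> ^ n"
      by (simp add: algebra_simps)
    also have "of_real (real N - real n) * c n = of_real (3 * kernel_coeff p n)"
      unfolding c_def of_real_mult[symmetric] of_real_eq_iff using False by simp
    finally show ?thesis using False by simp
  qed (simp add: c_def)
  with 3 4 show "of_nat N * eser p N \<eta> - \<eta> * (\<Sum>n. diffs c n * \<eta> ^ n) = 3 * (kernel_fun p \<eta> - of_real (kernel_coeff p N) * \<eta> ^ N)"
    by (simp only: sums_unique2)
qed

text \<open>Up to the factor w^(m+1) this is the lower incomplete gamma function at (m+1, w); unlike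
  that product it comes with a bound by 1 on the right half-plane. Upper limits other than 1 are
  restored by \<open>phi_scaling\<close>.\<close>

definition phi :: "nat \<Rightarrow> complex \<Rightarrow> complex" where
  "phi m w = integral {0..1} (\<lambda>\<tau>. exp (-(w * of_real \<tau>)) * of_real \<tau> ^ m)"

lemma contractive_phi: "contractive (phi m)"
  unfolding contractive_def
proof (intro conjI allI impI)
  have "(\<lambda>w. integral (cbox 0 1) (\<lambda>\<tau>. exp (-(w * of_real \<tau>)) * of_real \<tau> ^ m)) holomorphic_on UNIV"
  proof (rule leibniz_rule_holomorphic)
    show "((\<lambda>w. exp (-(w * of_real \<tau>)) * of_real \<tau> ^ m) has_field_derivative
       - of_real \<tau> * exp (-(w * of_real \<tau>)) * of_real \<tau> ^ m) (at w within UNIV)" for w and \<tau> :: real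
      by (rule derivative_eq_intros refl | simp)+
    show "(\<lambda>\<tau>. exp (-(w * of_real \<tau>)) * of_real \<tau> ^ m) integrable_on cbox 0 1" for w :: complex
      by (intro integrable_continuous continuous_intros)
    show "continuous_on (UNIV \<times> cbox 0 1) (\<lambda>(w, \<tau>). - of_real \<tau> * exp (-(w * of_real \<tau>)) * of_real \<tau> ^ m :: complex)"
      unfolding case_prod_unfold by (intro continuous_intros)
  qed simp
  then show "phi m holomorphic_on UNIV" by (simp add: phi_def[abs_def])
  fix w :: complex assume w: "Re w \<ge> 0"
  have "norm (phi m w) \<le> 1 * (1 - 0)"
    unfolding phi_def
  proof (rule integral_bound)
    show "continuous_on {0..1} (\<lambda>\<tau>. exp (-(w * of_real \<tau>)) * of_real \<tau> ^ m)" by (intro continuous_intros)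
    fix \<tau> :: real assume t: "\<tau> \<in> {0..1}"
    have "norm (exp (-(w * of_real \<tau>)) * of_real \<tau> ^ m) \<le> 1 * 1"
      unfolding norm_mult
      by (intro mult_mono) (use t w in \<open>auto simp: norm_exp_eq_Re norm_power power_le_one\<close>)
    then show "norm (exp (-(w * of_real \<tau>)) * of_real \<tau> ^ m) \<le> 1" by simp
  qed simp
  then show "norm (phi m w) \<le> 1" by simp
qed

lemma cubic_laplace_phi:
  assumes "Re z > 0" "Re s \<ge> 0"
  shows "cubic_laplace p (phi m) z s = integral {0..1} (\<lambda>\<tau>. cubic_laplace p (\<lambda>w. exp (- w)) z (s * of_real \<tau>) * of_real \<tau> ^ m)"
  unfolding cubic_laplace_def[of p "phi m"] phi_def
  by (rule cubic_laplace_fubini[OF assms]) (auto intro!: continuous_intros)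

text \<open>Homogeneity under \<rho> -> \<rho>/x, here read off from \<open>kernel_series\<close>.
  It reduces two real parameters to the single one y/x^3.\<close>

lemma kernel_scaling:
  fixes x y :: real
  assumes x: "x > 0" and y: "y > 0"
  shows "cubic_laplace p (\<lambda>w. exp (- w)) (of_real x) (of_real y) * of_real x ^ (p + 1) = cubic_laplace p (\<lambda>w. exp (- w)) 1 (of_real (y / x ^ 3))"
proof -
  have v: "y / x ^ 3 > 0" using x y by simp
  have L: "Ln (of_real y) = of_real (ln y)" "Ln (of_real (y / x ^ 3)) = of_real (ln y - 3 * ln x)"
    using x y by (simp add: Ln_of_real, subst Ln_of_real[OF v]) (simp add: ln_div ln_realpow)
  have xe: "of_real x = (exp (of_real (ln x)) :: complex)" using x by (simp add: exp_of_real)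
  have 1: "cubic_laplace p (\<lambda>w. exp (- w)) (of_real x) (of_real y) =
      exp (-(of_real (real (p + 1) / 3) * of_real (ln y))) * kernel_fun p (of_real x * exp (-(of_real (ln y) / 3)))"
    using kernel_series[of "of_real x" "of_real y" p] x y L by simp
  have 2: "cubic_laplace p (\<lambda>w. exp (- w)) 1 (of_real (y / x ^ 3)) =
      exp (-(of_real (real (p + 1) / 3) * of_real (ln y - 3 * ln x))) * kernel_fun p (1 * exp (-(of_real (ln y - 3 * ln x) / 3)))"
    using kernel_series[of 1 "of_real (y / x ^ 3)" p] v L(2) x y by simp
  have 3: "of_real x * exp (-(of_real (ln y) / 3)) = (1 * exp (-(of_real (ln y - 3 * ln x) / 3)) :: complex)"
    unfolding xe exp_add[symmetric] mult_1 by (rule arg_cong[of _ _ exp]) (simp add: field_simps)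
  have 4: "exp (-(of_real (real (p + 1) / 3) * of_real (ln y))) * of_real x ^ (p + 1) =
     (exp (-(of_real (real (p + 1) / 3) * of_real (ln y - 3 * ln x))) :: complex)"
    unfolding xe exp_of_nat_mult[symmetric] exp_add[symmetric] by (rule arg_cong[of _ _ exp]) (simp add: field_simps)
  show ?thesis unfolding 1 2 3 4[symmetric] by (simp only: mult_ac)
qed

lemma kernel_continuous:
  assumes "Re z > 0" "continuous_on A f" "\<And>x. x \<in> A \<Longrightarrow> Re (f x) \<ge> 0"
  shows "continuous_on A (\<lambda>x. cubic_laplace p (\<lambda>w. exp (- w)) z (f x))"
proof -
  have "continuous_on A (\<lambda>x. (z, f x))" by (intro continuous_intros assms)
  from continuous_on_compose2[OF cubic_laplace_continuous_on[OF contractive_exp, of p] this] assms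
  show ?thesis by auto
qed

text \<open>Both sides have the same derivative on the positive axis, by the differential equation
  in \<open>eser_has_derivative\<close>. The condition on \<open>N\<close> says that the kernel term
  of degree \<open>N\<close> times \<sigma>^m has exponent -1, whence the logarithm.
  \<open>D\<close> is the constant of integration; its value never matters, because the weighted sum
  over the rays annihilates it.\<close>

lemma monomial_integral:
  assumes N: "N + p = 3 * m + 2"
  obtains D :: complex where "\<And>v::real. v > 0 \<Longrightarrow>
     integral {0..v} (\<lambda>\<sigma>. cubic_laplace p (\<lambda>w. exp (- w)) 1 (of_real \<sigma>) * of_real \<sigma> ^ m) =
     exp (of_real (real N / 3) * of_real (ln v)) * eser p N (exp (-(of_real (ln v) / 3)))
       + of_real (kernel_coeff p N * ln v) + D"
proof -
  define K where "K = (\<lambda>\<sigma>::real. cubic_laplace p (\<lambda>w. exp (- w)) 1 (of_real \<sigma>) * of_real \<sigma> ^ m)"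
  have Kc: "continuous_on {0..b} K" for b
    unfolding K_def by (intro continuous_intros kernel_continuous) auto
  define R where "R = (\<lambda>w::complex. exp (of_real (real N / 3) * Ln w) * eser p N (exp (-(Ln w / 3))) + of_real (kernel_coeff p N) * Ln w)"
  have R': "(R has_field_derivative K v) (at (of_real v))" if v: "v > 0" for v :: real
  proof -
    define w :: complex where "w = of_real v"
    define \<eta> where "\<eta> = exp (-(Ln w / 3))"
    have w: "w \<notin> \<real>\<^sub>\<le>\<^sub>0" "w \<noteq> 0" "exp (Ln w) = w" using v by (auto simp: w_def)
    obtain e' where e': "(eser p N has_field_derivative e') (at \<eta>)"
      "of_nat N * eser p N \<eta> - \<eta> * e' = 3 * (kernel_fun p \<eta> - of_real (kernel_coeff p N) * \<eta> ^ N)"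
      by (rule eser_has_derivative)
    have "((\<lambda>w. exp (-(Ln w / 3))) has_field_derivative - \<eta> / (3 * w)) (at w)"
      unfolding \<eta>_def using w by (auto intro!: derivative_eq_intros simp: field_simps)
    from DERIV_chain2[OF e'(1)[unfolded \<eta>_def] this]
    have 1: "((\<lambda>w. eser p N (exp (-(Ln w / 3)))) has_field_derivative e' * (- \<eta> / (3 * w))) (at w)" .
    have 2: "((\<lambda>w. exp (of_real (real N / 3) * Ln w)) has_field_derivative
        exp (of_real (real N / 3) * Ln w) * (of_nat N / (3 * w))) (at w)"
      using w by (auto intro!: derivative_eq_intros simp: field_simps)
    have 3: "((\<lambda>w. of_real (kernel_coeff p N) * Ln w) has_field_derivative of_real (kernel_coeff p N) / w) (at w)"
      using w by (auto intro!: derivative_eq_intros simp: field_simps)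
    have d: "(R has_field_derivative
       (exp (of_real (real N / 3) * Ln w) * (of_nat N / (3 * w))) * eser p N \<eta>
        + e' * (- \<eta> / (3 * w)) * exp (of_real (real N / 3) * Ln w) + of_real (kernel_coeff p N) / w) (at w)"
      using DERIV_add[OF DERIV_mult[OF 2 1] 3] unfolding R_def \<eta>_def by simp
    \<comment> \<open>The prefactor w^(N/3) is exactly the inverse of \<eta>^N, so the term omitted
      from \<open>eser\<close> cancels the derivative of the logarithm.\<close>
    have e: "exp (of_real (real N / 3) * Ln w) * \<eta> ^ N = 1"
      unfolding \<eta>_def exp_of_nat_mult[symmetric] exp_add[symmetric] by simp
    have "(exp (of_real (real N / 3) * Ln w) * (of_nat N / (3 * w))) * eser p N \<eta>
        + e' * (- \<eta> / (3 * w)) * exp (of_real (real N / 3) * Ln w) + of_real (kernel_coeff p N) / w =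
       exp (of_real (real N / 3) * Ln w) / (3 * w) * (of_nat N * eser p N \<eta> - \<eta> * e') + of_real (kernel_coeff p N) / w"
      using w by (simp add: field_simps)
    also have "\<dots> = exp (of_real (real N / 3) * Ln w) / w * kernel_fun p \<eta>
        - of_real (kernel_coeff p N) / w * (exp (of_real (real N / 3) * Ln w) * \<eta> ^ N) + of_real (kernel_coeff p N) / w"
      unfolding e'(2) using w by (simp add: field_simps)
    also have "\<dots> = exp (of_real (real N / 3) * Ln w) / w * kernel_fun p \<eta>" unfolding e by simp
    \<comment> \<open>This is the exponent count N/3 - 1 = m - (p+1)/3, a rewriting of the
      assumption on \<open>N\<close>.\<close>
    also have "exp (of_real (real N / 3) * Ln w) / w = exp (-(of_real (real (p + 1) / 3) * Ln w)) * w ^ m"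
    proof -
      have "of_nat (N + p) = (of_nat (3 * m + 2) :: complex)" unfolding N ..
      then have Nc: "of_nat N = (3 * of_nat m + 2 - of_nat p :: complex)" by (simp add: algebra_simps)
      have "exp (of_real (real N / 3) * Ln w) = exp (-(of_real (real (p + 1) / 3) * Ln w)) * exp (Ln w) ^ m * exp (Ln w)"
        unfolding exp_of_nat_mult[symmetric] exp_add[symmetric] by (intro arg_cong[of _ _ exp]) (simp add: Nc field_simps)
      then show ?thesis using w by simp
    qed
    also have "exp (-(of_real (real (p + 1) / 3) * Ln w)) * w ^ m * kernel_fun p \<eta> = K v"
      using kernel_series[of 1 w p] v by (simp add: K_def w_def \<eta>_def)
    finally show ?thesis using d by (simp add: w_def)
  qed
  have "((\<lambda>v. integral {0..v} K - R (of_real v)) has_vector_derivative 0) (at v within {0<..})" if "v \<in> {0<..}" for v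
  proof -
    have v: "v > 0" using that by simp
    have "((\<lambda>v. integral {0..v} K) has_vector_derivative K v) (at v within {0..v+1})"
      by (rule integral_has_vector_derivative[OF Kc]) (use v in auto)
    then have "((\<lambda>v. integral {0..v} K) has_vector_derivative K v) (at v)"
      using v by (simp add: at_within_Icc_at)
    moreover have "((\<lambda>v. R (of_real v)) has_vector_derivative K v) (at v)"
      by (rule has_vector_derivative_real_field[OF R'[OF v]])
    ultimately have "((\<lambda>v. integral {0..v} K - R (of_real v)) has_vector_derivative K v - K v) (at v)"
      by (rule has_vector_derivative_diff)
    then show ?thesis by (simp add: has_vector_derivative_at_within)
  qed
  then obtain D where D: "\<And>v. v \<in> {0<..} \<Longrightarrow> integral {0..v} K - R (of_real v) = D"
    using has_vector_derivative_zero_constant[of "{0<..}" "\<lambda>v. integral {0..v} K - R (of_real v)"] convex_real_interval by blast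
  have "integral {0..v} K = R (of_real v) + D" if "v > 0" for v
    using D[of v] that by (simp add: algebra_simps)
  then show ?thesis
    by (intro that[of D]) (simp add: K_def R_def Ln_of_real)
qed

text \<open>For real parameters, \<sigma> = v\<tau> with v = y/x^3 turns the integral over the unit
  interval into the one of \<open>monomial_integral\<close>, and ln v = ln y - 3 ln x becomes Ln
  \<open>s\<close> - 3 Ln \<open>z\<close>. \<open>cubic_laplace_eqI\<close> extends the result. The
  factor \<open>s ^ (m + 1)\<close> on the left avoids a division.\<close>

lemma cubic_laplace_phi_series:
  assumes N: "N + p = 3 * m + 2"
  obtains D :: complex where "\<And>z s. Re z > 0 \<Longrightarrow> Re s \<ge> 0 \<Longrightarrow> s \<noteq> 0 \<Longrightarrow>
     s ^ (m + 1) * cubic_laplace p (phi m) z s =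
     exp (of_real (real N / 3) * Ln s) * eser p N (z * exp (-(Ln s / 3)))
       + z ^ N * (of_real (kernel_coeff p N) * (Ln s - 3 * Ln z) + D)"
proof -
  obtain D where D: "\<And>v::real. v > 0 \<Longrightarrow>
     integral {0..v} (\<lambda>\<sigma>. cubic_laplace p (\<lambda>w. exp (- w)) 1 (of_real \<sigma>) * of_real \<sigma> ^ m) =
     exp (of_real (real N / 3) * of_real (ln v)) * eser p N (exp (-(of_real (ln v) / 3)))
       + of_real (kernel_coeff p N * ln v) + D"
    using monomial_integral[OF N] by blast
  define F where "F = (\<lambda>z s. (exp (of_real (real N / 3) * Ln s) * eser p N (z * exp (-(Ln s / 3)))
       + z ^ N * (of_real (kernel_coeff p N) * (Ln s - 3 * Ln z) + D)) / s ^ (m + 1))"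
  have real: "cubic_laplace p (phi m) (of_real x) (of_real y) = F (of_real x) (of_real y)" if x: "x > 0" and y: "y > 0" for x y :: real
  proof -
    define v where "v = y / x ^ 3"
    have v: "v > 0" using x y by (simp add: v_def)
    have yv: "y = v * x ^ 3" using x by (simp add: v_def)
    define K where "K = (\<lambda>\<sigma>::real. cubic_laplace p (\<lambda>w. exp (- w)) 1 (of_real \<sigma>) * of_real \<sigma> ^ m)"
    have "((\<lambda>\<tau>. v *\<^sub>R K (v * \<tau>)) has_integral integral {v * 0..v * 1} K) {0..1}"
    proof (rule has_integral_substitution[where c = 0 and d = v])
      show "continuous_on {0..v} K"
        unfolding K_def by (intro continuous_intros kernel_continuous) auto
      show "(*) v ` {0..1} \<subseteq> {0..v}" using v by (auto intro: mult_left_le)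
    qed (use v in \<open>auto intro!: derivative_eq_intros\<close>)
    then have 1: "((\<lambda>\<tau>. of_real v * K (v * \<tau>)) has_integral integral {0..v} K) {0..1}"
      by (simp add: scaleR_conv_of_real)
    have S: "integral {0..1} (\<lambda>\<tau>. of_real x ^ (p + 1) * of_real v ^ (m + 1) *
             (cubic_laplace p (\<lambda>w. exp (- w)) (of_real x) (of_real y * of_real \<tau>) * of_real \<tau> ^ m)) =
          integral {0..1} (\<lambda>\<tau>. of_real v * K (v * \<tau>))"
    \<comment> \<open>The point \<tau> = 0 is left out because \<open>kernel_scaling\<close> asks
      for a positive second parameter.\<close>
    proof (rule integral_spike[of "{0}"])
      fix \<tau> :: real assume "\<tau> \<in> {0..1} - {0}"
      then have t: "\<tau> > 0" by auto
      have "cubic_laplace p (\<lambda>w. exp (- w)) (of_real x) (of_real (y * \<tau>)) * of_real x ^ (p + 1) = cubic_laplace p (\<lambda>w. exp (- w)) 1 (of_real (v * \<tau>))"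
        using kernel_scaling[of x "y * \<tau>" p] x y t by (simp add: v_def)
      then show "of_real v * K (v * \<tau>) = of_real x ^ (p + 1) * of_real v ^ (m + 1) *
             (cubic_laplace p (\<lambda>w. exp (- w)) (of_real x) (of_real y * of_real \<tau>) * of_real \<tau> ^ m)"
        unfolding K_def by (simp only: of_real_mult[symmetric] power_mult_distrib flip: of_real_power) (simp add: power_mult_distrib mult_ac)
    qed auto
    have lp: "cubic_laplace p (phi m) (of_real x) (of_real y) =
        integral {0..1} (\<lambda>\<tau>. cubic_laplace p (\<lambda>w. exp (- w)) (of_real x) (of_real y * of_real \<tau>) * of_real \<tau> ^ m)"
      by (rule cubic_laplace_phi) (use x y in simp_all)
    have 2: "of_real x ^ (p + 1) * of_real v ^ (m + 1) * cubic_laplace p (phi m) (of_real x) (of_real y) = integral {0..v} K"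
      unfolding lp integral_mult_right[symmetric] S by (rule integral_unique[OF 1])
    have "of_real y ^ (m + 1) * of_real x ^ (p + 1) = of_real x ^ N * (of_real x ^ (p + 1) * (of_real x ^ (p + 1) * of_real v ^ (m + 1)) :: complex)"
    proof -
      \<comment> \<open>The degree count: x^(3(m+1)) splits into the resonant power x^N and the
        x^(p+1) of \<open>kernel_scaling\<close>.\<close>
      have "3 * (m + 1) = N + (p + 1)" using N by simp
      then have "(x ^ 3) ^ (m + 1) = x ^ N * x ^ (p + 1)" unfolding power_mult[symmetric] power_add[symmetric] by (simp only:)
      then have "y ^ (m + 1) * x ^ (p + 1) = x ^ N * (x ^ (p + 1) * (x ^ (p + 1) * v ^ (m + 1)))"
        unfolding yv power_mult_distrib by (simp only: mult_ac)
      from arg_cong[OF this, of of_real] show ?thesis unfolding of_real_mult of_real_power .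
    qed
    then have "of_real y ^ (m + 1) * of_real x ^ (p + 1) = (of_real x ^ N * (of_real x ^ (p + 1) * of_real v ^ (m + 1))) * (of_real x ^ (p + 1) :: complex)"
      by (simp only: mult_ac)
    moreover have "(of_real x :: complex) ^ (p + 1) \<noteq> 0" using x by simp
    ultimately have "of_real y ^ (m + 1) = (of_real x ^ N * (of_real x ^ (p + 1) * of_real v ^ (m + 1)) :: complex)"
      by (rule mult_right_cancel[THEN iffD1, rotated])
    then have "of_real y ^ (m + 1) * cubic_laplace p (phi m) (of_real x) (of_real y) = of_real x ^ N * integral {0..v} K"
      using 2 by (simp only: mult.assoc)
    also have "integral {0..v} K = exp (of_real (real N / 3) * of_real (ln v)) * eser p N (exp (-(of_real (ln v) / 3)))
       + of_real (kernel_coeff p N * ln v) + D"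
      unfolding K_def by (rule D[OF v])
    also have "of_real x ^ N * \<dots> = of_real y ^ (m + 1) * F (of_real x) (of_real y)"
    proof -
      have lv: "ln v = ln y - 3 * ln x" using x y by (simp add: v_def ln_div ln_realpow)
      have L: "Ln (of_real y) = of_real (ln y)" "Ln (of_real x) = of_real (ln x)"
        using x y by (auto simp: Ln_of_real)
      have xe: "of_real x = (exp (of_real (ln x)) :: complex)" using x by (simp add: exp_of_real)
      have a: "of_real x ^ N * exp (of_real (real N / 3) * of_real (ln v)) = (exp (of_real (real N / 3) * of_real (ln y)) :: complex)"
        unfolding xe exp_of_nat_mult[symmetric] exp_add[symmetric] lv by (rule arg_cong[of _ _ exp]) (simp add: field_simps)
      have b: "exp (-(of_real (ln v) / 3)) = (of_real x * exp (-(of_real (ln y) / 3)) :: complex)"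
        unfolding xe exp_add[symmetric] lv by (rule arg_cong[of _ _ exp]) (simp add: field_simps)
      have "of_real y ^ (m + 1) * F (of_real x) (of_real y) =
         exp (of_real (real N / 3) * of_real (ln y)) * eser p N (of_real x * exp (-(of_real (ln y) / 3)))
         + of_real x ^ N * (of_real (kernel_coeff p N) * (of_real (ln y) - 3 * of_real (ln x)) + D)"
        unfolding F_def L using y by simp
      also have "\<dots> = of_real x ^ N * (exp (of_real (real N / 3) * of_real (ln v)) * eser p N (exp (-(of_real (ln v) / 3)))
       + of_real (kernel_coeff p N * ln v) + D)"
        unfolding a[symmetric] b[symmetric] lv by (simp add: algebra_simps)
      finally show ?thesis by simp
    qed
    finally show ?thesis using y by simp
  qed
  have "cubic_laplace p (phi m) z s = F z s" if "Re z > 0" "Re s \<ge> 0" "s \<noteq> 0" for z s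
  proof (rule cubic_laplace_eqI[OF contractive_phi _ _ _ real that])
    show "(\<lambda>z. F z s) holomorphic_on {z. 0 < Re z}" if "0 < Re s" for s
    proof -
      have "s \<noteq> 0" using that by auto
      then show ?thesis unfolding F_def
        by (intro holomorphic_intros eser_holomorphic_compose) (auto simp: Re_pos_notin_nonpos_Reals)
    qed
    show "(\<lambda>s. F z s) holomorphic_on {s. 0 < Re s}" for z
      unfolding F_def
      by (intro holomorphic_intros eser_holomorphic_compose) (auto simp: Re_pos_notin_nonpos_Reals)
    show "continuous_on {s. 0 \<le> Re s \<and> s \<noteq> 0} (F z)" for z
      unfolding F_def
      by (intro continuous_intros eser_continuous_compose) (auto simp: Re_nonneg_notin_nonpos_Reals)
  qed
  then show ?thesis
    by (intro that[of D]) (simp add: F_def)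
qed

section \<open>Oscillatory boundary integrals\<close>

lemma DERIV_divide_power:
  fixes w :: complex
  assumes "w \<noteq> 0"
  shows "((\<lambda>w. 1 / w ^ n) has_field_derivative - (of_nat n / w ^ (n + 1))) (at w)"
proof (cases n)
  case (Suc k)
  have "((\<lambda>w. 1 / w ^ n) has_field_derivative (0 * w ^ n - 1 * (of_nat n * w ^ (n - 1))) / (w ^ n * w ^ n)) (at w)"
    using assms by (auto intro!: derivative_eq_intros)
  also have "(0 * w ^ n - 1 * (of_nat n * w ^ (n - 1))) / (w ^ n * w ^ n) = - (of_nat n / w ^ (n + 1))"
    using assms by (simp add: Suc field_simps)
  finally show ?thesis .
qed simp

text \<open>Integration by parts in packaged form: \<open>H'\<close> has a convergent improper
  integral because its primitive \<open>H\<close> tends to 0, and what \<open>k\<close> differs from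
  it by is absolutely integrable.\<close>

lemma integrable_of_antiderivative:
  fixes k H H' :: "real \<Rightarrow> complex"
  assumes H: "\<And>\<rho>. \<rho> \<ge> 1 \<Longrightarrow> (H has_vector_derivative H' \<rho>) (at \<rho>)"
    and lim: "(H \<longlongrightarrow> 0) at_top"
    and cont: "continuous_on {1..} (\<lambda>\<rho>. k \<rho> - H' \<rho>)"
    and le: "\<And>\<rho>. \<rho> \<ge> 1 \<Longrightarrow> norm (k \<rho> - H' \<rho>) \<le> M / \<rho> ^ 2"
  shows "k integrable_on {1..}"
proof -
  have FTC: "(H' has_integral (H R - H 1)) {1..R}" if "R \<ge> 1" for R
    using that by (intro fundamental_theorem_of_calculus) (auto intro: H has_vector_derivative_at_within)
  have "(H' has_integral (0 - H 1)) {1..}"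
  proof (rule has_integral_atLeastI)
    show "H' integrable_on {1..R}" if "R \<ge> 1" for R using FTC[OF that] by (auto simp: integrable_on_def)
    have "((\<lambda>R. H R - H 1) \<longlongrightarrow> 0 - H 1) at_top" by (intro tendsto_intros lim)
    moreover have "eventually (\<lambda>R. H R - H 1 = integral {1..R} H') at_top"
      using FTC by (auto simp: eventually_at_top_linorder intro!: exI[of _ 1] integral_unique[symmetric])
    ultimately show "((\<lambda>R. integral {1..R} H') \<longlongrightarrow> 0 - H 1) at_top"
      by (rule Lim_transform_eventually)
  qed
  moreover have "(\<lambda>\<rho>. k \<rho> - H' \<rho>) integrable_on {1..}"
  proof (rule bounded_by_integrable_atLeast[OF cont])
    have "(\<lambda>\<rho>. 1 / \<rho> ^ 2) integrable_on {1::real..}"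
      using has_integral_inverse_power_to_inf[of 2 1] by (auto simp: integrable_on_def)
    from integrable_on_mult_right[OF this, of M]
    show "(\<lambda>\<rho>. M / \<rho> ^ 2) integrable_on {1..}" by simp
  qed (use le in auto)
  ultimately have "(\<lambda>\<rho>. (k \<rho> - H' \<rho>) + H' \<rho>) integrable_on {1..}"
    by (intro integrable_add) (auto simp: integrable_on_def)
  then show ?thesis by simp
qed

lemma norm_oscillation:
  assumes "Re z \<ge> 0" "Re s = 0" "\<rho> \<ge> 0"
  shows "norm (exp (-(z * of_real \<rho>) - s * of_real \<rho> ^ 3 * of_real c)) \<le> 1"
proof -
  have "Re (s * of_real \<rho> ^ 3 * of_real c) = 0" using assms by (simp flip: of_real_power of_real_mult)
  then show ?thesis using assms by (simp add: norm_exp_eq_Re)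
qed

lemma one_div_power_le:
  fixes \<rho> :: real
  assumes "\<rho> \<ge> 1" "n \<ge> 2"
  shows "1 / \<rho> ^ n \<le> 1 / \<rho> ^ 2"
  using assms by (intro divide_left_mono power_increasing) auto

lemma oscillation_tendsto_0:
  assumes "Re z \<ge> 0" "Re s = 0" "n \<ge> 1"
  shows "((\<lambda>\<rho>. C * exp (-(z * of_real \<rho>) - s * of_real \<rho> ^ 3 * of_real c) * (1 / of_real \<rho> ^ n)) \<longlongrightarrow> (0::complex)) at_top"
proof (rule Lim_null_comparison)
  show "\<forall>\<^sub>F \<rho> in at_top. norm (C * exp (-(z * of_real \<rho>) - s * of_real \<rho> ^ 3 * of_real c) * (1 / of_real \<rho> ^ n)) \<le> norm C * (1 / \<rho>)"
    unfolding eventually_at_top_linorder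
  proof (intro exI[of _ 1] allI impI)
    fix \<rho> :: real assume r: "\<rho> \<ge> 1"
    have "\<rho> ^ 1 \<le> \<rho> ^ n" using r assms(3) by (intro power_increasing) auto
    then have "1 / \<rho> ^ n \<le> 1 / \<rho>" using r by (intro divide_left_mono) auto
    then have "norm (1 / of_real \<rho> ^ n :: complex) \<le> 1 / \<rho>" using r by (simp add: norm_divide norm_power)
    moreover have "norm (exp (-(z * of_real \<rho>) - s * of_real \<rho> ^ 3 * of_real c)) \<le> 1"
      using assms r by (intro norm_oscillation) auto
    ultimately have "norm C * norm (exp (-(z * of_real \<rho>) - s * of_real \<rho> ^ 3 * of_real c)) * norm (1 / of_real \<rho> ^ n :: complex) \<le> norm C * 1 * (1 / \<rho>)"
      by (intro mult_mono) auto
    then show "norm (C * exp (-(z * of_real \<rho>) - s * of_real \<rho> ^ 3 * of_real c) * (1 / of_real \<rho> ^ n)) \<le> norm C * (1 / \<rho>)"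
      unfolding norm_mult by simp
  qed
  show "((\<lambda>\<rho>. norm C * (1 / \<rho>)) \<longlongrightarrow> 0) at_top" by real_asymp
qed

text \<open>One integration by parts gains the missing decay, but the dominant phase depends on
  \<open>c\<close>. For c = 0 only exp(-z\<rho>) oscillates and z is divided out; otherwise the
  cubic phase dominates and 3sc\<rho>^2 is divided out.\<close>

lemma oscillation_integrable:
  assumes z: "Re z \<ge> 0" "z \<noteq> 0" and s: "Re s = 0" "s \<noteq> 0" and c: "c \<ge> 0" and n: "n \<ge> 1"
  shows "(\<lambda>\<rho>. exp (-(z * of_real \<rho>) - s * of_real \<rho> ^ 3 * of_real c) * (1 / of_real \<rho> ^ n)) integrable_on {1..}"
proof -
  define E where "E = (\<lambda>w::complex. exp (-(z * w) - s * w ^ 3 * of_real c))"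
  have E': "(E has_field_derivative - (z + 3 * s * of_real c * w ^ 2) * E w) (at w)" for w
    unfolding E_def by (auto intro!: derivative_eq_intros simp: algebra_simps)
  have E1: "norm (E (of_real \<rho>)) \<le> 1" if "\<rho> \<ge> 1" for \<rho>
    unfolding E_def using z s that by (intro norm_oscillation) auto
  have Ec: "continuous_on A E" for A unfolding E_def by (intro continuous_intros)
  have ne: "(of_real \<rho> :: complex) \<noteq> 0" if "\<rho> \<ge> 1" for \<rho>::real using that by auto
  have nrm: "norm (1 / of_real \<rho> ^ k :: complex) \<le> 1 / \<rho> ^ 2" if "\<rho> \<ge> 1" "k \<ge> 2" for \<rho> :: real and k
    using one_div_power_le[OF that] that by (simp add: norm_divide norm_power)
  have "(\<lambda>\<rho>. E (of_real \<rho>) * (1 / of_real \<rho> ^ n)) integrable_on {1..}"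
  proof (cases "c = 0")
    case True
    \<comment> \<open>Differentiating the exponential reproduces the integrand; differentiating the
      power gives an error of order \<rho>^(-n-1).\<close>
    define H where "H = (\<lambda>w. (-1/z) * E w * (1 / w ^ n))"
    have d: "(H has_field_derivative (E w * (1 / w ^ n) - (- of_nat n / z) * E w * (1 / w ^ (n + 1)))) (at w)" if "w \<noteq> 0" for w
    proof -
      have "(H has_field_derivative ((-1/z) * (- (z + 3 * s * of_real c * w ^ 2) * E w)) * (1 / w ^ n) +
           - (of_nat n / w ^ (n + 1)) * ((-1/z) * E w)) (at w)"
        unfolding H_def by (intro DERIV_mult DERIV_cmult E' DERIV_divide_power that)
      then show ?thesis using z True that by (simp add: field_simps)
    qed
    show ?thesis
    proof (rule integrable_of_antiderivative[where M = "norm (of_nat n / z)"])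
      fix \<rho> :: real assume r: "\<rho> \<ge> 1"
      show "((\<lambda>\<rho>. H (of_real \<rho>)) has_vector_derivative (E (of_real \<rho>) * (1 / of_real \<rho> ^ n) - (- of_nat n / z) * E (of_real \<rho>) * (1 / of_real \<rho> ^ (n + 1)))) (at \<rho>)"
        by (rule has_vector_derivative_real_field[OF d[OF ne[OF r]]])
      have "norm ((- of_nat n / z) * E (of_real \<rho>) * (1 / of_real \<rho> ^ (n + 1))) \<le> norm (of_nat n / z) * 1 * (1 / \<rho> ^ 2)"
        unfolding norm_mult using E1[OF r] nrm[OF r, of "n + 1"] n by (intro mult_mono) (auto simp: norm_divide)
      then show "norm (E (of_real \<rho>) * (1 / of_real \<rho> ^ n) - (E (of_real \<rho>) * (1 / of_real \<rho> ^ n) - (- of_nat n / z) * E (of_real \<rho>) * (1 / of_real \<rho> ^ (n + 1)))) \<le> norm (of_nat n / z) / \<rho> ^ 2"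
        by simp
    next
      show "((\<lambda>\<rho>. H (of_real \<rho>)) \<longlongrightarrow> 0) at_top"
        unfolding H_def E_def using z s n by (intro oscillation_tendsto_0) auto
      show "continuous_on {1..} (\<lambda>\<rho>. E (of_real \<rho>) * (1 / of_real \<rho> ^ n) - (E (of_real \<rho>) * (1 / of_real \<rho> ^ n) - (- of_nat n / z) * E (of_real \<rho>) * (1 / of_real \<rho> ^ (n + 1))))"
        using z unfolding E_def by (intro continuous_intros) auto
    qed
  next
    case False
    define q where "q = 3 * s * of_real c"
    have q: "q \<noteq> 0" using False s by (simp add: q_def)
    \<comment> \<open>Since \<open>E\<close> has derivative -(z + q w^2) E, the part with q w^2
      reproduces the integrand, while the part with z and the derivative of the power are collected
      in \<open>G\<close>, of orders \<rho>^(-n-2) and \<rho>^(-n-3).\<close>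
    define H where "H = (\<lambda>w. (-1/q) * E w * (1 / w ^ (n + 2)))"
    define G where "G = (\<lambda>w. (- z / q) * E w * (1 / w ^ (n + 2)) + (- of_nat (n + 2) / q) * E w * (1 / w ^ (n + 3)))"
    have d: "(H has_field_derivative (E w * (1 / w ^ n) - G w)) (at w)" if "w \<noteq> 0" for w
    proof -
      have "(H has_field_derivative ((-1/q) * (- (z + q * w ^ 2) * E w)) * (1 / w ^ (n + 2)) +
           - (of_nat (n + 2) / w ^ (n + 2 + 1)) * ((-1/q) * E w)) (at w)"
        unfolding H_def by (intro DERIV_mult DERIV_cmult E'[folded q_def] DERIV_divide_power that)
      moreover have "((-1/q) * (- (z + q * w ^ 2) * E w)) * (1 / w ^ (n + 2)) +
           - (of_nat (n + 2) / w ^ (n + 2 + 1)) * ((-1/q) * E w) = E w * (1 / w ^ n) - G w"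
      proof -
        have e: "w ^ (n + 2) = w ^ n * w ^ 2" "w ^ (n + 2 + 1) = w ^ n * w ^ 3" "w ^ (n + 3) = w ^ n * w ^ 3"
          by (simp_all add: power_add power2_eq_square power3_eq_cube)
        show ?thesis unfolding G_def e using q that by (simp add: field_simps)
      qed
      ultimately show ?thesis by simp
    qed
    show ?thesis
    proof (rule integrable_of_antiderivative[where M = "norm (z / q) + norm (of_nat (n + 2) / q)"])
      fix \<rho> :: real assume r: "\<rho> \<ge> 1"
      show "((\<lambda>\<rho>. H (of_real \<rho>)) has_vector_derivative (E (of_real \<rho>) * (1 / of_real \<rho> ^ n) - G (of_real \<rho>))) (at \<rho>)"
        by (rule has_vector_derivative_real_field[OF d[OF ne[OF r]]])
      have "norm (G (of_real \<rho>)) \<le> norm (z / q) * 1 * (1 / \<rho> ^ 2) + norm (of_nat (n + 2) / q) * 1 * (1 / \<rho> ^ 2)"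
        unfolding G_def
      proof (rule norm_triangle_le[OF add_mono])
        show "norm ((- z / q) * E (of_real \<rho>) * (1 / of_real \<rho> ^ (n + 2))) \<le> norm (z / q) * 1 * (1 / \<rho> ^ 2)"
          unfolding norm_mult using E1[OF r] nrm[OF r, of "n + 2"] by (intro mult_mono) (auto simp: norm_divide)
        show "norm ((- of_nat (n + 2) / q) * E (of_real \<rho>) * (1 / of_real \<rho> ^ (n + 3))) \<le> norm (of_nat (n + 2) / q) * 1 * (1 / \<rho> ^ 2)"
          unfolding norm_mult minus_divide_left[symmetric] norm_minus_cancel
          using E1[OF r] nrm[OF r, of "n + 3"] by (intro mult_mono) auto
      qed
      then show "norm (E (of_real \<rho>) * (1 / of_real \<rho> ^ n) - (E (of_real \<rho>) * (1 / of_real \<rho> ^ n) - G (of_real \<rho>))) \<le> (norm (z / q) + norm (of_nat (n + 2) / q)) / \<rho> ^ 2"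
        by (simp add: add_divide_distrib)
    next
      show "((\<lambda>\<rho>. H (of_real \<rho>)) \<longlongrightarrow> 0) at_top"
        unfolding H_def E_def using z s n by (intro oscillation_tendsto_0) auto
      show "continuous_on {1..} (\<lambda>\<rho>. E (of_real \<rho>) * (1 / of_real \<rho> ^ n) - (E (of_real \<rho>) * (1 / of_real \<rho> ^ n) - G (of_real \<rho>)))"
        using q unfolding E_def G_def by (intro continuous_intros) auto
    qed
  qed
  then show ?thesis by (simp add: E_def)
qed

lemma exp_integral_by_parts:
  fixes g g1 :: "real \<Rightarrow> complex" and w :: complex
  assumes "a \<le> b" "w \<noteq> 0" "\<And>\<tau>. \<tau> \<in> {a..b} \<Longrightarrow> (g has_vector_derivative g1 \<tau>) (at \<tau> within {a..b})"
    and c: "continuous_on {a..b} g1"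
  shows "integral {a..b} (\<lambda>\<tau>. exp (-(w * of_real \<tau>)) * g \<tau>) =
    (exp (-(w * of_real a)) * g a - exp (-(w * of_real b)) * g b + integral {a..b} (\<lambda>\<tau>. exp (-(w * of_real \<tau>)) * g1 \<tau>)) / w"
proof -
  have e: "((\<lambda>\<tau>. exp (-(w * of_real \<tau>))) has_vector_derivative - w * exp (-(w * of_real \<tau>))) (at \<tau> within {a..b})" for \<tau>
    by (rule has_vector_derivative_real_field) (auto intro!: derivative_eq_intros)
  have "((\<lambda>\<tau>. exp (-(w * of_real \<tau>)) * g1 \<tau> + - w * exp (-(w * of_real \<tau>)) * g \<tau>) has_integral
     (exp (-(w * of_real b)) * g b - exp (-(w * of_real a)) * g a)) {a..b}"
    by (intro fundamental_theorem_of_calculus has_vector_derivative_mult e assms)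
  moreover have 1: "(\<lambda>\<tau>. exp (-(w * of_real \<tau>)) * g1 \<tau>) integrable_on {a..b}"
    by (intro integrable_continuous_interval continuous_intros c)
  ultimately have "((\<lambda>\<tau>. exp (-(w * of_real \<tau>)) * g1 \<tau> - (exp (-(w * of_real \<tau>)) * g1 \<tau> + - w * exp (-(w * of_real \<tau>)) * g \<tau>)) has_integral
     (integral {a..b} (\<lambda>\<tau>. exp (-(w * of_real \<tau>)) * g1 \<tau>) - (exp (-(w * of_real b)) * g b - exp (-(w * of_real a)) * g a))) {a..b}"
    by (intro has_integral_diff integrable_integral)
  then have "((\<lambda>\<tau>. w * (exp (-(w * of_real \<tau>)) * g \<tau>)) has_integral
     (integral {a..b} (\<lambda>\<tau>. exp (-(w * of_real \<tau>)) * g1 \<tau>) - (exp (-(w * of_real b)) * g b - exp (-(w * of_real a)) * g a))) {a..b}"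
    by (simp add: mult.assoc)
  from integral_unique[OF this] have "w * integral {a..b} (\<lambda>\<tau>. exp (-(w * of_real \<tau>)) * g \<tau>) =
    integral {a..b} (\<lambda>\<tau>. exp (-(w * of_real \<tau>)) * g1 \<tau>) - (exp (-(w * of_real b)) * g b - exp (-(w * of_real a)) * g a)"
    by (simp only: integral_mult_right)
  then show ?thesis using assms(2) by (simp add: field_simps)
qed

text \<open>Integration by parts rewrites the difference through \<epsilon> times the integral of
  exp(-\<epsilon>\<rho>) \<open>B\<close>, where \<open>B\<close> vanishes at infinity. Up to
  \<open>R0\<close> this is at most \<epsilon> R0 M, and beyond \<open>R0\<close> at most \<delta>,
  since \<epsilon> exp(-\<epsilon>\<rho>) has total mass 1.\<close>

lemma abel_improper_integral:
  fixes F :: "real \<Rightarrow> complex"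
  assumes cont: "continuous_on {0..} F" and I: "(F has_integral I) {0..}"
    and G: "\<And>\<epsilon>. \<epsilon> > 0 \<Longrightarrow> ((\<lambda>\<rho>. exp (-(of_real \<epsilon> * of_real \<rho>)) * F \<rho>) has_integral G \<epsilon>) {0..}"
  shows "(G \<longlongrightarrow> I) (at_right 0)"
proof -
  \<comment> \<open>The primitive is normalised to vanish at infinity rather than at 0: the boundary
    term at \<open>R\<close> then disappears, and the one at 0 supplies the limit
    \<open>I\<close>.\<close>
  define B where "B = (\<lambda>\<rho>. integral {0..\<rho>} F - I)"
  have cR: "continuous_on {0..R} F" for R by (rule continuous_on_subset[OF cont]) auto
  have B': "(B has_vector_derivative F \<rho>) (at \<rho> within {0..R})" if "\<rho> \<in> {0..R}" for \<rho> R
    unfolding B_def using integral_has_vector_derivative[OF cR that] by (auto intro!: derivative_eq_intros)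
  have Bc: "continuous_on {0..R} B" for R
    using has_vector_derivative_continuous[OF B'] by (simp add: continuous_on_eq_continuous_within)
  have Blim: "(B \<longlongrightarrow> 0) at_top"
    using tendsto_diff[OF has_integral_atLeastD[OF I] tendsto_const[of I]] by (simp add: B_def)
  have parts: "integral {0..R} (\<lambda>\<rho>. exp (-(of_real \<epsilon> * of_real \<rho>)) * F \<rho>) - I =
      exp (-(of_real \<epsilon> * of_real R)) * B R + of_real \<epsilon> * integral {0..R} (\<lambda>\<rho>. exp (-(of_real \<epsilon> * of_real \<rho>)) * B \<rho>)"
    if "\<epsilon> > 0" "R \<ge> 0" for \<epsilon> R
  proof -
    have "integral {0..R} (\<lambda>\<rho>. exp (-(of_real \<epsilon> * of_real \<rho>)) * B \<rho>) =
      (exp (-(of_real \<epsilon> * of_real 0)) * B 0 - exp (-(of_real \<epsilon> * of_real R)) * B R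
       + integral {0..R} (\<lambda>\<rho>. exp (-(of_real \<epsilon> * of_real \<rho>)) * F \<rho>)) / of_real \<epsilon>"
      by (rule exp_integral_by_parts[OF that(2) _ B' cR]) (use that in auto)
    moreover have "B 0 = - I" by (simp add: B_def)
    ultimately show ?thesis using that by (simp add: field_simps)
  qed
  have bound: "norm (G \<epsilon> - I) \<le> \<epsilon> * (R0 * M) + \<delta>"
    if e: "\<epsilon> > 0" and d: "\<delta> > 0" and R0: "R0 \<ge> 0" "\<And>\<rho>. \<rho> \<ge> R0 \<Longrightarrow> norm (B \<rho>) \<le> \<delta>"
      and M: "\<And>\<rho>. \<rho> \<in> {0..R0} \<Longrightarrow> norm (B \<rho>) \<le> M" for \<epsilon> \<delta> R0 M
  proof (rule tendsto_le[OF trivial_limit_at_top_linorder])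
    show "((\<lambda>R. norm (integral {0..R} (\<lambda>\<rho>. exp (-(of_real \<epsilon> * of_real \<rho>)) * F \<rho>) - I)) \<longlongrightarrow> norm (G \<epsilon> - I)) at_top"
      by (intro tendsto_intros has_integral_atLeastD G e)
    show "((\<lambda>R. norm (B R) + (\<epsilon> * (R0 * M) + \<delta>)) \<longlongrightarrow> \<epsilon> * (R0 * M) + \<delta>) at_top"
      using tendsto_add[OF tendsto_norm_zero[OF Blim] tendsto_const] by simp
    have "norm (integral {0..R} (\<lambda>\<rho>. exp (-(of_real \<epsilon> * of_real \<rho>)) * F \<rho>) - I) \<le> norm (B R) + (\<epsilon> * (R0 * M) + \<delta>)"
      if R: "R \<ge> R0" for R
    proof -
      define h where "h = (\<lambda>\<rho>. exp (-(of_real \<epsilon> * of_real \<rho>)) * B \<rho>)"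
      have hc: "continuous_on {u..v} h" if "u \<ge> 0" for u v
        unfolding h_def using that by (intro continuous_intros continuous_on_subset[OF Bc[of v]]) auto
      have he: "norm (h \<rho>) = exp (-\<epsilon> * \<rho>) * norm (B \<rho>)" for \<rho>
        by (simp add: h_def norm_mult norm_exp_eq_Re)
      have 1: "norm (integral {0..R0} h) \<le> M * (R0 - 0)"
      proof (rule integral_bound[OF R0(1) hc[OF order_refl]])
        fix \<rho> assume "\<rho> \<in> {0..R0}"
        then have "exp (-\<epsilon> * \<rho>) * norm (B \<rho>) \<le> 1 * M" using e M by (intro mult_mono) auto
        then show "norm (h \<rho>) \<le> M" unfolding he by simp
      qed
      have 2: "norm (integral {R0..R} h) \<le> integral {R0..R} (\<lambda>\<rho>. exp (-\<epsilon> * \<rho>) * \<delta>)"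
      proof (rule integral_norm_bound_integral)
        show "h integrable_on {R0..R}" using hc[OF R0(1)] by (rule integrable_continuous_interval)
        show "(\<lambda>\<rho>. exp (-\<epsilon> * \<rho>) * \<delta>) integrable_on {R0..R}" by (intro integrable_continuous_interval continuous_intros)
        fix \<rho> assume "\<rho> \<in> {R0..R}"
        then show "norm (h \<rho>) \<le> exp (-\<epsilon> * \<rho>) * \<delta>" unfolding he using R0(2)[of \<rho>] by (intro mult_left_mono) auto
      qed
      have "((\<lambda>\<rho>. exp (-\<epsilon> * \<rho>) * \<delta>) has_integral ((- exp (-\<epsilon> * R) * \<delta> / \<epsilon>) - (- exp (-\<epsilon> * R0) * \<delta> / \<epsilon>))) {R0..R}"
        using e R by (intro fundamental_theorem_of_calculus)
          (auto intro!: derivative_eq_intros simp flip: has_real_derivative_iff_has_vector_derivative)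
      from integral_unique[OF this]
      have "\<epsilon> * integral {R0..R} (\<lambda>\<rho>. exp (-\<epsilon> * \<rho>) * \<delta>) = exp (-\<epsilon> * R0) * \<delta> - exp (-\<epsilon> * R) * \<delta>"
        using e by (simp only:) (simp add: field_simps)
      also have "\<dots> \<le> \<delta>" using e d R0(1) by (smt (verit) exp_ge_zero mult_left_le_one_le mult_nonneg_nonneg exp_le_one_iff mult_minus_left)
      finally have 3: "\<epsilon> * integral {R0..R} (\<lambda>\<rho>. exp (-\<epsilon> * \<rho>) * \<delta>) \<le> \<delta>" .
      have "integral {0..R} h = integral {0..R0} h + integral {R0..R} h"
        using Henstock_Kurzweil_Integration.integral_combine[OF R0(1) R integrable_continuous_interval[OF hc[OF order_refl]]] by simp
      then have "norm (integral {0..R} h) \<le> M * (R0 - 0) + integral {R0..R} (\<lambda>\<rho>. exp (-\<epsilon> * \<rho>) * \<delta>)"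
        using norm_triangle_le[OF add_mono[OF 1 2]] by simp
      then have "\<epsilon> * norm (integral {0..R} h) \<le> \<epsilon> * (M * (R0 - 0) + integral {R0..R} (\<lambda>\<rho>. exp (-\<epsilon> * \<rho>) * \<delta>))"
        using e by (intro mult_left_mono) auto
      also have "\<dots> \<le> \<epsilon> * (R0 * M) + \<delta>" using 3 by (simp add: distrib_left mult.commute)
      finally have 4: "norm (of_real \<epsilon> * integral {0..R} h) \<le> \<epsilon> * (R0 * M) + \<delta>" using e by (simp add: norm_mult)
      have 5: "norm (exp (-(of_real \<epsilon> * of_real R)) * B R) \<le> norm (B R)"
        using e R R0 by (simp add: norm_mult norm_exp_eq_Re mult_left_le_one_le)
      show ?thesis
        using norm_triangle_le[OF add_mono[OF 5 4]] parts[OF e, of R] R R0 by (simp add: h_def)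
    qed
    then show "\<forall>\<^sub>F R in at_top. norm (integral {0..R} (\<lambda>\<rho>. exp (-(of_real \<epsilon> * of_real \<rho>)) * F \<rho>) - I) \<le> norm (B R) + (\<epsilon> * (R0 * M) + \<delta>)"
      unfolding eventually_at_top_linorder by blast
  qed
  show ?thesis
  proof (rule tendstoI)
    fix e :: real assume "e > 0"
    define \<delta> where "\<delta> = e / 3"
    have d: "\<delta> > 0" using \<open>e > 0\<close> by (simp add: \<delta>_def)
    have "eventually (\<lambda>\<rho>. dist (B \<rho>) 0 < \<delta>) at_top" using Blim d by (rule tendstoD)
    then obtain R1 where R1: "\<And>\<rho>. \<rho> \<ge> R1 \<Longrightarrow> norm (B \<rho>) < \<delta>"
      unfolding eventually_at_top_linorder by auto
    define R0 where "R0 = max R1 0"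
    obtain M where M: "M > 0" "\<And>\<rho>. \<rho> \<in> {0..R0} \<Longrightarrow> norm (B \<rho>) \<le> M"
      using compact_continuous_image[OF Bc[of R0] compact_Icc, THEN compact_imp_bounded] unfolding bounded_pos by auto
    have R0: "R0 \<ge> 0" "\<And>\<rho>. \<rho> \<ge> R0 \<Longrightarrow> norm (B \<rho>) \<le> \<delta>" using R1 by (auto simp: R0_def intro: less_imp_le)
    \<comment> \<open>The added 1 keeps the denominator positive when R0 = 0.\<close>
    define \<epsilon>0 where "\<epsilon>0 = \<delta> / (R0 * M + 1)"
    have p: "R0 * M + 1 > 0" using R0(1) M(1) by (simp add: add_nonneg_pos)
    then have "\<epsilon>0 > 0" using d by (simp add: \<epsilon>0_def)
    moreover have "dist (G \<epsilon>) I < e" if "\<epsilon> > 0" "\<epsilon> < \<epsilon>0" for \<epsilon>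
    proof -
      have "\<epsilon> * (R0 * M) \<le> \<epsilon> * (R0 * M + 1)" using that by (simp add: distrib_left)
      also have "\<dots> \<le> \<epsilon>0 * (R0 * M + 1)" using that p by (intro mult_right_mono) auto
      also have "\<dots> = \<delta>" using p by (simp add: \<epsilon>0_def)
      finally have "norm (G \<epsilon> - I) \<le> \<delta> + \<delta>" using bound[OF that(1) d R0 M(2)] by simp
      then show ?thesis using \<open>e > 0\<close> by (simp add: dist_norm \<delta>_def)
    qed
    ultimately show "\<forall>\<^sub>F \<epsilon> in at_right 0. dist (G \<epsilon>) I < e"
      unfolding eventually_at_right_field by (metis (lifting))
  qed
qed

text \<open>Two derivatives, because a single integration by parts in \<tau> leaves a remainder of
  order \<rho>^(p-3), which for p = 2 is not absolutely integrable. One constant \<open>K\<close>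
  bounds all three functions, so that estimates linear in \<open>K\<close> are estimates in a C2
  norm.\<close>

definition C2_bounded :: "real \<Rightarrow> real \<Rightarrow> (real \<Rightarrow> complex) \<Rightarrow> real \<Rightarrow> bool" where
  "C2_bounded a b g K \<longleftrightarrow> (\<exists>g1 g2. continuous_on {a..b} g2 \<and>
     (\<forall>\<tau>\<in>{a..b}. (g has_vector_derivative g1 \<tau>) (at \<tau> within {a..b}) \<and>
        (g1 has_vector_derivative g2 \<tau>) (at \<tau> within {a..b}) \<and>
        norm (g \<tau>) \<le> K \<and> norm (g1 \<tau>) \<le> K \<and> norm (g2 \<tau>) \<le> K))"

lemma C2_bounded_continuous:
  assumes "C2_bounded a b g K"
  shows "continuous_on {a..b} g"
proof -
  obtain g1 where "\<And>\<tau>. \<tau> \<in> {a..b} \<Longrightarrow> (g has_vector_derivative g1 \<tau>) (at \<tau> within {a..b})"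
    using assms unfolding C2_bounded_def by blast
  from has_vector_derivative_continuous[OF this] show ?thesis
    by (simp add: continuous_on_eq_continuous_within)
qed

definition Jfun :: "nat \<Rightarrow> (real \<Rightarrow> complex) \<Rightarrow> real \<Rightarrow> real \<Rightarrow> complex \<Rightarrow> complex \<Rightarrow> real \<Rightarrow> complex" where
  "Jfun p g a b s z \<rho> = of_real \<rho> ^ p * exp (- (z * of_real \<rho>)) *
     integral {a..b} (\<lambda>\<tau>. exp (- (s * of_real \<rho> ^ 3 * of_real \<tau>)) * g \<tau>)"

definition Jint :: "nat \<Rightarrow> (real \<Rightarrow> complex) \<Rightarrow> real \<Rightarrow> real \<Rightarrow> complex \<Rightarrow> complex \<Rightarrow> complex" where
  "Jint p g a b s z = integral {0..} (Jfun p g a b s z)"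

lemma Jfun_continuous:
  assumes "continuous_on {a..b} g"
  shows "continuous_on A (Jfun p g a b s z)"
proof -
  have "continuous_on (UNIV \<times> {a..b}) (\<lambda>x. g (snd x))"
    by (rule continuous_on_compose2[OF assms]) (auto intro!: continuous_intros)
  then have "continuous_on (UNIV \<times> {a..b}) (\<lambda>(\<rho>, \<tau>). exp (- (s * of_real \<rho> ^ 3 * of_real \<tau>)) * g \<tau>)"
    unfolding case_prod_unfold by (intro continuous_intros)
  then have "continuous_on UNIV (\<lambda>\<rho>. integral {a..b} (\<lambda>\<tau>. exp (- (s * of_real \<rho> ^ 3 * of_real \<tau>)) * g \<tau>))"
    using integral_continuous_on_param[of UNIV a b "\<lambda>\<rho> \<tau>. exp (- (s * of_real \<rho> ^ 3 * of_real \<tau>)) * g \<tau>"] by simp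
  then have "continuous_on UNIV (Jfun p g a b s z)"
    unfolding Jfun_def[abs_def] by (intro continuous_intros)
  then show ?thesis by (rule continuous_on_subset) simp
qed

lemma norm_exp_imaginary:
  assumes "Re s = 0"
  shows "norm (exp (- (s * of_real \<rho> ^ 3 * of_real \<tau>))) = 1"
proof -
  have "Re (s * of_real \<rho> ^ 3 * of_real \<tau>) = 0" using assms by (simp flip: of_real_power of_real_mult)
  then show ?thesis by (simp add: norm_exp_eq_Re)
qed

lemma exp_integral_bound:
  assumes "a \<le> b" "Re s = 0" "continuous_on {a..b} g" "\<And>\<tau>. \<tau> \<in> {a..b} \<Longrightarrow> norm (g \<tau>) \<le> K"
  shows "norm (integral {a..b} (\<lambda>\<tau>. exp (- (s * of_real \<rho> ^ 3 * of_real \<tau>)) * g \<tau>)) \<le> K * (b - a)"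
  by (rule integral_bound[OF assms(1)])
     (use assms in \<open>auto intro!: continuous_intros simp: norm_mult norm_exp_imaginary\<close>)

text \<open>Two integrations by parts in \<tau>. The boundary terms of the first, of order
  \<rho>^(p-3), are kept explicitly because they may converge only conditionally; the rest carries
  the factor \<rho>^(p-6) and is bounded by a multiple of \<rho>^(-2).\<close>

lemma Jfun_decomposition:
  assumes ab: "a \<le> b" and s: "Re s = 0" "s \<noteq> 0" and z: "Re z \<ge> 0" and p: "p \<le> 2"
    and g: "C2_bounded a b g K" and r: "\<rho> \<ge> 1"
  shows "norm (Jfun p g a b s z \<rho>
     - (g a / s * (exp (-(z * of_real \<rho>) - s * of_real \<rho> ^ 3 * of_real a) * (1 / of_real \<rho> ^ (3 - p)))
      - g b / s * (exp (-(z * of_real \<rho>) - s * of_real \<rho> ^ 3 * of_real b) * (1 / of_real \<rho> ^ (3 - p)))))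
     \<le> K * (2 + (b - a)) / norm s ^ 2 * (1 / \<rho> ^ 2)"
proof -
  obtain g1 g2 where g2: "continuous_on {a..b} g2"
    and d: "\<And>\<tau>. \<tau> \<in> {a..b} \<Longrightarrow> (g has_vector_derivative g1 \<tau>) (at \<tau> within {a..b})"
      "\<And>\<tau>. \<tau> \<in> {a..b} \<Longrightarrow> (g1 has_vector_derivative g2 \<tau>) (at \<tau> within {a..b})"
    and K: "\<And>\<tau>. \<tau> \<in> {a..b} \<Longrightarrow> norm (g \<tau>) \<le> K" "\<And>\<tau>. \<tau> \<in> {a..b} \<Longrightarrow> norm (g1 \<tau>) \<le> K" "\<And>\<tau>. \<tau> \<in> {a..b} \<Longrightarrow> norm (g2 \<tau>) \<le> K"
    using g unfolding C2_bounded_def by blast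
  have K0: "K \<ge> 0" using order_trans[OF norm_ge_zero K(1)[of a]] ab by simp
  have g1: "continuous_on {a..b} g1"
    using has_vector_derivative_continuous[OF d(2)] by (simp add: continuous_on_eq_continuous_within)
  define R where "R = (of_real \<rho> :: complex)"
  have R0: "R \<noteq> 0" using r by (auto simp: R_def)
  define w where "w = s * R ^ 3"
  have w0: "w \<noteq> 0" using R0 s by (simp add: w_def)
  define T where "T = exp (-(w * of_real a)) * g1 a - exp (-(w * of_real b)) * g1 b + integral {a..b} (\<lambda>\<tau>. exp (-(w * of_real \<tau>)) * g2 \<tau>)"
  have en: "norm (exp (-(w * of_real c))) = 1" for c
    unfolding w_def R_def by (rule norm_exp_imaginary[OF s(1)])
  have "integral {a..b} (\<lambda>\<tau>. exp (-(w * of_real \<tau>)) * g \<tau>) =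
    (exp (-(w * of_real a)) * g a - exp (-(w * of_real b)) * g b + T / w) / w"
    unfolding T_def using exp_integral_by_parts[OF ab w0 d(1) g1] exp_integral_by_parts[OF ab w0 d(2) g2] by simp
  then have "Jfun p g a b s z \<rho> = R ^ p * exp (-(z * R)) * ((exp (-(w * of_real a)) * g a - exp (-(w * of_real b)) * g b + T / w) / w)"
    unfolding Jfun_def R_def[symmetric] w_def[symmetric] by simp
  moreover have "exp (-(z * R) - w * of_real c) = exp (-(z * R)) * exp (-(w * of_real c))" for c
    by (simp add: exp_add[symmetric])
  moreover have "1 / R ^ (3 - p) = R ^ p / R ^ 3"
  proof -
    have "R ^ p * R ^ (3 - p) = R ^ 3" using p by (simp flip: power_add)
    then show ?thesis using R0 by (simp add: field_simps)
  qed
  ultimately have "Jfun p g a b s z \<rho>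
     - (g a / s * (exp (-(z * R) - w * of_real a) * (1 / R ^ (3 - p)))
      - g b / s * (exp (-(z * R) - w * of_real b) * (1 / R ^ (3 - p)))) = R ^ p * exp (-(z * R)) * T / (s ^ 2 * R ^ 6)"
  proof -
    assume 1: "Jfun p g a b s z \<rho> = R ^ p * exp (-(z * R)) * ((exp (-(w * of_real a)) * g a - exp (-(w * of_real b)) * g b + T / w) / w)"
      and 2: "\<And>c. exp (-(z * R) - w * of_real c) = exp (-(z * R)) * exp (-(w * of_real c))"
      and 3: "1 / R ^ (3 - p) = R ^ p / R ^ 3"
    have 4: "(A * ga - B * gb + T / w) / w = (ga / s * A - gb / s * B) / R ^ 3 + T / (s ^ 2 * R ^ 6)" for A B ga gb
    proof -
      have "R ^ 6 = R ^ 3 * R ^ 3" by (simp flip: power_add)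
      then show ?thesis using R0 s unfolding w_def by (simp add: field_simps power2_eq_square)
    qed
    show ?thesis unfolding 1 2 3 4 by (simp add: algebra_simps diff_divide_distrib)
  qed
  moreover have "norm (R ^ p * exp (-(z * R)) * T / (s ^ 2 * R ^ 6)) \<le> K * (2 + (b - a)) / norm s ^ 2 * (1 / \<rho> ^ 2)"
  proof -
    have "norm T \<le> K + K + K * (b - a)"
      unfolding T_def
    proof (rule norm_triangle_le[OF add_mono[OF norm_triangle_le_diff[OF add_mono]]])
      show "norm (exp (-(w * of_real a)) * g1 a) \<le> K" "norm (exp (-(w * of_real b)) * g1 b) \<le> K"
        unfolding norm_mult en using K(2) ab by auto
      show "norm (integral {a..b} (\<lambda>\<tau>. exp (-(w * of_real \<tau>)) * g2 \<tau>)) \<le> K * (b - a)"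
        unfolding w_def R_def by (rule exp_integral_bound[OF ab s(1) g2 K(3)])
    qed
    then have T: "norm T \<le> K * (2 + (b - a))" by (simp add: algebra_simps)
    have e1: "norm (exp (-(z * R))) \<le> 1" using z r by (simp add: R_def norm_exp_eq_Re)
    have "norm (R ^ p / R ^ 6) \<le> 1 / \<rho> ^ 2"
    proof -
      have "\<rho> ^ p \<le> \<rho> ^ 4" using r p by (intro power_increasing) auto
      then have "\<rho> ^ p / \<rho> ^ 6 \<le> \<rho> ^ 4 / \<rho> ^ 6" using r by (intro divide_right_mono) auto
      also have "\<dots> = 1 / \<rho> ^ 2"
      proof -
        have "\<rho> ^ 6 = \<rho> ^ 4 * \<rho> ^ 2" by (simp flip: power_add)
        show ?thesis unfolding \<open>\<rho> ^ 6 = \<rho> ^ 4 * \<rho> ^ 2\<close>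
          using r by (intro nonzero_divide_mult_cancel_left) auto
      qed
      finally show ?thesis using r by (simp add: R_def norm_divide norm_power)
    qed
    then have "norm (R ^ p / R ^ 6) * norm (exp (-(z * R))) * norm T * (1 / norm s ^ 2) \<le> (1 / \<rho> ^ 2) * 1 * (K * (2 + (b - a))) * (1 / norm s ^ 2)"
      using T e1 K0 ab by (intro mult_mono) auto
    then show ?thesis by (simp add: norm_mult norm_divide norm_power mult_ac)
  qed
  ultimately show ?thesis unfolding R_def w_def by simp
qed

text \<open>The order of the quantifiers is the purpose: \<open>C\<close> is fixed before
  \<open>g\<close> and \<open>K\<close>, so functions that tend to 0 in C2 have ray integrals that
  tend to 0. This replaces dominated convergence on the imaginary axis.\<close>

lemma Jint_integrable_bound:
  assumes ab: "0 \<le> a" "a \<le> b" and s: "Re s = 0" "s \<noteq> 0" and z: "Re z \<ge> 0" "z \<noteq> 0" and p: "p \<le> 2"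
  obtains C where "\<And>g K. C2_bounded a b g K \<Longrightarrow> Jfun p g a b s z integrable_on {0..} \<and> norm (Jint p g a b s z) \<le> C * K"
proof -
  define k where "k = (\<lambda>c \<rho>. exp (-(z * of_real \<rho>) - s * of_real \<rho> ^ 3 * of_real c) * (1 / of_real \<rho> ^ (3 - p)))"
  have ki: "k c integrable_on {1..}" if "c \<ge> 0" for c
    unfolding k_def using p that by (intro oscillation_integrable z s) auto
  define L where "L = (\<lambda>c. integral {1..} (k c))"
  \<comment> \<open>The three summands come from the range up to 1, from the two explicit boundary
    terms, and from the remainder, where the integral of \<rho>^(-2) over \<open>{1..}\<close> is
    1.\<close>
  define C where "C = (b - a) + (norm (L a) / norm s + norm (L b) / norm s) + (2 + (b - a)) / norm s ^ 2"
  have "Jfun p g a b s z integrable_on {0..} \<and> norm (Jint p g a b s z) \<le> C * K" if g: "C2_bounded a b g K" for g K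
  proof -
    have gc: "continuous_on {a..b} g" by (rule C2_bounded_continuous[OF g])
    have gK: "norm (g \<tau>) \<le> K" if "\<tau> \<in> {a..b}" for \<tau> using g that unfolding C2_bounded_def by blast
    have K0: "K \<ge> 0" using order_trans[OF norm_ge_zero gK[of a]] ab by simp
    let ?F = "Jfun p g a b s z"
    define M where "M = (\<lambda>\<rho>. g a / s * k a \<rho> - g b / s * k b \<rho>)"
    have Mi: "(M has_integral (g a / s * L a - g b / s * L b)) {1..}"
      unfolding M_def L_def using ab by (intro has_integral_diff has_integral_mult_right integrable_integral ki) auto
    define h where "h = (\<lambda>\<rho>::real. K * (2 + (b - a)) / norm s ^ 2 * (1 / \<rho> ^ 2))"
    have hi: "(h has_integral (K * (2 + (b - a)) / norm s ^ 2 * 1)) {1..}"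
      unfolding h_def using has_integral_inverse_power_to_inf[of 2 1] by (intro has_integral_mult_right) auto
    have "continuous_on {1..} (\<lambda>\<rho>. ?F \<rho> - M \<rho>)"
      unfolding M_def k_def by (intro continuous_intros Jfun_continuous gc) auto
    moreover have "norm (?F \<rho> - M \<rho>) \<le> h \<rho>" if "\<rho> \<ge> 1" for \<rho>
      unfolding M_def k_def h_def by (rule Jfun_decomposition[OF ab(2) s z(1) p g that])
    ultimately have R: "(\<lambda>\<rho>. ?F \<rho> - M \<rho>) integrable_on {1..}" "norm (integral {1..} (\<lambda>\<rho>. ?F \<rho> - M \<rho>)) \<le> integral {1..} h"
      using bounded_by_integrable_atLeast[of 1 "\<lambda>\<rho>. ?F \<rho> - M \<rho>" h] hi by (auto simp: integrable_on_def)
    have "((\<lambda>\<rho>. (?F \<rho> - M \<rho>) + M \<rho>) has_integral (integral {1..} (\<lambda>\<rho>. ?F \<rho> - M \<rho>) + (g a / s * L a - g b / s * L b))) {1..}"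
      by (intro has_integral_add integrable_integral R Mi)
    then have F1: "(?F has_integral (integral {1..} (\<lambda>\<rho>. ?F \<rho> - M \<rho>) + (g a / s * L a - g b / s * L b))) {1..}" by simp
    have F0: "(?F has_integral (integral {0..1} ?F)) {0..1}"
      by (intro integrable_integral integrable_continuous_interval Jfun_continuous gc)
    have "{0..} = {0..1} \<union> {1::real..}" by auto
    moreover have "negligible ({0..1} \<inter> {1::real..})" by (rule negligible_subset[of "{1}"]) auto
    ultimately have F: "(?F has_integral (integral {0..1} ?F + (integral {1..} (\<lambda>\<rho>. ?F \<rho> - M \<rho>) + (g a / s * L a - g b / s * L b)))) {0..}"
      using has_integral_Un[OF F0 F1] by simp
    have "norm (integral {0..1} ?F) \<le> (K * (b - a)) * (1 - 0)"
    proof (rule integral_bound)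
      fix \<rho> :: real assume r: "\<rho> \<in> {0..1}"
      have "norm (?F \<rho>) \<le> 1 * 1 * (K * (b - a))"
        unfolding Jfun_def norm_mult
        by (intro mult_mono exp_integral_bound[OF ab(2) s(1) gc gK])
           (use r z K0 ab in \<open>auto simp: norm_power power_le_one norm_exp_eq_Re\<close>)
      then show "norm (?F \<rho>) \<le> K * (b - a)" by simp
    qed (auto intro!: Jfun_continuous gc)
    moreover have "norm (integral {1..} (\<lambda>\<rho>. ?F \<rho> - M \<rho>)) \<le> K * (2 + (b - a)) / norm s ^ 2"
      using R(2) integral_unique[OF hi] by simp
    moreover have "norm (g a / s * L a - g b / s * L b) \<le> K * (norm (L a) / norm s) + K * (norm (L b) / norm s)"
    proof (rule norm_triangle_le_diff[OF add_mono])
      show "norm (g a / s * L a) \<le> K * (norm (L a) / norm s)"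
        using mult_right_mono[OF gK[of a], of "norm (L a) / norm s"] ab by (simp add: norm_mult norm_divide)
      show "norm (g b / s * L b) \<le> K * (norm (L b) / norm s)"
        using mult_right_mono[OF gK[of b], of "norm (L b) / norm s"] ab by (simp add: norm_mult norm_divide)
    qed
    ultimately have "norm (Jint p g a b s z) \<le> K * (b - a) + (K * (2 + (b - a)) / norm s ^ 2 + (K * (norm (L a) / norm s) + K * (norm (L b) / norm s)))"
      unfolding Jint_def integral_unique[OF F] by (intro norm_triangle_le add_mono) auto
    also have "\<dots> = C * K" by (simp add: C_def algebra_simps)
    finally show ?thesis using F by (auto simp: integrable_on_def)
  qed
  then show ?thesis by (rule that)
qed

text \<open>Abel's theorem applies because adding \<epsilon> to \<open>z\<close> merely multiplies
  the integrand by exp(-\<epsilon>\<rho>).\<close>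

lemma Jint_abel:
  assumes ab: "0 \<le> a" "a \<le> b" and s: "Re s = 0" "s \<noteq> 0" and z: "Re z \<ge> 0" "z \<noteq> 0" and p: "p \<le> 2"
    and g: "C2_bounded a b g K"
  shows "((\<lambda>\<epsilon>. Jint p g a b s (z + of_real \<epsilon>)) \<longlongrightarrow> Jint p g a b s z) (at_right 0)"
proof (rule abel_improper_integral)
  have gc: "continuous_on {a..b} g" by (rule C2_bounded_continuous[OF g])
  show "continuous_on {0..} (Jfun p g a b s z)" by (rule Jfun_continuous[OF gc])
  show "(Jfun p g a b s z has_integral Jint p g a b s z) {0..}"
    unfolding Jint_def using Jint_integrable_bound[OF ab s z p] g integrable_integral by metis
  fix \<epsilon> :: real assume e: "\<epsilon> > 0"
  have z': "Re (z + of_real \<epsilon>) \<ge> 0" "z + of_real \<epsilon> \<noteq> 0" using z e by (auto simp: complex_eq_iff)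
  have "(Jfun p g a b s (z + of_real \<epsilon>) has_integral Jint p g a b s (z + of_real \<epsilon>)) {0..}"
    unfolding Jint_def using Jint_integrable_bound[OF ab s z' p] g integrable_integral by metis
  moreover have "Jfun p g a b s (z + of_real \<epsilon>) = (\<lambda>\<rho>. exp (-(of_real \<epsilon> * of_real \<rho>)) * Jfun p g a b s z \<rho>)"
    by (rule ext) (simp add: Jfun_def algebra_simps exp_diff exp_minus divide_inverse)
  ultimately show "((\<lambda>\<rho>. exp (-(of_real \<epsilon> * of_real \<rho>)) * Jfun p g a b s z \<rho>) has_integral Jint p g a b s (z + of_real \<epsilon>)) {0..}"
    by simp
qed

section \<open>The four boundary rays\<close>

text \<open>With \<open>k = \<rho> cis \<beta>\<close> the exponential \<open>exp (i k x)\<close> becomes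
  \<open>exp (- \<rho> x cis \<theta>)\<close> and \<open>i k\<^sup>3\<close> becomes \<open>\<rho>\<^sup>3 cis \<sigma>\<close>; the rays are listed in the order
  \<open>\<beta> = 0, 2\<pi>/3, \<pi>, \<pi>/3\<close>, and \<open>ray_weight\<close> collects the prefactors, the orientation and the factor \<open>cis \<beta> ^ (p + 1)\<close>.\<close>

definition ztheta :: "nat \<Rightarrow> real" where "ztheta l = [- pi / 2, pi / 6, pi / 2, - pi / 6] ! l"
definition ssigma :: "nat \<Rightarrow> real" where "ssigma l = [pi / 2, pi / 2, - pi / 2, - pi / 2] ! l"

definition ray_weight :: "nat \<Rightarrow> nat \<Rightarrow> complex" where
  "ray_weight p l = (if p = 2 then [1 - alpha, 1 - alpha\<^sup>2, 1 - alpha\<^sup>2, 1 - alpha] ! l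
     else [(1 - alpha\<^sup>2) / \<i>, (alpha\<^sup>2 - 1) / \<i>, (alpha - 1) / \<i>, (1 - alpha) / \<i>] ! l)"

text \<open>On ray \<open>l\<close> the quantity z^n s^(-(n+p+1)/3) has exactly this phase, so
  \<open>weight_sum\<close> is the total weight with which x^n enters the combined contour
  integral.\<close>

definition weight_sum :: "nat \<Rightarrow> nat \<Rightarrow> complex" where
  "weight_sum p n = (\<Sum>l<4. ray_weight p l * cis (real n * ztheta l - real (n + p + 1) / 3 * ssigma l))"

lemma lessThan_4: "{..<4::nat} = {0, 1, 2, 3}" by auto

lemma alpha_cis: "alpha = cis (2 * pi / 3)"
  by (simp add: alpha_def cis_conv_exp mult_ac)

lemma alpha_eq: "alpha = Complex (-1/2) (sqrt 3 / 2)"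
  unfolding alpha_cis cis.ctr cos_120 sin_120 by simp

lemma alpha_sq: "alpha\<^sup>2 = Complex (-1/2) (- sqrt 3 / 2)"
  unfolding alpha_eq power2_eq_square by (simp add: complex_eq_iff)

lemma alpha_cube: "alpha ^ 3 = 1"
proof -
  have "alpha ^ 3 = cis (real 3 * (2 * pi / 3))" unfolding alpha_cis by (rule Complex.DeMoivre)
  then show ?thesis by simp
qed

lemma alpha_sq_sq: "(alpha\<^sup>2)\<^sup>2 = alpha"
  unfolding alpha_sq unfolding alpha_eq power2_eq_square by (simp add: complex_eq_iff)

lemma cnj_alpha: "cnj alpha = alpha\<^sup>2"
  unfolding alpha_sq unfolding alpha_eq by (simp add: complex_eq_iff)

lemma phase_eq:
  "cis (real n * ztheta 0 - real (n + p + 1) / 3 * ssigma 0) = (alpha\<^sup>2) ^ n * cis (- (real (p + 1) * pi / 6))"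
  "cis (real n * ztheta 1 - real (n + p + 1) / 3 * ssigma 1) = cis (- (real (p + 1) * pi / 6))"
  "cis (real n * ztheta 2 - real (n + p + 1) / 3 * ssigma 2) = alpha ^ n * cis (real (p + 1) * pi / 6)"
  "cis (real n * ztheta 3 - real (n + p + 1) / 3 * ssigma 3) = cis (real (p + 1) * pi / 6)"
proof -
  have v: "ztheta 0 = - pi / 2" "ztheta 1 = pi / 6" "ztheta 2 = pi / 2" "ztheta 3 = - pi / 6"
    "ssigma 0 = pi / 2" "ssigma 1 = pi / 2" "ssigma 2 = - pi / 2" "ssigma 3 = - pi / 2"
    by (simp_all add: ztheta_def ssigma_def numeral_2_eq_2 numeral_3_eq_3)
  show "cis (real n * ztheta 0 - real (n + p + 1) / 3 * ssigma 0) = (alpha\<^sup>2) ^ n * cis (- (real (p + 1) * pi / 6))"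
    unfolding v cnj_alpha[symmetric] unfolding alpha_cis cis_cnj Complex.DeMoivre cis_mult
    by (rule arg_cong[of _ _ cis]) (simp add: field_simps)
  show "cis (real n * ztheta 1 - real (n + p + 1) / 3 * ssigma 1) = cis (- (real (p + 1) * pi / 6))"
    unfolding v by (rule arg_cong[of _ _ cis]) (simp add: field_simps)
  show "cis (real n * ztheta 2 - real (n + p + 1) / 3 * ssigma 2) = alpha ^ n * cis (real (p + 1) * pi / 6)"
    unfolding v alpha_cis Complex.DeMoivre cis_mult
    by (rule arg_cong[of _ _ cis]) (simp add: field_simps)
  show "cis (real n * ztheta 3 - real (n + p + 1) / 3 * ssigma 3) = cis (real (p + 1) * pi / 6)"
    unfolding v by (rule arg_cong[of _ _ cis]) (simp add: field_simps)
qed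

lemma cis_phase:
  "cis (real (2 + 1) * pi / 6) = \<i>" "cis (- (real (2 + 1) * pi / 6)) = - \<i>"
  "cis (real (1 + 1) * pi / 6) = - (alpha\<^sup>2)" "cis (- (real (1 + 1) * pi / 6)) = - alpha"
proof -
  have v: "real (2 + 1) * pi / 6 = pi / 2" "real (1 + 1) * pi / 6 = pi / 3" by simp_all
  show "cis (real (2 + 1) * pi / 6) = \<i>" "cis (- (real (2 + 1) * pi / 6)) = - \<i>"
    unfolding v by (simp_all add: complex_eq_iff)
  show "cis (real (1 + 1) * pi / 6) = - (alpha\<^sup>2)" "cis (- (real (1 + 1) * pi / 6)) = - alpha"
    unfolding v alpha_sq unfolding alpha_eq by (simp_all add: complex_eq_iff cos_60 sin_60)
qed

lemma alpha_power_mod: "alpha ^ n = alpha ^ (n mod 3)"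
proof -
  have "alpha ^ n = alpha ^ (3 * (n div 3) + n mod 3)" by simp
  also have "\<dots> = alpha ^ (n mod 3)" unfolding power_add power_mult alpha_cube by simp
  finally show ?thesis .
qed

lemma alpha_sq_power_mod: "(alpha\<^sup>2) ^ n = (alpha\<^sup>2) ^ (n mod 3)"
proof -
  have "(alpha\<^sup>2) ^ n = (alpha ^ n)\<^sup>2" by (simp only: power_mult[symmetric] mult.commute)
  also have "\<dots> = (alpha\<^sup>2) ^ (n mod 3)"
    unfolding alpha_power_mod[of n] by (simp only: power_mult[symmetric] mult.commute)
  finally show ?thesis .
qed

lemma ray_weight_2: "ray_weight 2 0 = 1 - alpha" "ray_weight 2 1 = 1 - alpha\<^sup>2" "ray_weight 2 2 = 1 - alpha\<^sup>2" "ray_weight 2 3 = 1 - alpha"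
  by (simp_all add: ray_weight_def numeral_2_eq_2 numeral_3_eq_3)

lemma ray_weight_1: "ray_weight 1 0 = (1 - alpha\<^sup>2) / \<i>" "ray_weight 1 1 = (alpha\<^sup>2 - 1) / \<i>" "ray_weight 1 2 = (alpha - 1) / \<i>" "ray_weight 1 3 = (1 - alpha) / \<i>"
  by (simp_all add: ray_weight_def numeral_2_eq_2 numeral_3_eq_3)

lemma weight_sum_alt:
  "weight_sum p n = cis (- (real (p + 1) * pi / 6)) * (ray_weight p 0 * (alpha\<^sup>2) ^ (n mod 3) + ray_weight p 1)
     + cis (real (p + 1) * pi / 6) * (ray_weight p 2 * alpha ^ (n mod 3) + ray_weight p 3)"
proof -
  have "weight_sum p n = (\<Sum>l\<in>{0, 1, 2, 3}. ray_weight p l * cis (real n * ztheta l - real (n + p + 1) / 3 * ssigma l))"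
    unfolding weight_sum_def lessThan_4 ..
  also have "\<dots> = ray_weight p 0 * cis (real n * ztheta 0 - real (n + p + 1) / 3 * ssigma 0)
     + (ray_weight p 1 * cis (real n * ztheta 1 - real (n + p + 1) / 3 * ssigma 1)
     + (ray_weight p 2 * cis (real n * ztheta 2 - real (n + p + 1) / 3 * ssigma 2)
     + ray_weight p 3 * cis (real n * ztheta 3 - real (n + p + 1) / 3 * ssigma 3)))"
    by simp
  finally show ?thesis
    unfolding phase_eq alpha_power_mod[of n] alpha_sq_power_mod[of n] by (simp only: algebra_simps)
qed

text \<open>The phases depend on n only modulo 3, which leaves three evaluations for each
  \<open>p\<close>. The value 3 sqrt 3, with the 3 in the denominator of \<open>kernel_coeff\<close>
  and the prefactor 1/(2\<pi>), produces the sqrt 3 / (2\<pi>) of the coefficients.\<close>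

lemma weight_sum_eq:
  assumes "p \<in> {1, 2}"
  shows "weight_sum p n = (if n mod 3 = 2 then of_real (3 * sqrt 3) else 0)"
proof -
  have "n mod 3 < 3" by simp
  then have k: "n mod 3 \<in> {0, 1, 2}" unfolding insert_iff empty_iff by linarith
  have two: "weight_sum 2 n = (if n mod 3 = 2 then of_real (3 * sqrt 3) else 0)" if "n mod 3 = k" "k \<in> {0, 1, 2}" for k
    unfolding weight_sum_alt cis_phase ray_weight_2 that(1) using that(2)
    by (elim insertE emptyE; simp only: power_0 power_one_right alpha_sq_sq; simp only: alpha_sq; simp add: alpha_eq complex_eq_iff)
  have one: "weight_sum 1 n = (if n mod 3 = 2 then of_real (3 * sqrt 3) else 0)" if "n mod 3 = k" "k \<in> {0, 1, 2}" for k
    unfolding weight_sum_alt cis_phase ray_weight_1 that(1) using that(2)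
    by (elim insertE emptyE; simp only: power_0 power_one_right alpha_sq_sq divide_i; simp only: alpha_sq; simp add: alpha_eq complex_eq_iff)
  from assms show ?thesis using two[OF refl k] one[OF refl k] by blast
qed

text \<open>Only the rays 0 and 2 contribute to the resonant term: \<open>ssigma l - 3 * ztheta l\<close>, the imaginary part of
  \<open>Ln s - 3 Ln z\<close>, is \<open>2\<pi>\<close>, 0, \<open>-2\<pi>\<close>, 0 on the four rays.\<close>

lemma weight_sum_resonance:
  assumes "p \<in> {1, 2}" and N: "N + p = 3 * m + 2"
  shows "ray_weight p 0 * cis (real N * ztheta 0 - real (N + p + 1) / 3 * ssigma 0)
       - ray_weight p 2 * cis (real N * ztheta 2 - real (N + p + 1) / 3 * ssigma 2) = - \<i> * 3 * (-1) ^ (N + m)"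
proof (cases "p = 2")
  case True
  then have Nm: "N = 3 * m" using N by simp
  have "even (N + m)" using Nm by simp
  moreover have "N mod 3 = 0" using Nm by simp
  ultimately show ?thesis
    unfolding phase_eq alpha_power_mod[of N] alpha_sq_power_mod[of N] unfolding True cis_phase ray_weight_2
    by (simp only: power_0; simp only: alpha_sq; simp add: alpha_eq complex_eq_iff)
next
  case False
  then have p: "p = 1" using assms by simp
  then have Nm: "N = 3 * m + 1" using N by simp
  have "odd (N + m)" using Nm by simp
  moreover have "N mod 3 = 1" using Nm by simp
  ultimately show ?thesis
    unfolding phase_eq alpha_power_mod[of N] alpha_sq_power_mod[of N] unfolding p cis_phase ray_weight_1
    by (simp only: power_one_right divide_i; simp only: alpha_sq; simp add: alpha_eq complex_eq_iff)
qed

section \<open>Ray parameters and their principal logarithms\<close>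

definition ray_z :: "nat \<Rightarrow> real \<Rightarrow> complex" where "ray_z l x = cis (ztheta l) * of_real x"
definition ray_s :: "nat \<Rightarrow> complex" where "ray_s l = cis (ssigma l)"

definition ray_sum :: "nat \<Rightarrow> (real \<Rightarrow> complex) \<Rightarrow> real \<Rightarrow> real \<Rightarrow> real \<Rightarrow> complex" where
  "ray_sum p g a b x = (\<Sum>l<4. ray_weight p l * Jint p g a b (ray_s l) (ray_z l x))"

lemma ray_cases: "l < 4 \<Longrightarrow> l \<in> {0, 1, 2, 3::nat}" by auto

lemma ztheta_ssigma_values:
  "ztheta 0 = - pi / 2" "ztheta 1 = pi / 6" "ztheta 2 = pi / 2" "ztheta 3 = - pi / 6"
  "ssigma 0 = pi / 2" "ssigma 1 = pi / 2" "ssigma 2 = - pi / 2" "ssigma 3 = - pi / 2"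
  by (simp_all add: ztheta_def ssigma_def numeral_2_eq_2 numeral_3_eq_3)

lemma ztheta_bounds:
  assumes "l < 4"
  shows "- pi / 2 \<le> ztheta l" "ztheta l \<le> pi / 2"
  using ray_cases[OF assms] pi_gt_zero
  by (elim insertE emptyE; simp only: ztheta_ssigma_values; linarith)+

lemma ssigma_bounds:
  assumes "l < 4"
  shows "ssigma l \<in> {pi / 2, - pi / 2}"
  using ray_cases[OF assms] by (elim insertE emptyE; simp only: ztheta_ssigma_values; blast)

lemma ray_z_halfplane:
  assumes "l < 4" "x > 0"
  shows "Re (ray_z l x) \<ge> 0" "ray_z l x \<noteq> 0"
  using ztheta_bounds[OF assms(1)] assms(2) cos_ge_zero[of "ztheta l"] by (auto simp: ray_z_def)

lemma ray_s_imaginary: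
  assumes "l < 4"
  shows "Re (ray_s l) = 0" "ray_s l \<noteq> 0"
  using ssigma_bounds[OF assms] unfolding ray_s_def by (elim insertE emptyE; simp only: cis.ctr; simp add: complex_eq_iff)+

lemma Ln_polar:
  assumes "r > 0" "- pi < a" "a \<le> pi"
  shows "Ln (cis a * of_real r) = of_real (ln r) + \<i> * of_real a"
proof -
  have "cis a * of_real r = exp (of_real (ln r) + \<i> * of_real a)"
    using assms by (simp add: exp_add cis_conv_exp exp_of_real mult.commute)
  then show ?thesis using assms by simp
qed

lemma Ln_ray_z:
  assumes "l < 4" "x > 0"
  shows "Ln (ray_z l x) = of_real (ln x) + \<i> * of_real (ztheta l)"
proof -
  have "- pi < ztheta l" "ztheta l \<le> pi" using ztheta_bounds[OF assms(1)] pi_gt_zero by linarith+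
  then show ?thesis unfolding ray_z_def by (rule Ln_polar[OF assms(2)])
qed

lemma Ln_ray_s:
  assumes "l < 4" "y > 0"
  shows "Ln (ray_s l * of_real y) = of_real (ln y) + \<i> * of_real (ssigma l)"
proof -
  have "- pi < ssigma l" "ssigma l \<le> pi" using ssigma_bounds[OF assms(1)] pi_gt_zero by (elim insertE emptyE; linarith)+
  then show ?thesis unfolding ray_s_def by (rule Ln_polar[OF assms(2)])
qed

section \<open>Ray integrals on the imaginary axis as boundary values\<close>

lemma Jint_fubini:
  assumes "Re z > 0" "Re s \<ge> 0" "0 \<le> a" "continuous_on {a..b} g"
  shows "Jint p g a b s z = integral {a..b} (\<lambda>\<tau>. cubic_laplace p (\<lambda>w. exp (- w)) z (s * of_real \<tau>) * g \<tau>)"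
  unfolding Jint_def Jfun_def[abs_def] by (rule cubic_laplace_fubini[OF assms])

text \<open>The point z + \<epsilon> approaches \<open>z\<close> from inside the right half-plane:
  the left side converges by \<open>Jint_abel\<close>, the right side by continuity. Rays 0 and 2,
  whose \<open>z\<close> is imaginary, are the ones that depend on this passage.\<close>

lemma Jint_boundary_value:
  assumes ab: "0 \<le> a" "a \<le> b" and s: "Re s = 0" "s \<noteq> 0" and z: "Re z \<ge> 0" "z \<noteq> 0" and p: "p \<le> 2"
    and g: "C2_bounded a b g K"
    and eq: "\<And>z. Re z > 0 \<Longrightarrow> Jint p g a b s z = Q z"
    and Q: "continuous_on {z. Re z \<ge> 0 \<and> z \<noteq> 0} Q"
  shows "Jint p g a b s z = Q z"
proof -
  have "((\<lambda>\<epsilon>. Jint p g a b s (z + of_real \<epsilon>)) \<longlongrightarrow> Jint p g a b s z) (at_right 0)"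
    by (rule Jint_abel[OF ab s z p g])
  moreover have "((\<lambda>\<epsilon>. Q (z + of_real \<epsilon>)) \<longlongrightarrow> Q z) (at_right 0)"
  proof (rule continuous_on_tendsto_compose[OF Q])
    have "((\<lambda>\<epsilon>. z + of_real \<epsilon>) \<longlongrightarrow> z + of_real 0) (at_right 0)"
      by (intro tendsto_intros)
    then show "((\<lambda>\<epsilon>. z + of_real \<epsilon>) \<longlongrightarrow> z) (at_right 0)" by simp
    show "\<forall>\<^sub>F \<epsilon> in at_right 0. z + of_real \<epsilon> \<in> {z. Re z \<ge> 0 \<and> z \<noteq> 0}"
      unfolding eventually_at_right_field using z by (intro exI[of _ 1]) (auto simp: complex_eq_iff)
  qed (use z in auto)
  moreover have "\<forall>\<^sub>F \<epsilon> in at_right 0. Jint p g a b s (z + of_real \<epsilon>) = Q (z + of_real \<epsilon>)"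
    unfolding eventually_at_right_field using z by (intro exI[of _ 1]) (auto intro!: eq)
  ultimately have "((\<lambda>\<epsilon>. Q (z + of_real \<epsilon>)) \<longlongrightarrow> Jint p g a b s z) (at_right 0)"
    by (simp add: Lim_transform_eventually)
  with \<open>((\<lambda>\<epsilon>. Q (z + of_real \<epsilon>)) \<longlongrightarrow> Q z) (at_right 0)\<close> show ?thesis
    using tendsto_unique[OF trivial_limit_at_right_real] by blast
qed

text \<open>Cauchy's estimates on discs of radius \<open>d\<close> bound the first two derivatives
  by B/d and 2B/d^2; the stated constant is the sum of the three bounds and so dominates
  each.\<close>

lemma C2_bounded_holomorphic:
  fixes g :: "complex \<Rightarrow> complex"
  assumes S: "open S" "g holomorphic_on S" and d: "d > 0"
    and sub: "\<And>\<tau>. \<tau> \<in> {a..b} \<Longrightarrow> cball (of_real \<tau>) d \<subseteq> S"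
    and B: "\<And>\<tau> w. \<tau> \<in> {a..b} \<Longrightarrow> w \<in> cball (of_real \<tau>) d \<Longrightarrow> norm (g w) \<le> B"
  shows "C2_bounded a b (\<lambda>\<tau>. g (of_real \<tau>)) (B * (1 + 1 / d + 2 / d ^ 2))"
  unfolding C2_bounded_def
proof (intro exI conjI ballI)
  have inS: "of_real \<tau> \<in> S" if "\<tau> \<in> {a..b}" for \<tau> using sub[OF that] d by auto
  have h1: "deriv g holomorphic_on S" by (rule holomorphic_deriv[OF S(2,1)])
  have h2: "deriv (deriv g) holomorphic_on S" by (rule holomorphic_deriv[OF h1 S(1)])
  show "continuous_on {a..b} (\<lambda>\<tau>. deriv (deriv g) (of_real \<tau>))"
    by (rule continuous_on_compose2[OF holomorphic_on_imp_continuous_on[OF h2]]) (use inS in \<open>auto intro!: continuous_intros\<close>)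
  fix \<tau> assume t: "\<tau> \<in> {a..b}"
  show "((\<lambda>\<tau>. g (of_real \<tau>)) has_vector_derivative deriv g (of_real \<tau>)) (at \<tau> within {a..b})"
    by (rule has_vector_derivative_real_field[OF holomorphic_derivI[OF S(2,1) inS[OF t]]])
  show "((\<lambda>\<tau>. deriv g (of_real \<tau>)) has_vector_derivative deriv (deriv g) (of_real \<tau>)) (at \<tau> within {a..b})"
    by (rule has_vector_derivative_real_field[OF holomorphic_derivI[OF h1 S(1) inS[OF t]]])
  have g0: "norm (g (of_real \<tau>)) \<le> B" using B[OF t, of "of_real \<tau>"] d by simp
  then have B0: "B \<ge> 0" using norm_ge_zero order_trans by blast
  have cauchy: "norm ((deriv ^^ n) g (of_real \<tau>)) \<le> fact n * B / d ^ n" for n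
  proof (rule Cauchy_inequality)
    show "g holomorphic_on ball (of_real \<tau>) d"
      by (rule holomorphic_on_subset[OF S(2)]) (use sub[OF t] in auto)
    show "continuous_on (cball (of_real \<tau>) d) g"
      by (rule continuous_on_subset[OF holomorphic_on_imp_continuous_on[OF S(2)] sub[OF t]])
    show "norm (g x) \<le> B" if "norm (of_real \<tau> - x) = d" for x
      using B[OF t, of x] that by (simp add: dist_norm)
  qed (fact d)
  have nn: "0 \<le> 1 / d" "0 \<le> 2 / d ^ 2" using d by auto
  have "B * 1 \<le> B * (1 + 1 / d + 2 / d ^ 2)" using B0 nn by (intro mult_left_mono) auto
  then show "norm (g (of_real \<tau>)) \<le> B * (1 + 1 / d + 2 / d ^ 2)" using g0 by simp
  have "B * (1 / d) \<le> B * (1 + 1 / d + 2 / d ^ 2)" using B0 nn by (intro mult_left_mono) auto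
  then show "norm (deriv g (of_real \<tau>)) \<le> B * (1 + 1 / d + 2 / d ^ 2)" using cauchy[of 1] by simp
  have "B * (2 / d ^ 2) \<le> B * (1 + 1 / d + 2 / d ^ 2)" using B0 nn by (intro mult_left_mono) auto
  then show "norm (deriv (deriv g) (of_real \<tau>)) \<le> B * (1 + 1 / d + 2 / d ^ 2)"
    using cauchy[of 2] by (simp add: numeral_2_eq_2 mult.commute)
qed

lemma C2_bounded_holomorphic_ex:
  fixes g :: "complex \<Rightarrow> complex"
  assumes S: "open S" "g holomorphic_on S" and sub: "of_real ` {a..b} \<subseteq> S"
  obtains K where "C2_bounded a b (\<lambda>\<tau>. g (of_real \<tau>)) K"
proof -
  have comp: "compact (of_real ` {a..b} :: complex set)"
    by (intro compact_continuous_image continuous_intros) auto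
  obtain d where d: "d > 0" "(\<Union>x\<in>of_real ` {a..b}. cball x d) \<subseteq> S"
    using compact_subset_open_imp_cball_epsilon_subset[OF comp S(1) sub] by blast
  define C where "C = (\<Union>x\<in>of_real ` {a..b}. cball (x::complex) d)"
  have "compact C"
    unfolding C_def by (rule compact_minkowski_sum_cball[OF comp])
  moreover have "continuous_on C g"
    using d(2) continuous_on_subset[OF holomorphic_on_imp_continuous_on[OF S(2)]] by (simp add: C_def)
  ultimately have "bounded (g ` C)" by (intro compact_imp_bounded compact_continuous_image)
  then obtain B where B: "\<And>w. w \<in> C \<Longrightarrow> norm (g w) \<le> B" unfolding bounded_iff by auto
  have "C2_bounded a b (\<lambda>\<tau>. g (of_real \<tau>)) (B * (1 + 1 / d + 2 / d ^ 2))"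
  proof (rule C2_bounded_holomorphic[OF S d(1)])
    fix \<tau> :: real assume "\<tau> \<in> {a..b}"
    then have *: "cball (of_real \<tau>) d \<subseteq> C" unfolding C_def by blast
    then show "cball (of_real \<tau>) d \<subseteq> S" using d(2) unfolding C_def by blast
    show "norm (g w) \<le> B" if "w \<in> cball (of_real \<tau>) d" for w using * that B by blast
  qed
  then show ?thesis by (rule that)
qed

text \<open>For \<tau> \<ge> a > 0 the argument s\<tau> stays away from 0 and from the branch cut,
  so the right side is continuous in \<open>z\<close> across the imaginary axis and
  \<open>Jint_boundary_value\<close> applies.\<close>

lemma Jint_far:
  assumes ab: "0 < a" "a \<le> b" and s: "Re s = 0" "s \<noteq> 0" and z: "Re z \<ge> 0" "z \<noteq> 0" and p: "p \<le> 2"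
    and g: "C2_bounded a b g K"
  shows "Jint p g a b s z = integral {a..b} (\<lambda>\<tau>. exp (-(of_real (real (p + 1) / 3) * Ln (s * of_real \<tau>))) *
     kernel_fun p (z * exp (-(Ln (s * of_real \<tau>) / 3))) * g \<tau>)"
proof (rule Jint_boundary_value[OF _ ab(2) s z p g, where
    Q = "\<lambda>z. integral {a..b} (\<lambda>\<tau>. exp (-(of_real (real (p + 1) / 3) * Ln (s * of_real \<tau>))) *
     kernel_fun p (z * exp (-(Ln (s * of_real \<tau>) / 3))) * g \<tau>)"])
  have gc: "continuous_on {a..b} g" by (rule C2_bounded_continuous[OF g])
  have np: "s * of_real \<tau> \<notin> \<real>\<^sub>\<le>\<^sub>0" if "\<tau> \<in> {a..b}" for \<tau> :: real
    using that ab s by (intro Re_nonneg_notin_nonpos_Reals) auto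
  show "0 \<le> a" using ab by simp
  fix z :: complex assume z: "Re z > 0"
  show "Jint p g a b s z = integral {a..b} (\<lambda>\<tau>. exp (-(of_real (real (p + 1) / 3) * Ln (s * of_real \<tau>))) *
     kernel_fun p (z * exp (-(Ln (s * of_real \<tau>) / 3))) * g \<tau>)"
    unfolding Jint_fubini[OF z order_eq_refl[OF s(1)[symmetric]] \<open>0 \<le> a\<close> gc]
    by (rule Henstock_Kurzweil_Integration.integral_cong, subst kernel_series) (use z s ab in auto)
next
  have gc: "continuous_on {a..b} g" by (rule C2_bounded_continuous[OF g])
  have np: "s * of_real \<tau> \<notin> \<real>\<^sub>\<le>\<^sub>0" if "\<tau> \<in> {a..b}" for \<tau> :: real
    using that ab s by (intro Re_nonneg_notin_nonpos_Reals) auto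
  have g2: "continuous_on (UNIV \<times> {a..b}) (\<lambda>x. g (snd x))"
    by (rule continuous_on_compose2[OF gc]) (auto intro!: continuous_intros)
  have L2: "continuous_on (UNIV \<times> {a..b}) (\<lambda>x. Ln (s * of_real (snd x)))"
    by (intro continuous_intros) (use np in auto)
  have "continuous_on (UNIV \<times> {a..b}) (\<lambda>(z, \<tau>). exp (-(of_real (real (p + 1) / 3) * Ln (s * of_real \<tau>))) *
     kernel_fun p (z * exp (-(Ln (s * of_real \<tau>) / 3))) * g \<tau>)"
    unfolding case_prod_unfold by (intro continuous_intros kernel_fun_continuous_compose g2 L2) auto
  then have "continuous_on UNIV (\<lambda>z. integral {a..b} (\<lambda>\<tau>. exp (-(of_real (real (p + 1) / 3) * Ln (s * of_real \<tau>))) *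
     kernel_fun p (z * exp (-(Ln (s * of_real \<tau>) / 3))) * g \<tau>))"
    using integral_continuous_on_param[of UNIV a b "\<lambda>z \<tau>. exp (-(of_real (real (p + 1) / 3) * Ln (s * of_real \<tau>))) *
     kernel_fun p (z * exp (-(Ln (s * of_real \<tau>) / 3))) * g \<tau>"] by simp
  then show "continuous_on {z. Re z \<ge> 0 \<and> z \<noteq> 0} (\<lambda>z. integral {a..b} (\<lambda>\<tau>. exp (-(of_real (real (p + 1) / 3) * Ln (s * of_real \<tau>))) *
     kernel_fun p (z * exp (-(Ln (s * of_real \<tau>) / 3))) * g \<tau>))"
    by (rule continuous_on_subset) simp
qed

section \<open>Monomials in the time lag and the resonant power of x\<close>

lemma monomial_C2:
  obtains K where "C2_bounded a b (\<lambda>\<tau>. of_real \<tau> ^ m) K"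
proof -
  have "(\<lambda>w::complex. w ^ m) holomorphic_on UNIV" by (intro holomorphic_intros)
  from C2_bounded_holomorphic_ex[OF open_UNIV this subset_UNIV, of a b] that show ?thesis by blast
qed

lemma phi_scaling:
  assumes "\<delta> > 0"
  shows "integral {0..\<delta>} (\<lambda>\<tau>. exp (-(w * of_real \<tau>)) * of_real \<tau> ^ m) = of_real \<delta> ^ (m + 1) * phi m (w * of_real \<delta>)"
proof -
  define f where "f = (\<lambda>\<tau>::real. exp (-(w * of_real \<tau>)) * of_real \<tau> ^ m)"
  have "((\<lambda>\<tau>. \<delta> *\<^sub>R f (\<delta> * \<tau>)) has_integral integral {\<delta> * 0..\<delta> * 1} f) {0..1}"
  proof (rule has_integral_substitution[where c = 0 and d = \<delta>])
    show "continuous_on {0..\<delta>} f" unfolding f_def by (intro continuous_intros)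
    show "(*) \<delta> ` {0..1} \<subseteq> {0..\<delta>}" using assms by (auto intro: mult_left_le)
  qed (use assms in \<open>auto intro!: derivative_eq_intros\<close>)
  moreover have "\<delta> *\<^sub>R f (\<delta> * \<tau>) = of_real \<delta> ^ (m + 1) * (exp (-(w * of_real \<delta> * of_real \<tau>)) * of_real \<tau> ^ m)" for \<tau>
    by (simp add: f_def scaleR_conv_of_real power_mult_distrib mult_ac)
  ultimately have "integral {0..1} (\<lambda>\<tau>. of_real \<delta> ^ (m + 1) * (exp (-(w * of_real \<delta> * of_real \<tau>)) * of_real \<tau> ^ m)) = integral {0..\<delta>} f"
    by (simp add: has_integral_iff)
  then show ?thesis unfolding phi_def f_def integral_mult_right by simp
qed

text \<open>\<open>cubic_laplace_phi_series\<close> at the parameter s\<delta>, carried to the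
  imaginary axis. The constant \<open>D\<close> is the same for all \<open>z\<close>,
  \<open>s\<close> and \<delta>, hence for all four rays; only this makes it cancel in the weighted
  sum.\<close>

lemma Jint_monomial:
  assumes N: "N + p = 3 * m + 2" and p: "p \<le> 2"
  obtains D :: complex where "\<And>z s \<delta>. Re z \<ge> 0 \<Longrightarrow> z \<noteq> 0 \<Longrightarrow> Re s = 0 \<Longrightarrow> s \<noteq> 0 \<Longrightarrow> \<delta> > 0 \<Longrightarrow>
     s ^ (m + 1) * Jint p (\<lambda>\<tau>. of_real \<tau> ^ m) 0 \<delta> s z =
     exp (of_real (real N / 3) * Ln (s * of_real \<delta>)) * eser p N (z * exp (-(Ln (s * of_real \<delta>) / 3)))
       + z ^ N * (of_real (kernel_coeff p N) * (Ln (s * of_real \<delta>) - 3 * Ln z) + D)"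
proof -
  obtain D where D: "\<And>z s. Re z > 0 \<Longrightarrow> Re s \<ge> 0 \<Longrightarrow> s \<noteq> 0 \<Longrightarrow>
     s ^ (m + 1) * cubic_laplace p (phi m) z s =
     exp (of_real (real N / 3) * Ln s) * eser p N (z * exp (-(Ln s / 3)))
       + z ^ N * (of_real (kernel_coeff p N) * (Ln s - 3 * Ln z) + D)"
    using cubic_laplace_phi_series[OF N] by blast
  show ?thesis
  proof (rule that[of D])
    fix z s :: complex and \<delta> :: real
    assume z: "Re z \<ge> 0" "z \<noteq> 0" and s: "Re s = 0" "s \<noteq> 0" and \<delta>: "\<delta> > 0"
    obtain K where K: "C2_bounded 0 \<delta> (\<lambda>\<tau>. of_real \<tau> ^ m) K" using monomial_C2 by blast
    define Q where "Q = (\<lambda>z. (exp (of_real (real N / 3) * Ln (s * of_real \<delta>)) * eser p N (z * exp (-(Ln (s * of_real \<delta>) / 3)))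
       + z ^ N * (of_real (kernel_coeff p N) * (Ln (s * of_real \<delta>) - 3 * Ln z) + D)) / s ^ (m + 1))"
    have "Jint p (\<lambda>\<tau>. of_real \<tau> ^ m) 0 \<delta> s z = Q z"
    proof (rule Jint_boundary_value[OF order_refl less_imp_le[OF \<delta>] s z p K])
      fix z :: complex assume z: "Re z > 0"
      have "Jfun p (\<lambda>\<tau>. of_real \<tau> ^ m) 0 \<delta> s z =
          (\<lambda>\<rho>. of_real \<delta> ^ (m + 1) * (of_real \<rho> ^ p * exp (- (z * of_real \<rho>)) * phi m (s * of_real \<delta> * of_real \<rho> ^ 3)))"
        unfolding Jfun_def[abs_def] phi_scaling[OF \<delta>] by (simp add: mult_ac)
      then have "Jint p (\<lambda>\<tau>. of_real \<tau> ^ m) 0 \<delta> s z = of_real \<delta> ^ (m + 1) * cubic_laplace p (phi m) z (s * of_real \<delta>)"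
        unfolding Jint_def cubic_laplace_def by (simp only: integral_mult_right)
      then have "s ^ (m + 1) * Jint p (\<lambda>\<tau>. of_real \<tau> ^ m) 0 \<delta> s z = (s * of_real \<delta>) ^ (m + 1) * cubic_laplace p (phi m) z (s * of_real \<delta>)"
        unfolding power_mult_distrib by (simp only: mult_ac)
      also have "\<dots> = exp (of_real (real N / 3) * Ln (s * of_real \<delta>)) * eser p N (z * exp (-(Ln (s * of_real \<delta>) / 3)))
       + z ^ N * (of_real (kernel_coeff p N) * (Ln (s * of_real \<delta>) - 3 * Ln z) + D)"
        by (rule D) (use z s \<delta> in auto)
      finally show "Jint p (\<lambda>\<tau>. of_real \<tau> ^ m) 0 \<delta> s z = Q z"
        using s by (simp add: Q_def nonzero_eq_divide_eq mult.commute)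
    next
      show "continuous_on {z. Re z \<ge> 0 \<and> z \<noteq> 0} Q"
        unfolding Q_def using s by (intro continuous_intros eser_continuous_compose) (auto simp: Re_nonneg_notin_nonpos_Reals)
    qed
    then show "s ^ (m + 1) * Jint p (\<lambda>\<tau>. of_real \<tau> ^ m) 0 \<delta> s z =
     exp (of_real (real N / 3) * Ln (s * of_real \<delta>)) * eser p N (z * exp (-(Ln (s * of_real \<delta>) / 3)))
       + z ^ N * (of_real (kernel_coeff p N) * (Ln (s * of_real \<delta>) - 3 * Ln z) + D)"
      using s by (simp add: Q_def)
  qed
qed

text \<open>Separates modulus and phase of one series term on a ray. It is applied with a = N/3 to
  the monomials and with a = -(p+1)/3 to the large time lags.\<close>

lemma phase_term:
  assumes "l < 4" and x: "x > 0" and y: "y > 0"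
  shows "exp (of_real a * Ln (ray_s l * of_real y)) * (ray_z l x * exp (-(Ln (ray_s l * of_real y) / 3))) ^ n =
    of_real (x ^ n * exp ((a - real n / 3) * ln y)) * cis (real n * ztheta l + (a - real n / 3) * ssigma l)"
proof -
  define L where "L = of_real (ln y) + \<i> * of_real (ssigma l)"
  have "exp (of_real a * L) * exp (-(L / 3)) ^ n = exp (of_real (a - real n / 3) * L)"
    unfolding exp_of_nat_mult[symmetric] exp_add[symmetric] by (rule arg_cong[of _ _ exp]) (simp add: field_simps)
  also have "\<dots> = exp (of_real ((a - real n / 3) * ln y)) * exp (\<i> * of_real ((a - real n / 3) * ssigma l))"
    unfolding exp_add[symmetric] L_def by (rule arg_cong[of _ _ exp]) (simp add: algebra_simps)
  also have "\<dots> = of_real (exp ((a - real n / 3) * ln y)) * cis ((a - real n / 3) * ssigma l)"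
    by (simp only: exp_of_real cis_conv_exp)
  finally have 1: "exp (of_real a * L) * exp (-(L / 3)) ^ n = of_real (exp ((a - real n / 3) * ln y)) * cis ((a - real n / 3) * ssigma l)" .
  have 2: "ray_z l x ^ n = cis (real n * ztheta l) * of_real (x ^ n)"
    unfolding ray_z_def power_mult_distrib Complex.DeMoivre of_real_power ..
  have "exp (of_real a * L) * (ray_z l x * exp (-(L / 3))) ^ n = ray_z l x ^ n * (exp (of_real a * L) * exp (-(L / 3)) ^ n)"
    unfolding power_mult_distrib by (simp only: mult_ac)
  also have "\<dots> = of_real (x ^ n * exp ((a - real n / 3) * ln y)) * (cis (real n * ztheta l) * cis ((a - real n / 3) * ssigma l))"
    unfolding 1 2 of_real_mult by (simp only: mult_ac)
  finally show ?thesis unfolding cis_mult Ln_ray_s[OF assms(1) y] L_def .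
qed

lemma weight_sum_cong: "(\<Sum>l<4. ray_weight p l * (of_real C * cis (real n * ztheta l - real (n + p + 1) / 3 * ssigma l))) = of_real C * weight_sum p n"
  unfolding weight_sum_def sum_distrib_left by (intro sum.cong refl) (simp only: mult_ac)

text \<open>On each ray the integral is \<open>A l\<close>, the part from \<open>eser\<close>, plus
  \<open>B l\<close>, the resonant part. Summation with the weights leaves in the first only the
  degrees n with n mod 3 = 2, and turns the second into the multiple of x^N that is
  subtracted.\<close>

lemma ray_sum_monomial:
  assumes x: "x > 0" and \<delta>: "\<delta> > 0" and p: "p \<in> {1, 2}" and N: "N + p = 3 * m + 2"
  shows "(\<lambda>n. of_real (if n mod 3 = 2 then 3 * sqrt 3 * (kernel_coeff p n * x ^ n *
            (\<delta> powr (real (m + 1) - real (n + p + 1) / 3) / (real (m + 1) - real (n + p + 1) / 3))) else 0)) sums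
     (ray_sum p (\<lambda>\<tau>. of_real \<tau> ^ m) 0 \<delta> x - of_real (2 * pi * (-1) ^ m * fact m / fact N * x ^ N))"
proof -
  have p2: "p \<le> 2" using p by auto
  obtain D :: complex where D: "\<And>z s \<delta>. Re z \<ge> 0 \<Longrightarrow> z \<noteq> 0 \<Longrightarrow> Re s = 0 \<Longrightarrow> s \<noteq> 0 \<Longrightarrow> \<delta> > 0 \<Longrightarrow>
     s ^ (m + 1) * Jint p (\<lambda>\<tau>. of_real \<tau> ^ m) 0 \<delta> s z =
     exp (of_real (real N / 3) * Ln (s * of_real \<delta>)) * eser p N (z * exp (-(Ln (s * of_real \<delta>) / 3)))
       + z ^ N * (of_real (kernel_coeff p N) * (Ln (s * of_real \<delta>) - 3 * Ln z) + D)"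
    using Jint_monomial[OF N p2] by blast
  define d where "d = (\<lambda>n. if n = N then 0 else 3 * kernel_coeff p n / (real N - real n))"
  define A where "A = (\<lambda>l. exp (of_real (real N / 3) * Ln (ray_s l * of_real \<delta>)) * eser p N (ray_z l x * exp (-(Ln (ray_s l * of_real \<delta>) / 3))) / ray_s l ^ (m + 1))"
  define B where "B = (\<lambda>l. ray_z l x ^ N * (of_real (kernel_coeff p N) * (Ln (ray_s l * of_real \<delta>) - 3 * Ln (ray_z l x)) + D) / ray_s l ^ (m + 1))"
  have J: "Jint p (\<lambda>\<tau>. of_real \<tau> ^ m) 0 \<delta> (ray_s l) (ray_z l x) = A l + B l" if l: "l < 4" for l
    using D[OF ray_z_halfplane[OF l x] ray_s_imaginary[OF l] \<delta>] ray_s_imaginary[OF l]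
    unfolding A_def B_def add_divide_distrib[symmetric] by (simp only: nonzero_eq_divide_eq power_not_zero mult.commute not_False_eq_True)
  have spow: "ray_s l ^ (m + 1) = cis (real (m + 1) * ssigma l)" for l
    unfolding ray_s_def by (rule Complex.DeMoivre)
  have Nr: "real N = 3 * real (m + 1) - 1 - real p" using N by (simp add: of_nat_diff algebra_simps flip: of_nat_add)
  have A: "(\<lambda>n. of_real (d n * x ^ n * exp ((real N / 3 - real n / 3) * ln \<delta>)) * cis (real n * ztheta l - real (n + p + 1) / 3 * ssigma l)) sums A l"
    if l: "l < 4" for l
  proof -
    have "(\<lambda>n. exp (of_real (real N / 3) * Ln (ray_s l * of_real \<delta>)) * (of_real (d n) * (ray_z l x * exp (-(Ln (ray_s l * of_real \<delta>) / 3))) ^ n) / ray_s l ^ (m + 1)) sums A l"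
      unfolding A_def d_def by (intro sums_divide sums_mult eser_sums)
    moreover have "exp (of_real (real N / 3) * Ln (ray_s l * of_real \<delta>)) * (of_real (d n) * (ray_z l x * exp (-(Ln (ray_s l * of_real \<delta>) / 3))) ^ n) / ray_s l ^ (m + 1)
       = of_real (d n * x ^ n * exp ((real N / 3 - real n / 3) * ln \<delta>)) * cis (real n * ztheta l - real (n + p + 1) / 3 * ssigma l)" for n
    proof -
      have "exp (of_real (real N / 3) * Ln (ray_s l * of_real \<delta>)) * (of_real (d n) * (ray_z l x * exp (-(Ln (ray_s l * of_real \<delta>) / 3))) ^ n) / ray_s l ^ (m + 1)
        = of_real (d n) * (exp (of_real (real N / 3) * Ln (ray_s l * of_real \<delta>)) * (ray_z l x * exp (-(Ln (ray_s l * of_real \<delta>) / 3))) ^ n) / ray_s l ^ (m + 1)"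
        by (simp only: mult_ac)
      also have "\<dots> = of_real (d n) * (of_real (x ^ n * exp ((real N / 3 - real n / 3) * ln \<delta>))
         * (cis (real n * ztheta l + (real N / 3 - real n / 3) * ssigma l) / cis (real (m + 1) * ssigma l)))"
        unfolding phase_term[OF l x \<delta>] spow by (simp only: times_divide_eq_right)
      also have "cis (real n * ztheta l + (real N / 3 - real n / 3) * ssigma l) / cis (real (m + 1) * ssigma l)
         = cis (real n * ztheta l - real (n + p + 1) / 3 * ssigma l)"
        unfolding cis_divide Nr by (rule arg_cong[of _ _ cis]) (simp add: field_simps)
      finally show ?thesis by (simp only: of_real_mult mult_ac)
    qed
    ultimately show ?thesis by simp
  qed
  have B: "B l = of_real (x ^ N) * cis (real N * ztheta l - real (N + p + 1) / 3 * ssigma l) *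
      (of_real (kernel_coeff p N) * (of_real (ln \<delta> - 3 * ln x) + \<i> * of_real (ssigma l - 3 * ztheta l)) + D)" if l: "l < 4" for l
  proof -
    have "ray_z l x ^ N / ray_s l ^ (m + 1) = of_real (x ^ N) * cis (real N * ztheta l - real (N + p + 1) / 3 * ssigma l)"
    proof -
      have e: "real (N + p + 1) / 3 = real (m + 1)" using Nr by simp
      show ?thesis
        unfolding e spow ray_z_def power_mult_distrib Complex.DeMoivre cis_divide[symmetric] of_real_power
        by (simp only: times_divide_eq_right mult.commute)
    qed
    moreover have "Ln (ray_s l * of_real \<delta>) - 3 * Ln (ray_z l x) = of_real (ln \<delta> - 3 * ln x) + \<i> * of_real (ssigma l - 3 * ztheta l)"
      unfolding Ln_ray_s[OF l \<delta>] Ln_ray_z[OF l x] by (simp add: algebra_simps)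
    moreover have "B l = (ray_z l x ^ N / ray_s l ^ (m + 1)) * (of_real (kernel_coeff p N) * (Ln (ray_s l * of_real \<delta>) - 3 * Ln (ray_z l x)) + D)"
      unfolding B_def by (simp only: times_divide_eq_left)
    ultimately show ?thesis by (simp only:)
  qed
  have "(\<lambda>n. \<Sum>l<4. ray_weight p l * (of_real (d n * x ^ n * exp ((real N / 3 - real n / 3) * ln \<delta>)) * cis (real n * ztheta l - real (n + p + 1) / 3 * ssigma l))) sums (\<Sum>l<4. ray_weight p l * A l)"
    by (intro sums_sum sums_mult A) auto
  then have 1: "(\<lambda>n. of_real (d n * x ^ n * exp ((real N / 3 - real n / 3) * ln \<delta>)) * weight_sum p n) sums (\<Sum>l<4. ray_weight p l * A l)"
    unfolding weight_sum_cong .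
  \<comment> \<open>The resonant degree has residue 2 - p, so it never meets the degrees that
    survive the weights: no surviving denominator vanishes, and \<open>weight_sum p N\<close> is
    0.\<close>
  have NM: "N mod 3 \<noteq> 2"
  proof -
    have "N = 3 * m + (2 - p)" "2 - p < 2" using N p by auto
    then show ?thesis by simp
  qed
  have eq: "of_real (d n * x ^ n * exp ((real N / 3 - real n / 3) * ln \<delta>)) * weight_sum p n =
     of_real (if n mod 3 = 2 then 3 * sqrt 3 * (kernel_coeff p n * x ^ n *
            (\<delta> powr (real (m + 1) - real (n + p + 1) / 3) / (real (m + 1) - real (n + p + 1) / 3))) else 0)" for n
  proof (cases "n mod 3 = 2")
    case True
    then have nN: "n \<noteq> N" using NM by auto
    have e: "real N - real n = 3 * (real (m + 1) - real (n + p + 1) / 3)" unfolding Nr by (simp add: field_simps)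
    have nz: "real (m + 1) - real (n + p + 1) / 3 \<noteq> 0"
    proof
      assume "real (m + 1) - real (n + p + 1) / 3 = 0"
      then have "real N - real n = 0" unfolding e by simp
      then show False using nN by simp
    qed
    have pw: "exp ((real N / 3 - real n / 3) * ln \<delta>) = \<delta> powr (real (m + 1) - real (n + p + 1) / 3)"
    proof -
      have "real N / 3 - real n / 3 = real (m + 1) - real (n + p + 1) / 3" using e by (simp add: field_simps)
      then show ?thesis using \<delta> by (simp add: powr_def)
    qed
    have dd: "d n = kernel_coeff p n / (real (m + 1) - real (n + p + 1) / 3)"
    proof -
      have "d n = 3 * kernel_coeff p n / (real N - real n)" using nN by (simp add: d_def)
      then show ?thesis unfolding e by (simp only: mult_divide_mult_cancel_left[of "3::real"] zero_neq_numeral[symmetric] not_False_eq_True)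
    qed
    have "weight_sum p n = of_real (3 * sqrt 3)" using weight_sum_eq[OF p, of n] True by simp
    then show ?thesis unfolding pw dd using True by (simp add: field_simps)
  next
    case False
    then show ?thesis using weight_sum_eq[OF p, of n] by simp
  qed
  \<comment> \<open>The real part of the logarithms and the constant \<open>D\<close> are common to
    all rays and meet the factor \<open>weight_sum p N\<close> = 0. What remains is the imaginary
    part, 2\<pi> on ray 0 and -2\<pi> on ray 2.\<close>
  have BB: "(\<Sum>l<4. ray_weight p l * B l) = of_real (2 * pi * (-1) ^ m * fact m / fact N * x ^ N)"
  proof -
    let ?ph = "\<lambda>l. cis (real N * ztheta l - real (N + p + 1) / 3 * ssigma l)"
    define E where "E = of_real (kernel_coeff p N) * of_real (ln \<delta> - 3 * ln x) + D"
    have "(\<Sum>l<4. ray_weight p l * B l) = (\<Sum>l<4. of_real (x ^ N) * E * (ray_weight p l * ?ph l) + of_real (x ^ N) * of_real (kernel_coeff p N) * \<i> * (of_real (ssigma l - 3 * ztheta l) * (ray_weight p l * ?ph l)))"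
      by (intro sum.cong refl, subst B) (simp_all add: E_def algebra_simps)
    also have "\<dots> = of_real (x ^ N) * E * weight_sum p N + of_real (x ^ N) * of_real (kernel_coeff p N) * \<i> * (\<Sum>l<4. of_real (ssigma l - 3 * ztheta l) * (ray_weight p l * ?ph l))"
      unfolding sum.distrib weight_sum_def sum_distrib_left[symmetric] ..
    also have "weight_sum p N = 0" using weight_sum_eq[OF p, of N] NM by simp
    also have "(\<Sum>l<4. of_real (ssigma l - 3 * ztheta l) * (ray_weight p l * ?ph l)) = of_real (2 * pi) * (ray_weight p 0 * ?ph 0 - ray_weight p 2 * ?ph 2)"
    proof -
      have v: "ssigma 0 - 3 * ztheta 0 = 2 * pi" "ssigma 1 - 3 * ztheta 1 = 0" "ssigma 2 - 3 * ztheta 2 = - (2 * pi)" "ssigma 3 - 3 * ztheta 3 = 0"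
        unfolding ztheta_ssigma_values by simp_all
      have "(\<Sum>l<4. of_real (ssigma l - 3 * ztheta l) * (ray_weight p l * ?ph l)) =
         of_real (ssigma 0 - 3 * ztheta 0) * (ray_weight p 0 * ?ph 0) + (of_real (ssigma 1 - 3 * ztheta 1) * (ray_weight p 1 * ?ph 1)
          + (of_real (ssigma 2 - 3 * ztheta 2) * (ray_weight p 2 * ?ph 2) + of_real (ssigma 3 - 3 * ztheta 3) * (ray_weight p 3 * ?ph 3)))"
        unfolding lessThan_4 by simp
      then show ?thesis unfolding v by (simp add: algebra_simps)
    qed
    also have "ray_weight p 0 * ?ph 0 - ray_weight p 2 * ?ph 2 = - \<i> * 3 * (-1) ^ (N + m)" by (rule weight_sum_resonance[OF p N])
    also have "of_real (x ^ N) * E * 0 + of_real (x ^ N) * of_real (kernel_coeff p N) * \<i> * (of_real (2 * pi) * (- \<i> * 3 * (-1) ^ (N + m)))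
       = of_real (x ^ N * kernel_coeff p N * (2 * pi) * 3 * (-1) ^ (N + m))"
    proof -
      have *: "A * E * 0 + A * k * \<i> * (P * (- \<i> * 3 * s)) = A * k * P * 3 * s" for A k P s :: complex
        by (simp add: algebra_simps)
      show ?thesis unfolding * of_real_mult of_real_numeral of_real_power of_real_minus of_real_1 ..
    qed
    also have "x ^ N * kernel_coeff p N * (2 * pi) * 3 * (-1) ^ (N + m) = 2 * pi * (-1) ^ m * fact m / fact N * x ^ N"
    proof -
      \<comment> \<open>At the resonant degree the Gamma value in \<open>kernel_coeff\<close> is
        Gamma(m+1) = m!, the source of the factorial that later cancels the one in the Taylor
        coefficient.\<close>
      have "real (N + p + 1) / 3 = 1 + real m" using Nr by simp
      then have "kernel_coeff p N = (-1) ^ N * fact m / (3 * fact N)" unfolding kernel_coeff_def by (simp only: Gamma_fact)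
      then have "x ^ N * kernel_coeff p N * (2 * pi) * 3 * (-1) ^ (N + m) = 2 * pi * ((-1) ^ N * (-1) ^ (N + m)) * fact m / fact N * x ^ N"
        by (simp only:) (simp add: field_simps)
      moreover have "(-1) ^ N * (-1) ^ (N + m) = (-1 :: real) ^ m"
        by (simp only: power_add mult.assoc[symmetric] power_mult_distrib[symmetric]) simp
      ultimately show ?thesis by (simp only:)
    qed
    finally show ?thesis .
  qed
  have "ray_sum p (\<lambda>\<tau>. of_real \<tau> ^ m) 0 \<delta> x = (\<Sum>l<4. ray_weight p l * A l) + (\<Sum>l<4. ray_weight p l * B l)"
    unfolding ray_sum_def sum.distrib[symmetric] by (intro sum.cong refl, subst J) (simp_all add: distrib_left)
  then have "(\<Sum>l<4. ray_weight p l * A l) = ray_sum p (\<lambda>\<tau>. of_real \<tau> ^ m) 0 \<delta> x - of_real (2 * pi * (-1) ^ m * fact m / fact N * x ^ N)"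
    unfolding BB by (simp only: add_diff_cancel_right')
  with 1 show ?thesis unfolding eq by (simp only:)
qed

text \<open>With \<tau> bounded away from 0 the kernel series converges uniformly in \<tau>, so it
  may be integrated termwise on each ray; the weights are applied afterwards.\<close>

lemma ray_sum_far:
  assumes x: "x > 0" and ab: "0 < a" "a \<le> b" and p: "p \<in> {1, 2}" and g: "C2_bounded a b g K"
  shows "(\<lambda>n. of_real (if n mod 3 = 2 then 3 * sqrt 3 * (kernel_coeff p n * x ^ n) else 0) *
      integral {a..b} (\<lambda>\<tau>. g \<tau> * of_real (\<tau> powr (- (real (n + p + 1) / 3))))) sums ray_sum p g a b x"
proof -
  have p2: "p \<le> 2" using p by auto
  have gc: "continuous_on {a..b} g" by (rule C2_bounded_continuous[OF g])
  have gK: "norm (g \<tau>) \<le> K" if "\<tau> \<in> {a..b}" for \<tau> using g that unfolding C2_bounded_def by blast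
  have K0: "K \<ge> 0" using order_trans[OF norm_ge_zero gK[of a]] ab by simp
  define I where "I = (\<lambda>n. integral {a..b} (\<lambda>\<tau>. g \<tau> * of_real (\<tau> powr (- (real (n + p + 1) / 3)))))"
  have J: "(\<lambda>n. of_real (kernel_coeff p n * x ^ n) * cis (real n * ztheta l - real (n + p + 1) / 3 * ssigma l) * I n) sums Jint p g a b (ray_s l) (ray_z l x)"
    if l: "l < 4" for l
  proof -
    define c where "c = (\<lambda>n. of_real (kernel_coeff p n * x ^ n) * cis (real n * ztheta l - real (n + p + 1) / 3 * ssigma l))"
    define F where "F = (\<lambda>n \<tau>. c n * (g \<tau> * of_real (\<tau> powr (- (real (n + p + 1) / 3)))))"
    define S where "S = (\<lambda>\<tau>. exp (-(of_real (real (p + 1) / 3) * Ln (ray_s l * of_real \<tau>))) *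
     kernel_fun p (ray_z l x * exp (-(Ln (ray_s l * of_real \<tau>) / 3))) * g \<tau>)"
    have Fs: "(\<lambda>n. F n \<tau>) sums S \<tau>" if t: "\<tau> \<in> {a..b}" for \<tau>
    proof -
      have t0: "\<tau> > 0" using t ab by simp
      have "(\<lambda>n. exp (-(of_real (real (p + 1) / 3) * Ln (ray_s l * of_real \<tau>))) * (of_real (kernel_coeff p n) * (ray_z l x * exp (-(Ln (ray_s l * of_real \<tau>) / 3))) ^ n) * g \<tau>) sums S \<tau>"
        unfolding S_def by (intro sums_mult sums_mult2 kernel_fun_sums)
      moreover have "exp (-(of_real (real (p + 1) / 3) * Ln (ray_s l * of_real \<tau>))) * (of_real (kernel_coeff p n) * (ray_z l x * exp (-(Ln (ray_s l * of_real \<tau>) / 3))) ^ n) * g \<tau> = F n \<tau>" for n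
      proof -
        have e: "- (real (p + 1) / 3) - real n / 3 = - (real (n + p + 1) / 3)" by (simp add: field_simps)
        have h: "exp (-(of_real (real (p + 1) / 3) * Ln (ray_s l * of_real \<tau>))) * (ray_z l x * exp (-(Ln (ray_s l * of_real \<tau>) / 3))) ^ n
          = of_real (x ^ n * \<tau> powr (- (real (n + p + 1) / 3))) * cis (real n * ztheta l + - (real (n + p + 1) / 3) * ssigma l)"
          using phase_term[OF l x t0, of "- (real (p + 1) / 3)" n] t0 unfolding e by (simp only: of_real_minus mult_minus_left powr_def if_False) simp
        have "exp (-(of_real (real (p + 1) / 3) * Ln (ray_s l * of_real \<tau>))) * (of_real (kernel_coeff p n) * (ray_z l x * exp (-(Ln (ray_s l * of_real \<tau>) / 3))) ^ n) * g \<tau>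
           = of_real (kernel_coeff p n) * (of_real (x ^ n * \<tau> powr (- (real (n + p + 1) / 3))) * cis (real n * ztheta l + - (real (n + p + 1) / 3) * ssigma l)) * g \<tau>"
          unfolding h[symmetric] by (simp only: mult_ac)
        also have "real n * ztheta l + - (real (n + p + 1) / 3) * ssigma l = real n * ztheta l - real (n + p + 1) / 3 * ssigma l" by simp
        finally show ?thesis unfolding F_def c_def of_real_mult by (simp only: mult_ac)
      qed
      ultimately show ?thesis by simp
    qed
    have Fc: "continuous_on {a..b} (F n)" for n
      unfolding F_def by (intro continuous_intros gc) (use ab in auto)
    \<comment> \<open>The negative powers of \<tau> are largest at \<tau> = a, so the majorant is
      the absolute kernel series at x a^(-1/3).\<close>
    define M where "M = (\<lambda>n. K * a powr (- (real (p + 1) / 3)) * norm (of_real (kernel_coeff p n) * of_real (x * a powr (- (1 / 3))) ^ n :: complex))"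
    have Ms: "summable M" unfolding M_def by (intro summable_mult kernel_coeff_abs_summable)
    have FM: "norm (F n \<tau>) \<le> M n" if t: "\<tau> \<in> {a..b}" for n \<tau>
    proof -
      have "\<tau> powr (- (real (n + p + 1) / 3)) \<le> a powr (- (real (n + p + 1) / 3))"
        using t ab by (intro powr_mono2') auto
      also have "\<dots> = a powr (- (real (p + 1) / 3)) * (a powr (- (1 / 3))) ^ n"
      proof -
        have p1: "(a powr (- (1 / 3))) ^ n = a powr (- (real n / 3))" using ab by (simp add: powr_power)
        show ?thesis unfolding p1 powr_add[symmetric]
          by (rule arg_cong[of _ _ "\<lambda>e. a powr e"]) (simp add: field_simps)
      qed
      finally have "norm (g \<tau>) * \<tau> powr (- (real (n + p + 1) / 3)) \<le> K * (a powr (- (real (p + 1) / 3)) * (a powr (- (1 / 3))) ^ n)"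
        using gK[OF t] K0 by (intro mult_mono) auto
      then have "(\<bar>kernel_coeff p n\<bar> * x ^ n) * (norm (g \<tau>) * \<tau> powr (- (real (n + p + 1) / 3))) \<le> (\<bar>kernel_coeff p n\<bar> * x ^ n) * (K * (a powr (- (real (p + 1) / 3)) * (a powr (- (1 / 3))) ^ n))"
        using x by (intro mult_left_mono) auto
      moreover have "norm (F n \<tau>) = (\<bar>kernel_coeff p n\<bar> * x ^ n) * (norm (g \<tau>) * \<tau> powr (- (real (n + p + 1) / 3)))"
        unfolding F_def c_def norm_mult norm_of_real norm_cis using x by (simp add: abs_mult)
      moreover have "M n = (\<bar>kernel_coeff p n\<bar> * x ^ n) * (K * (a powr (- (real (p + 1) / 3)) * (a powr (- (1 / 3))) ^ n))"
        unfolding M_def norm_mult norm_power norm_of_real power_mult_distrib abs_mult using x by (simp add: power_mult_distrib mult_ac)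
      ultimately show ?thesis by simp
    qed
    have "(\<lambda>k. integral {a..b} (\<lambda>\<tau>. \<Sum>n<k. F n \<tau>)) \<longlonglongrightarrow> integral {a..b} S"
    proof (rule dominated_convergence(2)[where h = "\<lambda>_. suminf M"])
      show "(\<lambda>\<tau>. \<Sum>n<k. F n \<tau>) integrable_on {a..b}" for k
        by (intro integrable_continuous_interval continuous_on_sum Fc)
      show "(\<lambda>_. suminf M) integrable_on {a..b}" by (rule integrable_const_ivl)
      fix k \<tau> assume t: "\<tau> \<in> {a..b}"
      have "norm (\<Sum>n<k. F n \<tau>) \<le> (\<Sum>n<k. M n)" by (rule sum_norm_le) (rule FM[OF t])
      also have "\<dots> \<le> suminf M"
        by (rule sum_le_suminf[OF Ms]) (use order_trans[OF norm_ge_zero FM[OF t]] in auto)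
      finally show "norm (\<Sum>n<k. F n \<tau>) \<le> suminf M" .
    next
      fix \<tau> assume "\<tau> \<in> {a..b}"
      from Fs[OF this] show "(\<lambda>k. \<Sum>n<k. F n \<tau>) \<longlonglongrightarrow> S \<tau>" unfolding sums_def .
    qed
    moreover have "integral {a..b} (\<lambda>\<tau>. \<Sum>n<k. F n \<tau>) = (\<Sum>n<k. c n * I n)" for k
    proof -
      have "integral {a..b} (F n) = c n * I n" for n unfolding F_def I_def by (rule integral_mult_right)
      then show ?thesis by (subst integral_sum) (auto intro!: integrable_continuous_interval Fc)
    qed
    moreover have "integral {a..b} S = Jint p g a b (ray_s l) (ray_z l x)"
      unfolding S_def by (rule Jint_far[OF ab ray_s_imaginary[OF l] ray_z_halfplane[OF l x] p2 g, symmetric])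
    ultimately show ?thesis unfolding sums_def c_def by simp
  qed
  have "(\<lambda>n. \<Sum>l<4. ray_weight p l * (of_real (kernel_coeff p n * x ^ n) * cis (real n * ztheta l - real (n + p + 1) / 3 * ssigma l) * I n)) sums ray_sum p g a b x"
    unfolding ray_sum_def by (intro sums_sum sums_mult J) auto
  moreover have "(\<Sum>l<4. ray_weight p l * (of_real (kernel_coeff p n * x ^ n) * cis (real n * ztheta l - real (n + p + 1) / 3 * ssigma l) * I n))
      = of_real (if n mod 3 = 2 then 3 * sqrt 3 * (kernel_coeff p n * x ^ n) else 0) * I n" for n
  proof -
    have "(\<Sum>l<4. ray_weight p l * (of_real (kernel_coeff p n * x ^ n) * cis (real n * ztheta l - real (n + p + 1) / 3 * ssigma l) * I n))
       = (of_real (kernel_coeff p n * x ^ n) * weight_sum p n) * I n"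
      unfolding weight_sum_cong[symmetric] sum_distrib_right by (simp only: mult.assoc)
    also have "of_real (kernel_coeff p n * x ^ n) * weight_sum p n = of_real (if n mod 3 = 2 then 3 * sqrt 3 * (kernel_coeff p n * x ^ n) else 0)"
      unfolding weight_sum_eq[OF p] by (simp add: mult_ac)
    finally show ?thesis .
  qed
  ultimately show ?thesis unfolding I_def by simp
qed

section \<open>Small and large time lags\<close>

text \<open>The tails of the absolute series at radius \<open>\<rho>\<close> dominate the Taylor
  remainders uniformly on the closed disc. The last conclusion provides the majorant in the exchange
  of sums in \<open>ray_sum_local\<close>.\<close>

lemma powser_tail_bound:
  fixes c :: "nat \<Rightarrow> complex"
  assumes s: "\<And>w. w \<in> ball 0 R \<Longrightarrow> (\<lambda>m. c m * w ^ m) sums g w" and \<rho>: "0 < \<rho>" "\<rho> < R"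
  obtains T where "T \<longlonglongrightarrow> 0" "\<And>M w. norm w \<le> \<rho> \<Longrightarrow> norm (g w - (\<Sum>m<M. c m * w ^ m)) \<le> T M"
    "summable (\<lambda>m. norm (c m) * \<rho> ^ m)"
proof -
  \<comment> \<open>An intermediate radius: convergence there gives absolute convergence at the
    smaller \<open>\<rho>\<close>.\<close>
  define \<rho>' where "\<rho>' = (\<rho> + R) / 2"
  have r': "\<rho> < \<rho>'" "\<rho>' < R" using \<rho> by (auto simp: \<rho>'_def)
  have "(of_real \<rho>' :: complex) \<in> ball 0 R" using r' \<rho> by simp
  then have "summable (\<lambda>m. c m * of_real \<rho>' ^ m)" by (rule sums_summable[OF s])
  then have "summable (\<lambda>m. norm (c m * of_real \<rho> ^ m))"
    by (rule powser_insidea) (use r' \<rho> in simp)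
  then have sm: "summable (\<lambda>m. norm (c m) * \<rho> ^ m)" using \<rho> by (simp add: norm_mult norm_power)
  define T where "T = (\<lambda>M. (\<Sum>m. norm (c m) * \<rho> ^ m) - (\<Sum>m<M. norm (c m) * \<rho> ^ m))"
  have "T \<longlonglongrightarrow> (\<Sum>m. norm (c m) * \<rho> ^ m) - (\<Sum>m. norm (c m) * \<rho> ^ m)"
    unfolding T_def by (intro tendsto_intros summable_LIMSEQ sm)
  then have "T \<longlonglongrightarrow> 0" by simp
  moreover have "norm (g w - (\<Sum>m<M. c m * w ^ m)) \<le> T M" if w: "norm w \<le> \<rho>" for M w
  proof -
    have "w \<in> ball 0 R" using w \<rho> by simp
    note sw = s[OF this]
    have "g w - (\<Sum>m<M. c m * w ^ m) = (\<Sum>m. c (m + M) * w ^ (m + M))"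
      using suminf_minus_initial_segment[OF sums_summable[OF sw], of M] sums_unique[OF sw] by simp
    moreover have sm': "summable (\<lambda>m. norm (c (m + M)) * \<rho> ^ (m + M))"
      using summable_ignore_initial_segment[OF sm, of M] .
    moreover have "norm (c (m + M) * w ^ (m + M)) \<le> norm (c (m + M)) * \<rho> ^ (m + M)" for m
      unfolding norm_mult norm_power using w by (intro mult_left_mono power_mono) auto
    ultimately have "norm (g w - (\<Sum>m<M. c m * w ^ m)) \<le> (\<Sum>m. norm (c (m + M)) * \<rho> ^ (m + M))"
      using norm_suminf_le[of "\<lambda>m. c (m + M) * w ^ (m + M)" "\<lambda>m. norm (c (m + M)) * \<rho> ^ (m + M)"] by simp
    also have "\<dots> = T M" unfolding T_def by (rule suminf_minus_initial_segment[OF sm])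
    finally show ?thesis .
  qed
  ultimately show ?thesis using sm by (rule that)
qed

lemma powser_ball_holomorphic:
  fixes c :: "nat \<Rightarrow> complex"
  assumes "\<And>w. w \<in> ball 0 R \<Longrightarrow> (\<lambda>m. c m * w ^ m) sums g w"
  shows "g holomorphic_on ball 0 R"
  by (rule power_series_holomorphic[of 0 R c g]) (use assms in auto)

text \<open>The remainder of the Taylor series tends to 0 uniformly on a disc slightly larger than
  \<delta>, hence in C2 on the interval by Cauchy's estimates. The uniform constant of
  \<open>Jint_integrable_bound\<close> then makes its ray integral tend to 0.\<close>

lemma Jint_taylor:
  fixes c :: "nat \<Rightarrow> complex"
  assumes sg: "\<And>w. w \<in> ball 0 R \<Longrightarrow> (\<lambda>m. c m * w ^ m) sums g w"
    and \<delta>: "0 < \<delta>" "\<delta> < R" and s: "Re s = 0" "s \<noteq> 0" and z: "Re z \<ge> 0" "z \<noteq> 0" and p: "p \<le> 2"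
  shows "(\<lambda>m. c m * Jint p (\<lambda>\<tau>. of_real \<tau> ^ m) 0 \<delta> s z) sums Jint p (\<lambda>\<tau>. g (of_real \<tau>)) 0 \<delta> s z"
proof -
  define \<rho> where "\<rho> = (\<delta> + R) / 2"
  have r: "\<delta> < \<rho>" "\<rho> < R" "0 < \<rho>" using \<delta> by (auto simp: \<rho>_def)
  \<comment> \<open>Discs of this radius about points of \<open>{0..\<delta>}\<close> stay inside
    the disc of radius \<open>\<rho>\<close> on which the tails are controlled.\<close>
  define d where "d = \<rho> - \<delta>"
  have d: "d > 0" using r by (simp add: d_def)
  obtain T where T: "T \<longlonglongrightarrow> 0" "\<And>M w. norm w \<le> \<rho> \<Longrightarrow> norm (g w - (\<Sum>m<M. c m * w ^ m)) \<le> T M"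
    "summable (\<lambda>m. norm (c m) * \<rho> ^ m)"
    by (rule powser_tail_bound[OF sg r(3,2)]) (assumption, (rule that; assumption))
  have gh: "g holomorphic_on ball 0 R" by (rule powser_ball_holomorphic[OF sg])
  obtain C where C: "\<And>g K. C2_bounded 0 \<delta> g K \<Longrightarrow> Jfun p g 0 \<delta> s z integrable_on {0..} \<and> norm (Jint p g 0 \<delta> s z) \<le> C * K"
    by (rule Jint_integrable_bound[OF order_refl less_imp_le[OF \<delta>(1)] s z p]) (rule that; assumption)
  define rem where "rem = (\<lambda>M w. g w - (\<Sum>m<M. c m * w ^ m))"
  define E where "E = 1 + 1 / d + 2 / d ^ 2"
  have cbn: "norm w \<le> \<rho>" if "\<tau> \<in> {0..\<delta>}" "w \<in> cball (of_real \<tau>) d" for \<tau> :: real and w :: complex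
  proof -
    have "norm w \<le> norm (of_real \<tau> :: complex) + norm (w - of_real \<tau>)" by (rule norm_triangle_sub)
    also have "\<dots> \<le> \<delta> + d" using that by (intro add_mono) (auto simp: dist_norm norm_minus_commute)
    finally show ?thesis by (simp add: d_def)
  qed
  have cbs: "cball (of_real \<tau>) d \<subseteq> ball (0::complex) R" if "\<tau> \<in> {0..\<delta>}" for \<tau> :: real
  proof
    fix w :: complex assume "w \<in> cball (of_real \<tau>) d"
    from cbn[OF that this] r show "w \<in> ball 0 R" by simp
  qed
  have remC: "C2_bounded 0 \<delta> (\<lambda>\<tau>. rem M (of_real \<tau>)) (T M * E)" for M
    unfolding E_def
  proof (rule C2_bounded_holomorphic[OF open_ball _ d])
    show "rem M holomorphic_on ball 0 R" unfolding rem_def by (intro holomorphic_intros gh)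
    show "norm (rem M w) \<le> T M" if "\<tau> \<in> {0..\<delta>}" "w \<in> cball (of_real \<tau>) d" for \<tau> w
      unfolding rem_def by (rule T(2)[OF cbn[OF that]])
  qed (rule cbs)
  have gC: "C2_bounded 0 \<delta> (\<lambda>\<tau>. g (of_real \<tau>)) (T 0 * E)" using remC[of 0] by (simp add: rem_def)
  have gc: "continuous_on {0..\<delta>} (\<lambda>\<tau>. g (of_real \<tau>))" by (rule C2_bounded_continuous[OF gC])
  have lin: "Jint p (\<lambda>\<tau>. rem M (of_real \<tau>)) 0 \<delta> s z = Jint p (\<lambda>\<tau>. g (of_real \<tau>)) 0 \<delta> s z
      - (\<Sum>m<M. c m * Jint p (\<lambda>\<tau>. of_real \<tau> ^ m) 0 \<delta> s z)" for M
  proof -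
    have mi: "Jfun p (\<lambda>\<tau>. of_real \<tau> ^ m) 0 \<delta> s z integrable_on {0..}" for m
      using monomial_C2[of 0 \<delta> m] C by metis
    have gi: "Jfun p (\<lambda>\<tau>. g (of_real \<tau>)) 0 \<delta> s z integrable_on {0..}" using C[OF gC] by blast
    have "Jfun p (\<lambda>\<tau>. rem M (of_real \<tau>)) 0 \<delta> s z \<rho> = Jfun p (\<lambda>\<tau>. g (of_real \<tau>)) 0 \<delta> s z \<rho>
      - (\<Sum>m<M. c m * Jfun p (\<lambda>\<tau>. of_real \<tau> ^ m) 0 \<delta> s z \<rho>)" for \<rho>
    proof -
      let ?e = "\<lambda>\<tau>. exp (- (s * of_real \<rho> ^ 3 * of_real \<tau>))"
      have "integral {0..\<delta>} (\<lambda>\<tau>. ?e \<tau> * rem M (of_real \<tau>)) =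
         integral {0..\<delta>} (\<lambda>\<tau>. ?e \<tau> * g (of_real \<tau>) - (\<Sum>m<M. c m * (?e \<tau> * of_real \<tau> ^ m)))"
        unfolding rem_def right_diff_distrib sum_distrib_left by (simp only: mult.left_commute)
      also have "\<dots> = integral {0..\<delta>} (\<lambda>\<tau>. ?e \<tau> * g (of_real \<tau>)) - integral {0..\<delta>} (\<lambda>\<tau>. \<Sum>m<M. c m * (?e \<tau> * of_real \<tau> ^ m))"
        by (intro Henstock_Kurzweil_Integration.integral_diff integrable_continuous_interval continuous_intros gc)
      also have "integral {0..\<delta>} (\<lambda>\<tau>. \<Sum>m<M. c m * (?e \<tau> * of_real \<tau> ^ m)) = (\<Sum>m<M. integral {0..\<delta>} (\<lambda>\<tau>. c m * (?e \<tau> * of_real \<tau> ^ m)))"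
        by (intro integral_sum integrable_continuous_interval continuous_intros) auto
      finally have h: "integral {0..\<delta>} (\<lambda>\<tau>. ?e \<tau> * rem M (of_real \<tau>)) = integral {0..\<delta>} (\<lambda>\<tau>. ?e \<tau> * g (of_real \<tau>))
          - (\<Sum>m<M. c m * integral {0..\<delta>} (\<lambda>\<tau>. ?e \<tau> * of_real \<tau> ^ m))"
        unfolding integral_mult_right .
      show ?thesis
        unfolding Jfun_def h right_diff_distrib sum_distrib_left by (simp only: mult.left_commute mult.assoc)
    qed
    then have "Jint p (\<lambda>\<tau>. rem M (of_real \<tau>)) 0 \<delta> s z = integral {0..} (\<lambda>\<rho>. Jfun p (\<lambda>\<tau>. g (of_real \<tau>)) 0 \<delta> s z \<rho>
      - (\<Sum>m<M. c m * Jfun p (\<lambda>\<tau>. of_real \<tau> ^ m) 0 \<delta> s z \<rho>))"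
      unfolding Jint_def by (intro Henstock_Kurzweil_Integration.integral_cong)
    also have "\<dots> = Jint p (\<lambda>\<tau>. g (of_real \<tau>)) 0 \<delta> s z - integral {0..} (\<lambda>\<rho>. \<Sum>m<M. c m * Jfun p (\<lambda>\<tau>. of_real \<tau> ^ m) 0 \<delta> s z \<rho>)"
      unfolding Jint_def by (intro Henstock_Kurzweil_Integration.integral_diff gi integrable_sum integrable_on_mult_right mi) auto
    also have "integral {0..} (\<lambda>\<rho>. \<Sum>m<M. c m * Jfun p (\<lambda>\<tau>. of_real \<tau> ^ m) 0 \<delta> s z \<rho>) = (\<Sum>m<M. c m * Jint p (\<lambda>\<tau>. of_real \<tau> ^ m) 0 \<delta> s z)"
      unfolding Jint_def by (subst integral_sum) (auto intro!: integrable_on_mult_right mi)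
    finally show ?thesis .
  qed
  have "(\<lambda>M. C * (T M * E)) \<longlonglongrightarrow> C * (0 * E)" by (intro tendsto_intros T(1))
  then have lim: "(\<lambda>M. C * (T M * E)) \<longlonglongrightarrow> 0" by simp
  have nb: "norm (Jint p (\<lambda>\<tau>. rem M (of_real \<tau>)) 0 \<delta> s z) \<le> C * (T M * E)" for M
    by (rule conjunct2[OF C[OF remC]])
  have "(\<lambda>M. Jint p (\<lambda>\<tau>. rem M (of_real \<tau>)) 0 \<delta> s z) \<longlonglongrightarrow> 0"
    by (rule Lim_null_comparison[OF always_eventually lim]) (intro allI nb)
  from tendsto_diff[OF tendsto_const[of "Jint p (\<lambda>\<tau>. g (of_real \<tau>)) 0 \<delta> s z"] this]
  show ?thesis unfolding sums_def lin by simp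
qed

lemma ray_sum_taylor:
  fixes c :: "nat \<Rightarrow> complex"
  assumes sg: "\<And>w. w \<in> ball 0 R \<Longrightarrow> (\<lambda>m. c m * w ^ m) sums g w"
    and \<delta>: "0 < \<delta>" "\<delta> < R" and x: "x > 0" and p: "p \<le> 2"
  shows "(\<lambda>m. c m * ray_sum p (\<lambda>\<tau>. of_real \<tau> ^ m) 0 \<delta> x) sums ray_sum p (\<lambda>\<tau>. g (of_real \<tau>)) 0 \<delta> x"
proof -
  have "(\<lambda>m. \<Sum>l<4. ray_weight p l * (c m * Jint p (\<lambda>\<tau>. of_real \<tau> ^ m) 0 \<delta> (ray_s l) (ray_z l x))) sums ray_sum p (\<lambda>\<tau>. g (of_real \<tau>)) 0 \<delta> x"
    unfolding ray_sum_def
    by (intro sums_sum sums_mult Jint_taylor[OF sg \<delta> _ _ _ _ p]) (auto simp: ray_s_imaginary ray_z_halfplane x)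
  moreover have "(\<Sum>l<4. ray_weight p l * (c m * Jint p (\<lambda>\<tau>. of_real \<tau> ^ m) 0 \<delta> (ray_s l) (ray_z l x))) = c m * ray_sum p (\<lambda>\<tau>. of_real \<tau> ^ m) 0 \<delta> x" for m
    unfolding ray_sum_def sum_distrib_left by (simp only: mult.left_commute)
  ultimately show ?thesis by simp
qed

definition far_coeff :: "nat \<Rightarrow> real \<Rightarrow> nat \<Rightarrow> real" where
  "far_coeff p x n = (if n mod 3 = 2 then 3 * sqrt 3 * (kernel_coeff p n * x ^ n) else 0)"

text \<open>Hadamard's finite part of the integral of \<tau>^(m - (n+p+1)/3) over (0, \<delta>): the
  ordinary value when the exponent exceeds -1, and otherwise the primitive at \<delta> with the
  divergent power at 0 dropped.\<close>

definition local_coeff :: "nat \<Rightarrow> real \<Rightarrow> nat \<Rightarrow> nat \<Rightarrow> real" where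
  "local_coeff p \<delta> m n = \<delta> powr (real (m + 1) - real (n + p + 1) / 3) / (real (m + 1) - real (n + p + 1) / 3)"

text \<open>For n mod 3 = 2 the number n + p + 1 is congruent to p, hence not divisible by 3. Thirds
  of integers that are not integers keep distance 1/3 from the integers, so there are no small
  denominators.\<close>

lemma exponent_gap:
  assumes "n mod 3 = 2" "p \<in> {1, 2}"
  shows "1 / 3 \<le> \<bar>real (m + 1) - real (n + p + 1) / 3\<bar>"
proof -
  have "p = 1 \<or> p = 2" using assms(2) by simp
  then have "(n + p + 1) mod 3 \<noteq> 0" using assms(1) by presburger
  then have "3 * (m + 1) \<noteq> n + p + 1" by (metis mod_mult_self1_is_0)
  then have "real (3 * (m + 1)) \<noteq> real (n + p + 1)" by (simp only: of_nat_eq_iff not_False_eq_True)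
  have "1 \<le> \<bar>int (3 * (m + 1)) - int (n + p + 1)\<bar>" using \<open>3 * (m + 1) \<noteq> n + p + 1\<close> by linarith
  then have "1 \<le> \<bar>real (3 * (m + 1)) - real (n + p + 1)\<bar>" by linarith
  then show ?thesis by (simp add: field_simps)
qed

text \<open>The Taylor sum over m and the sum over powers of x have to be exchanged, and only finite
  Taylor sums are known to commute with the ray integrals. Tannery's theorem, with the majorant A n
  S, passes to the limit. \<open>L\<close> separates the degrees with n mod 3 = 2 from the resonant
  ones.\<close>

lemma ray_sum_local:
  fixes c :: "nat \<Rightarrow> complex"
  assumes sg: "\<And>w. w \<in> ball 0 R \<Longrightarrow> (\<lambda>m. c m * w ^ m) sums g w"
    and \<delta>: "0 < \<delta>" "\<delta> < R" and x: "x > 0" and p: "p \<in> {1, 2}"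
  obtains L where
    "(\<lambda>n. of_real (far_coeff p x n) * (\<Sum>m. c m * of_real (local_coeff p \<delta> m n))) sums L"
    "(\<lambda>m. c m * of_real (2 * pi * (-1) ^ m * fact m / fact (3 * m + 2 - p) * x ^ (3 * m + 2 - p))) sums
        (ray_sum p (\<lambda>\<tau>. g (of_real \<tau>)) 0 \<delta> x - L)"
proof -
  have p2: "p \<le> 2" using p by auto
  define res where "res = (\<lambda>m. of_real (2 * pi * (-1) ^ m * fact m / fact (3 * m + 2 - p) * x ^ (3 * m + 2 - p)) :: complex)"
  define cm where "cm = (\<lambda>m. ray_sum p (\<lambda>\<tau>. of_real \<tau> ^ m) 0 \<delta> x)"
  have sm: "summable (\<lambda>m. norm (c m) * \<delta> ^ m)" by (rule powser_tail_bound[OF sg \<delta>])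
  have mono: "(\<lambda>n. of_real (far_coeff p x n) * of_real (local_coeff p \<delta> m n)) sums (cm m - res m)" for m
  proof -
    have N: "3 * m + 2 - p + p = 3 * m + 2" using p2 by simp
    have "of_real (if n mod 3 = 2 then 3 * sqrt 3 * (kernel_coeff p n * x ^ n *
            (\<delta> powr (real (m + 1) - real (n + p + 1) / 3) / (real (m + 1) - real (n + p + 1) / 3))) else 0) =
        (of_real (far_coeff p x n) * of_real (local_coeff p \<delta> m n) :: complex)" for n
      unfolding far_coeff_def local_coeff_def of_real_mult[symmetric] by (simp only: mult_zero_left mult.assoc split: if_split) simp
    then show ?thesis using ray_sum_monomial[OF x \<delta>(1) p N] unfolding cm_def res_def by (simp only:)
  qed
  \<comment> \<open>The factor 3 is the reciprocal of the gap in
    \<open>exponent_gap\<close>.\<close>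
  define A where "A = (\<lambda>n. 3 * (\<bar>far_coeff p x n\<bar> * \<delta> powr (1 - real (n + p + 1) / 3)))"
  have lb: "\<bar>far_coeff p x n\<bar> * \<bar>local_coeff p \<delta> m n\<bar> \<le> A n * \<delta> ^ m" for m n
  proof (cases "n mod 3 = 2")
    case True
    have g: "1 / 3 \<le> \<bar>real (m + 1) - real (n + p + 1) / 3\<bar>" by (rule exponent_gap[OF True p])
    have "\<delta> powr (real (m + 1) - real (n + p + 1) / 3) = \<delta> powr (1 - real (n + p + 1) / 3) * \<delta> ^ m"
      using \<delta>(1) by (simp add: powr_realpow[symmetric] powr_add[symmetric] algebra_simps)
    then have "\<bar>local_coeff p \<delta> m n\<bar> = \<delta> powr (1 - real (n + p + 1) / 3) * \<delta> ^ m / \<bar>real (m + 1) - real (n + p + 1) / 3\<bar>"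
      unfolding local_coeff_def abs_divide using \<delta>(1) by simp
    also have "\<dots> \<le> \<delta> powr (1 - real (n + p + 1) / 3) * \<delta> ^ m / (1 / 3)"
    proof (rule divide_left_mono[OF g])
      show "0 < \<bar>real (m + 1) - real (n + p + 1) / 3\<bar> * (1 / 3)"
        using g by (intro mult_pos_pos) linarith+
    qed (use \<delta>(1) in simp)
    finally have "\<bar>local_coeff p \<delta> m n\<bar> \<le> 3 * (\<delta> powr (1 - real (n + p + 1) / 3) * \<delta> ^ m)" by simp
    from mult_left_mono[OF this, of "\<bar>far_coeff p x n\<bar>"] show ?thesis unfolding A_def by (simp add: mult_ac)
  qed (simp add: far_coeff_def A_def)
  have As: "summable A"
  proof (rule summable_comparison_test')
    show "summable (\<lambda>n. 9 * sqrt 3 * \<delta> powr (1 - real (p + 1) / 3) * norm (of_real (kernel_coeff p n) * of_real (x * \<delta> powr (- (1 / 3))) ^ n :: complex))"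
      by (intro summable_mult kernel_coeff_abs_summable)
    fix n
    have p1: "(\<delta> powr (- (1 / 3))) ^ n = \<delta> powr (- (real n / 3))" using \<delta>(1) by (simp add: powr_power)
    have e: "\<delta> powr (1 - real (n + p + 1) / 3) = \<delta> powr (1 - real (p + 1) / 3) * (\<delta> powr (- (1 / 3))) ^ n"
      unfolding p1 powr_add[symmetric] by (rule arg_cong[of _ _ "\<lambda>e. \<delta> powr e"]) (simp add: field_simps)
    have "\<bar>far_coeff p x n\<bar> \<le> 3 * sqrt 3 * (\<bar>kernel_coeff p n\<bar> * x ^ n)"
      using x by (simp add: far_coeff_def abs_mult)
    then have "A n \<le> 3 * ((3 * sqrt 3 * (\<bar>kernel_coeff p n\<bar> * x ^ n)) * \<delta> powr (1 - real (n + p + 1) / 3))"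
      unfolding A_def by (intro mult_left_mono mult_right_mono) auto
    also have "\<dots> = 9 * sqrt 3 * \<delta> powr (1 - real (p + 1) / 3) * norm (of_real (kernel_coeff p n) * of_real (x * \<delta> powr (- (1 / 3))) ^ n :: complex)"
      unfolding e norm_mult norm_power norm_of_real power_mult_distrib abs_mult using x by (simp add: power_mult_distrib mult_ac)
    moreover have "0 \<le> A n" unfolding A_def by simp
    ultimately show "norm (A n) \<le> 9 * sqrt 3 * \<delta> powr (1 - real (p + 1) / 3) * norm (of_real (kernel_coeff p n) * of_real (x * \<delta> powr (- (1 / 3))) ^ n :: complex)"
      by simp
  qed
  define f where "f = (\<lambda>n M. of_real (far_coeff p x n) * (\<Sum>m<M. c m * of_real (local_coeff p \<delta> m n)))"
  define S where "S = (\<Sum>m. norm (c m) * \<delta> ^ m)"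
  have wsm: "summable (\<lambda>m. norm (of_real (far_coeff p x n) * (c m * of_real (local_coeff p \<delta> m n))))" for n
  proof (rule summable_comparison_test')
    show "summable (\<lambda>m. A n * (norm (c m) * \<delta> ^ m))" by (intro summable_mult sm)
    show "norm (norm (of_real (far_coeff p x n) * (c m * of_real (local_coeff p \<delta> m n)))) \<le> A n * (norm (c m) * \<delta> ^ m)" for m
      using mult_left_mono[OF lb[of n m] norm_ge_zero[of "c m"]] by (simp add: norm_mult mult_ac)
  qed
  have fb: "norm (f n M) \<le> A n * S" for n M
  proof -
    have "norm (f n M) \<le> (\<Sum>m<M. A n * (norm (c m) * \<delta> ^ m))"
      unfolding f_def sum_distrib_left
    proof (rule sum_norm_le)
      fix m show "norm (of_real (far_coeff p x n) * (c m * of_real (local_coeff p \<delta> m n))) \<le> A n * (norm (c m) * \<delta> ^ m)"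
        using mult_left_mono[OF lb[of n m] norm_ge_zero[of "c m"]] by (simp add: norm_mult mult_ac)
    qed
    also have "\<dots> = A n * (\<Sum>m<M. norm (c m) * \<delta> ^ m)" by (simp only: sum_distrib_left)
    also have "\<dots> \<le> A n * S"
      unfolding S_def by (intro mult_left_mono sum_le_suminf sm) (use \<delta> in \<open>auto simp: A_def\<close>)
    finally show ?thesis .
  qed
  define F where "F = (\<lambda>n. of_real (far_coeff p x n) * (\<Sum>m. c m * of_real (local_coeff p \<delta> m n)))"
  have flim: "(\<lambda>M. f n M) \<longlonglongrightarrow> F n" for n
  \<comment> \<open>If the coefficient vanishes, so do both sides; otherwise it can be divided out
    of the summable products to obtain the inner series.\<close>
  proof (cases "far_coeff p x n = 0")
    case False
    have "summable (\<lambda>m. of_real (far_coeff p x n) * (c m * of_real (local_coeff p \<delta> m n)))"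
      by (rule summable_norm_cancel[OF wsm])
    then have "summable (\<lambda>m. c m * of_real (local_coeff p \<delta> m n))" by (rule summable_mult_D) (use False in simp)
    then show ?thesis unfolding f_def F_def by (intro tendsto_intros summable_LIMSEQ)
  qed (simp add: f_def F_def)
  have "eventually (\<lambda>(n, M). norm (f n M) \<le> A n * S) (at_top \<times>\<^sub>F sequentially)"
    by (intro always_eventually) (use fb in auto)
  from tannerys_theorem[OF flim this summable_mult2[OF As]]
  have tan: "summable (\<lambda>n. norm (F n))" "(\<lambda>M. \<Sum>n. f n M) \<longlonglongrightarrow> suminf F" by auto
  have fs: "(\<lambda>n. f n M) sums (\<Sum>m<M. c m * (cm m - res m))" for M
  proof -
    have "(\<lambda>n. \<Sum>m<M. c m * (of_real (far_coeff p x n) * of_real (local_coeff p \<delta> m n))) sums (\<Sum>m<M. c m * (cm m - res m))"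
      by (intro sums_sum sums_mult mono)
    then show ?thesis unfolding f_def sum_distrib_left by (simp only: mult_ac)
  qed
  have 1: "(\<lambda>M. \<Sum>m<M. c m * (cm m - res m)) \<longlonglongrightarrow> suminf F"
    using tan(2) sums_unique[OF fs] by simp
  have 2: "(\<lambda>M. \<Sum>m<M. c m * cm m) \<longlonglongrightarrow> ray_sum p (\<lambda>\<tau>. g (of_real \<tau>)) 0 \<delta> x"
    using ray_sum_taylor[OF sg \<delta> x p2] unfolding cm_def sums_def .
  show ?thesis
  proof (rule that[of "suminf F"])
    show "(\<lambda>n. of_real (far_coeff p x n) * (\<Sum>m. c m * of_real (local_coeff p \<delta> m n))) sums suminf F"
      using summable_sums[OF summable_norm_cancel[OF tan(1)]] unfolding F_def .
    have "(\<lambda>M. (\<Sum>m<M. c m * cm m) - (\<Sum>m<M. c m * (cm m - res m))) \<longlonglongrightarrow> ray_sum p (\<lambda>\<tau>. g (of_real \<tau>)) 0 \<delta> x - suminf F"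
      by (rule tendsto_diff[OF 2 1])
    then show "(\<lambda>m. c m * of_real (2 * pi * (-1) ^ m * fact m / fact (3 * m + 2 - p) * x ^ (3 * m + 2 - p))) sums
        (ray_sum p (\<lambda>\<tau>. g (of_real \<tau>)) 0 \<delta> x - suminf F)"
      unfolding sums_def sum_subtractf[symmetric] res_def by (simp add: algebra_simps)
  qed
qed

lemma ray_sum_split:
  assumes "0 \<le> \<delta>" "\<delta> \<le> t" and x: "x > 0" and p: "p \<le> 2" and g: "C2_bounded 0 t g K"
    and g1: "C2_bounded 0 \<delta> g K1" and g2: "C2_bounded \<delta> t g K2"
  shows "ray_sum p g 0 t x = ray_sum p g 0 \<delta> x + ray_sum p g \<delta> t x"
proof -
  have gc: "continuous_on {0..t} g" by (rule C2_bounded_continuous[OF g])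
  have "Jint p g 0 t (ray_s l) (ray_z l x) = Jint p g 0 \<delta> (ray_s l) (ray_z l x) + Jint p g \<delta> t (ray_s l) (ray_z l x)" if l: "l < 4" for l
  proof -
    have "Jfun p g 0 t (ray_s l) (ray_z l x) \<rho> = Jfun p g 0 \<delta> (ray_s l) (ray_z l x) \<rho> + Jfun p g \<delta> t (ray_s l) (ray_z l x) \<rho>" for \<rho>
    proof -
      have "(\<lambda>\<tau>. exp (- (ray_s l * of_real \<rho> ^ 3 * of_real \<tau>)) * g \<tau>) integrable_on {0..t}"
        by (intro integrable_continuous_interval continuous_intros gc)
      from Henstock_Kurzweil_Integration.integral_combine[OF assms(1,2) this]
      show ?thesis unfolding Jfun_def by (simp add: distrib_left[symmetric])
    qed
    then have "Jint p g 0 t (ray_s l) (ray_z l x) = integral {0..} (\<lambda>\<rho>. Jfun p g 0 \<delta> (ray_s l) (ray_z l x) \<rho> + Jfun p g \<delta> t (ray_s l) (ray_z l x) \<rho>)"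
      unfolding Jint_def by (intro Henstock_Kurzweil_Integration.integral_cong)
    also have "\<dots> = Jint p g 0 \<delta> (ray_s l) (ray_z l x) + Jint p g \<delta> t (ray_s l) (ray_z l x)"
      unfolding Jint_def
    proof (rule Henstock_Kurzweil_Integration.integral_add)
      show "Jfun p g 0 \<delta> (ray_s l) (ray_z l x) integrable_on {0..}"
        using Jint_integrable_bound[OF order_refl assms(1) ray_s_imaginary[OF l] ray_z_halfplane[OF l x] p] g1 by metis
      show "Jfun p g \<delta> t (ray_s l) (ray_z l x) integrable_on {0..}"
        using Jint_integrable_bound[OF assms(1,2) ray_s_imaginary[OF l] ray_z_halfplane[OF l x] p] g2 by metis
    qed
    finally show ?thesis .
  qed
  then show ?thesis unfolding ray_sum_def sum.distrib[symmetric] by (intro sum.cong refl) (simp add: distrib_left)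
qed

section \<open>The regularized fractional integral\<close>

text \<open>The Taylor coefficients at 0 of the function w -> f(t - w).\<close>

definition reflected_coeff :: "(complex \<Rightarrow> complex) \<Rightarrow> real \<Rightarrow> nat \<Rightarrow> complex" where
  "reflected_coeff f t m = (-1) ^ m * (deriv ^^ m) f (of_real t) / fact m"

lemma reflected_coeff_sums:
  assumes "f holomorphic_on ball (of_real t) R" "w \<in> ball 0 R"
  shows "(\<lambda>m. reflected_coeff f t m * w ^ m) sums f (of_real t - w)"
proof -
  have "of_real t - w \<in> ball (of_real t) R" using assms(2) by (simp add: dist_norm)
  from holomorphic_power_series[OF assms(1) this]
  have "(\<lambda>m. (deriv ^^ m) f (of_real t) / fact m * (- w) ^ m) sums f (of_real t - w)" by simp
  moreover have "(deriv ^^ m) f (of_real t) / fact m * (- w) ^ m = reflected_coeff f t m * w ^ m" for m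
    unfolding reflected_coeff_def power_minus[of w] by (simp add: mult_ac)
  ultimately show ?thesis by simp
qed

lemma reflected_coeff_deriv: "reflected_coeff (deriv f) t m = - (of_nat (Suc m) * reflected_coeff f t (Suc m))"
  unfolding reflected_coeff_def funpow_Suc_right o_apply by (simp add: field_simps del: of_nat_Suc)

text \<open>Hadamard's finite part of the integral of f(t - \<tau>) \<tau>^(-n-q) over (0,
  \<delta>), by Taylor's formula; for n = 0 it is the convergent integral itself, as
  \<open>singular_integral_local\<close> shows.\<close>

definition local_series :: "real \<Rightarrow> (complex \<Rightarrow> complex) \<Rightarrow> real \<Rightarrow> nat \<Rightarrow> real \<Rightarrow> complex" where
  "local_series q f t n \<delta> = (\<Sum>m. reflected_coeff f t m * of_real (\<delta> powr (real (m + 1) - (real n + q)) / (real (m + 1) - (real n + q))))"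

text \<open>The number n + q lies strictly between the integers n and n + 1, at distances q and 1 -
  q.\<close>

lemma noninteger_gap:
  assumes q: "0 < q" "q < 1"
  shows "min q (1 - q) \<le> \<bar>real m - (real n + q)\<bar>"
proof (cases "m \<le> n")
  case True
  then have "real m \<le> real n" by simp
  then show ?thesis using q by linarith
next
  case False
  then have "real n + 1 \<le> real m" by linarith
  then show ?thesis using q by linarith
qed

lemma local_series_sums:
  assumes f: "f holomorphic_on ball (of_real t) R" and \<delta>: "0 < \<delta>" "\<delta> < R" and q: "0 < q" "q < 1"
  shows "(\<lambda>m. reflected_coeff f t m * of_real (\<delta> powr (real (m + 1) - (real n + q)) / (real (m + 1) - (real n + q)))) sums local_series q f t n \<delta>"
  unfolding local_series_def
proof (rule summable_sums, rule summable_norm_cancel, rule summable_comparison_test')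
  define \<delta>' where "\<delta>' = (\<delta> + R) / 2"
  have d': "\<delta> < \<delta>'" "\<delta>' < R" using \<delta> by (auto simp: \<delta>'_def)
  have "(of_real \<delta>' :: complex) \<in> ball 0 R" using d' \<delta> by simp
  then have "summable (\<lambda>m. reflected_coeff f t m * of_real \<delta>' ^ m)" by (rule sums_summable[OF reflected_coeff_sums[OF f]])
  then have sm: "summable (\<lambda>m. norm (reflected_coeff f t m * of_real \<delta> ^ m))"
    by (rule powser_insidea) (use d' \<delta> in simp)
  define \<kappa> where "\<kappa> = min q (1 - q)"
  have k: "\<kappa> > 0" using q by (simp add: \<kappa>_def)
  show "summable (\<lambda>m. \<delta> powr (1 - (real n + q)) / \<kappa> * norm (reflected_coeff f t m * of_real \<delta> ^ m))"
    by (intro summable_mult sm)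
  fix m
  have g: "\<kappa> \<le> \<bar>real (m + 1) - (real n + q)\<bar>" unfolding \<kappa>_def by (rule noninteger_gap[OF q])
  have pw: "\<delta> powr (real (m + 1) - (real n + q)) = \<delta> powr (1 - (real n + q)) * \<delta> ^ m"
    using \<delta>(1) by (simp add: powr_realpow[symmetric] powr_add[symmetric] algebra_simps)
  have "\<bar>\<delta> powr (real (m + 1) - (real n + q)) / (real (m + 1) - (real n + q))\<bar> = \<delta> powr (1 - (real n + q)) * \<delta> ^ m / \<bar>real (m + 1) - (real n + q)\<bar>"
    unfolding pw abs_divide using \<delta>(1) by simp
  also have "\<dots> \<le> \<delta> powr (1 - (real n + q)) * \<delta> ^ m / \<kappa>"
  proof (rule divide_left_mono[OF g])
    show "0 < \<bar>real (m + 1) - (real n + q)\<bar> * \<kappa>" using g k by (intro mult_pos_pos) linarith+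
  qed (use \<delta>(1) in simp)
  finally have "norm (reflected_coeff f t m) * \<bar>\<delta> powr (real (m + 1) - (real n + q)) / (real (m + 1) - (real n + q))\<bar>
     \<le> norm (reflected_coeff f t m) * (\<delta> powr (1 - (real n + q)) * \<delta> ^ m / \<kappa>)"
    by (intro mult_left_mono) auto
  also have "\<dots> = \<delta> powr (1 - (real n + q)) / \<kappa> * norm (reflected_coeff f t m * of_real \<delta> ^ m)"
    using \<delta>(1) by (simp add: norm_mult norm_power)
  finally show "norm (norm (reflected_coeff f t m * of_real (\<delta> powr (real (m + 1) - (real n + q)) / (real (m + 1) - (real n + q)))))
     \<le> \<delta> powr (1 - (real n + q)) / \<kappa> * norm (reflected_coeff f t m * of_real \<delta> ^ m)"
    unfolding norm_mult norm_of_real real_norm_def abs_mult by (simp only: abs_norm_cancel abs_abs)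
qed

text \<open>An explicit primitive replaces the exchange of sum and singular integral: with
  \<open>S\<close> the power series of coefficients c_m/(m+1-q), the function \<tau>^(1-q) S(\<tau>)
  has derivative f(t - \<tau>) \<tau>^(-q). It is continuous at \<tau> = 0 since q < 1, so the
  fundamental theorem with differentiability only in the interior suffices.\<close>

lemma singular_integral_local:
  assumes f: "f holomorphic_on ball (of_real t) R" and \<delta>: "0 < \<delta>" "\<delta> < R" and q: "0 < q" "q < 1"
  shows "((\<lambda>s. f (of_real s) / of_real ((t - s) powr q)) has_integral local_series q f t 0 \<delta>) {t - \<delta>..t}"
proof -
  define d where "d = (\<lambda>m. reflected_coeff f t m / of_real (real (m + 1) - q))"
  have nz: "real (m + 1) - q \<noteq> 0" for m using q by (simp add: algebra_simps)
  define S where "S = (\<lambda>w. \<Sum>m. d m * w ^ m)"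
  have dsm: "summable (\<lambda>m. d m * w ^ m)" if w: "norm w < R" for w
  proof -
    define r' where "r' = (norm w + R) / 2"
    have r': "norm w < r'" "r' < R" using w by (auto simp: r'_def)
    then have "r' > 0" using norm_ge_zero[of w] by linarith
    then have "(of_real r' :: complex) \<in> ball 0 R" using r' by simp
    then have "summable (\<lambda>m. reflected_coeff f t m * of_real r' ^ m)" by (rule sums_summable[OF reflected_coeff_sums[OF f]])
    then have sm: "summable (\<lambda>m. norm (reflected_coeff f t m * w ^ m))"
      by (rule powser_insidea) (use r' \<open>r' > 0\<close> in simp)
    show ?thesis
    proof (rule summable_norm_cancel, rule summable_comparison_test')
      show "summable (\<lambda>m. (1 / (1 - q)) * norm (reflected_coeff f t m * w ^ m))" by (intro summable_mult sm)
      fix m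
      have "norm (d m) = norm (reflected_coeff f t m) / (real (m + 1) - q)"
        unfolding d_def norm_divide norm_of_real using q by simp
      also have "\<dots> \<le> norm (reflected_coeff f t m) / (1 - q)" using q by (intro divide_left_mono) auto
      finally have "norm (d m) * norm (w ^ m) \<le> norm (reflected_coeff f t m) / (1 - q) * norm (w ^ m)" by (intro mult_right_mono) auto
      then show "norm (norm (d m * w ^ m)) \<le> (1 / (1 - q)) * norm (reflected_coeff f t m * w ^ m)" by (simp add: norm_mult)
    qed
  qed
  have S': "(S has_field_derivative (\<Sum>m. diffs d m * w ^ m)) (at w)" if "norm w < R" for w
    unfolding S_def by (rule termdiffs_strong'[OF dsm that])
  \<comment> \<open>The Euler equation (1-q) S + w S' = f(t - w), obtained coefficientwise because
    (1-q) + m cancels the denominator of \<open>d m\<close>.\<close>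
  have key: "of_real (1 - q) * S w + w * (\<Sum>m. diffs d m * w ^ m) = f (of_real t - w)" if w: "norm w < R" for w
  proof -
    define r' where "r' = (norm w + R) / 2"
    have r': "norm w < r'" "r' < R" using w by (auto simp: r'_def)
    have "summable (\<lambda>m. diffs d m * w ^ m)"
      by (rule termdiff_converges[OF r'(1)], rule dsm) (use r'(2) in linarith)
    then have "(\<lambda>m. of_nat m * d m * w ^ (m - Suc 0)) sums (\<Sum>m. diffs d m * w ^ m)" by (rule diffs_equiv)
    then have "(\<lambda>m. w * (of_nat m * d m * w ^ (m - Suc 0))) sums (w * (\<Sum>m. diffs d m * w ^ m))" by (rule sums_mult)
    moreover have "w * (of_nat m * d m * w ^ (m - Suc 0)) = of_nat m * (d m * w ^ m)" for m by (cases m) auto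
    ultimately have 1: "(\<lambda>m. of_nat m * (d m * w ^ m)) sums (w * (\<Sum>m. diffs d m * w ^ m))" by simp
    have 2: "(\<lambda>m. of_real (1 - q) * (d m * w ^ m)) sums (of_real (1 - q) * S w)"
      unfolding S_def by (intro sums_mult summable_sums dsm w)
    have "(\<lambda>m. of_real (1 - q) * (d m * w ^ m) + of_nat m * (d m * w ^ m)) sums (of_real (1 - q) * S w + w * (\<Sum>m. diffs d m * w ^ m))"
      by (rule sums_add[OF 2 1])
    moreover have "of_real (1 - q) * (d m * w ^ m) + of_nat m * (d m * w ^ m) = reflected_coeff f t m * w ^ m" for m
    proof -
      have "of_real (1 - q) * (d m * w ^ m) + of_nat m * (d m * w ^ m) = (of_real (real (m + 1) - q) * d m) * w ^ m"
        by (simp add: algebra_simps)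
      also have "of_real (real (m + 1) - q) * d m = reflected_coeff f t m"
      proof -
        have "(of_real (real (m + 1) - q) :: complex) \<noteq> 0" unfolding of_real_eq_0_iff by (rule nz)
        then show ?thesis unfolding d_def times_divide_eq_right by (rule nonzero_mult_div_cancel_left)
      qed
      finally show ?thesis .
    qed
    ultimately have "(\<lambda>m. reflected_coeff f t m * w ^ m) sums (of_real (1 - q) * S w + w * (\<Sum>m. diffs d m * w ^ m))" by simp
    moreover have "(\<lambda>m. reflected_coeff f t m * w ^ m) sums f (of_real t - w)" by (rule reflected_coeff_sums[OF f]) (use w in simp)
    ultimately show ?thesis by (rule sums_unique2)
  qed
  define H where "H = (\<lambda>s. - (of_real ((t - s) powr (1 - q)) * S (of_real (t - s))))"
  have "((\<lambda>s. f (of_real s) / of_real ((t - s) powr q)) has_integral (H t - H (t - \<delta>))) {t - \<delta>..t}"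
  proof (rule fundamental_theorem_of_calculus_interior)
    have Sc: "continuous_on (ball 0 R) S"
      by (rule continuous_at_imp_continuous_on, intro ballI, rule DERIV_isCont[OF S']) simp
    have "continuous_on {t - \<delta>..t} (\<lambda>s. S (of_real (t - s)))"
      by (rule continuous_on_compose2[OF Sc]) (use \<delta> in \<open>auto intro!: continuous_intros simp del: of_real_diff\<close>)
    moreover have "continuous_on {t - \<delta>..t} (\<lambda>s. (t - s) powr (1 - q))"
      by (rule continuous_on_powr') (use q in \<open>auto intro!: continuous_intros\<close>)
    ultimately show "continuous_on {t - \<delta>..t} H"
      unfolding H_def by (intro continuous_on_minus continuous_on_mult continuous_on_of_real)
  next
    fix s assume s: "s \<in> {t - \<delta><..<t}"
    define \<tau> where "\<tau> = t - s"
    have t0: "\<tau> > 0" "\<tau> < \<delta>" using s by (auto simp: \<tau>_def)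
    have nw: "norm (of_real \<tau> :: complex) < R" using t0 \<delta> by simp
    define D where "D = (\<Sum>m. diffs d m * of_real \<tau> ^ m)"
    have 1: "((\<lambda>s. S (of_real s)) has_vector_derivative D) (at \<tau>)"
      unfolding D_def by (rule has_vector_derivative_real_field[OF S'[OF nw]])
    have 2: "((\<lambda>s. of_real (s powr (1 - q)) :: complex) has_vector_derivative of_real ((1 - q) * \<tau> powr (- q))) (at \<tau>)"
    proof (rule has_vector_derivative_of_real)
      show "((\<lambda>s. s powr (1 - q)) has_field_derivative (1 - q) * \<tau> powr (- q)) (at \<tau>)"
        using has_real_derivative_powr[OF t0(1), of "1 - q"] by simp
    qed
    have 3: "((\<lambda>s. of_real (s powr (1 - q)) * S (of_real s)) has_vector_derivative
        of_real (\<tau> powr (1 - q)) * D + of_real ((1 - q) * \<tau> powr (- q)) * S (of_real \<tau>)) (at \<tau>)"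
      by (rule has_vector_derivative_mult[OF 2 1])
    have 4: "((\<lambda>s. t - s) has_vector_derivative (-1)) (at s)" by (auto intro!: derivative_eq_intros)
    have "((\<lambda>s. of_real ((t - s) powr (1 - q)) * S (of_real (t - s))) has_vector_derivative
       (-1) *\<^sub>R (of_real (\<tau> powr (1 - q)) * D + of_real ((1 - q) * \<tau> powr (- q)) * S (of_real \<tau>))) (at s)"
      using vector_diff_chain_at[OF 4 3[unfolded \<tau>_def]] unfolding \<tau>_def o_def .
    from has_vector_derivative_minus[OF this]
    have "(H has_vector_derivative (of_real (\<tau> powr (1 - q)) * D + of_real ((1 - q) * \<tau> powr (- q)) * S (of_real \<tau>))) (at s)"
      unfolding H_def by (simp only: scaleR_minus1_left minus_minus)
    moreover have "of_real (\<tau> powr (1 - q)) * D + of_real ((1 - q) * \<tau> powr (- q)) * S (of_real \<tau>) = f (of_real s) / of_real ((t - s) powr q)"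
    proof -
      have "\<tau> powr (1 - q) = \<tau> powr (- q) * \<tau>" using t0 by (simp add: powr_diff powr_minus field_simps)
      then have "of_real (\<tau> powr (1 - q)) * D + of_real ((1 - q) * \<tau> powr (- q)) * S (of_real \<tau>) =
         of_real (\<tau> powr (- q)) * (of_real (1 - q) * S (of_real \<tau>) + of_real \<tau> * D)"
        by (simp only: of_real_mult) (simp add: algebra_simps)
      also have "of_real (1 - q) * S (of_real \<tau>) + of_real \<tau> * D = f (of_real t - of_real \<tau>)"
        unfolding D_def by (rule key[OF nw])
      also have "of_real t - of_real \<tau> = (of_real s :: complex)" by (simp add: \<tau>_def)
      finally show ?thesis by (simp add: \<tau>_def powr_minus divide_inverse mult.commute)
    qed
    ultimately show "(H has_vector_derivative f (of_real s) / of_real ((t - s) powr q)) (at s)" by simp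
  qed (use \<delta> in simp)
  moreover have "H t - H (t - \<delta>) = local_series q f t 0 \<delta>"
  proof -
    have "(\<lambda>m. of_real (\<delta> powr (1 - q)) * (d m * of_real \<delta> ^ m)) sums (of_real (\<delta> powr (1 - q)) * S (of_real \<delta>))"
      unfolding S_def by (intro sums_mult summable_sums dsm) (use \<delta> in simp)
    moreover have "of_real (\<delta> powr (1 - q)) * (d m * of_real \<delta> ^ m) = reflected_coeff f t m * of_real (\<delta> powr (real (m + 1) - (real 0 + q)) / (real (m + 1) - (real 0 + q)))" for m
    proof -
      have e: "\<delta> powr (real (m + 1) - (real 0 + q)) = \<delta> powr (1 - q) * \<delta> ^ m"
        using \<delta>(1) by (simp add: powr_realpow[symmetric] powr_add[symmetric] algebra_simps)
      show ?thesis unfolding d_def e by simp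
    qed
    ultimately have "(\<lambda>m. reflected_coeff f t m * of_real (\<delta> powr (real (m + 1) - (real 0 + q)) / (real (m + 1) - (real 0 + q)))) sums (of_real (\<delta> powr (1 - q)) * S (of_real \<delta>))"
      by simp
    from sums_unique2[OF this local_series_sums[OF f \<delta> q, of 0]] show ?thesis by (simp add: H_def)
  qed
  ultimately show ?thesis by simp
qed

text \<open>For index 0 the finite sum is empty and only the singular integral remains; it is cut at
  t - \<delta>, and s = t - \<tau> is substituted in the regular piece.\<close>

lemma frac_bracket_0:
  assumes f: "f holomorphic_on ball (of_real t) R" and \<delta>: "0 < \<delta>" "\<delta> < R" "\<delta> \<le> t" and q: "0 < q" "q < 1"
    and fc: "continuous_on (of_real ` {0..t}) f"
  shows "frac_bracket q f 0 t = integral {\<delta>..t} (\<lambda>\<tau>. f (of_real (t - \<tau>)) * of_real (\<tau> powr (- (real 0 + q)))) + local_series q f t 0 \<delta>"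
proof -
  define h where "h = (\<lambda>\<tau>. f (of_real (t - \<tau>)) * of_real (\<tau> powr (- (real 0 + q))) :: complex)"
  have hc: "continuous_on {\<delta>..t} h"
  proof -
    have "continuous_on {\<delta>..t} (\<lambda>\<tau>. f (of_real (t - \<tau>)))"
      by (rule continuous_on_compose2[OF fc]) (use \<delta> in \<open>auto intro!: continuous_intros simp del: of_real_diff\<close>)
    then show ?thesis unfolding h_def by (intro continuous_intros) (use \<delta> in auto)
  qed
  have "((\<lambda>s. (-1) *\<^sub>R h (t - s)) has_integral (integral {t - 0..t - (t - \<delta>)} h - integral {t - (t - \<delta>)..t - 0} h)) {0..t - \<delta>}"
    by (rule has_integral_substitution_general[of "{}" 0 "t - \<delta>" "\<lambda>s. t - s" \<delta> t])
       (use \<delta> hc in \<open>auto intro!: continuous_intros derivative_eq_intros\<close>)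
  \<comment> \<open>This correction term of the orientation-free substitution rule is over
    \<open>{t..\<delta>}\<close>, which is empty, or a single point if \<delta> = t.\<close>
  moreover have "integral {t - 0..t - (t - \<delta>)} h = 0" using \<delta> by (cases "\<delta> = t") auto
  ultimately have "((\<lambda>s. - h (t - s)) has_integral - integral {\<delta>..t} h) {0..t - \<delta>}" by simp
  from has_integral_neg[OF this] have 1: "((\<lambda>s. h (t - s)) has_integral integral {\<delta>..t} h) {0..t - \<delta>}" by simp
  have "h (t - s) = f (of_real s) / of_real ((t - s) powr q)" for s
    by (simp add: h_def powr_minus divide_inverse)
  with 1 have 2: "((\<lambda>s. f (of_real s) / of_real ((t - s) powr q)) has_integral integral {\<delta>..t} h) {0..t - \<delta>}" by simp
  have "((\<lambda>s. f (of_real s) / of_real ((t - s) powr q)) has_integral (integral {\<delta>..t} h + local_series q f t 0 \<delta>)) {0..t}"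
    by (rule has_integral_combine[OF _ _ 2 singular_integral_local[OF f \<delta>(1,2) q]]) (use \<delta> in auto)
  then show ?thesis unfolding frac_bracket_def h_def[symmetric] by (simp add: integral_unique)
qed

text \<open>Splitting off m = 1 isolates f(0). In the remaining terms each derivative of
  \<open>f\<close> is one derivative lower of \<open>deriv f\<close>, so the bracket of
  \<open>deriv f\<close> at index n reappears.\<close>

lemma frac_bracket_Suc:
  assumes t: "t > 0"
  shows "frac_bracket q f (Suc n) t = of_real ((-1) ^ n * Gamma (real n + q) / Gamma q * t powr (- (real n + q))) * f 0 + frac_bracket q (deriv f) n t"
proof -
  let ?F = "\<lambda>m. of_real ((- 1) ^ (Suc n - m) * Gamma (real (Suc n - m) + q) / (t powr (real (Suc n - m) + q) * Gamma q)) * (deriv ^^ (m - 1)) f 0"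
  have "(\<Sum>m = 1..Suc n. ?F m) = ?F 1 + (\<Sum>m = Suc 1..Suc n. ?F m)"
    by (rule sum.atLeast_Suc_atMost) simp
  also have "(\<Sum>m = Suc 1..Suc n. ?F m) = (\<Sum>m = 1..n. ?F (Suc m))"
    by (rule sum.shift_bounds_cl_Suc_ivl)
  also have "\<dots> = (\<Sum>m = 1..n. of_real ((- 1) ^ (n - m) * Gamma (real (n - m) + q) / (t powr (real (n - m) + q) * Gamma q)) * (deriv ^^ (m - 1)) (deriv f) 0)"
  proof (rule sum.cong[OF refl])
    fix m assume "m \<in> {1..n}"
    then obtain k where "m = Suc k" by (cases m) auto
    then show "?F (Suc m) = of_real ((- 1) ^ (n - m) * Gamma (real (n - m) + q) / (t powr (real (n - m) + q) * Gamma q)) * (deriv ^^ (m - 1)) (deriv f) 0"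
      by (simp add: funpow_Suc_right del: funpow.simps)
  qed
  also have "?F 1 = of_real ((-1) ^ n * Gamma (real n + q) / Gamma q * t powr (- (real n + q))) * f 0"
    unfolding diff_Suc_1 powr_minus by (simp add: divide_inverse mult_ac)
  finally show ?thesis
    unfolding frac_bracket_def by (simp add: funpow_Suc_right del: funpow.simps)
qed

text \<open>Induction on n for all \<open>f\<close> at once, since the step passes to
  \<open>deriv f\<close>. Integrating by parts over \<open>{\<delta>..t}\<close> produces a boundary
  term at t that cancels the f(0) term of \<open>frac_bracket_Suc\<close>, and one at \<delta> that
  \<open>local_series\<close> absorbs. The factors -(n+q) accumulate to the sign and the Gamma
  quotient.\<close>

lemma frac_bracket_regularized:
  assumes S: "open S" and f: "f holomorphic_on S" and B: "ball (of_real t) R \<subseteq> S" "of_real ` {0..t} \<subseteq> S"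
    and \<delta>: "0 < \<delta>" "\<delta> < R" "\<delta> \<le> t" and q: "0 < q" "q < 1"
  shows "frac_bracket q f n t = of_real ((-1) ^ n * Gamma (real n + q) / Gamma q) *
     (integral {\<delta>..t} (\<lambda>\<tau>. f (of_real (t - \<tau>)) * of_real (\<tau> powr (- (real n + q)))) + local_series q f t n \<delta>)"
  using f
proof (induction n arbitrary: f)
  case 0
  have "Gamma q \<noteq> 0" using q by (simp add: Gamma_real_pos less_imp_neq[symmetric])
  then show ?case
    using frac_bracket_0[OF holomorphic_on_subset[OF 0 B(1)] \<delta> q continuous_on_subset[OF holomorphic_on_imp_continuous_on[OF 0] B(2)]] by simp
next
  case (Suc n)
  note f = Suc.prems
  have f': "deriv f holomorphic_on S" by (rule holomorphic_deriv[OF f S])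
  have fB: "f holomorphic_on ball (of_real t) R" "deriv f holomorphic_on ball (of_real t) R"
    by (rule holomorphic_on_subset[OF f B(1)], rule holomorphic_on_subset[OF f' B(1)])
  have t: "t > 0" using \<delta> by simp
  define a where "a = real n + q"
  have a: "a > 0" using q by (simp add: a_def add_nonneg_pos)
  define C where "C = (-1) ^ n * Gamma (real n + q) / Gamma q"
  have C': "(-1) ^ Suc n * Gamma (real (Suc n) + q) / Gamma q = - a * C"
  proof -
    have G: "Gamma (a + 1) = a * Gamma a" by (rule Gamma_plus1) (use a in \<open>auto elim!: nonpos_Ints_cases\<close>)
    have r: "real (Suc n) + q = a + 1" by (simp add: a_def)
    show ?thesis unfolding r C_def a_def[symmetric] G by simp
  qed
  define I :: "nat \<Rightarrow> (complex \<Rightarrow> complex) \<Rightarrow> complex" where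
    "I = (\<lambda>n f. integral {\<delta>..t} (\<lambda>\<tau>. f (of_real (t - \<tau>)) * of_real (\<tau> powr (- (real n + q)))))"
  have inS: "of_real (t - \<tau>) \<in> S" if "\<tau> \<in> {\<delta>..t}" for \<tau>
  proof -
    have "t - \<tau> \<in> {0..t}" using that \<delta> by auto
    then show ?thesis using B(2) by blast
  qed
  have fc: "continuous_on {\<delta>..t} (\<lambda>\<tau>. f (of_real (t - \<tau>)))"
    by (rule continuous_on_compose2[OF holomorphic_on_imp_continuous_on[OF f]]) (use inS in \<open>auto intro!: continuous_intros simp del: of_real_diff\<close>)
  have fc': "continuous_on {\<delta>..t} (\<lambda>\<tau>. deriv f (of_real (t - \<tau>)))"
    by (rule continuous_on_compose2[OF holomorphic_on_imp_continuous_on[OF f']]) (use inS in \<open>auto intro!: continuous_intros simp del: of_real_diff\<close>)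
  have parts: "I n (deriv f) = f (of_real (t - \<delta>)) * of_real (\<delta> powr (- a)) - f 0 * of_real (t powr (- a)) - of_real a * I (Suc n) f"
  proof -
    have d: "((\<lambda>\<tau>. f (of_real (t - \<tau>)) * of_real (\<tau> powr (- a))) has_vector_derivative
        f (of_real (t - \<tau>)) * of_real (- a * \<tau> powr (- a - 1)) + - deriv f (of_real (t - \<tau>)) * of_real (\<tau> powr (- a))) (at \<tau> within {\<delta>..t})"
      if \<tau>: "\<tau> \<in> {\<delta>..t}" for \<tau>
    proof (rule has_vector_derivative_mult)
      have 1: "((\<lambda>w. f (of_real t - w)) has_field_derivative (deriv f (of_real t - of_real \<tau>) * (0 - 1))) (at (of_real \<tau>))"
        by (rule DERIV_chain2[where f = f, OF holomorphic_derivI[OF f S]])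
           (use inS[OF \<tau>] in \<open>auto intro!: derivative_eq_intros\<close>)
      from has_vector_derivative_real_field[OF this]
      show "((\<lambda>\<tau>. f (of_real (t - \<tau>))) has_vector_derivative - deriv f (of_real (t - \<tau>))) (at \<tau> within {\<delta>..t})" by simp
      have "((\<lambda>\<tau>. \<tau> powr (- a)) has_field_derivative (- a * \<tau> powr (- a - 1))) (at \<tau> within {\<delta>..t})"
        using \<tau> \<delta> by (intro has_real_derivative_powr has_field_derivative_at_within) auto
      then show "((\<lambda>\<tau>. of_real (\<tau> powr (- a)) :: complex) has_vector_derivative of_real (- a * \<tau> powr (- a - 1))) (at \<tau> within {\<delta>..t})"
        by (rule has_vector_derivative_of_real)
    qed
    have "((\<lambda>\<tau>. f (of_real (t - \<tau>)) * of_real (- a * \<tau> powr (- a - 1)) + - deriv f (of_real (t - \<tau>)) * of_real (\<tau> powr (- a))) has_integral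
       (f (of_real (t - t)) * of_real (t powr (- a)) - f (of_real (t - \<delta>)) * of_real (\<delta> powr (- a)))) {\<delta>..t}"
      by (rule fundamental_theorem_of_calculus[OF \<delta>(3) d])
    moreover have "((\<lambda>\<tau>. (- of_real a) * (f (of_real (t - \<tau>)) * of_real (\<tau> powr (- (real (Suc n) + q)))) - deriv f (of_real (t - \<tau>)) * of_real (\<tau> powr (- (real n + q)))) has_integral
       ((- of_real a) * I (Suc n) f - I n (deriv f))) {\<delta>..t}"
      unfolding I_def
      by (intro has_integral_diff has_integral_mult_right integrable_integral integrable_continuous_interval continuous_intros fc fc') (use \<delta> in auto)
    moreover have "(- of_real a) * (f (of_real (t - \<tau>)) * of_real (\<tau> powr (- (real (Suc n) + q)))) - deriv f (of_real (t - \<tau>)) * of_real (\<tau> powr (- (real n + q)))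
      = f (of_real (t - \<tau>)) * of_real (- a * \<tau> powr (- a - 1)) + - deriv f (of_real (t - \<tau>)) * of_real (\<tau> powr (- a))" for \<tau>
    proof -
      have "- (real (Suc n) + q) = - a - 1" by (simp add: a_def)
      then show ?thesis unfolding a_def[symmetric] by (simp only: of_real_mult of_real_minus) (simp add: algebra_simps)
    qed
    ultimately have "f (of_real (t - t)) * of_real (t powr (- a)) - f (of_real (t - \<delta>)) * of_real (\<delta> powr (- a)) = (- of_real a) * I (Suc n) f - I n (deriv f)"
      by (simp only:) (rule has_integral_unique)
    then show ?thesis by (simp add: algebra_simps)
  qed
  \<comment> \<open>The same integration by parts for finite parts, verified coefficientwise: 1 -
    m/(m-a) = -a/(m-a).\<close>
  have ser: "f (of_real (t - \<delta>)) * of_real (\<delta> powr (- a)) + local_series q (deriv f) t n \<delta> = - of_real a * local_series q f t (Suc n) \<delta>"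
  proof -
    have "(of_real \<delta> :: complex) \<in> ball 0 R" using \<delta> by simp
    from reflected_coeff_sums[OF fB(1) this]
    have 1: "(\<lambda>m. reflected_coeff f t m * of_real \<delta> ^ m * of_real (\<delta> powr (- a))) sums (f (of_real (t - \<delta>)) * of_real (\<delta> powr (- a)))"
      by (intro sums_mult2) simp
    \<comment> \<open>Its term at m = 0 vanishes through the factor m, so shifting the index of the
      series for \<open>deriv f\<close> changes nothing.\<close>
    define u where "u = (\<lambda>m. - (of_nat m * reflected_coeff f t m) * of_real (\<delta> powr (real m - a) / (real m - a)) :: complex)"
    have "(\<lambda>m. u (Suc m)) sums local_series q (deriv f) t n \<delta>"
      using local_series_sums[OF fB(2) \<delta>(1,2) q, of n] unfolding u_def reflected_coeff_deriv a_def Suc_eq_plus1 .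
    then have 2: "u sums local_series q (deriv f) t n \<delta>" by (subst (asm) sums_Suc_iff) (simp add: u_def)
    have 3: "(\<lambda>m. - of_real a * (reflected_coeff f t m * of_real (\<delta> powr (real (m + 1) - (real (Suc n) + q)) / (real (m + 1) - (real (Suc n) + q))))) sums (- of_real a * local_series q f t (Suc n) \<delta>)"
      by (intro sums_mult local_series_sums[OF fB(1) \<delta>(1,2) q])
    have "reflected_coeff f t m * of_real \<delta> ^ m * of_real (\<delta> powr (- a)) + u m = - of_real a * (reflected_coeff f t m * of_real (\<delta> powr (real (m + 1) - (real (Suc n) + q)) / (real (m + 1) - (real (Suc n) + q))))" for m
    proof -
      have "min q (1 - q) \<le> \<bar>real m - a\<bar>" unfolding a_def by (rule noninteger_gap[OF q])
      then have nz: "real m - a \<noteq> 0" using q by auto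
      have e: "real (m + 1) - (real (Suc n) + q) = real m - a" by (simp add: a_def)
      have pw: "of_real \<delta> ^ m * of_real (\<delta> powr (- a)) = (of_real (\<delta> powr (real m - a)) :: complex)"
      proof -
        have "\<delta> powr (real m - a) = \<delta> ^ m * \<delta> powr (- a)"
          using \<delta>(1) by (simp add: powr_realpow[symmetric] powr_add[symmetric])
        then show ?thesis by simp
      qed
      have "reflected_coeff f t m * of_real \<delta> ^ m * of_real (\<delta> powr (- a)) + u m = reflected_coeff f t m * of_real (\<delta> powr (real m - a) - real m * (\<delta> powr (real m - a) / (real m - a)))"
        unfolding mult.assoc pw u_def by (simp add: algebra_simps)
      also have "\<delta> powr (real m - a) - real m * (\<delta> powr (real m - a) / (real m - a)) = - a * (\<delta> powr (real m - a) / (real m - a))"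
        using nz by (simp add: field_simps)
      finally show ?thesis unfolding e of_real_mult of_real_minus by (simp only: mult.left_commute)
    qed
    with sums_add[OF 1 2] 3 show ?thesis by (simp add: sums_unique2)
  qed
  have "frac_bracket q f (Suc n) t = of_real (C * t powr (- a)) * f 0 + of_real C * (I n (deriv f) + local_series q (deriv f) t n \<delta>)"
    unfolding frac_bracket_Suc[OF t] Suc.IH[OF f'] C_def I_def a_def ..
  also have "\<dots> = of_real C * ((f (of_real (t - \<delta>)) * of_real (\<delta> powr (- a)) + local_series q (deriv f) t n \<delta>) - of_real a * I (Suc n) f)"
    unfolding parts by (simp add: algebra_simps)
  also have "\<dots> = of_real (- a * C) * (I (Suc n) f + local_series q f t (Suc n) \<delta>)"
    unfolding ser by (simp add: algebra_simps)
  finally show ?case unfolding C' I_def .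
qed

section \<open>Derivatives of the fractional integral\<close>

text \<open>The substitution \<open>s = t (1 - v\<^sup>3)\<close> turns \<open>\<integral>\<^sub>0\<^sup>t f(s) (t - s)\<^sup>-\<^sup>q ds\<close>, \<open>q = p/3\<close>, into a regular integral
  that makes sense for complex \<open>t\<close>.\<close>

definition frac_integral :: "nat \<Rightarrow> (complex \<Rightarrow> complex) \<Rightarrow> complex \<Rightarrow> complex" where
  "frac_integral p f t = 3 * exp (of_real (1 - real p / 3) * Ln t) *
     integral {0..1} (\<lambda>v. f (t * of_real (1 - v ^ 3)) * of_real (v ^ (2 - p)))"

text \<open>Differentiation produces the moment \<open>M\<close>, from the power of t, and the
  moments \<open>X\<close>, \<open>Y\<close> of \<open>deriv f\<close>. Integration by parts in v
  trades (3-p) M for f(0) + 3tX, which cancels \<open>X\<close> and leaves an integral of the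
  original form together with f(0) t^(-p/3).\<close>

lemma frac_integral_has_field_derivative:
  assumes S: "open S" "f holomorphic_on S" and \<Omega>: "open \<Omega>" "\<And>t. t \<in> \<Omega> \<Longrightarrow> Re t > 0"
    and sub: "\<And>t u. t \<in> \<Omega> \<Longrightarrow> u \<in> {0..1} \<Longrightarrow> t * of_real u \<in> S" and p: "p \<in> {1, 2}" and t: "t \<in> \<Omega>"
  shows "(frac_integral p f has_field_derivative f 0 * exp (- (of_real (real p / 3) * Ln t)) + frac_integral p (deriv f) t) (at t)"
proof -
  obtain r where r: "r > 0" "ball t r \<subseteq> \<Omega>" using \<Omega>(1) t openE by blast
  have u01: "1 - v ^ 3 \<in> {0..1}" if "v \<in> {0..1}" for v :: real
    using that by (auto simp: power_le_one)
  have inS: "w * of_real (1 - v ^ 3) \<in> S" if "w \<in> \<Omega>" "v \<in> {0..1}" for w v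
    by (rule sub[OF that(1) u01[OF that(2)]])
  have f': "deriv f holomorphic_on S" by (rule holomorphic_deriv[OF S(2,1)])
  have fd: "((\<lambda>w. f (w * of_real (1 - v ^ 3))) has_field_derivative deriv f (w * of_real (1 - v ^ 3)) * of_real (1 - v ^ 3)) (at w)"
    if "w \<in> \<Omega>" "v \<in> {0..1}" for w v
  proof (rule DERIV_chain2[where f = f and g = "\<lambda>w. w * of_real (1 - v ^ 3)", OF holomorphic_derivI[OF S(2,1) inS[OF that]]])
    have "((\<lambda>w. w * of_real (1 - v ^ 3)) has_field_derivative 1 * of_real (1 - v ^ 3)) (at w)"
      by (rule DERIV_cmult_right[OF DERIV_ident])
    then show "((\<lambda>w. w * of_real (1 - v ^ 3)) has_field_derivative of_real (1 - v ^ 3)) (at w)"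
      by (simp only: mult_1_left)
  qed
  have cont: "continuous_on (ball t r \<times> {0..1}) (\<lambda>x. g (fst x * of_real (1 - snd x ^ 3)))" if "g holomorphic_on S" for g
    by (rule continuous_on_compose2[OF holomorphic_on_imp_continuous_on[OF that]])
       (use r inS in \<open>auto intro!: continuous_intros simp del: of_real_diff of_real_power\<close>)
  have cont1: "continuous_on {0..1} (\<lambda>v. g (w * of_real (1 - v ^ 3)))" if "g holomorphic_on S" "w \<in> \<Omega>" for g w
    by (rule continuous_on_compose2[OF holomorphic_on_imp_continuous_on[OF that(1)]])
       (use that(2) inS in \<open>auto intro!: continuous_intros simp del: of_real_diff of_real_power\<close>)
  define M where "M = (\<lambda>w. integral {0..1} (\<lambda>v. f (w * of_real (1 - v ^ 3)) * of_real (v ^ (2 - p))))"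
  define X where "X = integral {0..1} (\<lambda>v. deriv f (t * of_real (1 - v ^ 3)) * of_real (v ^ (2 - p)) * of_real (v ^ 3))"
  define Y where "Y = integral {0..1} (\<lambda>v. deriv f (t * of_real (1 - v ^ 3)) * of_real (v ^ (2 - p)))"
  have M': "(M has_field_derivative integral {0..1} (\<lambda>v. deriv f (t * of_real (1 - v ^ 3)) * of_real (1 - v ^ 3) * of_real (v ^ (2 - p)))) (at t)"
  proof -
    have "((\<lambda>w. integral (cbox 0 1) (\<lambda>v. f (w * of_real (1 - v ^ 3)) * of_real (v ^ (2 - p)))) has_field_derivative
      integral (cbox 0 1) (\<lambda>v. deriv f (t * of_real (1 - v ^ 3)) * of_real (1 - v ^ 3) * of_real (v ^ (2 - p)))) (at t within ball t r)"
    proof (rule leibniz_rule_field_derivative)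
      fix w and v :: real assume w: "w \<in> ball t r" and v: "v \<in> cbox 0 1"
      have "w \<in> \<Omega>" "v \<in> {0..1}" using w v r by auto
      from DERIV_cmult_right[OF fd[OF this]]
      show "((\<lambda>w. f (w * of_real (1 - v ^ 3)) * of_real (v ^ (2 - p))) has_field_derivative
         deriv f (w * of_real (1 - v ^ 3)) * of_real (1 - v ^ 3) * of_real (v ^ (2 - p))) (at w within ball t r)"
        by (rule has_field_derivative_at_within)
    next
      fix w assume "w \<in> ball t r"
      then have "w \<in> \<Omega>" using r by auto
      then show "(\<lambda>v. f (w * of_real (1 - v ^ 3)) * of_real (v ^ (2 - p))) integrable_on cbox 0 1"
        by (intro integrable_continuous continuous_on_mult) (auto intro!: cont1[OF S(2), simplified] continuous_intros)
    next
      show "continuous_on (ball t r \<times> cbox 0 1) (\<lambda>(w, v). deriv f (w * of_real (1 - v ^ 3)) * of_real (1 - v ^ 3) * of_real (v ^ (2 - p)))"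
        unfolding case_prod_unfold box_real(2) by (intro continuous_on_mult cont[OF f'] continuous_intros)
    qed (use r in auto)
    then show ?thesis unfolding M_def using r by (simp add: at_within_open[OF _ open_ball])
  qed
  have XY: "integral {0..1} (\<lambda>v. deriv f (t * of_real (1 - v ^ 3)) * of_real (1 - v ^ 3) * of_real (v ^ (2 - p))) = Y - X"
  proof -
    have "integral {0..1} (\<lambda>v. deriv f (t * of_real (1 - v ^ 3)) * of_real (1 - v ^ 3) * of_real (v ^ (2 - p))) =
      integral {0..1} (\<lambda>v. deriv f (t * of_real (1 - v ^ 3)) * of_real (v ^ (2 - p)) - deriv f (t * of_real (1 - v ^ 3)) * of_real (v ^ (2 - p)) * of_real (v ^ 3))"
    proof (rule Henstock_Kurzweil_Integration.integral_cong)
      fix v :: real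
      have "A * of_real (1 - v ^ 3) * B = A * B - A * B * of_real (v ^ 3)" for A B :: complex by (simp add: algebra_simps)
      then show "deriv f (t * of_real (1 - v ^ 3)) * of_real (1 - v ^ 3) * of_real (v ^ (2 - p)) =
        deriv f (t * of_real (1 - v ^ 3)) * of_real (v ^ (2 - p)) - deriv f (t * of_real (1 - v ^ 3)) * of_real (v ^ (2 - p)) * of_real (v ^ 3)" .
    qed
    also have "\<dots> = Y - X"
      unfolding X_def Y_def
      by (intro Henstock_Kurzweil_Integration.integral_diff integrable_continuous_interval continuous_on_mult cont1[OF f' t] continuous_intros)
    finally show ?thesis .
  qed
  \<comment> \<open>The function differentiated in v is f(t(1 - v^3)) v^(3-p): it vanishes at v = 0,
    because 3 - p > 0, and equals f(0) at v = 1.\<close>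
  have parts: "of_nat (3 - p) * M t = f 0 + 3 * t * X"
  proof -
    have p3: "3 - p - Suc 0 = 2 - p" using p by auto
    have "((\<lambda>v. f (t * of_real (1 - v ^ 3)) * of_real (real (3 - p) * v ^ (2 - p)) + deriv f (t * of_real (1 - v ^ 3)) * (- (3 * t * of_real (v ^ 2))) * of_real (v ^ (3 - p))) has_integral
      (f (t * of_real (1 - 1 ^ 3)) * of_real (1 ^ (3 - p)) - f (t * of_real (1 - 0 ^ 3)) * of_real (0 ^ (3 - p)))) {0..1}"
    proof (rule fundamental_theorem_of_calculus)
      fix v :: real assume v: "v \<in> {0..1}"
      have 1: "((\<lambda>w. f (t * (1 - w ^ 3))) has_field_derivative deriv f (t * (1 - of_real v ^ 3)) * (- (3 * t * of_real v ^ 2))) (at (of_real v))"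
        by (rule DERIV_chain2[where f = f, OF holomorphic_derivI[OF S(2,1)]])
           (use inS[OF t v] in \<open>auto intro!: derivative_eq_intros\<close>)
      from has_vector_derivative_real_field[OF this]
      have "((\<lambda>v. f (t * of_real (1 - v ^ 3))) has_vector_derivative deriv f (t * of_real (1 - v ^ 3)) * (- (3 * t * of_real (v ^ 2)))) (at v within {0..1})"
        by simp
      moreover have "((\<lambda>v. of_real (v ^ (3 - p)) :: complex) has_vector_derivative of_real (real (3 - p) * v ^ (2 - p))) (at v within {0..1})"
        by (rule has_vector_derivative_of_real) (use DERIV_pow[of "3 - p" v "{0..1}"] p3 in simp)
      ultimately show "((\<lambda>v. f (t * of_real (1 - v ^ 3)) * of_real (v ^ (3 - p))) has_vector_derivative
        f (t * of_real (1 - v ^ 3)) * of_real (real (3 - p) * v ^ (2 - p)) + deriv f (t * of_real (1 - v ^ 3)) * (- (3 * t * of_real (v ^ 2))) * of_real (v ^ (3 - p))) (at v within {0..1})"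
        by (rule has_vector_derivative_mult)
    qed simp
    moreover have "f (t * of_real (1 - 1 ^ 3)) * of_real (1 ^ (3 - p)) - f (t * of_real (1 - 0 ^ 3)) * of_real (0 ^ (3 - p)) = f 0"
      using p by auto
    moreover have "f (t * of_real (1 - v ^ 3)) * of_real (real (3 - p) * v ^ (2 - p)) + deriv f (t * of_real (1 - v ^ 3)) * (- (3 * t * of_real (v ^ 2))) * of_real (v ^ (3 - p))
      = of_nat (3 - p) * (f (t * of_real (1 - v ^ 3)) * of_real (v ^ (2 - p))) - 3 * t * (deriv f (t * of_real (1 - v ^ 3)) * of_real (v ^ (2 - p)) * of_real (v ^ 3))" for v
    proof -
      have v3: "(of_real (v ^ 2) :: complex) * of_real (v ^ (3 - p)) = of_real (v ^ (2 - p)) * of_real (v ^ 3)"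
      proof -
        have "2 + (3 - p) = (2 - p) + 3" using p by auto
        then have "v ^ 2 * v ^ (3 - p) = v ^ (2 - p) * v ^ 3" by (simp only: power_add[symmetric])
        then show ?thesis by (simp only: of_real_mult[symmetric])
      qed
      have "F * of_real (real (3 - p) * v ^ (2 - p)) + D * (- (3 * t * of_real (v ^ 2))) * of_real (v ^ (3 - p)) =
         of_nat (3 - p) * (F * of_real (v ^ (2 - p))) - 3 * t * (D * (of_real (v ^ 2) * of_real (v ^ (3 - p))))" for F D
        by (simp only: of_real_mult of_real_of_nat_eq) (simp add: algebra_simps del: of_real_power of_nat_diff)
      then show ?thesis unfolding v3 by (simp only: mult.assoc)
    qed
    ultimately have 1: "((\<lambda>v. of_nat (3 - p) * (f (t * of_real (1 - v ^ 3)) * of_real (v ^ (2 - p))) - 3 * t * (deriv f (t * of_real (1 - v ^ 3)) * of_real (v ^ (2 - p)) * of_real (v ^ 3))) has_integral f 0) {0..1}"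
      by (simp only:)
    have 2: "((\<lambda>v. of_nat (3 - p) * (f (t * of_real (1 - v ^ 3)) * of_real (v ^ (2 - p))) - 3 * t * (deriv f (t * of_real (1 - v ^ 3)) * of_real (v ^ (2 - p)) * of_real (v ^ 3))) has_integral
       (of_nat (3 - p) * M t - 3 * t * X)) {0..1}"
      unfolding M_def X_def
      by (intro has_integral_diff has_integral_mult_right integrable_integral integrable_continuous_interval continuous_on_mult cont1[OF f' t] cont1[OF S(2) t] continuous_intros)
    from has_integral_unique[OF 1 2] show ?thesis by (simp add: algebra_simps)
  qed
  have t0: "Re t > 0" "t \<noteq> 0" "t \<notin> \<real>\<^sub>\<le>\<^sub>0" using \<Omega>(2)[OF t] by (auto simp: complex_nonpos_Reals_iff)
  define E where "E = exp (of_real (1 - real p / 3) * Ln t)"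
  have E': "((\<lambda>t. 3 * exp (of_real (1 - real p / 3) * Ln t)) has_field_derivative of_nat (3 - p) * E / t) (at t)"
  proof -
    have c: "(of_nat (3 - p) :: complex) = 3 * of_real (1 - real p / 3)" using p by auto
    show ?thesis unfolding E_def c using t0 by (auto intro!: derivative_eq_intros simp: field_simps)
  qed
  have "(frac_integral p f has_field_derivative of_nat (3 - p) * E / t * M t + (Y - X) * (3 * E)) (at t)"
  proof -
    have G: "frac_integral p f = (\<lambda>t. 3 * exp (of_real (1 - real p / 3) * Ln t) * M t)"
      by (rule ext) (simp only: frac_integral_def M_def)
    show ?thesis unfolding G using DERIV_mult[OF E' M'] unfolding XY E_def[symmetric] .
  qed
  also have "of_nat (3 - p) * E / t * M t + (Y - X) * (3 * E) = E / t * (of_nat (3 - p) * M t) + (Y - X) * (3 * E)" by simp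
  also have "\<dots> = f 0 * (E / t) + 3 * E * Y" unfolding parts using t0 by (simp add: field_simps)
  also have "E / t = exp (- (of_real (real p / 3) * Ln t))"
  proof -
    have "E / t = exp (of_real (1 - real p / 3) * Ln t) / exp (Ln t)" using t0 by (simp add: E_def)
    also have "\<dots> = exp (- (of_real (real p / 3) * Ln t))"
      unfolding exp_diff[symmetric] by (rule arg_cong[of _ _ exp]) (simp add: algebra_simps)
    finally show ?thesis .
  qed
  also have "3 * E * Y = frac_integral p (deriv f) t" unfolding frac_integral_def E_def Y_def ..
  finally show ?thesis .
qed

text \<open>\<open>frac_bracket\<close> for complex t, with powers of t written through
  \<open>Ln\<close> and the singular integral through \<open>frac_integral\<close>, so that it can
  be differentiated.\<close>

definition frac_integral_deriv :: "nat \<Rightarrow> (complex \<Rightarrow> complex) \<Rightarrow> nat \<Rightarrow> complex \<Rightarrow> complex" where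
  "frac_integral_deriv p f n t = (\<Sum>m = 1..n. of_real ((-1) ^ (n - m) * Gamma (real (n - m) + real p / 3) / Gamma (real p / 3)) *
       exp (- (of_real (real (n - m) + real p / 3) * Ln t)) * (deriv ^^ (m - 1)) f 0) + frac_integral p ((deriv ^^ n) f) t"

text \<open>Differentiating c_k t^(-k-q) gives c_(k+1) t^(-k-1-q), since the Gamma quotient
  satisfies c_(k+1) = -(k+q) c_k. The boundary term released by \<open>frac_integral\<close>
  supplies the new summand m = n + 1, whose constant is c_0 = 1.\<close>

lemma frac_integral_deriv_has_field_derivative:
  assumes S: "open S" "f holomorphic_on S" and \<Omega>: "open \<Omega>" "\<And>t. t \<in> \<Omega> \<Longrightarrow> Re t > 0"
    and sub: "\<And>t u. t \<in> \<Omega> \<Longrightarrow> u \<in> {0..1} \<Longrightarrow> t * of_real u \<in> S" and p: "p \<in> {1, 2}" and t: "t \<in> \<Omega>"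
  shows "(frac_integral_deriv p f n has_field_derivative frac_integral_deriv p f (Suc n) t) (at t)"
proof -
  define q where "q = real p / 3"
  have q: "q > 0" using p by (auto simp: q_def)
  have t0: "Re t > 0" "t \<noteq> 0" "t \<notin> \<real>\<^sub>\<le>\<^sub>0" using \<Omega>(2)[OF t] by (auto simp: complex_nonpos_Reals_iff)
  have hn: "(deriv ^^ n) f holomorphic_on S" by (rule holomorphic_higher_deriv[OF S(2,1)])
  define c where "c = (\<lambda>k. (-1) ^ k * Gamma (real k + q) / Gamma q)"
  have Gq: "Gamma q \<noteq> 0" using Gamma_real_pos[OF q] by simp
  have c0: "c 0 = 1" using Gq by (simp add: c_def)
  have cS: "c (Suc k) = - (real k + q) * c k" for k
  proof -
    define K where "K = real k + q"
    have K: "K > 0" using q by (simp add: K_def add_nonneg_pos)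
    have G: "Gamma (K + 1) = K * Gamma K" by (rule Gamma_plus1) (use K in \<open>auto elim!: nonpos_Ints_cases\<close>)
    have r: "real (Suc k) + q = K + 1" by (simp add: K_def)
    show ?thesis unfolding c_def r K_def[symmetric] G by simp
  qed
  define e where "e = (\<lambda>k t. exp (- (of_real (real k + q) * Ln t)))"
  have e': "(e k has_field_derivative of_real (- (real k + q)) * e (Suc k) t) (at t)" for k
  proof -
    define K where "K = real k + q"
    have "(e k has_field_derivative e k t * (- (of_real K * (1 / t)))) (at t)"
      unfolding e_def K_def[symmetric] using t0 by (auto intro!: derivative_eq_intros simp: field_simps)
    moreover have "e (Suc k) t = e k t / t"
    proof -
      have "e k t / t = exp (- (of_real (real k + q) * Ln t)) / exp (Ln t)" using t0 by (simp add: e_def)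
      also have "\<dots> = e (Suc k) t" unfolding e_def exp_diff[symmetric] by (rule arg_cong[of _ _ exp]) (simp add: algebra_simps)
      finally show ?thesis by simp
    qed
    ultimately show ?thesis unfolding K_def[symmetric] by (simp add: mult.commute)
  qed
  have trm: "((\<lambda>t. of_real (c k) * e k t * a) has_field_derivative of_real (c (Suc k)) * e (Suc k) t * a) (at t)" for k a
  proof -
    have "((\<lambda>t. of_real (c k) * e k t * a) has_field_derivative of_real (c k) * (of_real (- (real k + q)) * e (Suc k) t) * a) (at t)"
      by (intro DERIV_cmult_right DERIV_cmult e')
    then show ?thesis unfolding cS of_real_mult by (simp only: mult_ac)
  qed
  have "((\<lambda>t. (\<Sum>m = 1..n. of_real (c (n - m)) * e (n - m) t * (deriv ^^ (m - 1)) f 0) + frac_integral p ((deriv ^^ n) f) t) has_field_derivative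
     (\<Sum>m = 1..n. of_real (c (Suc (n - m))) * e (Suc (n - m)) t * (deriv ^^ (m - 1)) f 0)
      + ((deriv ^^ n) f 0 * exp (- (of_real (real p / 3) * Ln t)) + frac_integral p (deriv ((deriv ^^ n) f)) t)) (at t)"
    by (intro DERIV_add DERIV_sum trm frac_integral_has_field_derivative[OF S(1) hn \<Omega> sub p t])
  moreover have "(\<Sum>m = 1..n. of_real (c (Suc (n - m))) * e (Suc (n - m)) t * (deriv ^^ (m - 1)) f 0)
      + ((deriv ^^ n) f 0 * exp (- (of_real (real p / 3) * Ln t)) + frac_integral p (deriv ((deriv ^^ n) f)) t) = frac_integral_deriv p f (Suc n) t"
  proof -
    have "(\<Sum>m = 1..Suc n. of_real (c (Suc n - m)) * e (Suc n - m) t * (deriv ^^ (m - 1)) f 0) =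
      (\<Sum>m = 1..n. of_real (c (Suc n - m)) * e (Suc n - m) t * (deriv ^^ (m - 1)) f 0) + of_real (c 0) * e 0 t * (deriv ^^ n) f 0"
      by simp
    also have "(\<Sum>m = 1..n. of_real (c (Suc n - m)) * e (Suc n - m) t * (deriv ^^ (m - 1)) f 0) =
       (\<Sum>m = 1..n. of_real (c (Suc (n - m))) * e (Suc (n - m)) t * (deriv ^^ (m - 1)) f 0)"
      by (intro sum.cong refl) (simp add: Suc_diff_le)
    finally have 1: "(\<Sum>m = 1..Suc n. of_real (c (Suc n - m)) * e (Suc n - m) t * (deriv ^^ (m - 1)) f 0) =
        (\<Sum>m = 1..n. of_real (c (Suc (n - m))) * e (Suc (n - m)) t * (deriv ^^ (m - 1)) f 0)
        + (deriv ^^ n) f 0 * exp (- (of_real (real p / 3) * Ln t))"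
      unfolding c0 by (simp add: e_def q_def)
    have "frac_integral_deriv p f (Suc n) t = (\<Sum>m = 1..Suc n. of_real (c (Suc n - m)) * e (Suc n - m) t * (deriv ^^ (m - 1)) f 0)
        + frac_integral p (deriv ((deriv ^^ n) f)) t"
      unfolding frac_integral_deriv_def c_def e_def q_def funpow.simps o_apply ..
    then show ?thesis unfolding 1 by simp
  qed
  moreover have "frac_integral_deriv p f n = (\<lambda>t. (\<Sum>m = 1..n. of_real (c (n - m)) * e (n - m) t * (deriv ^^ (m - 1)) f 0) + frac_integral p ((deriv ^^ n) f) t)"
    unfolding frac_integral_deriv_def c_def e_def q_def ..
  ultimately show ?thesis by (simp only:)
qed

lemma higher_deriv_frac_integral:
  assumes S: "open S" "f holomorphic_on S" and \<Omega>: "open \<Omega>" "\<And>t. t \<in> \<Omega> \<Longrightarrow> Re t > 0"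
    and sub: "\<And>t u. t \<in> \<Omega> \<Longrightarrow> u \<in> {0..1} \<Longrightarrow> t * of_real u \<in> S" and p: "p \<in> {1, 2}" and t: "t \<in> \<Omega>"
  shows "(deriv ^^ n) (frac_integral p f) t = frac_integral_deriv p f n t"
  using t
proof (induction n arbitrary: t)
  case 0
  then show ?case by (simp add: frac_integral_deriv_def)
next
  case (Suc n)
  have "((deriv ^^ n) (frac_integral p f) has_field_derivative frac_integral_deriv p f (Suc n) t) (at t)"
    by (rule has_field_derivative_transform_within_open[OF frac_integral_deriv_has_field_derivative[OF S \<Omega> sub p Suc.prems] \<Omega>(1) Suc.prems])
       (auto simp: Suc.IH)
  then show ?case by (simp add: DERIV_imp_deriv)
qed

lemma frac_integral_holomorphic:
  assumes S: "open S" "f holomorphic_on S" and \<Omega>: "open \<Omega>" "\<And>t. t \<in> \<Omega> \<Longrightarrow> Re t > 0"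
    and sub: "\<And>t u. t \<in> \<Omega> \<Longrightarrow> u \<in> {0..1} \<Longrightarrow> t * of_real u \<in> S" and p: "p \<in> {1, 2}"
  shows "frac_integral p f holomorphic_on \<Omega>"
proof -
  have "frac_integral p f field_differentiable at t within \<Omega>" if "t \<in> \<Omega>" for t
    using has_field_derivative_at_within[OF frac_integral_has_field_derivative[OF S \<Omega> sub p that]]
    unfolding field_differentiable_def by blast
  then show ?thesis unfolding holomorphic_on_def by blast
qed

text \<open>Substitution with v = ((t-s)/t)^(1/3): the measure contributes 3 t v^2 and the kernel
  t^(-q) v^(-p), which combine to 3 t^(1-q) v^(2-p). Since this v has unbounded derivative at s = t,
  the argument uses the composed primitive and interior differentiability only.\<close>

lemma singular_integral_frac_integral:
  assumes h: "continuous_on (of_real ` {0..t}) h" and t: "t > 0" and p: "p \<in> {1, 2}"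
  shows "integral {0..t} (\<lambda>s. h (of_real s) / of_real ((t - s) powr (real p / 3))) = frac_integral p h (of_real t)"
proof -
  define q where "q = real p / 3"
  have q: "0 < q" "q < 1" using p by (auto simp: q_def)
  define k where "k = (\<lambda>y. h (of_real (t * (1 - y ^ 3))) * of_real (y ^ (2 - p)))"
  have kc: "continuous_on {0..1} k"
  proof -
    have "(\<lambda>y. of_real (t * (1 - y ^ 3)) :: complex) ` {0..1} \<subseteq> of_real ` {0..t}"
    proof (rule image_subsetI)
      fix y :: real assume y: "y \<in> {0..1}"
      have "0 \<le> 1 - y ^ 3" "1 - y ^ 3 \<le> 1" using y by (auto simp: power_le_one)
      then have "t * (1 - y ^ 3) \<in> {0..t}" using t by (auto intro: mult_left_le)
      then show "(of_real (t * (1 - y ^ 3)) :: complex) \<in> of_real ` {0..t}" by (rule imageI)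
    qed
    then have "continuous_on {0..1} (\<lambda>y. h (of_real (t * (1 - y ^ 3))))"
      by (rule continuous_on_compose2[OF h, rotated]) (intro continuous_intros)
    then show ?thesis unfolding k_def by (intro continuous_on_mult continuous_intros)
  qed
  define W where "W = (\<lambda>v. integral {0..v} k)"
  have W': "(W has_vector_derivative k v) (at v)" if "0 < v" "v < 1" for v
    using integral_has_vector_derivative[OF kc, of v] that unfolding W_def by (simp add: at_within_Icc_at)
  have Wc: "continuous_on {0..1} W"
    unfolding W_def by (intro indefinite_integral_continuous_1 integrable_continuous_interval kc)
  define V where "V = (\<lambda>s. ((t - s) / t) powr (1 / 3))"
  define A where "A = (of_real (3 * t powr (1 - q)) :: complex)"
  have "((\<lambda>s. h (of_real s) / of_real ((t - s) powr q)) has_integral ((- (A * W (V t))) - (- (A * W (V 0))))) {0..t}"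
  proof (rule fundamental_theorem_of_calculus_interior)
    have Vc: "continuous_on {0..t} V"
      unfolding V_def by (rule continuous_on_powr') (use t in \<open>auto intro!: continuous_intros\<close>)
    have Vi: "V ` {0..t} \<subseteq> {0..1}"
    proof (rule image_subsetI)
      fix s assume "s \<in> {0..t}"
      then have "0 \<le> (t - s) / t" "(t - s) / t \<le> 1" using t by auto
      then show "V s \<in> {0..1}" unfolding V_def by (auto intro: powr_le1)
    qed
    show "continuous_on {0..t} (\<lambda>s. - (A * W (V s)))"
      by (intro continuous_on_minus continuous_on_mult continuous_on_const continuous_on_compose2[OF Wc Vc Vi])
  next
    fix s assume s: "s \<in> {0<..<t}"
    define b where "b = (t - s) / t"
    have b: "0 < b" "b < 1" using s t by (auto simp: b_def)
    define v where "v = V s"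
    have vb: "v = b powr (1 / 3)" by (simp add: v_def V_def b_def)
    have v: "0 < v" "v < 1" unfolding vb using b powr_less_mono2[of "1/3" b 1] by auto
    have v3: "v ^ 3 = b" unfolding vb using b by (simp add: powr_power)
    have ts: "t * (1 - v ^ 3) = s" unfolding v3 b_def using t by (simp add: field_simps)
    have "(V has_field_derivative (1 / 3 * b powr (1 / 3 - 1) * (- 1 / t))) (at s)"
      unfolding V_def
    proof (rule DERIV_chain2[where f = "\<lambda>b. b powr (1/3)"])
      show "((\<lambda>b. b powr (1 / 3)) has_field_derivative 1 / 3 * b powr (1 / 3 - 1)) (at ((t - s) / t))"
        using has_real_derivative_powr[OF b(1), of "1/3"] by (simp add: b_def)
      show "((\<lambda>s. (t - s) / t) has_field_derivative - 1 / t) (at s)"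
        using t by (auto intro!: derivative_eq_intros)
    qed
    then have "(V has_vector_derivative (1 / 3 * b powr (1 / 3 - 1) * (- 1 / t))) (at s)"
      by (simp add: has_real_derivative_iff_has_vector_derivative)
    from vector_diff_chain_at[OF this W'[OF v, unfolded v_def]]
    have "((\<lambda>s. W (V s)) has_vector_derivative (1 / 3 * b powr (1 / 3 - 1) * (- 1 / t)) *\<^sub>R k v) (at s)"
      unfolding o_def v_def .
    then have "((\<lambda>s. A * W (V s)) has_vector_derivative A * ((1 / 3 * b powr (1 / 3 - 1) * (- 1 / t)) *\<^sub>R k v)) (at s)"
      by (rule has_vector_derivative_mult_right)
    from has_vector_derivative_minus[OF this]
    have "((\<lambda>s. - (A * W (V s))) has_vector_derivative - (A * ((1 / 3 * b powr (1 / 3 - 1) * (- 1 / t)) *\<^sub>R k v))) (at s)" .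
    moreover have "- (A * ((1 / 3 * b powr (1 / 3 - 1) * (- 1 / t)) *\<^sub>R k v)) = h (of_real s) / of_real ((t - s) powr q)"
    proof -
      have "(t - s) = t * b" using t by (simp add: b_def)
      then have 1: "(t - s) powr q = t powr q * b powr q" using t b by (simp add: powr_mult)
      have 2: "v ^ (2 - p) = b powr (real (2 - p) / 3)" unfolding vb using b by (simp add: powr_power)
      have 3: "3 * t powr (1 - q) * (1 / 3 * b powr (1 / 3 - 1) * (1 / t)) * v ^ (2 - p) = inverse ((t - s) powr q)"
      proof -
        have "b powr (1 / 3 - 1) * b powr (real (2 - p) / 3) = b powr (- q)"
          unfolding powr_add[symmetric] q_def by (rule arg_cong[of _ _ "\<lambda>e. b powr e"]) (use p in auto)
        moreover have "t powr (1 - q) * (1 / t) = t powr (- q)" using t by (simp add: powr_diff powr_minus field_simps)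
        moreover have "3 * t powr (1 - q) * (1 / 3 * b powr (1 / 3 - 1) * (1 / t)) * b powr (real (2 - p) / 3) =
           (t powr (1 - q) * (1 / t)) * (b powr (1 / 3 - 1) * b powr (real (2 - p) / 3))" by simp
        ultimately show ?thesis unfolding 1 2 by (simp add: powr_minus)
      qed
      have "- (A * ((1 / 3 * b powr (1 / 3 - 1) * (- 1 / t)) *\<^sub>R k v)) = h (of_real s) * of_real (3 * t powr (1 - q) * (1 / 3 * b powr (1 / 3 - 1) * (1 / t)) * v ^ (2 - p))"
        unfolding k_def ts A_def scaleR_conv_of_real by simp
      then show ?thesis unfolding 3 by (simp only: of_real_inverse divide_inverse)
    qed
    ultimately show "((\<lambda>s. - (A * W (V s))) has_vector_derivative h (of_real s) / of_real ((t - s) powr q)) (at s)" by simp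
  qed (use t in simp)
  moreover have "V t = 0" "V 0 = 1" using t by (auto simp: V_def)
  moreover have "W 0 = 0" by (simp add: W_def)
  moreover have "A * W 1 = frac_integral p h (of_real t)"
  proof -
    have "exp (of_real (1 - real p / 3) * Ln (of_real t)) = (of_real (t powr (1 - q)) :: complex)"
    proof -
      have "of_real (1 - real p / 3) * Ln (of_real t) = (of_real ((1 - q) * ln t) :: complex)"
        unfolding Ln_of_real[OF t] q_def by (simp only: of_real_mult)
      then have "exp (of_real (1 - real p / 3) * Ln (of_real t)) = (of_real (exp ((1 - q) * ln t)) :: complex)"
        by (simp only: exp_of_real)
      then show ?thesis using t by (simp add: powr_def)
    qed
    then show ?thesis unfolding frac_integral_def W_def k_def A_def by simp
  qed
  ultimately show ?thesis unfolding q_def[symmetric] by (simp add: integral_unique)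
qed

lemma frac_bracket_eq_frac_integral_deriv:
  assumes S: "open S" "f holomorphic_on S" and t: "t > 0" and sub: "of_real ` {0..t} \<subseteq> S" and p: "p \<in> {1, 2}"
  shows "frac_bracket (real p / 3) f n t = frac_integral_deriv p f n (of_real t)"
proof -
  have "continuous_on (of_real ` {0..t}) ((deriv ^^ n) f)"
    by (rule continuous_on_subset[OF holomorphic_on_imp_continuous_on[OF holomorphic_higher_deriv[OF S(2,1)]] sub])
  note 1 = singular_integral_frac_integral[OF this t p]
  have E: "exp (- (of_real r * Ln (of_real t))) = (of_real (1 / t powr r) :: complex)" for r
  proof -
    have "exp (- (of_real r * Ln (of_real t))) = (exp (of_real (- (r * ln t))) :: complex)"
      using t by (simp add: Ln_of_real)
    also have "\<dots> = of_real (1 / t powr r)" unfolding exp_of_real using t by (simp add: powr_def exp_minus inverse_eq_divide)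
    finally show ?thesis .
  qed
  show ?thesis
    unfolding frac_bracket_def frac_integral_deriv_def 1 E
    by (intro arg_cong2[of _ _ _ _ "(+)"] sum.cong refl arg_cong2[of _ _ _ _ "(*)"]) simp
qed

section \<open>Joint analyticity\<close>

lemma Cauchy_bound_higher_deriv:
  fixes h :: "complex \<Rightarrow> complex"
  assumes "h holomorphic_on ball z R" "0 < r" "r < R"
  obtains M where "M \<ge> 0" "\<And>k. norm ((deriv ^^ k) h z) \<le> M * fact k / r ^ k"
proof -
  have sub: "cball z r \<subseteq> ball z R" using assms by auto
  have c: "continuous_on (cball z r) h"
    by (rule holomorphic_on_imp_continuous_on[OF holomorphic_on_subset[OF assms(1) sub]])
  have "bounded (h ` cball z r)" by (rule compact_imp_bounded[OF compact_continuous_image[OF c compact_cball]])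
  then obtain M where M: "M > 0" "\<And>w. w \<in> cball z r \<Longrightarrow> norm (h w) \<le> M" unfolding bounded_pos by blast
  have "norm ((deriv ^^ k) h z) \<le> fact k * M / r ^ k" for k
  proof (rule Cauchy_inequality[OF holomorphic_on_subset[OF assms(1)] c assms(2)])
    show "ball z r \<subseteq> ball z R" using sub ball_subset_cball by blast
    show "norm (h w) \<le> M" if "norm (z - w) = r" for w using that by (intro M(2)) (simp add: dist_norm)
  qed
  then show ?thesis using M(1) by (intro that[of M]) (auto simp: mult.commute)
qed

text \<open>Cauchy's estimates grow like k!, but k! k! \<le> (2k)! \<le> (3k+e)! leaves an
  exponential series in y X^3. This is why the radius of analyticity in t imposes no bound on
  x.\<close>

lemma summable_fact_quotient:
  assumes "y \<ge> 0" "X \<ge> (0::real)"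
  shows "summable (\<lambda>k. fact k * y ^ k * (X ^ (3 * k + e) / fact (3 * k + e)))"
proof (rule summable_comparison_test')
  show "summable (\<lambda>k. X ^ e * (inverse (fact k) * (y * X ^ 3) ^ k))" by (intro summable_mult summable_exp)
next
  fix k :: nat
  have "(fact k * fact k :: nat) \<le> fact (k + k)" by (intro dvd_imp_le fact_fact_dvd_fact) simp
  also have "(fact (k + k) :: nat) \<le> fact (3 * k + e)" by (rule fact_mono) simp
  finally have "real (fact k * fact k) \<le> real (fact (3 * k + e))" by (rule of_nat_mono)
  then have "fact k * fact k \<le> (fact (3 * k + e) :: real)" by simp
  then have 1: "fact k / fact (3 * k + e) \<le> (inverse (fact k) :: real)" by (simp add: field_simps)
  have "fact k * y ^ k * (X ^ (3 * k + e) / fact (3 * k + e)) = (X ^ e * (y * X ^ 3) ^ k) * (fact k / fact (3 * k + e))"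
    by (simp add: power_add power_mult power_mult_distrib)
  also have "\<dots> \<le> (X ^ e * (y * X ^ 3) ^ k) * inverse (fact k)"
    by (rule mult_left_mono[OF 1]) (use assms in auto)
  finally show "norm (fact k * y ^ k * (X ^ (3 * k + e) / fact (3 * k + e))) \<le> X ^ e * (inverse (fact k) * (y * X ^ 3) ^ k)"
    using assms by (simp add: mult_ac)
qed

lemma summable_on_product_nonneg:
  fixes f :: "'a \<Rightarrow> real" and g :: "'b \<Rightarrow> real"
  assumes "f summable_on UNIV" "g summable_on UNIV" "\<And>x. f x \<ge> 0" "\<And>y. g y \<ge> 0"
  shows "(\<lambda>(x, y). f x * g y) summable_on UNIV"
proof -
  have "(\<lambda>(x, y). f x * g y) summable_on (SIGMA x:UNIV. UNIV)"
  proof (rule summable_on_SigmaI)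
    show "((\<lambda>y. case (x, y) of (x, y) \<Rightarrow> f x * g y) has_sum f x * infsum g UNIV) UNIV" for x
      using has_sum_cmult_right[OF has_sum_infsum[OF assms(2)], of "f x"] by simp
    show "(\<lambda>x. f x * infsum g UNIV) summable_on UNIV" by (rule summable_on_cmult_left[OF assms(1)])
  qed (use assms in auto)
  then show ?thesis by simp
qed

text \<open>The Taylor coefficients of x^N / N! at x0.\<close>

definition taylor_monom :: "real \<Rightarrow> nat \<Rightarrow> nat \<Rightarrow> real" where
  "taylor_monom x0 N m = (if m \<le> N then x0 ^ (N - m) / (fact m * fact (N - m)) else 0)"

lemma taylor_monom_has_sum: "((\<lambda>m. taylor_monom x0 N m * \<xi> ^ m) has_sum (x0 + \<xi>) ^ N / fact N) UNIV"
proof -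
  have "(\<Sum>m\<le>N. taylor_monom x0 N m * \<xi> ^ m) = (\<Sum>m\<le>N. (of_nat (N choose m) * \<xi> ^ m * x0 ^ (N - m)) / fact N)"
    by (intro sum.cong refl) (simp add: taylor_monom_def binomial_fact field_simps)
  also have "\<dots> = (x0 + \<xi>) ^ N / fact N" by (simp add: sum_divide_distrib[symmetric] binomial_ring[symmetric] add.commute)
  finally have 1: "((\<lambda>m. taylor_monom x0 N m * \<xi> ^ m) has_sum (x0 + \<xi>) ^ N / fact N) {..N}"
    by (intro has_sum_finiteI) auto
  show ?thesis
    by (rule iffD1[OF has_sum_cong_neutral 1]) (auto simp: taylor_monom_def)
qed

text \<open>The binomial coefficient is at most 2^N and the power of x0 at most X^N because X \<ge>
  1; the displacement, at most 1/2, provides geometric decay in m.\<close>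

lemma taylor_monom_bound:
  assumes X: "\<bar>x0\<bar> \<le> X" "1 \<le> X" and \<xi>: "\<bar>\<xi>\<bar> \<le> 1 / 2"
  shows "\<bar>taylor_monom x0 N m * \<xi> ^ m\<bar> \<le> (2 * X) ^ N / fact N * (1 / 2) ^ m"
proof (cases "m \<le> N")
  case True
  have "\<bar>taylor_monom x0 N m * \<xi> ^ m\<bar> = real (N choose m) / fact N * \<bar>x0\<bar> ^ (N - m) * \<bar>\<xi>\<bar> ^ m"
    using True by (simp add: taylor_monom_def abs_mult power_abs binomial_fact field_simps)
  also have "\<dots> \<le> 2 ^ N / fact N * X ^ N * (1 / 2) ^ m"
  proof (intro mult_mono divide_right_mono)
    have "real (N choose m) \<le> real (2 ^ N)" by (rule of_nat_mono[OF binomial_le_pow2])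
    then show "real (N choose m) \<le> 2 ^ N" by simp
    have "\<bar>x0\<bar> ^ (N - m) \<le> X ^ (N - m)" by (rule power_mono[OF X(1)]) simp
    also have "\<dots> \<le> X ^ N" by (rule power_increasing) (use X in auto)
    finally show "\<bar>x0\<bar> ^ (N - m) \<le> X ^ N" .
    show "\<bar>\<xi>\<bar> ^ m \<le> (1 / 2) ^ m" by (rule power_mono[OF \<xi>]) simp
  qed (use X in auto)
  finally show ?thesis by (simp add: power_mult_distrib)
next
  case False
  then show ?thesis using X by (simp add: taylor_monom_def)
qed

lemma higher_deriv_taylor:
  fixes h :: "complex \<Rightarrow> complex"
  assumes "h holomorphic_on ball z R" "w \<in> ball z R"
  shows "(\<lambda>n. (deriv ^^ (k + n)) h z / fact n * (w - z) ^ n) sums (deriv ^^ k) h w"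
proof -
  have "(deriv ^^ n) ((deriv ^^ k) h) = (deriv ^^ (k + n)) h" for n
    using fun_cong[OF funpow_add[of n k deriv], of h] by (simp only: o_apply add.commute[of n k])
  then show ?thesis
    using holomorphic_power_series[OF holomorphic_higher_deriv[OF assms(1) open_ball] assms(2), of k] by simp
qed

lemma fact_add_le: "fact (k + n) \<le> (2 ^ (k + n) * fact k * fact n :: real)"
proof -
  have "fact (k + n) = real ((k + n) choose k) * fact k * fact n" using binomial_fact[of k "k + n", where 'a = real] by simp
  also have "\<dots> \<le> real (2 ^ (k + n)) * fact k * fact n"
    by (intro mult_right_mono of_nat_mono binomial_le_pow2) auto
  finally show ?thesis by simp
qed

text \<open>Expanding both factors of the k-th term about (x0, t0) gives a triple series dominated
  by A k 2^(-m) 2^(-n). Being absolutely summable, it may be summed over (m, n) first, which gives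
  back the series in k, or over k first, which defines the coefficients \<open>c\<close>.\<close>

lemma deriv_series_double_expansion:
  fixes h :: "complex \<Rightarrow> complex" and x0 t0 R :: real
  assumes h: "h holomorphic_on ball (of_real t0) R" and R: "R > 0"
  obtains \<delta> c where "\<delta> > 0"
    "\<And>x t. \<bar>x - x0\<bar> < \<delta> \<Longrightarrow> \<bar>t - t0\<bar> < \<delta> \<Longrightarrow> \<exists>s.
       (\<lambda>k. (deriv ^^ k) h (of_real t) * of_real (x ^ (3 * k + e) / fact (3 * k + e))) sums s \<and>
       ((\<lambda>(m, n). c m n * of_real (x - x0) ^ m * of_real (t - t0) ^ n) has_sum s) UNIV"
proof -
  define r where "r = R / 2"
  have r: "0 < r" "r < R" using R by (auto simp: r_def)
  obtain M where M: "M \<ge> 0" "\<And>k. norm ((deriv ^^ k) h (of_real t0)) \<le> M * fact k / r ^ k"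
    using Cauchy_bound_higher_deriv[OF h r] by blast
  define X where "X = \<bar>x0\<bar> + 1"
  have X: "\<bar>x0\<bar> \<le> X" "1 \<le> X" by (auto simp: X_def)
  \<comment> \<open>The 1/2 is what \<open>taylor_monom_bound\<close> requires. In the time
    direction \<open>fact_add_le\<close> costs 2^n against r^n, so r/4 leaves the factor
    2^(-n).\<close>
  define \<delta> where "\<delta> = min (1 / 2) (r / 4)"
  have \<delta>: "\<delta> > 0" "\<delta> \<le> 1 / 2" "\<delta> \<le> r / 4" using r by (auto simp: \<delta>_def)
  define A where "A = (\<lambda>k. M * (fact k * (2 / r) ^ k * ((2 * X) ^ (3 * k + e) / fact (3 * k + e))))"
  define d where "d = (\<lambda>k n. (deriv ^^ (k + n)) h (of_real t0) / fact n)"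
  define b where "b = (\<lambda>k m. (of_real (taylor_monom x0 (3 * k + e) m) :: complex))"
  define c where "c = (\<lambda>m n. infsum (\<lambda>k. d k n * b k m) UNIV)"
  have A0: "A k \<ge> 0" for k using M r X by (auto simp: A_def)
  have As: "A summable_on UNIV"
  proof (rule norm_summable_imp_summable_on)
    have "norm (A k) = A k" for k using A0[of k] by simp
    moreover have "summable A" unfolding A_def by (rule summable_mult[OF summable_fact_quotient]) (use r X in auto)
    ultimately show "summable (\<lambda>k. norm (A k))" by simp
  qed
  have geo: "(\<lambda>n. (1 / 2 :: real) ^ n) summable_on UNIV"
    by (rule norm_summable_imp_summable_on) (simp add: summable_geometric)
  have \<tau>_bound: "norm (d k n * of_real \<tau> ^ n) \<le> M * (fact k * (2 / r) ^ k) * (1 / 2) ^ n" if "\<bar>\<tau>\<bar> \<le> \<delta>" for k n and \<tau> :: real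
  proof -
    have "norm (d k n * of_real \<tau> ^ n) = norm ((deriv ^^ (k + n)) h (of_real t0)) / fact n * \<bar>\<tau>\<bar> ^ n"
      by (simp add: d_def norm_mult norm_divide norm_power)
    also have "\<dots> \<le> (M * fact (k + n) / r ^ (k + n)) / fact n * (r / 4) ^ n"
      using that \<delta> M r by (intro mult_mono divide_right_mono power_mono) auto
    also have "\<dots> \<le> (M * (2 ^ (k + n) * fact k * fact n) / r ^ (k + n)) / fact n * (r / 4) ^ n"
      using M r by (intro mult_right_mono divide_right_mono mult_left_mono fact_add_le) auto
    also have "\<dots> = M * (fact k * (2 / r) ^ k) * (2 / 4) ^ n"
    proof -
      have 1: "(r / 4) ^ n = (1 / 4) ^ n * r ^ n" by (simp add: power_divide)
      have 2: "(2::real) ^ n * (1 / 4) ^ n = (2 / 4) ^ n" by (simp only: power_mult_distrib[symmetric]) simp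
      have 3: "(M * (2 ^ k * 2 ^ n * F * G) / (P * Q)) / G * (y * Q) = M * (F * (2 ^ k / P)) * (2 ^ n * y)"
        if "P \<noteq> 0" "Q \<noteq> 0" "G \<noteq> 0" for F G P Q y :: real
        using that by (simp add: field_simps)
      show ?thesis unfolding power_add 1 power_divide[of 2 r] 2[symmetric] by (rule 3) (use r in auto)
    qed
    finally show ?thesis by simp
  qed
  have main: "\<exists>s. (\<lambda>k. (deriv ^^ k) h (of_real t) * of_real (x ^ (3 * k + e) / fact (3 * k + e))) sums s \<and>
       ((\<lambda>(m, n). c m n * of_real (x - x0) ^ m * of_real (t - t0) ^ n) has_sum s) UNIV"
    if xt: "\<bar>x - x0\<bar> < \<delta>" "\<bar>t - t0\<bar> < \<delta>" for x t
  proof -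
    define \<xi> where "\<xi> = x - x0"
    define \<tau> where "\<tau> = t - t0"
    define D where "D = (\<lambda>k n. d k n * of_real \<tau> ^ n)"
    define B where "B = (\<lambda>k m. b k m * of_real \<xi> ^ m)"
    define T where "T = (\<lambda>(k, (m, n)). D k n * B k m)"
    have Dn: "norm (D k n) \<le> M * (fact k * (2 / r) ^ k) * (1 / 2) ^ n" for k n
      unfolding D_def by (rule \<tau>_bound) (use xt in \<open>simp add: \<tau>_def\<close>)
    have Bn: "norm (B k m) \<le> (2 * X) ^ (3 * k + e) / fact (3 * k + e) * (1 / 2) ^ m" for k m
    proof -
      have "norm (B k m) = \<bar>taylor_monom x0 (3 * k + e) m * \<xi> ^ m\<bar>"
        unfolding B_def b_def of_real_power[symmetric] of_real_mult[symmetric] norm_of_real ..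
      also have "\<dots> \<le> (2 * X) ^ (3 * k + e) / fact (3 * k + e) * (1 / 2) ^ m"
        by (rule taylor_monom_bound[OF X]) (use xt \<delta> in \<open>simp add: \<xi>_def\<close>)
      finally show ?thesis .
    qed
    have Dsum: "(D k has_sum (deriv ^^ k) h (of_real t)) UNIV" for k
    proof (rule norm_summable_imp_has_sum)
      show "summable (\<lambda>n. norm (D k n))"
      proof (rule summable_comparison_test')
        show "summable (\<lambda>n. M * (fact k * (2 / r) ^ k) * (1 / 2) ^ n)" by (intro summable_mult summable_geometric) simp
        show "norm (norm (D k n)) \<le> M * (fact k * (2 / r) ^ k) * (1 / 2) ^ n" for n using Dn by simp
      qed
      have "(of_real t :: complex) \<in> ball (of_real t0) R"
        using xt \<delta> r by (simp add: dist_norm norm_minus_commute flip: of_real_diff)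
      from higher_deriv_taylor[OF h this, of k]
      show "D k sums (deriv ^^ k) h (of_real t)" unfolding D_def d_def \<tau>_def of_real_diff .
    qed
    have Bsum: "(B k has_sum of_real (x ^ (3 * k + e) / fact (3 * k + e))) UNIV" for k
    proof -
      have "((\<lambda>m. of_real (taylor_monom x0 (3 * k + e) m * \<xi> ^ m)) has_sum (of_real ((x0 + \<xi>) ^ (3 * k + e) / fact (3 * k + e)) :: complex)) UNIV"
        by (rule has_sum_of_real[OF taylor_monom_has_sum])
      moreover have "x0 + \<xi> = x" by (simp add: \<xi>_def)
      ultimately show ?thesis unfolding B_def b_def of_real_power[symmetric] of_real_mult[symmetric] by simp
    qed
    have "(\<lambda>(k, mn). A k * (case mn of (m, n) \<Rightarrow> (1 / 2) ^ m * (1 / 2) ^ n)) summable_on UNIV"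
      by (rule summable_on_product_nonneg[OF As summable_on_product_nonneg[OF geo geo]]) (auto simp: A0)
    then have "(\<lambda>x. norm (T x)) summable_on UNIV"
    proof (rule Infinite_Sum.abs_summable_on_comparison_test')
      fix y :: "nat \<times> nat \<times> nat"
      obtain k m n where y: "y = (k, m, n)" by (cases y)
      have "norm (T y) = norm (D k n) * norm (B k m)" by (simp add: y T_def norm_mult)
      also have "\<dots> \<le> (M * (fact k * (2 / r) ^ k) * (1 / 2) ^ n) * ((2 * X) ^ (3 * k + e) / fact (3 * k + e) * (1 / 2) ^ m)"
        by (intro mult_mono Dn Bn) (use M r in auto)
      also have "\<dots> = (case y of (k, mn) \<Rightarrow> A k * (case mn of (m, n) \<Rightarrow> (1 / 2) ^ m * (1 / 2) ^ n))"
        by (simp add: y A_def)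
      finally show "norm (T y) \<le> (case y of (k, mn) \<Rightarrow> A k * (case mn of (m, n) \<Rightarrow> (1 / 2) ^ m * (1 / 2) ^ n))" .
    qed
    then have Ts: "T summable_on UNIV" by (rule abs_summable_summable)
    define s where "s = infsum T UNIV"
    have Th: "(T has_sum s) (UNIV \<times> UNIV)" using has_sum_infsum[OF Ts] by (simp add: s_def)
    have inner: "((\<lambda>mn. T (k, mn)) has_sum (deriv ^^ k) h (of_real t) * of_real (x ^ (3 * k + e) / fact (3 * k + e))) UNIV" for k
    proof -
      have "(\<lambda>(k, mn). T (k, mn)) summable_on (SIGMA k:UNIV. UNIV)" using Ts by simp
      from summable_on_SigmaD1[OF this, of k] have 1: "(\<lambda>mn. T (k, mn)) summable_on (SIGMA m:UNIV. UNIV)" by simp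
      have "((\<lambda>mn. T (k, mn)) has_sum (deriv ^^ k) h (of_real t) * of_real (x ^ (3 * k + e) / fact (3 * k + e))) (SIGMA m:UNIV. UNIV)"
      proof (rule has_sum_SigmaI[OF _ _ 1])
        show "((\<lambda>n. T (k, m, n)) has_sum (deriv ^^ k) h (of_real t) * B k m) UNIV" for m
          using has_sum_cmult_left[OF Dsum[of k], of "B k m"] by (simp add: T_def)
        show "((\<lambda>m. (deriv ^^ k) h (of_real t) * B k m) has_sum (deriv ^^ k) h (of_real t) * of_real (x ^ (3 * k + e) / fact (3 * k + e))) UNIV"
          by (rule has_sum_cmult_right[OF Bsum])
      qed
      then show ?thesis by simp
    qed
    have "((\<lambda>k. (deriv ^^ k) h (of_real t) * of_real (x ^ (3 * k + e) / fact (3 * k + e))) has_sum s) UNIV"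
      by (rule has_sum_SigmaD[OF Th inner])
    then have 1: "(\<lambda>k. (deriv ^^ k) h (of_real t) * of_real (x ^ (3 * k + e) / fact (3 * k + e))) sums s"
      by (rule has_sum_imp_sums)
    \<comment> \<open>The same absolutely convergent sum in the other order; its inner sums over k
      are the coefficients of the double power series.\<close>
    have Th': "((\<lambda>(mn, k). T (k, mn)) has_sum s) (UNIV \<times> UNIV)" using iffD1[OF has_sum_swap Th] by simp
    have "((\<lambda>k. T (k, mn)) has_sum (case mn of (m, n) \<Rightarrow> c m n * of_real (x - x0) ^ m * of_real (t - t0) ^ n)) UNIV" for mn
    proof -
      obtain m n where mn: "mn = (m, n)" by (cases mn)
      have "(\<lambda>(mn, k). T (k, mn)) summable_on (SIGMA mn:UNIV. UNIV)" using Th' by (auto simp: summable_on_def)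
      from summable_on_SigmaD1[OF this, of mn] have "(\<lambda>k. T (k, mn)) summable_on UNIV" by simp
      from has_sum_infsum[OF this] have "((\<lambda>k. T (k, mn)) has_sum (\<Sum>\<^sub>\<infinity>k. T (k, mn))) UNIV" .
      moreover have "(\<Sum>\<^sub>\<infinity>k. T (k, mn)) = (\<Sum>\<^sub>\<infinity>k. d k n * b k m * (of_real \<xi> ^ m * of_real \<tau> ^ n))"
        by (intro infsum_cong) (simp add: T_def mn D_def B_def mult_ac)
      moreover have "\<dots> = c m n * (of_real \<xi> ^ m * of_real \<tau> ^ n)" unfolding c_def by (rule infsum_cmult_left')
      ultimately show ?thesis unfolding mn \<xi>_def \<tau>_def by (simp only: prod.case mult.assoc)
    qed
    then have "((\<lambda>mn. case mn of (m, n) \<Rightarrow> c m n * of_real (x - x0) ^ m * of_real (t - t0) ^ n) has_sum s) UNIV"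
      by (intro has_sum_SigmaD[OF Th']) simp
    with 1 show ?thesis by blast
  qed
  show ?thesis by (rule that[OF \<delta>(1) main])
qed

section \<open>From coefficient series to entire and real analytic functions\<close>

lemma sums_residue_class:
  fixes f :: "nat \<Rightarrow> 'a :: real_normed_vector"
  assumes "e < 3"
  shows "(\<lambda>n. if n mod 3 = e then f n else 0) sums s \<longleftrightarrow> (\<lambda>k. f (3 * k + e)) sums s"
proof -
  have "strict_mono (\<lambda>k::nat. 3 * k + e)" by (rule strict_monoI) simp
  moreover have "(if n mod 3 = e then f n else 0) = 0" if "n \<notin> range (\<lambda>k. 3 * k + e)" for n
  proof -
    have "n mod 3 \<noteq> e" using that mult_div_mod_eq[of 3 n] by (metis rangeI)
    then show ?thesis by simp
  qed
  ultimately have "(\<lambda>k. if (3 * k + e) mod 3 = e then f (3 * k + e) else 0) sums s \<longleftrightarrow> (\<lambda>n. if n mod 3 = e then f n else 0) sums s"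
    by (rule sums_mono_reindex)
  then show ?thesis using assms by simp
qed

lemma entire_seriesI:
  assumes "\<And>x::real. x > 0 \<Longrightarrow> summable (\<lambda>n. c n * of_real x ^ n)"
  shows "entire_series c"
  unfolding entire_series_def
  using summable_norm_cancel[OF powser_abs_summable_everywhere[OF assms]]
    powser_holomorphic[OF powser_abs_summable_everywhere[OF assms], of UNIV] by blast

text \<open>The sum is an entire function of complex x, so its Taylor series at any x0 represents
  it; radius 1 is an arbitrary choice.\<close>

lemma real_analytic_on_entire_series:
  assumes c: "entire_series c" and s: "\<And>x. x \<in> S \<Longrightarrow> (\<lambda>n. c n * of_real x ^ n) sums u x"
  shows "real_analytic_on u S"
  unfolding real_analytic_on_def
proof
  fix x0 assume "x0 \<in> S"
  define F where "F = (\<lambda>z. \<Sum>n. c n * z ^ n)"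
  have F: "F holomorphic_on ball (of_real x0) 1"
    using c unfolding entire_series_def F_def by (auto intro: holomorphic_on_subset)
  have "(\<lambda>n. (deriv ^^ n) F (of_real x0) / fact n * of_real (x - x0) ^ n) sums u x" if "x \<in> S" "\<bar>x - x0\<bar> < 1" for x
  proof -
    have "(of_real x :: complex) \<in> ball (of_real x0) 1"
      using that(2) by (simp add: dist_norm norm_minus_commute flip: of_real_diff)
    from holomorphic_power_series[OF F this]
    have "(\<lambda>n. (deriv ^^ n) F (of_real x0) / fact n * of_real (x - x0) ^ n) sums F (of_real x)" unfolding of_real_diff .
    moreover have "F (of_real x) = u x" unfolding F_def by (rule sums_unique[OF s[OF that(1)], symmetric])
    ultimately show ?thesis by simp
  qed
  then show "\<exists>\<delta>>0. \<exists>c. \<forall>x\<in>S. \<bar>x - x0\<bar> < \<delta> \<longrightarrow> (\<lambda>n. c n * of_real (x - x0) ^ n) sums u x"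
    by (intro exI[of _ "1::real"] conjI exI[of _ "\<lambda>n. (deriv ^^ n) F (of_real x0) / fact n"]) auto
qed

section \<open>The contour integrals\<close>

definition integrandp :: "nat \<Rightarrow> (complex \<Rightarrow> complex) \<Rightarrow> real \<Rightarrow> real \<Rightarrow> complex \<Rightarrow> complex" where
  "integrandp p f x t k = exp (\<i> * k * of_real x - \<i> * k ^ 3 * of_real t) * k ^ p * F_transform f (\<i> * k ^ 3) t"

lemma integrandp_eqs: "integrand0 f x t = integrandp 2 f x t" "integrand1 f x t = integrandp 1 f x t"
  by (simp_all add: fun_eq_iff integrand0_def integrand1_def integrandp_def)

text \<open>After s = t - \<tau> the growing factor in \<open>F\<close> and the decaying prefactor
  merge into exp(-w\<tau>). For negative t both integrals are over the empty set.\<close>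

lemma F_transform_reflect:
  assumes "continuous_on {0..t} (\<lambda>s. f (of_real s))"
  shows "exp (- (w * of_real t)) * F_transform f w t = integral {0..t} (\<lambda>\<tau>. exp (- (w * of_real \<tau>)) * f (of_real (t - \<tau>)))"
proof (cases "t \<ge> 0")
  case True
  define h where "h = (\<lambda>s. exp (- (w * of_real (t - s))) * f (of_real s))"
  have hc: "continuous_on {0..t} h" unfolding h_def by (intro continuous_on_mult assms continuous_intros)
  have "((\<lambda>\<tau>. h (t - \<tau>)) has_integral integral {0..t} h) {0..t}"
    using has_integral_affinity[of h "integral {0..t} h" 0 t "-1" t] integrable_integral[OF integrable_continuous_interval[OF hc]] True
    by (simp add: image_affinity_atLeastAtMost algebra_simps)
  then have "integral {0..t} (\<lambda>\<tau>. h (t - \<tau>)) = integral {0..t} h" by (rule integral_unique)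
  also have "\<dots> = integral {0..t} (\<lambda>s. exp (- (w * of_real t)) * (exp (w * of_real s) * f (of_real s)))"
  proof (rule Henstock_Kurzweil_Integration.integral_cong)
    fix s
    have "exp (- (w * of_real (t - s))) = exp (- (w * of_real t)) * exp (w * of_real s)"
      unfolding exp_add[symmetric] by (rule arg_cong[of _ _ exp]) (simp add: algebra_simps)
    then show "h s = exp (- (w * of_real t)) * (exp (w * of_real s) * f (of_real s))" unfolding h_def by (simp only: mult.assoc)
  qed
  also have "\<dots> = exp (- (w * of_real t)) * F_transform f w t" unfolding F_transform_def by (rule integral_mult_right)
  finally show ?thesis unfolding h_def by simp
next
  case False
  then show ?thesis by (simp add: F_transform_def)
qed

lemma ray_integrand_Jfun:
  assumes fc: "continuous_on {0..t} (\<lambda>s. f (of_real s))"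
    and z: "\<i> * cis \<beta> = - cis (ztheta l)" and s: "\<i> * cis \<beta> ^ 3 = cis (ssigma l)"
  shows "ray_integrand \<beta> (integrandp p f x t) = (\<lambda>\<rho>. cis \<beta> ^ (p + 1) * Jfun p (\<lambda>\<tau>. f (of_real (t - \<tau>))) 0 t (ray_s l) (ray_z l x) \<rho>)"
proof
  fix \<rho>
  have k3: "\<i> * (of_real \<rho> * cis \<beta>) ^ 3 = ray_s l * of_real \<rho> ^ 3"
    unfolding ray_s_def s[symmetric] by (simp add: power_mult_distrib)
  have k1: "\<i> * (of_real \<rho> * cis \<beta>) * of_real x = - (ray_z l x * of_real \<rho>)"
  proof -
    have "\<i> * (of_real \<rho> * cis \<beta>) * of_real x = (\<i> * cis \<beta>) * of_real x * of_real \<rho>" by (simp only: mult_ac)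
    then show ?thesis unfolding z ray_z_def by simp
  qed
  have "ray_integrand \<beta> (integrandp p f x t) \<rho> = exp (- (ray_z l x * of_real \<rho>)) * (of_real \<rho> * cis \<beta>) ^ p *
     (exp (- (ray_s l * of_real \<rho> ^ 3 * of_real t)) * F_transform f (ray_s l * of_real \<rho> ^ 3) t) * cis \<beta>"
    unfolding ray_integrand_def integrandp_def k3 k1 diff_conv_add_uminus exp_add by (simp only: mult_ac)
  also have "\<dots> = cis \<beta> ^ (p + 1) * Jfun p (\<lambda>\<tau>. f (of_real (t - \<tau>))) 0 t (ray_s l) (ray_z l x) \<rho>"
    unfolding F_transform_reflect[OF fc] Jfun_def by (simp add: power_mult_distrib)
  finally show "ray_integrand \<beta> (integrandp p f x t) \<rho> = cis \<beta> ^ (p + 1) * Jfun p (\<lambda>\<tau>. f (of_real (t - \<tau>))) 0 t (ray_s l) (ray_z l x) \<rho>" .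
qed

lemma C2_bounded_reflected:
  assumes S: "open S" "f holomorphic_on S" and sub: "of_real ` {0..t} \<subseteq> S" and ab: "0 \<le> a" "b \<le> t"
  obtains K where "C2_bounded a b (\<lambda>\<tau>. f (of_real (t - \<tau>))) K"
proof -
  define S' where "S' = (\<lambda>w. of_real t - w) -` S"
  have "open S'" unfolding S'_def by (intro open_vimage S(1) continuous_intros)
  moreover have "(\<lambda>w. f (of_real t - w)) holomorphic_on S'"
    by (rule holomorphic_on_compose_gen[where g = f and f = "\<lambda>w. of_real t - w" and t = S, unfolded o_def, OF _ S(2)])
       (auto intro!: holomorphic_intros simp: S'_def)
  moreover have "of_real ` {a..b} \<subseteq> S'"
  proof (rule image_subsetI)
    fix y assume "y \<in> {a..b}"
    then have "t - y \<in> {0..t}" using ab by auto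
    then have "of_real (t - y) \<in> S" using sub by blast
    then show "of_real y \<in> S'" by (simp add: S'_def)
  qed
  ultimately obtain K where "C2_bounded a b (\<lambda>\<tau>. f (of_real t - of_real \<tau>)) K" by (rule C2_bounded_holomorphic_ex)
  then show ?thesis by (intro that[of K]) (simp only: of_real_diff)
qed

lemma ray_integral_Jint:
  assumes S: "open S" "f holomorphic_on S" and sub: "of_real ` {0..t} \<subseteq> S" and t: "0 \<le> t" and x: "x > 0" and p: "p \<le> 2"
    and l: "l < 4" and z: "\<i> * cis \<beta> = - cis (ztheta l)" and s: "\<i> * cis \<beta> ^ 3 = cis (ssigma l)"
  shows "ray_integrable \<beta> (integrandp p f x t)"
    "ray_integral \<beta> (integrandp p f x t) = cis \<beta> ^ (p + 1) * Jint p (\<lambda>\<tau>. f (of_real (t - \<tau>))) 0 t (ray_s l) (ray_z l x)"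
proof -
  have "continuous_on {0..t} (\<lambda>s. f (of_real s))"
    by (rule continuous_on_compose2[OF holomorphic_on_imp_continuous_on[OF S(2)] _ sub]) (intro continuous_intros)
  note R = ray_integrand_Jfun[OF this z s]
  obtain K where K: "C2_bounded 0 t (\<lambda>\<tau>. f (of_real (t - \<tau>))) K" by (rule C2_bounded_reflected[OF S sub order_refl order_refl])
  obtain C where C: "\<And>g K. C2_bounded 0 t g K \<Longrightarrow> Jfun p g 0 t (ray_s l) (ray_z l x) integrable_on {0..} \<and> norm (Jint p g 0 t (ray_s l) (ray_z l x)) \<le> C * K"
    by (rule Jint_integrable_bound[OF order_refl t ray_s_imaginary[OF l] ray_z_halfplane[OF l x] p]) (rule that; assumption)
  have i: "Jfun p (\<lambda>\<tau>. f (of_real (t - \<tau>))) 0 t (ray_s l) (ray_z l x) integrable_on {0..}" using C[OF K] ..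
  show "ray_integrable \<beta> (integrandp p f x t)"
    unfolding ray_integrable_def R by (rule integrable_on_mult_right[OF i])
  show "ray_integral \<beta> (integrandp p f x t) = cis \<beta> ^ (p + 1) * Jint p (\<lambda>\<tau>. f (of_real (t - \<tau>))) 0 t (ray_s l) (ray_z l x)"
    unfolding ray_integral_def R Jint_def by (rule integral_mult_right)
qed

lemma cis_rays:
  "\<i> * cis 0 = - cis (ztheta 0)" "\<i> * cis 0 ^ 3 = cis (ssigma 0)"
  "\<i> * cis (2 * pi / 3) = - cis (ztheta 1)" "\<i> * cis (2 * pi / 3) ^ 3 = cis (ssigma 1)"
  "\<i> * cis pi = - cis (ztheta 2)" "\<i> * cis pi ^ 3 = cis (ssigma 2)"
  "\<i> * cis (pi / 3) = - cis (ztheta 3)" "\<i> * cis (pi / 3) ^ 3 = cis (ssigma 3)"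
proof -
  have z: "\<i> * cis \<beta> = - cis \<theta>" if "\<beta> = \<theta> + pi / 2" for \<beta> \<theta>
  proof -
    have "cis \<beta> = cis \<theta> * cis (pi / 2)" unfolding that cis_mult ..
    then have "\<i> * cis \<beta> = cis \<theta> * (\<i> * \<i>)" unfolding cis_pi_half by (simp only: mult_ac)
    then show ?thesis by simp
  qed
  show "\<i> * cis 0 = - cis (ztheta 0)" "\<i> * cis (2 * pi / 3) = - cis (ztheta 1)" "\<i> * cis pi = - cis (ztheta 2)"
    "\<i> * cis (pi / 3) = - cis (ztheta 3)"
    unfolding ztheta_ssigma_values by (rule z; simp)+
  have "cis (2 * pi / 3) ^ 3 = 1" using alpha_cube unfolding alpha_cis .
  moreover have "cis (pi / 3) ^ 3 = -1"
  proof -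
    have "cis (pi / 3) ^ 3 = cis (real 3 * (pi / 3))" by (rule Complex.DeMoivre)
    then show ?thesis by simp
  qed
  ultimately show "\<i> * cis 0 ^ 3 = cis (ssigma 0)" "\<i> * cis (2 * pi / 3) ^ 3 = cis (ssigma 1)" "\<i> * cis pi ^ 3 = cis (ssigma 2)"
    "\<i> * cis (pi / 3) ^ 3 = cis (ssigma 3)"
    unfolding ztheta_ssigma_values by simp_all
qed

lemma cis_pi_thirds: "cis (pi / 3) = - (alpha\<^sup>2)"
  unfolding alpha_sq by (simp add: complex_eq_iff cos_60 sin_60)

context
  fixes S f t x
  assumes S: "open S" "f holomorphic_on S" and sub: "of_real ` {0..t} \<subseteq> S" and t: "0 \<le> t" and x: "(x::real) > 0"
begin

lemmas ray0 = ray_integral_Jint[OF S sub t x _ _ cis_rays(1,2)]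
lemmas ray1 = ray_integral_Jint[OF S sub t x _ _ cis_rays(3,4)]
lemmas ray2 = ray_integral_Jint[OF S sub t x _ _ cis_rays(5,6)]
lemmas ray3 = ray_integral_Jint[OF S sub t x _ _ cis_rays(7,8)]

lemma bd_Omega_integrable:
  assumes "p \<le> 2"
  shows "bd_Omega1_integrable (integrandp p f x t)" "bd_Omega2_integrable (integrandp p f x t)"
  unfolding bd_Omega1_integrable_def bd_Omega2_integrable_def
  by (intro conjI ray0(1)[OF assms] ray1(1)[OF assms] ray2(1)[OF assms] ray3(1)[OF assms]; simp)+

text \<open>For p = 2 the factor cis \<beta>^3 is 1 at the angles 0 and 2\<pi>/3, and -1 at \<pi>
  and \<pi>/3. The latter are the incoming rays, so this sign cancels the orientation and the bare
  prefactors remain as weights.\<close>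

lemma I_f0_ray_sum: "I_f0 f x t = ray_sum 2 (\<lambda>\<tau>. f (of_real (t - \<tau>))) 0 t x / (2 * of_real pi)"
proof -
  define J where "J = (\<lambda>l. Jint 2 (\<lambda>\<tau>. f (of_real (t - \<tau>))) 0 t (ray_s l) (ray_z l x))"
  have c: "cis 0 ^ (2 + 1) = 1" "cis (2 * pi / 3) ^ (2 + 1) = 1" "cis pi ^ (2 + 1) = -1" "cis (pi / 3) ^ (2 + 1) = -1"
  proof -
    have 1: "(2::nat) + 1 = 3" by simp
    show "cis (2 * pi / 3) ^ (2 + 1) = 1" unfolding 1 alpha_cis[symmetric] by (rule alpha_cube)
    show "cis (pi / 3) ^ (2 + 1) = -1"
    proof -
      have "(- (alpha\<^sup>2)) ^ 3 = - ((alpha ^ 3)\<^sup>2)" by (simp add: power_mult[symmetric])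
      then show ?thesis unfolding 1 cis_pi_thirds alpha_cube by simp
    qed
  qed simp_all
  have r: "ray_integral 0 (integrandp 2 f x t) = J 0" "ray_integral (2 * pi / 3) (integrandp 2 f x t) = J 1"
    "ray_integral pi (integrandp 2 f x t) = - J 2" "ray_integral (pi / 3) (integrandp 2 f x t) = - J 3"
    using ray0(2)[of 2] ray1(2)[of 2] ray2(2)[of 2] ray3(2)[of 2] unfolding c J_def by simp_all
  have cb: "ray_sum 2 (\<lambda>\<tau>. f (of_real (t - \<tau>))) 0 t x = (1 - alpha) * J 0 + (1 - alpha\<^sup>2) * J 1 + (1 - alpha\<^sup>2) * J 2 + (1 - alpha) * J 3"
    unfolding ray_sum_def J_def by (simp add: lessThan_4 ray_weight_def numeral_2_eq_2 numeral_3_eq_3)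
  show ?thesis
    unfolding I_f0_def integrandp_eqs bd_Omega1_integral_def bd_Omega2_integral_def r cb times_divide_eq_left add_divide_distrib[symmetric]
    by (rule arg_cong[of _ _ "\<lambda>y. y / (2 * of_real pi)"]) (simp only: minus_minus ring_distribs add_ac)
qed

text \<open>For p = 1 the factor cis \<beta>^2 is 1, \<alpha>^2, 1, \<alpha> on rays 0 to 3;
  multiplied with prefactor and orientation and reduced by \<alpha>^3 = 1 it gives the
  weights.\<close>

lemma I_f1_ray_sum: "I_f1 f x t = ray_sum 1 (\<lambda>\<tau>. f (of_real (t - \<tau>))) 0 t x / (2 * of_real pi)"
proof -
  define J where "J = (\<lambda>l. Jint 1 (\<lambda>\<tau>. f (of_real (t - \<tau>))) 0 t (ray_s l) (ray_z l x))"
  have a4: "alpha\<^sup>2 * alpha\<^sup>2 = alpha" using alpha_sq_sq by (simp only: power2_eq_square)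
  have a3: "alpha * alpha\<^sup>2 = 1" using alpha_cube by (simp only: power2_eq_square power3_eq_cube mult.assoc)
  have c: "cis 0 ^ (1 + 1) = 1" "cis (2 * pi / 3) ^ (1 + 1) = alpha\<^sup>2" "cis pi ^ (1 + 1) = 1" "cis (pi / 3) ^ (1 + 1) = alpha"
  proof -
    have 1: "(1::nat) + 1 = 2" by simp
    show "cis (2 * pi / 3) ^ (1 + 1) = alpha\<^sup>2" unfolding 1 alpha_cis[symmetric] ..
    show "cis (pi / 3) ^ (1 + 1) = alpha" unfolding 1 cis_pi_thirds power2_minus by (rule alpha_sq_sq)
  qed simp_all
  have r: "ray_integral 0 (integrandp 1 f x t) = J 0" "ray_integral (2 * pi / 3) (integrandp 1 f x t) = alpha\<^sup>2 * J 1"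
    "ray_integral pi (integrandp 1 f x t) = J 2" "ray_integral (pi / 3) (integrandp 1 f x t) = alpha * J 3"
    using ray0(2)[of 1] ray1(2)[of 1] ray2(2)[of 1] ray3(2)[of 1] unfolding c J_def by simp_all
  have cb: "ray_sum 1 (\<lambda>\<tau>. f (of_real (t - \<tau>))) 0 t x = (1 - alpha\<^sup>2) / \<i> * J 0 + (alpha\<^sup>2 - 1) / \<i> * J 1 + (alpha - 1) / \<i> * J 2 + (1 - alpha) / \<i> * J 3"
    unfolding ray_sum_def J_def by (simp add: lessThan_4 ray_weight_def numeral_2_eq_2 numeral_3_eq_3)
  have "(1 - alpha\<^sup>2) * (- (alpha * J 3) + J 0) + (1 - alpha) * (- J 2 + alpha\<^sup>2 * J 1) =
     (1 - alpha\<^sup>2) * J 0 + (alpha\<^sup>2 - alpha * alpha\<^sup>2) * J 1 + (alpha - 1) * J 2 + (alpha * alpha\<^sup>2 - alpha) * J 3"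
    by (simp add: algebra_simps)
  then have e: "(1 - alpha\<^sup>2) * (- (alpha * J 3) + J 0) + (1 - alpha) * (- J 2 + alpha\<^sup>2 * J 1) =
     (1 - alpha\<^sup>2) * J 0 + (alpha\<^sup>2 - 1) * J 1 + (alpha - 1) * J 2 + (1 - alpha) * J 3"
    unfolding a3 .
  have "I_f1 f x t = ((1 - alpha\<^sup>2) * (- (alpha * J 3) + J 0) + (1 - alpha) * (- J 2 + alpha\<^sup>2 * J 1)) / (2 * of_real pi * \<i>)"
    unfolding I_f1_def integrandp_eqs bd_Omega1_integral_def bd_Omega2_integral_def r
    by (simp only: times_divide_eq_left add_divide_distrib)
  also have "\<dots> = ray_sum 1 (\<lambda>\<tau>. f (of_real (t - \<tau>))) 0 t x / (2 * of_real pi)"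
    unfolding e cb times_divide_eq_left add_divide_distrib[symmetric] divide_divide_eq_left by (simp only: mult.commute)
  finally show ?thesis .
qed

end

text \<open>One formula for both parts: the residue 2 - p, where plain derivatives of
  \<open>f\<close> stand, is 0 for f0 and 1 for f1.\<close>

definition boundary_coeff :: "nat \<Rightarrow> (complex \<Rightarrow> complex) \<Rightarrow> nat \<Rightarrow> real \<Rightarrow> complex" where
  "boundary_coeff p f n t =
     (if n mod 3 = 2 then - of_real (sqrt 3 * Gamma (real p / 3) / (2 * pi * fact n)) * frac_bracket (real p / 3) f ((n + 1) div 3) t
      else if n mod 3 = 2 - p then (deriv ^^ (n div 3)) f (of_real t) / fact n else 0)"

lemma boundary_coeff_eqs: "a_coeff f n t = boundary_coeff 2 f n t" "b_coeff f n t = boundary_coeff 1 f n t"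
proof -
  have "n mod 3 = 0 \<or> n mod 3 = 1 \<or> n mod 3 = 2" by auto
  then show "a_coeff f n t = boundary_coeff 2 f n t" "b_coeff f n t = boundary_coeff 1 f n t"
    by (auto simp: a_coeff_def b_coeff_def boundary_coeff_def)
qed

lemma boundary_coeff_series_split:
  assumes p: "p \<in> {1, 2}"
    and 1: "(\<lambda>k. (deriv ^^ k) f (of_real t) * of_real (x ^ (3 * k + (2 - p)) / fact (3 * k + (2 - p)))) sums s1"
    and 2: "(\<lambda>n. if n mod 3 = 2 then - of_real (sqrt 3 * Gamma (real p / 3) / (2 * pi * fact n)) *
              frac_bracket (real p / 3) f ((n + 1) div 3) t * of_real x ^ n else 0) sums s2"
  shows "(\<lambda>n. boundary_coeff p f n t * of_real x ^ n) sums (s1 + s2)"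
proof -
  have "(\<lambda>n. if n mod 3 = 2 - p then (deriv ^^ (n div 3)) f (of_real t) * of_real (x ^ n / fact n) else 0) sums s1"
    using 1 p by (subst sums_residue_class) auto
  from sums_add[OF this 2] show ?thesis
    by (rule back_subst[of "\<lambda>g. g sums (s1 + s2)"]) (use p in \<open>auto simp: fun_eq_iff boundary_coeff_def\<close>)
qed

text \<open>The resonant terms of the small time lags give the derivatives of \<open>f\<close> at t.
  In degrees n with n mod 3 = 2 the far integral and the local finite part add up to the regularized
  integral that \<open>frac_bracket_regularized\<close> identifies with the bracket.\<close>

lemma boundary_series:
  assumes S: "open S" "f holomorphic_on S" and R: "R > 0" and sub: "\<And>s. s \<in> {0..t} \<Longrightarrow> ball (of_real s) R \<subseteq> S"
    and t: "t > 0" and x: "x > 0" and p: "p \<in> {1, 2}"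
  shows "(\<lambda>n. boundary_coeff p f n t * of_real x ^ n) sums (ray_sum p (\<lambda>\<tau>. f (of_real (t - \<tau>))) 0 t x / (2 * of_real pi))"
proof -
  define q where "q = real p / 3"
  have q: "0 < q" "q < 1" using p by (auto simp: q_def)
  have p2: "p \<le> 2" using p by auto
  \<comment> \<open>Below the Taylor radius \<open>R\<close> and within \<open>{0..t}\<close>; for
    small t it equals t and the far part is trivial.\<close>
  define \<delta> where "\<delta> = min t (R / 2)"
  have \<delta>: "0 < \<delta>" "\<delta> < R" "\<delta> \<le> t" using t R by (auto simp: \<delta>_def)
  have sub0: "of_real ` {0..t} \<subseteq> S"
  proof (rule image_subsetI)
    fix s assume "s \<in> {0..t}"
    from sub[OF this] show "of_real s \<in> S" using R by (meson centre_in_ball subsetD)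
  qed
  have bt: "ball (of_real t) R \<subseteq> S" using t by (intro sub) auto
  have fb: "f holomorphic_on ball (of_real t) R" by (rule holomorphic_on_subset[OF S(2) bt])
  define g where "g = (\<lambda>\<tau>. f (of_real (t - \<tau>)))"
  obtain K where K: "C2_bounded 0 t g K" unfolding g_def by (rule C2_bounded_reflected[OF S sub0 order_refl order_refl])
  obtain K1 where K1: "C2_bounded 0 \<delta> g K1" unfolding g_def by (rule C2_bounded_reflected[OF S sub0 order_refl \<delta>(3)])
  obtain K2 where K2: "C2_bounded \<delta> t g K2" unfolding g_def by (rule C2_bounded_reflected[OF S sub0 less_imp_le[OF \<delta>(1)] order_refl])
  have split: "ray_sum p g 0 t x = ray_sum p g 0 \<delta> x + ray_sum p g \<delta> t x"
    by (rule ray_sum_split[OF less_imp_le[OF \<delta>(1)] \<delta>(3) x p2 K K1 K2])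
  have gw: "(\<lambda>\<tau>. f (of_real t - of_real \<tau>)) = g" by (simp add: g_def)
  obtain L where L: "(\<lambda>n. of_real (far_coeff p x n) * (\<Sum>m. reflected_coeff f t m * of_real (local_coeff p \<delta> m n))) sums L"
    "(\<lambda>m. reflected_coeff f t m * of_real (2 * pi * (-1) ^ m * fact m / fact (3 * m + 2 - p) * x ^ (3 * m + 2 - p))) sums
        (ray_sum p g 0 \<delta> x - L)"
    by (rule ray_sum_local[of R "reflected_coeff f t" "\<lambda>w. f (of_real t - w)", OF reflected_coeff_sums[OF fb] \<delta>(1,2) x p, unfolded gw]) (assumption | rule that; assumption)+
  define c where "c = (2 * of_real pi :: complex)"
  have c0: "c \<noteq> 0" by (simp add: c_def)
  have s1: "(\<lambda>k. (deriv ^^ k) f (of_real t) * of_real (x ^ (3 * k + (2 - p)) / fact (3 * k + (2 - p)))) sums ((ray_sum p g 0 \<delta> x - L) / c)"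
  proof -
    have e: "3 * m + 2 - p = 3 * m + (2 - p)" for m using p by auto
    have "reflected_coeff f t m * of_real (2 * pi * (-1) ^ m * fact m / fact (3 * m + 2 - p) * x ^ (3 * m + 2 - p)) / c =
      (deriv ^^ m) f (of_real t) * of_real (x ^ (3 * m + (2 - p)) / fact (3 * m + (2 - p)))" for m
    proof -
      have "((-1) ^ m * D / F) * (2 * P * (-1) ^ m * F / G * X) / (2 * P) = D * (X / G)" if "F \<noteq> 0" "P \<noteq> 0" for D F P G X :: complex
      proof -
        have "(-1) ^ m * (-1) ^ m = (1::complex)" by (simp flip: power_mult_distrib)
        then have "((-1) ^ m * D / F) * (2 * P * (-1) ^ m * F / G * X) / (2 * P) = ((-1) ^ m * (-1) ^ m) * (D * (X / G))"
          using that by (simp add: field_simps del: power_minus1_even)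
        then show ?thesis using \<open>(-1) ^ m * (-1) ^ m = (1::complex)\<close> by simp
      qed
      from this[of "fact m" "of_real pi" "(deriv ^^ m) f (of_real t)" "fact (3 * m + (2 - p))" "of_real x ^ (3 * m + (2 - p))"]
      show ?thesis unfolding reflected_coeff_def e c_def by simp
    qed
    with sums_divide[OF L(2), of c] show ?thesis by simp
  qed
  define far where "far = (\<lambda>n. integral {\<delta>..t} (\<lambda>\<tau>. g \<tau> * of_real (\<tau> powr (- (real (n + p + 1) / 3)))))"
  define loc where "loc = (\<lambda>n. \<Sum>m. reflected_coeff f t m * of_real (local_coeff p \<delta> m n))"
  have "(\<lambda>n. of_real (far_coeff p x n) * far n) sums ray_sum p g \<delta> t x"
    using ray_sum_far[OF x \<delta>(1,3) p K2] unfolding far_coeff_def far_def .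
  from sums_divide[OF sums_add[OF this L(1)], of c]
  have "(\<lambda>n. (of_real (far_coeff p x n) * far n + of_real (far_coeff p x n) * loc n) / c) sums ((ray_sum p g \<delta> t x + L) / c)"
    unfolding loc_def .
  moreover have "(of_real (far_coeff p x n) * far n + of_real (far_coeff p x n) * loc n) / c =
     (if n mod 3 = 2 then - of_real (sqrt 3 * Gamma q / (2 * pi * fact n)) * frac_bracket q f ((n + 1) div 3) t * of_real x ^ n else 0)" for n
  proof (cases "n mod 3 = 2")
    case True
    define j where "j = (n + 1) div 3"
    have n: "n = 3 * j - 1" "n + 1 = 3 * j" using True unfolding j_def by presburger+
    have j: "real (n + p + 1) / 3 = real j + q"
    proof -
      have "real (n + p + 1) = real (3 * j) + real p" unfolding n(2)[symmetric] by simp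
      then show ?thesis by (simp add: q_def field_simps)
    qed
    have fr: "frac_bracket q f j t = of_real ((-1) ^ j * Gamma (real j + q) / Gamma q) * (far n + loc n)"
      unfolding frac_bracket_regularized[OF S bt sub0 \<delta> q] far_def loc_def local_series_def local_coeff_def j g_def ..
    have w: "far_coeff p x n = - (sqrt 3 / fact n * x ^ n) * ((-1) ^ j * Gamma (real j + q))"
    proof -
      have "(-1 :: real) ^ n = - ((-1) ^ j)"
      proof -
        have "(-1 :: real) ^ (n + 1) = (-1) ^ (3 * j)" unfolding n(2) ..
        also have "\<dots> = (-1) ^ j" by (simp add: power_mult)
        finally show ?thesis by simp
      qed
      then show ?thesis unfolding far_coeff_def kernel_coeff_def j using True by simp
    qed
    have G: "Gamma q \<noteq> 0" using Gamma_real_pos[OF q(1)] by simp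
    have "- (sqrt 3 * Gamma q / (2 * pi * fact n)) * ((-1) ^ j * Gamma (real j + q) / Gamma q) * x ^ n = far_coeff p x n / (2 * pi)"
      unfolding w using G by (simp add: field_simps)
    then have "(of_real (far_coeff p x n / (2 * pi)) :: complex) =
      of_real (- (sqrt 3 * Gamma q / (2 * pi * fact n)) * ((-1) ^ j * Gamma (real j + q) / Gamma q) * x ^ n)" by simp
    then have w': "of_real (far_coeff p x n) / c =
       - of_real (sqrt 3 * Gamma q / (2 * pi * fact n)) * of_real ((-1) ^ j * Gamma (real j + q) / Gamma q) * of_real x ^ n"
      unfolding c_def by (simp only: of_real_mult of_real_divide of_real_minus of_real_power of_real_numeral)
    have "(of_real (far_coeff p x n) * far n + of_real (far_coeff p x n) * loc n) / c = of_real (far_coeff p x n) / c * (far n + loc n)"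
      by (simp only: distrib_left[symmetric] times_divide_eq_left)
    then show ?thesis unfolding if_P[OF True] j_def[symmetric] fr w' by (simp only: mult_ac)
  next
    case False
    then show ?thesis by (simp add: far_coeff_def)
  qed
  ultimately have s2: "(\<lambda>n. if n mod 3 = 2 then - of_real (sqrt 3 * Gamma (real p / 3) / (2 * pi * fact n)) * frac_bracket (real p / 3) f ((n + 1) div 3) t * of_real x ^ n else 0)
      sums ((ray_sum p g \<delta> t x + L) / c)" unfolding q_def by simp
  \<comment> \<open>The auxiliary value \<open>L\<close> cancels between the two families of
    degrees.\<close>
  have "(ray_sum p g 0 \<delta> x - L) / c + (ray_sum p g \<delta> t x + L) / c = ray_sum p g 0 t x / c"
    unfolding split add_divide_distrib[symmetric] by (simp add: algebra_simps)
  with boundary_coeff_series_split[OF p s1 s2] show ?thesis unfolding g_def c_def by simp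
qed

text \<open>By default values: 0 \<open>powr\<close> anything is 0, division by 0 gives 0, and the
  integral is over a single point.\<close>

lemma frac_bracket_at_0: "frac_bracket q f n 0 = 0"
  by (simp add: frac_bracket_def)

text \<open>At t = 0 only the derivatives of \<open>f\<close> at 0 remain, and Cauchy's estimates
  suffice. Convergence is all that is claimed: the contour integral vanishes at t = 0, while for p =
  2 the constant term of the series is f(0).\<close>

lemma boundary_coeff_0_summable:
  assumes f: "f holomorphic_on ball 0 R" and R: "R > 0" and p: "p \<in> {1, 2}" and x: "x > 0"
  shows "summable (\<lambda>n. boundary_coeff p f n 0 * of_real x ^ n)"
proof -
  define r where "r = R / 2"
  have r: "0 < r" "r < R" using R by (auto simp: r_def)
  obtain M where M: "M \<ge> 0" "\<And>k. norm ((deriv ^^ k) f 0) \<le> M * fact k / r ^ k"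
    using Cauchy_bound_higher_deriv[OF f r] by blast
  have "summable (\<lambda>k. (deriv ^^ k) f (of_real 0) * of_real (x ^ (3 * k + (2 - p)) / fact (3 * k + (2 - p))))"
  proof (rule summable_comparison_test')
    show "summable (\<lambda>k. M * (fact k * (1 / r) ^ k * (x ^ (3 * k + (2 - p)) / fact (3 * k + (2 - p)))))"
      by (rule summable_mult[OF summable_fact_quotient]) (use r x in auto)
  next
    fix k :: nat
    have "norm ((deriv ^^ k) f (of_real 0) * of_real (x ^ (3 * k + (2 - p)) / fact (3 * k + (2 - p)))) =
      norm ((deriv ^^ k) f 0) * (x ^ (3 * k + (2 - p)) / fact (3 * k + (2 - p)))"
      unfolding norm_mult norm_of_real using x by simp
    also have "\<dots> \<le> (M * fact k / r ^ k) * (x ^ (3 * k + (2 - p)) / fact (3 * k + (2 - p)))"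
      by (rule mult_right_mono[OF M(2)]) (use x in auto)
    finally show "norm ((deriv ^^ k) f (of_real 0) * of_real (x ^ (3 * k + (2 - p)) / fact (3 * k + (2 - p)))) \<le>
      M * (fact k * (1 / r) ^ k * (x ^ (3 * k + (2 - p)) / fact (3 * k + (2 - p))))"
      by (simp add: power_divide)
  qed
  then obtain s where "(\<lambda>k. (deriv ^^ k) f (of_real 0) * of_real (x ^ (3 * k + (2 - p)) / fact (3 * k + (2 - p)))) sums s"
    unfolding summable_def by blast
  from boundary_coeff_series_split[OF p this, of 0] show ?thesis
    by (intro sums_summable[of _ "s + 0"]) (simp add: frac_bracket_at_0 cong: if_cong)
qed

text \<open>Both parts of the theorem are instances, with p = 2 and \<open>u = I_f0 f0\<close>, or p
  = 1 and \<open>u = I_f1 f1\<close>; from here on a contour integral enters only through its ray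
  sum.\<close>

locale boundary_data =
  fixes S f and R T :: real and p :: nat and u :: "real \<Rightarrow> real \<Rightarrow> complex"
  assumes S: "open S" "f holomorphic_on S" and R: "R > 0" and p: "p \<in> {1, 2}"
    and sub: "\<And>s. s \<in> {0..T} \<Longrightarrow> ball (of_real s) R \<subseteq> S" and T: "T > 0"
    and u: "\<And>x t. x > 0 \<Longrightarrow> t \<in> {0..T} \<Longrightarrow> u x t = ray_sum p (\<lambda>\<tau>. f (of_real (t - \<tau>))) 0 t x / (2 * of_real pi)"
begin

lemma series:
  assumes "x > 0" "t \<in> {0<..T}"
  shows "(\<lambda>n. boundary_coeff p f n t * of_real x ^ n) sums u x t"
proof -
  have "(\<lambda>n. boundary_coeff p f n t * of_real x ^ n) sums (ray_sum p (\<lambda>\<tau>. f (of_real (t - \<tau>))) 0 t x / (2 * of_real pi))"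
    by (rule boundary_series[OF S R sub _ assms(1) p]) (use assms(2) in auto)
  then show ?thesis using u[of x t] assms by simp
qed

lemma entire:
  assumes "t \<in> {0..T}"
  shows "entire_series (\<lambda>n. boundary_coeff p f n t)"
proof (rule entire_seriesI)
  fix x :: real assume x: "x > 0"
  show "summable (\<lambda>n. boundary_coeff p f n t * of_real x ^ n)"
  proof (cases "t = 0")
    case True
    have "ball (of_real 0) R \<subseteq> S" using T by (intro sub) auto
    then have "f holomorphic_on ball 0 R" by (intro holomorphic_on_subset[OF S(2)]) simp
    then show ?thesis unfolding True by (rule boundary_coeff_0_summable[OF _ R p x])
  next
    case False
    then show ?thesis using assms by (intro sums_summable[OF series[OF x]]) auto
  qed
qed

text \<open>At t = 0 the time integral is over a point and \<open>u\<close> vanishes identically;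
  for positive t it is the restriction of an entire function.\<close>

lemma analytic_x:
  assumes t: "t \<in> {0..T}"
  shows "real_analytic_on (\<lambda>x. u x t) {0<..}"
proof (cases "t = 0")
  case True
  have "u x t = 0" if "x > 0" for x
    unfolding u[OF that t] unfolding ray_sum_def Jint_def Jfun_def True by simp
  then show ?thesis unfolding real_analytic_on_def
    by (intro ballI exI[of _ "1::real"] conjI exI[of _ "\<lambda>_. 0"]) auto
next
  case False
  then show ?thesis using t by (intro real_analytic_on_entire_series[OF entire[OF t]] series) auto
qed

text \<open>The brackets are derivatives of one holomorphic function \<open>G\<close>, so
  \<open>u\<close> is a combination of two series to which
  \<open>deriv_series_double_expansion\<close> applies. Positivity of t0 is essential for this,
  since \<open>G\<close> has a branch point at 0.\<close>

lemma analytic_xt: "real_analytic2_on u ({0<..} \<times> {0<..T})"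
  unfolding real_analytic2_on_def
proof (rule ballI, unfold split_paired_all prod.case)
  fix x0 t0 :: real assume "(x0, t0) \<in> {0<..} \<times> {0<..T}"
  then have x0: "x0 > 0" and t0: "0 < t0" "t0 \<le> T" by auto
  \<comment> \<open>At most t0, so that the disc lies in the right half-plane where
    \<open>Ln\<close> is holomorphic; at most R, so that its points scaled by factors in
    \<open>{0..1}\<close> stay in \<open>S\<close>.\<close>
  define \<rho> where "\<rho> = min R t0"
  have \<rho>: "0 < \<rho>" "\<rho> \<le> R" "\<rho> \<le> t0" using R t0 by (auto simp: \<rho>_def)
  define \<Omega> where "\<Omega> = ball (of_real t0 :: complex) \<rho>"
  have O: "open \<Omega>" by (simp add: \<Omega>_def)
  have Re: "Re w > 0" if "w \<in> \<Omega>" for w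
  proof -
    have "\<bar>Re (of_real t0 - w)\<bar> < \<rho>"
      using that abs_Re_le_cmod[of "of_real t0 - w"] by (simp add: \<Omega>_def dist_norm)
    then show ?thesis using \<rho> by simp
  qed
  \<comment> \<open>Scaling w by v moves the centre t0 to t0 v, still in \<open>{0..T}\<close>, and
    does not increase the distance to it.\<close>
  have scale: "w * of_real v \<in> S" if "w \<in> \<Omega>" "v \<in> {0..1}" for w v
  proof -
    have "norm (of_real (t0 * v) - w * of_real v) = norm (of_real t0 - w) * v"
      using that(2) by (simp add: norm_mult flip: left_diff_distrib)
    also have "\<dots> \<le> norm (of_real t0 - w)" using that(2) by (intro mult_left_le) auto
    also have "\<dots> < R" using that(1) \<rho> by (simp add: \<Omega>_def dist_norm)
    finally have "w * of_real v \<in> ball (of_real (t0 * v)) R" by (simp add: dist_norm)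
    moreover have "t0 * v \<in> {0..T}" using t0 that(2) order_trans[OF mult_left_le[of v t0] t0(2)] by auto
    ultimately show ?thesis using sub by blast
  qed
  define G where "G = frac_integral p f"
  have "G holomorphic_on \<Omega>" unfolding G_def by (rule frac_integral_holomorphic[OF S O Re scale p])
  \<comment> \<open>The power x^(3k+2) carries the bracket of index k + 1, so the series starts with
    the first derivative of \<open>G\<close>.\<close>
  then have G': "deriv G holomorphic_on ball (of_real t0) \<rho>" unfolding \<Omega>_def by (rule holomorphic_deriv) simp
  have f: "f holomorphic_on ball (of_real t0) R"
    by (rule holomorphic_on_subset[OF S(2) sub]) (use t0 in auto)
  obtain \<delta>1 c1 where 1: "\<delta>1 > 0" "\<And>x t. \<bar>x - x0\<bar> < \<delta>1 \<Longrightarrow> \<bar>t - t0\<bar> < \<delta>1 \<Longrightarrow> \<exists>s.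
       (\<lambda>k. (deriv ^^ k) f (of_real t) * of_real (x ^ (3 * k + (2 - p)) / fact (3 * k + (2 - p)))) sums s \<and>
       ((\<lambda>(m, n). c1 m n * of_real (x - x0) ^ m * of_real (t - t0) ^ n) has_sum s) UNIV"
    by (rule deriv_series_double_expansion[OF f R, of x0 "2 - p"]) (rule that; assumption)
  obtain \<delta>2 c2 where 2: "\<delta>2 > 0" "\<And>x t. \<bar>x - x0\<bar> < \<delta>2 \<Longrightarrow> \<bar>t - t0\<bar> < \<delta>2 \<Longrightarrow> \<exists>s.
       (\<lambda>k. (deriv ^^ k) (deriv G) (of_real t) * of_real (x ^ (3 * k + 2) / fact (3 * k + 2))) sums s \<and>
       ((\<lambda>(m, n). c2 m n * of_real (x - x0) ^ m * of_real (t - t0) ^ n) has_sum s) UNIV"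
    by (rule deriv_series_double_expansion[OF G' \<rho>(1), of x0 2]) (rule that; assumption)
  \<comment> \<open>The constant of the coefficients of index 3k + 2 without the factorial; their
    minus sign appears as c1 - \<kappa> c2 below.\<close>
  define \<kappa> where "\<kappa> = (of_real (sqrt 3 * Gamma (real p / 3) / (2 * pi)) :: complex)"
  define \<delta> where "\<delta> = min \<rho> (min \<delta>1 \<delta>2)"
  have "((\<lambda>(m, n). (c1 m n - \<kappa> * c2 m n) * of_real (x - x0) ^ m * of_real (t - t0) ^ n) has_sum u x t) UNIV"
    if xt: "(x, t) \<in> {0<..} \<times> {0<..T}" "\<bar>x - x0\<bar> < \<delta>" "\<bar>t - t0\<bar> < \<delta>" for x t :: real
  proof -
    have x: "x > 0" and t: "t \<in> {0<..T}" using xt(1) by auto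
    obtain s1 where s1: "(\<lambda>k. (deriv ^^ k) f (of_real t) * of_real (x ^ (3 * k + (2 - p)) / fact (3 * k + (2 - p)))) sums s1"
      "((\<lambda>(m, n). c1 m n * of_real (x - x0) ^ m * of_real (t - t0) ^ n) has_sum s1) UNIV"
      using 1(2)[of x t] xt(2,3) unfolding \<delta>_def min_less_iff_conj by blast
    obtain s2 where s2: "(\<lambda>k. (deriv ^^ k) (deriv G) (of_real t) * of_real (x ^ (3 * k + 2) / fact (3 * k + 2))) sums s2"
      "((\<lambda>(m, n). c2 m n * of_real (x - x0) ^ m * of_real (t - t0) ^ n) has_sum s2) UNIV"
      using 2(2)[of x t] xt(2,3) unfolding \<delta>_def min_less_iff_conj by blast
    have tO: "of_real t \<in> \<Omega>" using xt(3) by (simp add: \<Omega>_def \<delta>_def dist_norm abs_minus_commute flip: of_real_diff)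
    have sub0: "of_real ` {0..t} \<subseteq> S"
    proof (rule image_subsetI)
      fix s assume "s \<in> {0..t}"
      then have "s \<in> {0..T}" using t by auto
      from sub[OF this] show "of_real s \<in> S" using R by (meson centre_in_ball subsetD)
    qed
    have b: "(deriv ^^ k) (deriv G) (of_real t) = frac_bracket (real p / 3) f (Suc k) t" for k
    proof -
      have "(deriv ^^ k) (deriv G) (of_real t) = (deriv ^^ Suc k) G (of_real t)" by (simp only: funpow_Suc_right o_apply)
      also have "\<dots> = frac_integral_deriv p f (Suc k) (of_real t)" unfolding G_def by (rule higher_deriv_frac_integral[OF S O Re scale p tO])
      also have "\<dots> = frac_bracket (real p / 3) f (Suc k) t"
        using t by (intro frac_bracket_eq_frac_integral_deriv[OF S _ sub0 p, symmetric]) auto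
      finally show ?thesis .
    qed
    have "(\<lambda>k. - \<kappa> * ((deriv ^^ k) (deriv G) (of_real t) * of_real (x ^ (3 * k + 2) / fact (3 * k + 2)))) sums (- \<kappa> * s2)"
      by (rule sums_mult[OF s2(1)])
    moreover have "- \<kappa> * ((deriv ^^ k) (deriv G) (of_real t) * of_real (x ^ (3 * k + 2) / fact (3 * k + 2))) =
       - of_real (sqrt 3 * Gamma (real p / 3) / (2 * pi * fact (3 * k + 2))) * frac_bracket (real p / 3) f ((3 * k + 2 + 1) div 3) t * of_real x ^ (3 * k + 2)" for k
    proof -
      have 1: "(3 * k + 2 + 1) div 3 = Suc k" by simp
      have 2: "of_real (sqrt 3 * Gamma (real p / 3) / (2 * pi * fact (3 * k + 2))) = \<kappa> / fact (3 * k + 2)"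
        unfolding \<kappa>_def by simp
      show ?thesis unfolding b 1 2 by (simp del: fact_Suc)
    qed
    ultimately have "(\<lambda>n. if n mod 3 = 2 then - of_real (sqrt 3 * Gamma (real p / 3) / (2 * pi * fact n)) *
              frac_bracket (real p / 3) f ((n + 1) div 3) t * of_real x ^ n else 0) sums (- \<kappa> * s2)"
      by (subst sums_residue_class) (simp_all only: numeral_less_iff semiring_norm)
    from boundary_coeff_series_split[OF p s1(1) this] have "(\<lambda>n. boundary_coeff p f n t * of_real x ^ n) sums (s1 + - \<kappa> * s2)" .
    from sums_unique2[OF series[OF x t] this] have u: "u x t = s1 + - \<kappa> * s2" .
    have "((\<lambda>y. (case y of (m, n) \<Rightarrow> c1 m n * of_real (x - x0) ^ m * of_real (t - t0) ^ n) +
        - \<kappa> * (case y of (m, n) \<Rightarrow> c2 m n * of_real (x - x0) ^ m * of_real (t - t0) ^ n)) has_sum u x t) UNIV"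
      unfolding u by (intro has_sum_add has_sum_cmult_right s1(2) s2(2))
    then show ?thesis
      by (rule back_subst[of "\<lambda>g. (g has_sum u x t) UNIV"]) (simp add: fun_eq_iff algebra_simps)
  qed
  moreover have "\<delta> > 0" using \<rho> 1(1) 2(1) by (simp add: \<delta>_def)
  ultimately show "\<exists>\<delta>>0. \<exists>c. \<forall>(x, t)\<in>{0<..} \<times> {0<..T}. \<bar>x - x0\<bar> < \<delta> \<longrightarrow> \<bar>t - t0\<bar> < \<delta> \<longrightarrow>
     ((\<lambda>(m, n). c m n * of_real (x - x0) ^ m * of_real (t - t0) ^ n) has_sum u x t) UNIV"
    by (intro exI[of _ \<delta>] conjI exI[of _ "\<lambda>m n. c1 m n - \<kappa> * c2 m n"]) auto
qed

end

text \<open>Analyticity on the closed neighbourhood means holomorphy on some open superset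
  \<open>S\<close>, and that neighbourhood contains every open disc of radius r about a point of the
  interval.\<close>

lemma analytic_time_domainE:
  assumes "f analytic_on time_domain T r"
  obtains S where "open S" "f holomorphic_on S" "\<And>s. s \<in> {0..T} \<Longrightarrow> ball (of_real s) r \<subseteq> S"
proof -
  obtain S where S: "open S" "time_domain T r \<subseteq> S" "f holomorphic_on S"
    using assms unfolding analytic_on_holomorphic by blast
  have "ball (of_real s) r \<subseteq> S" if "s \<in> {0..T}" for s
  proof
    fix w :: complex assume "w \<in> ball (of_real s) r"
    then have "dist w (of_real s) \<le> r" by (simp add: dist_commute)
    with infdist_le[OF imageI[OF that, of of_real], of w] have "w \<in> time_domain T r"
      unfolding time_domain_def by simp
    then show "w \<in> S" using S(2) by blast
  qed
  with S(1,3) show ?thesis by (rule that)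
qed

theorem theorem7:
  fixes T r :: real and f0 f1 :: "complex \<Rightarrow> complex"
  assumes "T > 0" and "r > 0"
  shows
    "(f0 analytic_on time_domain T r \<longrightarrow>
        (\<forall>x>0. \<forall>t\<in>{0..T}. bd_Omega1_integrable (integrand0 f0 x t)
                         \<and> bd_Omega2_integrable (integrand0 f0 x t))
      \<and> (\<forall>t\<in>{0..T}. real_analytic_on (\<lambda>x. I_f0 f0 x t) {0<..})
      \<and> real_analytic2_on (I_f0 f0) ({0<..} \<times> {0<..T})
      \<and> (\<forall>x>0. \<forall>t\<in>{0<..T}. (\<lambda>n. a_coeff f0 n t * of_real x ^ n) sums I_f0 f0 x t)
      \<and> (\<forall>t\<in>{0..T}. entire_series (\<lambda>n. a_coeff f0 n t)))
   \<and> (f1 analytic_on time_domain T r \<longrightarrow>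
        (\<forall>x>0. \<forall>t\<in>{0..T}. bd_Omega1_integrable (integrand1 f1 x t)
                         \<and> bd_Omega2_integrable (integrand1 f1 x t))
      \<and> (\<forall>t\<in>{0..T}. real_analytic_on (\<lambda>x. I_f1 f1 x t) {0<..})
      \<and> real_analytic2_on (I_f1 f1) ({0<..} \<times> {0<..T})
      \<and> (\<forall>x>0. \<forall>t\<in>{0<..T}. (\<lambda>n. b_coeff f1 n t * of_real x ^ n) sums I_f1 f1 x t)
      \<and> (\<forall>t\<in>{0..T}. entire_series (\<lambda>n. b_coeff f1 n t)))"
proof -
  have seg: "of_real ` {0..t} \<subseteq> S" if "t \<in> {0..T}" "\<And>s. s \<in> {0..T} \<Longrightarrow> ball (of_real s) r \<subseteq> S" for t and S :: "complex set"
  proof (rule image_subsetI)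
    fix s assume "s \<in> {0..t}"
    then have "s \<in> {0..T}" using that(1) by auto
    from that(2)[OF this] show "of_real s \<in> S" using assms(2) by (meson centre_in_ball subsetD)
  qed
  show ?thesis
  proof (intro conjI[of "_ \<longrightarrow> _"] impI)
    assume "f0 analytic_on time_domain T r"
    then obtain S where A: "open S" "f0 holomorphic_on S" "\<And>s. s \<in> {0..T} \<Longrightarrow> ball (of_real s) r \<subseteq> S"
      by (rule analytic_time_domainE) (rule that; assumption)
    interpret boundary_data S f0 r T 2 "I_f0 f0"
    proof (rule boundary_data.intro[OF A(1,2) assms(2) _ A(3) assms(1)])
      show "I_f0 f0 x t = ray_sum 2 (\<lambda>\<tau>. f0 (of_real (t - \<tau>))) 0 t x / (2 * of_real pi)" if "x > 0" "t \<in> {0..T}" for x t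
        by (rule I_f0_ray_sum[OF A(1,2) seg[OF that(2) A(3)] _ that(1)]) (use that(2) in auto)
    qed auto
    show "(\<forall>x>0. \<forall>t\<in>{0..T}. bd_Omega1_integrable (integrand0 f0 x t)
                         \<and> bd_Omega2_integrable (integrand0 f0 x t))
      \<and> (\<forall>t\<in>{0..T}. real_analytic_on (\<lambda>x. I_f0 f0 x t) {0<..})
      \<and> real_analytic2_on (I_f0 f0) ({0<..} \<times> {0<..T})
      \<and> (\<forall>x>0. \<forall>t\<in>{0<..T}. (\<lambda>n. a_coeff f0 n t * of_real x ^ n) sums I_f0 f0 x t)
      \<and> (\<forall>t\<in>{0..T}. entire_series (\<lambda>n. a_coeff f0 n t))"
      unfolding boundary_coeff_eqs integrandp_eqs
      by (intro conjI allI impI ballI analytic_x analytic_xt series entire bd_Omega_integrable[OF A(1,2) seg[OF _ A(3)]]) auto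
  next
    assume "f1 analytic_on time_domain T r"
    then obtain S where A: "open S" "f1 holomorphic_on S" "\<And>s. s \<in> {0..T} \<Longrightarrow> ball (of_real s) r \<subseteq> S"
      by (rule analytic_time_domainE) (rule that; assumption)
    interpret boundary_data S f1 r T 1 "I_f1 f1"
    proof (rule boundary_data.intro[OF A(1,2) assms(2) _ A(3) assms(1)])
      show "I_f1 f1 x t = ray_sum 1 (\<lambda>\<tau>. f1 (of_real (t - \<tau>))) 0 t x / (2 * of_real pi)" if "x > 0" "t \<in> {0..T}" for x t
        by (rule I_f1_ray_sum[OF A(1,2) seg[OF that(2) A(3)] _ that(1)]) (use that(2) in auto)
    qed auto
    show "(\<forall>x>0. \<forall>t\<in>{0..T}. bd_Omega1_integrable (integrand1 f1 x t)
                         \<and> bd_Omega2_integrable (integrand1 f1 x t))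
      \<and> (\<forall>t\<in>{0..T}. real_analytic_on (\<lambda>x. I_f1 f1 x t) {0<..})
      \<and> real_analytic2_on (I_f1 f1) ({0<..} \<times> {0<..T})
      \<and> (\<forall>x>0. \<forall>t\<in>{0<..T}. (\<lambda>n. b_coeff f1 n t * of_real x ^ n) sums I_f1 f1 x t)
      \<and> (\<forall>t\<in>{0..T}. entire_series (\<lambda>n. b_coeff f1 n t))"
      unfolding boundary_coeff_eqs integrandp_eqs
      by (intro conjI allI impI ballI analytic_x analytic_xt series entire bd_Omega_integrable[OF A(1,2) seg[OF _ A(3)]]) auto
  qed
qed

end
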